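(* For each $n\in\mathbb N$ the operator $A_n^*$ in $L^2(S)$ generates a holomorphic semigroup $\{e^{tA_n^*}\}_{t\ge0}$ in $L^2(S)$. Furthermore, there exists $\gamma>0$ such that $$\|e^{tA_n^*}\|_{\mathcal L(L^2(S))}\le e^{\gamma t},\qquad n\in\mathbb N,\ t\ge0.$$
   Context: Graph. Let $\mathcal G=(\mathcal V,\mathcal E)$ be a finite directed geometric graph in $\mathbb R^3$ without loops: $\mathcal V$ is the finite set of vertices and the edges $E_1,\dots,E_N$ are $C^1$ curves of finite lengths $d_i>0$ connecting vertices; put $\mathcal N=\{1,\dots,N\}$, $\mathbb N=\{1,2,\dots\}$. The initial and terminal vertices of $E_i$ are denoted $L_i$ (left endpoint) and $R_i$ (right endpoint); $L_i\ne R_i$ as vertices. $S$ is the disjoint union of the edges. Each $E_i$ is identified with $[0,d_i]$ by arc length, $L_i$ corresponding to $0$ and $R_i$ to $d_i$. A function $u$ on $S$ is identified with $(u_i)_{i\in\mathcal N}$, $u_i$ a function on $[0,d_i]$; $u(L_i)=u_i(0)$, $u(R_i)=u_i(d_i)$, $u'(L_i)=u_i'(0)$, $u'(R_i)=u_i'(d_i)$. Coefficients. $\sigma_i>0$ ($i\in\mathcal N$) are given and $\sigma$ is the function on $S$ equal to $\sigma_i$ on $E_i$. $l_i,r_i\ge 0$ and, for $i\neq j$, $l_{ij},r_{ij}\ge 0$ are real numbers with $\sum_{j\ne i}l_{ij}\le l_i$, $\sum_{j\neq i}r_{ij}\le r_i$; $l_{ij}=0$ if $E_j$ is not incident with the vertex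 $L_i$, and $r_{ij}=0$ if $E_j$ is not incident with the vertex $R_i$. $(\kappa_n)_{n\in\mathbb N}$ is a nondecreasing sequence of positive numbers converging to $+\infty$. Spaces and operators. $L^2(S)=\{u=(u_i)_{i\in\mathcal N}:u_i\in L^2(0,d_i)\}$ is the complex Hilbert space with $\langle u,v\rangle_{L^2(S)}=\sum_i\int_0^{d_i}u_i\overline{v_i}$; $\|\cdot\|_{\mathcal L(L^2(S))}$ is the operator norm. $H^2(S)$ is the set of $u\in L^2(S)$ with $u,u'$ weakly differentiable (on each edge) and $u',u''\in L^2(S)$. Functionals $F_{L,i},F_{R,i}$ on $H^2(S)$ are defined by $$\sigma_iF_{L,i}u=\sigma_il_iu(L_i)-\sum_{j\neq i:\,L_j=L_i}\sigma_jl_{ji}u(L_j)-\sum_{j\ne i:\,R_j=L_i}\sigma_jr_{ji}u(R_j),$$ $$\sigma_iF_{R,i}u=\sum_{j\neq i:\,L_j=R_i}\sigma_jl_{ji}u(L_j)+\sum_{j\ne i:\,R_j=R_i}\sigma_jr_{ji}u(R_j)-\sigma_ir_iu(R_i),$$ where equalities under the sums are equalities of vertices in $\mathcal V$. Then $A_n^*u=\kappa_n\sigma u''$ with $D(A_n^* )=\{u\in H^2(S):\ \kappa_nu'(L_i)=F_{L,i}u,\ \kappa_nu'(R_i)=F_{R,i}u,\ i\in\mathcal N\}$. *)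

theory Defs
  imports "HOL-Analysis.Analysis"
begin

section \<open>Operator semigroups on spaces of complex functions\<close>

text \<open>
  A normed space of (classes of) functions is given by a set \<open>X\<close> of representatives, closed under
  the pointwise operations, and a seminorm \<open>p\<close> on \<open>X\<close>.  Two representatives \<open>f\<close>, \<open>g\<close> denote the
  same element iff \<open>p (f - g) = 0\<close>; for \<open>L\<^sup>2\<close> this is equality almost everywhere.  All notions below
  are invariant under this identification.  In particular, boundedness and linearity force the
  operators to respect it.
\<close>

definition same_class :: "(('a \<Rightarrow> complex) \<Rightarrow> real) \<Rightarrow> ('a \<Rightarrow> complex) \<Rightarrow> ('a \<Rightarrow> complex) \<Rightarrow> bool" where
  "same_class p f g \<longleftrightarrow> p (\<lambda>s. f s - g s) = 0"

definition bounded_operator ::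
    "('a \<Rightarrow> complex) set \<Rightarrow> (('a \<Rightarrow> complex) \<Rightarrow> real) \<Rightarrow> (('a \<Rightarrow> complex) \<Rightarrow> ('a \<Rightarrow> complex)) \<Rightarrow> bool" where
  "bounded_operator X p B \<longleftrightarrow>
     (\<forall>f\<in>X. B f \<in> X) \<and>
     (\<forall>f\<in>X. \<forall>g\<in>X. same_class p (B (\<lambda>s. f s + g s)) (\<lambda>s. B f s + B g s)) \<and>
     (\<forall>a. \<forall>f\<in>X. same_class p (B (\<lambda>s. a * f s)) (\<lambda>s. a * B f s)) \<and>
     (\<exists>C. \<forall>f\<in>X. p (B f) \<le> C * p f)"

definition op_norm ::
    "('a \<Rightarrow> complex) set \<Rightarrow> (('a \<Rightarrow> complex) \<Rightarrow> real) \<Rightarrow> (('a \<Rightarrow> complex) \<Rightarrow> ('a \<Rightarrow> complex)) \<Rightarrow> real" where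
  "op_norm X p B = Sup {p (B f) | f. f \<in> X \<and> p f \<le> 1}"

text \<open>Strongly continuous semigroups; only the values of \<open>T\<close> on \<open>[0, \<infinity>)\<close> matter.\<close>

definition C0_semigroup ::
    "('a \<Rightarrow> complex) set \<Rightarrow> (('a \<Rightarrow> complex) \<Rightarrow> real) \<Rightarrow>
     (real \<Rightarrow> ('a \<Rightarrow> complex) \<Rightarrow> ('a \<Rightarrow> complex)) \<Rightarrow> bool" where
  "C0_semigroup X p T \<longleftrightarrow>
     (\<forall>t\<ge>0. bounded_operator X p (T t)) \<and>
     (\<forall>f\<in>X. same_class p (T 0 f) f) \<and>
     (\<forall>t\<ge>0. \<forall>r\<ge>0. \<forall>f\<in>X. same_class p (T (t + r) f) (T t (T r f))) \<and>
     (\<forall>f\<in>X. ((\<lambda>t. p (\<lambda>s. T t f s - f s)) \<longlongrightarrow> 0) (at_right 0))"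

text \<open>Unbounded operators are represented by their graphs.\<close>

definition generator ::
    "('a \<Rightarrow> complex) set \<Rightarrow> (('a \<Rightarrow> complex) \<Rightarrow> real) \<Rightarrow>
     (real \<Rightarrow> ('a \<Rightarrow> complex) \<Rightarrow> ('a \<Rightarrow> complex)) \<Rightarrow> (('a \<Rightarrow> complex) \<times> ('a \<Rightarrow> complex)) set" where
  "generator X p T =
     {(f, g). f \<in> X \<and> g \<in> X \<and>
        ((\<lambda>t. p (\<lambda>s. (T t f s - f s) / complex_of_real t - g s)) \<longlongrightarrow> 0) (at_right 0)}"

definition generates_semigroup ::
    "('a \<Rightarrow> complex) set \<Rightarrow> (('a \<Rightarrow> complex) \<Rightarrow> real) \<Rightarrow>
     (('a \<Rightarrow> complex) \<times> ('a \<Rightarrow> complex)) set \<Rightarrow>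
     (real \<Rightarrow> ('a \<Rightarrow> complex) \<Rightarrow> ('a \<Rightarrow> complex)) \<Rightarrow> bool" where
  "generates_semigroup X p A T \<longleftrightarrow> C0_semigroup X p T \<and> generator X p T = A"

definition sector :: "real \<Rightarrow> complex set" where
  "sector \<theta> = {z. z \<noteq> 0 \<and> \<bar>Arg z\<bar> < \<theta>}"

text \<open>
  Holomorphic semigroups of angle \<open>\<theta>\<close>, not assumed bounded on the sector.  Holomorphy is complex
  differentiability with respect to the operator norm.
\<close>

definition holomorphic_semigroup ::
    "('a \<Rightarrow> complex) set \<Rightarrow> (('a \<Rightarrow> complex) \<Rightarrow> real) \<Rightarrow> real \<Rightarrow>
     (complex \<Rightarrow> ('a \<Rightarrow> complex) \<Rightarrow> ('a \<Rightarrow> complex)) \<Rightarrow> bool" where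
  "holomorphic_semigroup X p \<theta> T \<longleftrightarrow>
     (\<forall>z \<in> insert 0 (sector \<theta>). bounded_operator X p (T z)) \<and>
     (\<forall>f\<in>X. same_class p (T 0 f) f) \<and>
     (\<forall>z \<in> insert 0 (sector \<theta>). \<forall>w \<in> insert 0 (sector \<theta>). \<forall>f\<in>X.
        same_class p (T (z + w) f) (T z (T w f))) \<and>
     (\<forall>z \<in> sector \<theta>. \<exists>B. bounded_operator X p B \<and>
        ((\<lambda>h. op_norm X p (\<lambda>f s. (T (z + h) f s - T z f s) / h - B f s)) \<longlongrightarrow> 0) (at 0)) \<and>
     (\<forall>\<theta>'. 0 < \<theta>' \<and> \<theta>' < \<theta> \<longrightarrow>
        (\<forall>f\<in>X. ((\<lambda>z. p (\<lambda>s. T z f s - f s)) \<longlongrightarrow> 0) (at 0 within sector \<theta>')))"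

definition generates_holomorphic_semigroup ::
    "('a \<Rightarrow> complex) set \<Rightarrow> (('a \<Rightarrow> complex) \<Rightarrow> real) \<Rightarrow>
     (('a \<Rightarrow> complex) \<times> ('a \<Rightarrow> complex)) set \<Rightarrow> bool" where
  "generates_holomorphic_semigroup X p A \<longleftrightarrow>
     (\<exists>\<theta> T. 0 < \<theta> \<and> \<theta> \<le> pi / 2 \<and> holomorphic_semigroup X p \<theta> T \<and>
        generates_semigroup X p A (\<lambda>t. T (complex_of_real t)))"

section \<open>Weak derivatives on an interval\<close>

definition test_function :: "real \<Rightarrow> (real \<Rightarrow> real) \<Rightarrow> bool" where
  "test_function a \<phi> \<longleftrightarrow>
     (\<forall>k x. ((deriv ^^ k) \<phi>) field_differentiable (at x)) \<and>
     (\<exists>K. compact K \<and> K \<subseteq> {0<..<a} \<and> (\<forall>x. x \<notin> K \<longrightarrow> \<phi> x = 0))"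

definition loc_integrable :: "real \<Rightarrow> (real \<Rightarrow> complex) \<Rightarrow> bool" where
  "loc_integrable a f \<longleftrightarrow> (\<forall>K. compact K \<and> K \<subseteq> {0<..<a} \<longrightarrow> f absolutely_integrable_on K)"

definition is_weak_deriv :: "real \<Rightarrow> (real \<Rightarrow> complex) \<Rightarrow> (real \<Rightarrow> complex) \<Rightarrow> bool" where
  "is_weak_deriv a f g \<longleftrightarrow> loc_integrable a f \<and> loc_integrable a g \<and>
     (\<forall>\<phi>. test_function a \<phi> \<longrightarrow>
        (LINT x|lebesgue_on {0<..<a}. f x * complex_of_real (deriv \<phi> x)) =
        - (LINT x|lebesgue_on {0<..<a}. g x * complex_of_real (\<phi> x)))"

definition weakly_differentiable :: "real \<Rightarrow> (real \<Rightarrow> complex) \<Rightarrow> bool" where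
  "weakly_differentiable a f \<longleftrightarrow> (\<exists>g. is_weak_deriv a f g)"

definition weak_deriv :: "real \<Rightarrow> (real \<Rightarrow> complex) \<Rightarrow> (real \<Rightarrow> complex)" where
  "weak_deriv a f = (SOME g. is_weak_deriv a f g)"

text \<open>
  Values at the endpoints \<open>0\<close> and \<open>a\<close> of a function determined only almost everywhere on \<open>(0,a)\<close>
  refer to its continuous representative on \<open>[0,a]\<close>, which is unique there if it exists.
\<close>

definition cont_rep :: "real \<Rightarrow> (real \<Rightarrow> complex) \<Rightarrow> (real \<Rightarrow> complex)" where
  "cont_rep a f =
     (SOME g. continuous_on {0..a} g \<and> (AE x in lebesgue_on {0<..<a}. g x = f x))"

section \<open>Metric graphs\<close>

text \<open>
  The edge \<open>E\<^sub>i\<close>, \<open>i \<in> {1..N}\<close>, is the curve \<open>c i\<close>, parametrised over \<open>[0,1]\<close>; its left and right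
  endpoints are \<open>pathstart (c i)\<close> and \<open>pathfinish (c i)\<close>.
\<close>

definition edge_length :: "(real \<Rightarrow> real ^ 3) \<Rightarrow> real" where
  "edge_length g = integral {0..1} (\<lambda>t. norm (vector_derivative g (at t)))"

definition geometric_graph :: "(real ^ 3) set \<Rightarrow> nat \<Rightarrow> (nat \<Rightarrow> real \<Rightarrow> real ^ 3) \<Rightarrow> bool" where
  "geometric_graph V N c \<longleftrightarrow> finite V \<and>
     (\<forall>i\<in>{1..N}. c i C1_differentiable_on {0..1} \<and> 0 < edge_length (c i) \<and>
        pathstart (c i) \<in> V \<and> pathfinish (c i) \<in> V \<and> pathstart (c i) \<noteq> pathfinish (c i))"

definition incident :: "(real \<Rightarrow> real ^ 3) \<Rightarrow> real ^ 3 \<Rightarrow> bool" where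
  "incident g v \<longleftrightarrow> pathstart g = v \<or> pathfinish g = v"

text \<open>
  Points of the disjoint union \<open>S\<close> of the edges are pairs \<open>(i, x)\<close> with \<open>i \<in> {1..N}\<close> and \<open>x\<close> the
  arc length coordinate in \<open>[0, d i]\<close>, where \<open>d i\<close> is the length of the edge \<open>i\<close>.
\<close>

type_synonym graph_fun = "nat \<times> real \<Rightarrow> complex"

definition on_edge :: "graph_fun \<Rightarrow> nat \<Rightarrow> real \<Rightarrow> complex" where
  "on_edge u i = (\<lambda>x. u (i, x))"

definition L2_graph :: "nat \<Rightarrow> (nat \<Rightarrow> real) \<Rightarrow> graph_fun set" where
  "L2_graph N d = {u. \<forall>i\<in>{1..N}.
     on_edge u i \<in> borel_measurable (lebesgue_on {0<..<d i}) \<and>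
     integrable (lebesgue_on {0<..<d i}) (\<lambda>x. (cmod (on_edge u i x))\<^sup>2)}"

definition L2_inner :: "nat \<Rightarrow> (nat \<Rightarrow> real) \<Rightarrow> graph_fun \<Rightarrow> graph_fun \<Rightarrow> complex" where
  "L2_inner N d u v =
     (\<Sum>i\<in>{1..N}. LINT x|lebesgue_on {0<..<d i}. on_edge u i x * cnj (on_edge v i x))"

definition L2_norm :: "nat \<Rightarrow> (nat \<Rightarrow> real) \<Rightarrow> graph_fun \<Rightarrow> real" where
  "L2_norm N d u = sqrt (Re (L2_inner N d u u))"

definition graph_deriv :: "(nat \<Rightarrow> real) \<Rightarrow> graph_fun \<Rightarrow> graph_fun" where
  "graph_deriv d u = (\<lambda>(i, x). weak_deriv (d i) (on_edge u i) x)"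

definition H2_graph :: "nat \<Rightarrow> (nat \<Rightarrow> real) \<Rightarrow> graph_fun set" where
  "H2_graph N d = {u \<in> L2_graph N d.
     (\<forall>i\<in>{1..N}. weakly_differentiable (d i) (on_edge u i) \<and>
        weakly_differentiable (d i) (on_edge (graph_deriv d u) i)) \<and>
     graph_deriv d u \<in> L2_graph N d \<and>
     graph_deriv d (graph_deriv d u) \<in> L2_graph N d}"

definition left_value :: "(nat \<Rightarrow> real) \<Rightarrow> graph_fun \<Rightarrow> nat \<Rightarrow> complex" where
  "left_value d u i = cont_rep (d i) (on_edge u i) 0"

definition right_value :: "(nat \<Rightarrow> real) \<Rightarrow> graph_fun \<Rightarrow> nat \<Rightarrow> complex" where
  "right_value d u i = cont_rep (d i) (on_edge u i) (d i)"

section \<open>The operators\<close>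

text \<open>
  The coefficients \<open>l\<^sub>i\<close>, \<open>r\<^sub>i\<close> are \<open>l i\<close>, \<open>r i\<close>, and \<open>l\<^sub>i\<^sub>j\<close>, \<open>r\<^sub>i\<^sub>j\<close> are \<open>ll i j\<close>, \<open>rr i j\<close>; the diagonal
  values of \<open>ll\<close> and \<open>rr\<close> are never used.
\<close>

definition F_left ::
    "nat \<Rightarrow> (nat \<Rightarrow> real \<Rightarrow> real ^ 3) \<Rightarrow> (nat \<Rightarrow> real) \<Rightarrow> (nat \<Rightarrow> real) \<Rightarrow>
     (nat \<Rightarrow> nat \<Rightarrow> real) \<Rightarrow> (nat \<Rightarrow> nat \<Rightarrow> real) \<Rightarrow> nat \<Rightarrow> graph_fun \<Rightarrow> complex" where
  "F_left N c \<sigma> l ll rr i u = (let d = (\<lambda>j. edge_length (c j)) in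
     (of_real (\<sigma> i * l i) * left_value d u i
      - (\<Sum>j\<in>{j\<in>{1..N}. j \<noteq> i \<and> pathstart (c j) = pathstart (c i)}.
            of_real (\<sigma> j * ll j i) * left_value d u j)
      - (\<Sum>j\<in>{j\<in>{1..N}. j \<noteq> i \<and> pathfinish (c j) = pathstart (c i)}.
            of_real (\<sigma> j * rr j i) * right_value d u j)) / of_real (\<sigma> i))"

definition F_right ::
    "nat \<Rightarrow> (nat \<Rightarrow> real \<Rightarrow> real ^ 3) \<Rightarrow> (nat \<Rightarrow> real) \<Rightarrow> (nat \<Rightarrow> real) \<Rightarrow>
     (nat \<Rightarrow> nat \<Rightarrow> real) \<Rightarrow> (nat \<Rightarrow> nat \<Rightarrow> real) \<Rightarrow> nat \<Rightarrow> graph_fun \<Rightarrow> complex" where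
  "F_right N c \<sigma> r ll rr i u = (let d = (\<lambda>j. edge_length (c j)) in
     ((\<Sum>j\<in>{j\<in>{1..N}. j \<noteq> i \<and> pathstart (c j) = pathfinish (c i)}.
            of_real (\<sigma> j * ll j i) * left_value d u j)
      + (\<Sum>j\<in>{j\<in>{1..N}. j \<noteq> i \<and> pathfinish (c j) = pathfinish (c i)}.
            of_real (\<sigma> j * rr j i) * right_value d u j)
      - of_real (\<sigma> i * r i) * right_value d u i) / of_real (\<sigma> i))"

text \<open>The domain and the graph of \<open>A\<^sub>n\<^sup>*\<close>, where \<open>k\<close> stands for \<open>\<kappa>\<^sub>n\<close>.\<close>

definition A_star_dom ::
    "nat \<Rightarrow> (nat \<Rightarrow> real \<Rightarrow> real ^ 3) \<Rightarrow> (nat \<Rightarrow> real) \<Rightarrow> (nat \<Rightarrow> real) \<Rightarrow> (nat \<Rightarrow> real) \<Rightarrow>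
     (nat \<Rightarrow> nat \<Rightarrow> real) \<Rightarrow> (nat \<Rightarrow> nat \<Rightarrow> real) \<Rightarrow> real \<Rightarrow> graph_fun set" where
  "A_star_dom N c \<sigma> l r ll rr k = (let d = (\<lambda>j. edge_length (c j)) in
     {u \<in> H2_graph N d. \<forall>i\<in>{1..N}.
        of_real k * left_value d (graph_deriv d u) i = F_left N c \<sigma> l ll rr i u \<and>
        of_real k * right_value d (graph_deriv d u) i = F_right N c \<sigma> r ll rr i u})"

definition A_star ::
    "nat \<Rightarrow> (nat \<Rightarrow> real \<Rightarrow> real ^ 3) \<Rightarrow> (nat \<Rightarrow> real) \<Rightarrow> (nat \<Rightarrow> real) \<Rightarrow> (nat \<Rightarrow> real) \<Rightarrow>
     (nat \<Rightarrow> nat \<Rightarrow> real) \<Rightarrow> (nat \<Rightarrow> nat \<Rightarrow> real) \<Rightarrow> real \<Rightarrow> (graph_fun \<times> graph_fun) set" where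
  "A_star N c \<sigma> l r ll rr k = (let d = (\<lambda>j. edge_length (c j)) in
     {(u, w). u \<in> A_star_dom N c \<sigma> l r ll rr k \<and> w \<in> L2_graph N d \<and>
        same_class (L2_norm N d) w
          (\<lambda>(i, x). of_real (k * \<sigma> i) * graph_deriv d (graph_deriv d u) (i, x))})"

end

theory Submission
  imports Defs "HOL-Complex_Analysis.Complex_Analysis" "HOL-Library.Function_Algebras"
begin

text \<open>
  Let \<open>A\<close> be the operator minus a constant \<open>\<gamma>\<close>.  Green's identity writes \<open>\<langle>A u, u\<rangle>\<close> as boundary terms
  minus \<open>\<kappa> \<integral> \<sigma> \<bar>u'\<bar>\<^sup>2\<close>, and a trace inequality absorbs the boundary terms; the constant \<open>\<gamma>\<close> needed for
  this only depends on the smallest \<open>\<kappa>\<close>.  Hence \<open>z A\<close> is dissipative for all \<open>z\<close> with \<open>\<bar>Im z\<bar> < Re z\<close>.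
  The equation \<open>u - z A u = f\<close> is a system of linear differential equations of second order, whose
  boundary conditions form a square linear system; it is injective by dissipativity, hence solvable.

  For such \<open>A\<close> the resolvents \<open>J z = (1 - z A)\<^sup>-\<^sup>1\<close> are contractions.  On the domain of \<open>A\<^sup>2\<close> the products
  \<open>J (z / 2\<^sup>k)\<close> to the power \<open>2\<^sup>k\<close> converge at rate \<open>2\<^sup>-\<^sup>k\<close>, and the limit is a semigroup of contractions
  on the whole sector that is weakly, and therefore by Cauchy's estimates also uniformly, holomorphic.

  The growth bound is needed for any semigroup with the given generator: by dissipativity the right
  derivative of \<open>exp (- 2 \<gamma> t) \<parallel>T t f\<parallel>\<^sup>2\<close> is nonpositive.  Strong continuity at \<open>0\<close> only gives
  continuity from the right; Baire's theorem provides points of two-sided continuity.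
\<close>

section \<open>Spaces with a positive semidefinite inner product\<close>

text \<open>The boundary conditions prescribe \<kappa> u', so the boundary terms of Green's identity
  become a form in the endpoint values of u that does not contain \<kappa>, while the gradient term
  carries the factor \<kappa>. A lower bound for \<kappa> is therefore all that the absorption
  needs, and the growth rate is uniform in n. The factor z rotates only the boundary form, the other
  terms being real; on the sector of half-angle \<pi>/4 this costs at most a factor 2, because |z|
  <= 2 Re z there. Powers of two enter because successive approximants then differ by splitting each
  step into two equal ones, a purely local comparison whose errors are not amplified by the
  remaining contractions. Elements of the space are functions, not classes, and the inner product is
  only semidefinite, so limits are unique only modulo null functions. The semigroup is therefore
  built on a linear system of representatives, where the form is definite, and carried back. The
  growth bound, in contrast, concerns operators that are linear only modulo null functions.\<close>

locale semi_hilbert = vector_space scl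
  for scl :: "complex \<Rightarrow> 'v::ab_group_add \<Rightarrow> 'v" (infixr \<open>\<cdot>\<close> 75) +
  fixes X :: "'v set" and ip :: "'v \<Rightarrow> 'v \<Rightarrow> complex"
  assumes subspace_X: "subspace X"
    and ip_add_left: "x \<in> X \<Longrightarrow> y \<in> X \<Longrightarrow> z \<in> X \<Longrightarrow> ip (x + y) z = ip x z + ip y z"
    and ip_scale_left: "x \<in> X \<Longrightarrow> y \<in> X \<Longrightarrow> ip (a \<cdot> x) y = a * ip x y"
    and ip_cnj: "x \<in> X \<Longrightarrow> y \<in> X \<Longrightarrow> ip y x = cnj (ip x y)"
    and ip_nonneg: "x \<in> X \<Longrightarrow> 0 \<le> Re (ip x x)"
    and complete: "(\<And>n::nat. f n \<in> X) \<Longrightarrow>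
      (\<And>e. 0 < e \<Longrightarrow> \<exists>K. \<forall>m\<ge>K. \<forall>n\<ge>K. sqrt (Re (ip (f m - f n) (f m - f n))) < e) \<Longrightarrow>
      \<exists>y\<in>X. (\<lambda>n. sqrt (Re (ip (f n - y) (f n - y)))) \<longlonglongrightarrow> 0"
begin

definition nrm :: "'v \<Rightarrow> real" where
  "nrm x = sqrt (Re (ip x x))"

lemma zero_in [simp]: "0 \<in> X"
  and add_in [simp]: "x \<in> X \<Longrightarrow> y \<in> X \<Longrightarrow> x + y \<in> X"
  and scale_in [simp]: "x \<in> X \<Longrightarrow> a \<cdot> x \<in> X"
  and diff_in [simp]: "x \<in> X \<Longrightarrow> y \<in> X \<Longrightarrow> x - y \<in> X"
  and minus_in [simp]: "x \<in> X \<Longrightarrow> - x \<in> X"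
  by (auto intro: subspace_0 subspace_add subspace_scale subspace_diff subspace_neg subspace_X)

lemma ip_minus_left: "x \<in> X \<Longrightarrow> z \<in> X \<Longrightarrow> ip (- x) z = - ip x z"
  using ip_scale_left[of x z "-1"] by simp

lemma ip_diff_left: "x \<in> X \<Longrightarrow> y \<in> X \<Longrightarrow> z \<in> X \<Longrightarrow> ip (x - y) z = ip x z - ip y z"
  using ip_add_left[of x "- y" z] by (simp add: ip_minus_left)

lemma ip_add_right: "x \<in> X \<Longrightarrow> y \<in> X \<Longrightarrow> z \<in> X \<Longrightarrow> ip z (x + y) = ip z x + ip z y"
  by (metis add_in complex_cnj_add ip_add_left ip_cnj)

lemma ip_scale_right: "x \<in> X \<Longrightarrow> y \<in> X \<Longrightarrow> ip x (a \<cdot> y) = cnj a * ip x y"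
  by (metis complex_cnj_mult ip_cnj ip_scale_left scale_in)

lemma ip_minus_right: "x \<in> X \<Longrightarrow> z \<in> X \<Longrightarrow> ip z (- x) = - ip z x"
  using ip_scale_right[of z x "-1"] by simp

lemma ip_diff_right: "x \<in> X \<Longrightarrow> y \<in> X \<Longrightarrow> z \<in> X \<Longrightarrow> ip z (x - y) = ip z x - ip z y"
  using ip_add_right[of x "- y" z] by (simp add: ip_minus_right)

lemmas ip_simps = ip_add_left ip_add_right ip_scale_left ip_scale_right ip_diff_left ip_diff_right
  ip_minus_left ip_minus_right

lemma nrm_ge_0 [simp]: "x \<in> X \<Longrightarrow> 0 \<le> nrm x"
  by (simp add: nrm_def ip_nonneg)

lemma nrm_sq: "x \<in> X \<Longrightarrow> (nrm x)\<^sup>2 = Re (ip x x)"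
  by (simp add: nrm_def ip_nonneg)

lemma ip_self: "x \<in> X \<Longrightarrow> ip x x = complex_of_real ((nrm x)\<^sup>2)"
proof -
  assume x: "x \<in> X"
  have "Im (ip x x) = - Im (ip x x)" using ip_cnj[OF x x] by (metis cnj.sel(2))
  then show ?thesis using nrm_sq[OF x] by (simp add: complex_eq_iff)
qed

lemma nrm_add_sq: "x \<in> X \<Longrightarrow> y \<in> X \<Longrightarrow> (nrm (x + y))\<^sup>2 = (nrm x)\<^sup>2 + (nrm y)\<^sup>2 + 2 * Re (ip x y)"
  by (simp add: nrm_sq ip_simps ip_cnj[of x y])

lemma nrm_diff_sq: "x \<in> X \<Longrightarrow> y \<in> X \<Longrightarrow> (nrm (x - y))\<^sup>2 = (nrm x)\<^sup>2 + (nrm y)\<^sup>2 - 2 * Re (ip x y)"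
  by (simp add: nrm_sq ip_simps ip_cnj[of x y])

lemma nrm_scale [simp]: "x \<in> X \<Longrightarrow> nrm (a \<cdot> x) = cmod a * nrm x"
proof -
  assume x: "x \<in> X"
  have "complex_of_real ((nrm (a \<cdot> x))\<^sup>2) = complex_of_real ((cmod a * nrm x)\<^sup>2)"
    using x by (simp add: ip_self[symmetric] ip_simps power_mult_distrib complex_norm_square del: of_real_power)
  then have "(nrm (a \<cdot> x))\<^sup>2 = (cmod a * nrm x)\<^sup>2" by (simp only: of_real_eq_iff)
  then show ?thesis using x by (simp add: power2_eq_iff_nonneg)
qed

lemma nrm_zero [simp]: "nrm 0 = 0"
  using nrm_scale[of 0 0] by simp

lemma nrm_minus [simp]: "x \<in> X \<Longrightarrow> nrm (- x) = nrm x"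
  using nrm_scale[of x "-1"] by simp

lemma nrm_commute: "x \<in> X \<Longrightarrow> y \<in> X \<Longrightarrow> nrm (x - y) = nrm (y - x)"
  using nrm_minus[of "x - y"] by simp

text \<open>A null vector need not be zero here, so dividing by the square norm of \<open>y\<close>
  is not always possible. Nonnegativity of the square norm of x - t c y for all real t covers both
  cases: a large t excludes \<open>c \<noteq> 0\<close> if \<open>y\<close> is null, and
  \<open>1 / (nrm y)\<^sup>2\<close> is the optimal t otherwise.\<close>

lemma Cauchy_Schwarz:
  assumes x: "x \<in> X" and y: "y \<in> X"
  shows "cmod (ip x y) \<le> nrm x * nrm y"
proof -
  define c where "c = ip x y"
  have main: "2 * t * (cmod c)\<^sup>2 \<le> (nrm x)\<^sup>2 + t\<^sup>2 * (cmod c)\<^sup>2 * (nrm y)\<^sup>2" for t :: real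
  proof -
    have "0 \<le> (nrm (x - (of_real t * c) \<cdot> y))\<^sup>2" by simp
    also have "\<dots> = (nrm x)\<^sup>2 + (cmod (of_real t * c) * nrm y)\<^sup>2 - 2 * Re (cnj (of_real t * c) * c)"
      using x y by (simp add: nrm_diff_sq ip_simps c_def)
    also have "Re (cnj (of_real t * c) * c) = t * (cmod c)\<^sup>2"
      by (simp add: cmod_power2) (simp add: power2_eq_square algebra_simps)
    finally show ?thesis by (simp add: norm_mult power_mult_distrib)
  qed
  have "(cmod c)\<^sup>2 \<le> (nrm x * nrm y)\<^sup>2"
  proof (cases "nrm y = 0")
    case True
    have "c = 0"
    proof (rule ccontr)
      assume "c \<noteq> 0"
      then show False using main[of "((nrm x)\<^sup>2 + 1) / (2 * (cmod c)\<^sup>2)"] True by (simp add: field_simps)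
    qed
    then show ?thesis by simp
  next
    case False
    then have b: "0 < (nrm y)\<^sup>2" by simp
    have "2 * (1 / (nrm y)\<^sup>2) * (cmod c)\<^sup>2 = 2 * ((cmod c)\<^sup>2 / (nrm y)\<^sup>2)"
      and "(1 / (nrm y)\<^sup>2)\<^sup>2 * (cmod c)\<^sup>2 * (nrm y)\<^sup>2 = (cmod c)\<^sup>2 / (nrm y)\<^sup>2"
      using b by (auto simp: power2_eq_square)
    then have "(cmod c)\<^sup>2 / (nrm y)\<^sup>2 \<le> (nrm x)\<^sup>2" using main[of "1 / (nrm y)\<^sup>2"] by linarith
    then show ?thesis using b by (simp add: pos_divide_le_eq power_mult_distrib)
  qed
  then show ?thesis unfolding c_def using x y by (meson mult_nonneg_nonneg nrm_ge_0 power2_le_imp_le)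
qed

lemma nrm_triangle: 
  assumes x: "x \<in> X" and y: "y \<in> X"
  shows "nrm (x + y) \<le> nrm x + nrm y"
proof -
  have "Re (ip x y) \<le> nrm x * nrm y"
    using Cauchy_Schwarz[OF x y] complex_Re_le_cmod[of "ip x y"] by linarith
  then have "(nrm (x + y))\<^sup>2 \<le> (nrm x + nrm y)\<^sup>2"
    by (simp add: nrm_add_sq x y power2_sum)
  then show ?thesis by (rule power2_le_imp_le) (use x y in simp)
qed

lemma nrm_triangle_diff: "x \<in> X \<Longrightarrow> y \<in> X \<Longrightarrow> nrm (x - y) \<le> nrm x + nrm y"
  using nrm_triangle[of x "- y"] by simp

lemma nrm_triangle3: "x \<in> X \<Longrightarrow> y \<in> X \<Longrightarrow> z \<in> X \<Longrightarrow> nrm (x - z) \<le> nrm (x - y) + nrm (y - z)"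
  using nrm_triangle[of "x - y" "y - z"] by simp

lemma nrm_triangle_add_diff: "x \<in> X \<Longrightarrow> y \<in> X \<Longrightarrow> z \<in> X \<Longrightarrow> nrm (x + y - z) \<le> nrm x + nrm y + nrm z"
  using nrm_triangle_diff[of "x + y" z] nrm_triangle[of x y] by simp

lemma nrm_triangle_add_add_diff:
  "x \<in> X \<Longrightarrow> y \<in> X \<Longrightarrow> z \<in> X \<Longrightarrow> v \<in> X \<Longrightarrow> nrm (x + y + z - v) \<le> nrm x + nrm y + nrm z + nrm v"
  using nrm_triangle_add_diff[of "x + y" z v] nrm_triangle[of x y] by simp

lemma nrm_diff_ge: "x \<in> X \<Longrightarrow> y \<in> X \<Longrightarrow> \<bar>nrm x - nrm y\<bar> \<le> nrm (x - y)"
  using nrm_triangle[of "x - y" y] nrm_triangle[of "y - x" x] nrm_commute[of x y] by auto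

lemma nrm_eq_mod: "x \<in> X \<Longrightarrow> y \<in> X \<Longrightarrow> nrm (x - y) = 0 \<Longrightarrow> nrm x = nrm y"
  using nrm_diff_ge[of x y] by simp

lemma ip_eq_mod_left: "x \<in> X \<Longrightarrow> y \<in> X \<Longrightarrow> z \<in> X \<Longrightarrow> nrm (x - y) = 0 \<Longrightarrow> ip x z = ip y z"
  using Cauchy_Schwarz[of "x - y" z] by (simp add: ip_simps)

lemma ip_eq_mod_right: "x \<in> X \<Longrightarrow> y \<in> X \<Longrightarrow> z \<in> X \<Longrightarrow> nrm (x - y) = 0 \<Longrightarrow> ip z x = ip z y"
  using Cauchy_Schwarz[of z "x - y"] by (simp add: ip_simps)

text \<open>Converts bounds on scalar products, such as those from Cauchy's estimates, into norm
  bounds; the hypothesis is tested with \<open>g = x\<close>.\<close>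

lemma nrm_dual_bound:
  assumes x: "x \<in> X" and c: "\<And>g. g \<in> X \<Longrightarrow> cmod (ip x g) \<le> c * nrm g" and "0 \<le> c"
  shows "nrm x \<le> c"
proof (cases "nrm x = 0")
  case False
  have "(nrm x)\<^sup>2 \<le> c * nrm x" using c[OF x] by (simp add: ip_self[OF x] norm_power)
  then show ?thesis using False x
    using mult_le_cancel_right[of "nrm x" "nrm x" c] nrm_ge_0[OF x] by (simp add: power2_eq_square)
qed (use \<open>0 \<le> c\<close> in simp)

lemma complete_nrm:
  assumes "\<And>n::nat. f n \<in> X" and "\<And>e. 0 < e \<Longrightarrow> \<exists>K. \<forall>m\<ge>K. \<forall>n\<ge>K. nrm (f m - f n) < e"
  shows "\<exists>y\<in>X. (\<lambda>n. nrm (f n - y)) \<longlonglongrightarrow> 0"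
  using complete[of f] assms unfolding nrm_def by blast

lemma complete_null:
  assumes f: "\<And>n::nat. f n \<in> X" and e: "\<epsilon> \<longlonglongrightarrow> 0"
    and b: "\<And>m n. m \<le> n \<Longrightarrow> nrm (f m - f n) \<le> \<epsilon> m"
  shows "\<exists>y\<in>X. (\<lambda>n. nrm (f n - y)) \<longlonglongrightarrow> 0"
proof (rule complete_nrm[OF f])
  fix e :: real assume "0 < e"
  then obtain K where K: "\<And>n. n \<ge> K \<Longrightarrow> \<epsilon> n < e"
    using order_tendstoD(2)[OF e] unfolding eventually_sequentially by blast
  have "nrm (f m - f n) < e" if "m \<ge> K" "n \<ge> K" for m n
  proof (cases "m \<le> n")
    case True then show ?thesis using b[of m n] K[of m] that by linarith
  next
    case False then show ?thesis using b[of n m] K[of n] that nrm_commute[OF f f, of m n] by fastforce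
  qed
  then show "\<exists>K. \<forall>m\<ge>K. \<forall>n\<ge>K. nrm (f m - f n) < e" by blast
qed

text \<open>The projection argument for a subspace that need not be closed: a minimising sequence in
  \<open>M\<close> converges in \<open>X\<close> to some \<open>v\<close>, and \<open>f - v\<close>
  is orthogonal to \<open>M\<close>, hence null.\<close>

lemma dense_if_orthogonal_trivial:
  assumes M: "subspace M" "M \<subseteq> X"
    and orth: "\<And>g. g \<in> X \<Longrightarrow> (\<forall>u\<in>M. ip g u = 0) \<Longrightarrow> nrm g = 0"
    and f: "f \<in> X" and e: "0 < e"
  shows "\<exists>u\<in>M. nrm (f - u) < e"
proof -
  define D where "D = (\<lambda>u. (nrm (f - u))\<^sup>2) ` M"
  define \<delta> where "\<delta> = Inf D"
  have M0: "0 \<in> M" using M(1) by (rule subspace_0)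
  have MX: "u \<in> M \<Longrightarrow> u \<in> X" for u using M(2) by blast
  have ne: "D \<noteq> {}" and bb: "bdd_below D"
    using M0 by (auto simp: D_def intro!: bdd_belowI[of _ 0])
  have lower: "\<delta> \<le> (nrm (f - u))\<^sup>2" if "u \<in> M" for u
    unfolding \<delta>_def using that bb by (intro cInf_lower) (auto simp: D_def)
  have "\<exists>u\<in>M. (nrm (f - u))\<^sup>2 < \<delta> + inverse (real (Suc n))" for n
    using cInf_lessD[OF ne, of "\<delta> + inverse (real (Suc n))"] unfolding \<delta>_def[symmetric]
    by (auto simp: D_def)
  then obtain u where uM: "\<And>n. u n \<in> M"
    and u: "\<And>n. (nrm (f - u n))\<^sup>2 < \<delta> + inverse (real (Suc n))" by metis
  have uX: "u n \<in> X" for n using uM MX by blast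
  \<comment> \<open>Parallelogram law: the midpoint of \<open>u m\<close> and \<open>u n\<close>
    lies in \<open>M\<close>, so its square distance from \<open>f\<close> is at least
    \<open>\<delta>\<close>.\<close>
  have par: "(nrm (u m - u n))\<^sup>2 \<le> 4 * inverse (real (Suc m))" if "m \<le> n" for m n
  proof -
    let ?a = "f - u m" and ?b = "f - u n"
    have aX: "?a \<in> X" "?b \<in> X" using f uX by auto
    have "(nrm (?a - ?b))\<^sup>2 + (nrm (?a + ?b))\<^sup>2 = 2 * (nrm ?a)\<^sup>2 + 2 * (nrm ?b)\<^sup>2"
      using nrm_add_sq[OF aX] nrm_diff_sq[OF aX] by linarith
    moreover have "?a + ?b = 2 \<cdot> (f - (1/2) \<cdot> (u m + u n))"
      using scale_left_distrib[of 1 1 f] by (simp add: algebra_simps)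
    moreover have "(1/2) \<cdot> (u m + u n) \<in> M"
      using uM M(1) by (simp add: subspace_add subspace_scale)
    ultimately have "(nrm (?a - ?b))\<^sup>2 + 4 * \<delta> \<le> 2 * (nrm ?a)\<^sup>2 + 2 * (nrm ?b)\<^sup>2"
      using lower[of "(1/2) \<cdot> (u m + u n)"] f uX by (simp add: power_mult_distrib)
    moreover have "inverse (real (Suc n)) \<le> inverse (real (Suc m))" using that by (simp add: field_simps)
    ultimately have "(nrm (?a - ?b))\<^sup>2 \<le> 4 * inverse (real (Suc m))" using u[of m] u[of n] by linarith
    moreover have "nrm (?a - ?b) = nrm (u m - u n)"
      using nrm_commute[OF uX uX, of m n] by (simp add: algebra_simps)
    ultimately show ?thesis by simp
  qed
  obtain v where v: "v \<in> X" and lim: "(\<lambda>n. nrm (u n - v)) \<longlonglongrightarrow> 0"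
  proof -
    have "(\<lambda>m. sqrt (4 * inverse (real (Suc m)))) \<longlonglongrightarrow> sqrt (4 * 0)"
      by (intro tendsto_intros LIMSEQ_inverse_real_of_nat)
    then have lim: "(\<lambda>m. sqrt (4 * inverse (real (Suc m)))) \<longlonglongrightarrow> 0" by simp
    have "\<exists>v\<in>X. (\<lambda>n. nrm (u n - v)) \<longlonglongrightarrow> 0"
      by (rule complete_null[OF uX lim]) (rule real_le_rsqrt[OF par])
    then show ?thesis using that by blast
  qed
  define g where "g = f - v"
  have gX: "g \<in> X" using f v by (simp add: g_def)
  have gd: "(nrm g)\<^sup>2 \<le> \<delta>"
  proof -
    have "(\<lambda>n. (sqrt (\<delta> + inverse (real (Suc n))) + nrm (u n - v))\<^sup>2) \<longlonglongrightarrow> (sqrt (\<delta> + 0) + 0)\<^sup>2"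
      by (intro tendsto_intros LIMSEQ_inverse_real_of_nat lim)
    moreover have "(nrm g)\<^sup>2 \<le> (sqrt (\<delta> + inverse (real (Suc n))) + nrm (u n - v))\<^sup>2" for n
    proof -
      have "nrm g \<le> nrm (f - u n) + nrm (u n - v)" unfolding g_def using f uX v by (intro nrm_triangle3)
      also have "nrm (f - u n) \<le> sqrt (\<delta> + inverse (real (Suc n)))"
        using u[of n] by (intro real_le_rsqrt) simp
      finally show ?thesis using gX by (intro power_mono) auto
    qed
    moreover have "0 \<le> \<delta>" unfolding \<delta>_def using ne by (intro cInf_greatest) (auto simp: D_def)
    ultimately show ?thesis using Lim_bounded2[of _ _ 0 "(nrm g)\<^sup>2"] by simp
  qed
  \<comment> \<open>The limit \<open>v\<close> inherits minimality, because \<open>v + w\<close> is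
    the limit of the elements \<open>u n + w\<close> of \<open>M\<close>.\<close>
  have near: "(nrm g)\<^sup>2 \<le> (nrm (g - w))\<^sup>2" if w: "w \<in> M" for w
  proof -
    have "(\<lambda>n. (nrm (g - w) + nrm (u n - v))\<^sup>2) \<longlonglongrightarrow> (nrm (g - w) + 0)\<^sup>2"
      by (intro tendsto_intros lim)
    moreover have "\<delta> \<le> (nrm (g - w) + nrm (u n - v))\<^sup>2" for n
    proof -
      have "\<delta> \<le> (nrm (f - (u n + w)))\<^sup>2" using uM w M(1) by (intro lower subspace_add)
      also have "f - (u n + w) = (g - w) - (u n - v)" by (simp add: g_def)
      also have "(nrm \<dots>)\<^sup>2 \<le> (nrm (g - w) + nrm (u n - v))\<^sup>2"
        using gX MX[OF w] uX v by (intro power_mono nrm_triangle_diff) auto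
      finally show ?thesis .
    qed
    ultimately have "\<delta> \<le> (nrm (g - w))\<^sup>2" using Lim_bounded2[of _ _ 0 \<delta>] by simp
    then show ?thesis using gd by linarith
  qed
  have "ip g w = 0" if w: "w \<in> M" for w
  proof (rule ccontr)
    define c where "c = ip g w"
    assume "ip g w \<noteq> 0"
    then have c: "c \<noteq> 0" by (simp add: c_def)
    have wX: "w \<in> X" using MX[OF w] .
    have ineq: "2 * t * (cmod c)\<^sup>2 \<le> t\<^sup>2 * (cmod c)\<^sup>2 * (nrm w)\<^sup>2" for t :: real
    proof -
      have "(nrm g)\<^sup>2 \<le> (nrm (g - (of_real t * c) \<cdot> w))\<^sup>2"
        using w M(1) by (intro near subspace_scale)
      also have "\<dots> = (nrm g)\<^sup>2 + (cmod (of_real t * c) * nrm w)\<^sup>2 - 2 * Re (cnj (of_real t * c) * c)"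
        using gX wX by (simp add: nrm_diff_sq ip_simps c_def)
      also have "Re (cnj (of_real t * c) * c) = t * (cmod c)\<^sup>2"
        by (simp add: cmod_power2) (simp add: power2_eq_square algebra_simps)
      finally show ?thesis by (simp add: norm_mult power_mult_distrib)
    qed
    \<comment> \<open>With this \<open>t\<close> the quadratic coefficient
      \<open>t\<^sup>2 * (nrm w)\<^sup>2\<close> equals \<open>t - t\<^sup>2\<close>, which is
      strictly below the linear one, \<open>2 * t\<close>.\<close>
    define t where "t = 1 / (1 + (nrm w)\<^sup>2)"
    have t: "0 < t" "t * (1 + (nrm w)\<^sup>2) = 1"
      unfolding t_def using zero_le_power2[of "nrm w"] by (auto simp: add_pos_nonneg add_nonneg_eq_0_iff)
    have "t\<^sup>2 * (nrm w)\<^sup>2 = t * (t * (1 + (nrm w)\<^sup>2)) - t\<^sup>2"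
      by (simp add: power2_eq_square algebra_simps)
    then have "t\<^sup>2 * (nrm w)\<^sup>2 = t - t\<^sup>2" by (simp only: t(2) mult_1_right)
    then have "t\<^sup>2 * (nrm w)\<^sup>2 < 2 * t" using t(1) zero_le_power2[of t] by linarith
    then have "t\<^sup>2 * (nrm w)\<^sup>2 * (cmod c)\<^sup>2 < 2 * t * (cmod c)\<^sup>2" using c by simp
    then show False using ineq[of t] by (simp only: mult.assoc mult.commute[of "(cmod c)\<^sup>2"])
  qed
  then have "nrm g = 0" using orth[OF gX] by blast
  obtain n where n: "nrm (u n - v) < e"
    using eventually_happens'[OF sequentially_bot order_tendstoD(2)[OF lim e]] by blast
  have "nrm (f - u n) \<le> nrm (f - v) + nrm (v - u n)" using f v uX by (intro nrm_triangle3)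
  then have "nrm (f - u n) < e" using \<open>nrm g = 0\<close> n nrm_commute[OF v uX, of n] by (simp add: g_def)
  then show ?thesis using uM by blast
qed

end

section \<open>Semigroups of m-sectorial operators\<close>

text \<open>The open sector of half-angle \<pi>/4 around the positive axis, in a form that makes
  closure under sums evident.\<close>

definition quarter :: "complex set" where
  "quarter = {z. \<bar>Im z\<bar> < Re z}"

lemma quarter_add: "z \<in> quarter \<Longrightarrow> w \<in> quarter \<Longrightarrow> z + w \<in> quarter"
  by (auto simp: quarter_def)

lemma quarter_nonzero: "z \<in> quarter \<Longrightarrow> z \<noteq> 0"
  by (auto simp: quarter_def)

lemma quarter_divide: "z \<in> quarter \<Longrightarrow> 0 < c \<Longrightarrow> z / complex_of_real c \<in> quarter"
  by (auto simp: quarter_def abs_mult divide_strict_right_mono abs_divide)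

lemma of_real_in_quarter: "0 < c \<Longrightarrow> complex_of_real c \<in> quarter"
  by (auto simp: quarter_def)

lemma open_quarter: "open quarter"
  unfolding quarter_def by (intro open_Collect_less continuous_intros)

lemma cone_add: "z \<in> insert 0 quarter \<Longrightarrow> w \<in> insert 0 quarter \<Longrightarrow> z + w \<in> insert 0 quarter"
  using quarter_add by auto

lemma cone_divide: "z \<in> insert 0 quarter \<Longrightarrow> z / 2 ^ k \<in> insert 0 quarter"
  using quarter_divide[of z "2 ^ k"] by auto

locale hilbert = semi_hilbert +
  assumes definite: "x \<in> X \<Longrightarrow> ip x x = 0 \<Longrightarrow> x = 0"
begin

lemma nrm_0D: "x \<in> X \<Longrightarrow> nrm x = 0 \<Longrightarrow> x = 0"
  using definite ip_self by simp

lemma nrm_diff_0D: "x \<in> X \<Longrightarrow> y \<in> X \<Longrightarrow> nrm (x - y) = 0 \<Longrightarrow> x = y"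
  using nrm_0D[of "x - y"] by simp

text \<open>The carrier type has no topology, so convergence is expressed by the norm; membership in
  \<open>X\<close> is included because the norm laws hold only there.\<close>

definition lim_to :: "(nat \<Rightarrow> 'a) \<Rightarrow> 'a \<Rightarrow> bool" where
  "lim_to s y \<longleftrightarrow> y \<in> X \<and> (\<forall>k. s k \<in> X) \<and> (\<lambda>k. nrm (s k - y)) \<longlonglongrightarrow> 0"

lemma lim_toI: 
  assumes "y \<in> X" "\<And>k. s k \<in> X" "\<And>k. nrm (s k - y) \<le> b k" "b \<longlonglongrightarrow> 0"
  shows "lim_to s y"
  unfolding lim_to_def using assms
  by (auto intro!: tendsto_sandwich[of "\<lambda>_. 0" "\<lambda>k. nrm (s k - y)" sequentially b])

lemma lim_to_const: "y \<in> X \<Longrightarrow> lim_to (\<lambda>_. y) y"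
  by (simp add: lim_to_def)

lemma lim_to_add:
  assumes "lim_to s y" "lim_to s' y'"
  shows "lim_to (\<lambda>k. s k + s' k) (y + y')"
proof (rule lim_toI)
  show "nrm (s k + s' k - (y + y')) \<le> nrm (s k - y) + nrm (s' k - y')" for k
    using assms nrm_triangle[of "s k - y" "s' k - y'"] by (simp add: lim_to_def algebra_simps)
  show "(\<lambda>k. nrm (s k - y) + nrm (s' k - y')) \<longlonglongrightarrow> 0"
    using assms tendsto_add[of "\<lambda>k. nrm (s k - y)" 0 sequentially "\<lambda>k. nrm (s' k - y')" 0]
    by (simp add: lim_to_def)
qed (use assms in \<open>auto simp: lim_to_def\<close>)

lemma lim_to_scale:
  assumes "lim_to s y"
  shows "lim_to (\<lambda>k. scl a (s k)) (scl a y)"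
proof (rule lim_toI)
  show "nrm (scl a (s k) - scl a y) \<le> cmod a * nrm (s k - y)" for k
    using assms nrm_scale[of "s k - y" a] by (simp add: lim_to_def algebra_simps)
  show "(\<lambda>k. cmod a * nrm (s k - y)) \<longlonglongrightarrow> 0"
    using assms tendsto_mult_right_zero[of "\<lambda>k. nrm (s k - y)" sequentially "cmod a"]
    by (simp add: lim_to_def)
qed (use assms in \<open>auto simp: lim_to_def\<close>)

lemma lim_to_diff: "lim_to s y \<Longrightarrow> lim_to s' y' \<Longrightarrow> lim_to (\<lambda>k. s k - s' k) (y - y')"
  using lim_to_add[of s y "\<lambda>k. scl (-1) (s' k)" "scl (-1) y'"] lim_to_scale[of s' y' "-1"] by simp

lemma lim_to_nrm: "lim_to s y \<Longrightarrow> (\<lambda>k. nrm (s k)) \<longlonglongrightarrow> nrm y"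
proof -
  assume l: "lim_to s y"
  have "(\<lambda>k. nrm (s k) - nrm y) \<longlonglongrightarrow> 0"
    by (rule tendsto_rabs_zero_cancel, rule tendsto_sandwich[of "\<lambda>_. 0" _ _ "\<lambda>k. nrm (s k - y)"])
      (use l nrm_diff_ge in \<open>auto simp: lim_to_def\<close>)
  then show ?thesis using LIM_zero_iff by blast
qed

lemma lim_to_nrm_le: 
  assumes "lim_to s y" "\<And>k. nrm (s k) \<le> b k" "b \<longlonglongrightarrow> c" shows "nrm y \<le> c"
  using LIMSEQ_le[OF lim_to_nrm[OF assms(1)] assms(3)] assms(2) by blast

lemma lim_to_unique: 
  assumes "lim_to s y" "lim_to s y'" shows "y = y'"
proof (rule nrm_diff_0D)
  show "nrm (y - y') = 0"
    using lim_to_nrm[OF lim_to_diff[OF assms]] LIMSEQ_unique[of "\<lambda>_. 0" "nrm (y - y')" 0] by simp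
qed (use assms in \<open>auto simp: lim_to_def\<close>)

definition contr :: "('a \<Rightarrow> 'a) \<Rightarrow> bool" where
  "contr P \<longleftrightarrow> (\<forall>f\<in>X. P f \<in> X \<and> nrm (P f) \<le> nrm f) \<and> (\<forall>f\<in>X. \<forall>g\<in>X. P (f + g) = P f + P g) \<and>
     (\<forall>a. \<forall>f\<in>X. P (scl a f) = scl a (P f))"

lemma contrD:
  assumes "contr P" "f \<in> X"
  shows "P f \<in> X" "nrm (P f) \<le> nrm f" "g \<in> X \<Longrightarrow> P (f + g) = P f + P g"
    "P (scl a f) = scl a (P f)"
  using assms by (auto simp: contr_def)

lemma contr_diff: "contr P \<Longrightarrow> f \<in> X \<Longrightarrow> g \<in> X \<Longrightarrow> P (f - g) = P f - P g"
  using contrD(3)[of P f "- g"] contrD(4)[of P g "-1"] by simp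

lemma contr_id: "contr (\<lambda>f. f)" 
  by (simp add: contr_def)

lemma contr_comp:
  assumes P: "contr P" and Q: "contr Q" shows "contr (\<lambda>f. P (Q f))"
  unfolding contr_def
proof (intro conjI ballI allI)
  fix f assume f: "f \<in> X"
  note Qf = contrD(1)[OF Q f]
  show "P (Q f) \<in> X" using contrD(1)[OF P Qf] .
  show "nrm (P (Q f)) \<le> nrm f" using contrD(2)[OF P Qf] contrD(2)[OF Q f] by linarith
  show "P (Q (scl a f)) = scl a (P (Q f))" for a
    by (simp add: contrD(4)[OF Q f] contrD(4)[OF P Qf])
  show "P (Q (f + g)) = P (Q f) + P (Q g)" if "g \<in> X" for g
    by (simp add: contrD(3)[OF Q f that] contrD(3)[OF P Qf contrD(1)[OF Q that]])
qed

lemma contr_funpow: "contr P \<Longrightarrow> contr (P ^^ n)"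
proof (induction n)
  case 0 then show ?case using contr_id by (simp add: id_def)
next
  case (Suc n) then show ?case using contr_comp[of P "P ^^ n"] by (simp add: o_def)
qed

lemma contr_funpow_commute:
  assumes P: "contr P" and Q: "contr Q" and c: "\<And>f. f \<in> X \<Longrightarrow> P (Q f) = Q (P f)" and f: "f \<in> X"
  shows "(P ^^ n) (Q f) = Q ((P ^^ n) f)"
  by (induction n) (use f in \<open>simp_all add: c contrD(1)[OF contr_funpow[OF P]]\<close>)

lemma contr_funpow_prod:
  assumes P: "contr P" and Q: "contr Q" and c: "\<And>f. f \<in> X \<Longrightarrow> P (Q f) = Q (P f)" and f: "f \<in> X"
  shows "((\<lambda>f. P (Q f)) ^^ n) f = (P ^^ n) ((Q ^^ n) f)"
proof (induction n)
  case (Suc n)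
  have "Q ((P ^^ n) ((Q ^^ n) f)) = (P ^^ n) (Q ((Q ^^ n) f))"
    using contr_funpow_commute[OF P Q c contrD(1)[OF contr_funpow[OF Q] f], where n = n] by simp
  then show ?case using Suc by simp
qed simp

text \<open>The difference of the n-th powers telescopes into n terms, each containing
  \<open>P - Q\<close> once. Commutation lets all other factors, which are contractions, act after
  \<open>P - Q\<close> has been applied to \<open>f\<close>.\<close>

lemma contr_funpow_diff:
  assumes P: "contr P" and Q: "contr Q" and c: "\<And>f. f \<in> X \<Longrightarrow> P (Q f) = Q (P f)" and f: "f \<in> X"
  shows "nrm ((P ^^ n) f - (Q ^^ n) f) \<le> real n * nrm (P f - Q f)"
proof (induction n)
  case (Suc n)
  let ?p = "(P ^^ n) f" and ?q = "(Q ^^ n) f"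
  have X: "?p \<in> X" "?q \<in> X" "P f \<in> X" "Q f \<in> X"
    using f contrD(1)[OF contr_funpow] contrD(1) P Q by auto
  have 1: "(P ^^ Suc n) f = (P ^^ n) (P f)" "(Q ^^ Suc n) f = Q ?q"
    by (simp_all add: funpow_swap1)
  have 2: "(P ^^ n) (Q f) = Q ?p" by (rule contr_funpow_commute[OF P Q c f])
  have "(P ^^ Suc n) f - (Q ^^ Suc n) f = (P ^^ n) (P f - Q f) + Q (?p - ?q)"
    unfolding 1 using X by (simp add: contr_diff[OF contr_funpow[OF P]] contr_diff[OF Q] 2)
  then have "nrm ((P ^^ Suc n) f - (Q ^^ Suc n) f) \<le> nrm ((P ^^ n) (P f - Q f)) + nrm (Q (?p - ?q))"
    using X contrD(1)[OF contr_funpow[OF P]] contrD(1)[OF Q] by (metis diff_in nrm_triangle)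
  also have "\<dots> \<le> nrm (P f - Q f) + nrm (?p - ?q)"
    using X by (intro add_mono contrD(2)[OF contr_funpow[OF P]] contrD(2)[OF Q]) auto
  finally show ?case using Suc by (simp add: algebra_simps)
qed simp

end

text \<open>The graph of an operator that is m-dissipative after multiplication by any
  \<open>z\<close> in \<open>quarter\<close>. The conditions \<open>A_single\<close> and
  \<open>A_cong\<close> make it well defined on classes modulo null vectors.\<close>

locale semi_sectorial = semi_hilbert scl X ip
  for scl :: "complex \<Rightarrow> 'v::ab_group_add \<Rightarrow> 'v" (infixr \<open>\<cdot>\<close> 75) and X ip +
  fixes A :: "('v \<times> 'v) set"
  assumes A_in: "(u, w) \<in> A \<Longrightarrow> u \<in> X \<and> w \<in> X"
    and A_add: "(u, w) \<in> A \<Longrightarrow> (u', w') \<in> A \<Longrightarrow> (u + u', w + w') \<in> A"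
    and A_scale: "(u, w) \<in> A \<Longrightarrow> (a \<cdot> u, a \<cdot> w) \<in> A"
    and A_single: "(u, w) \<in> A \<Longrightarrow> nrm u = 0 \<Longrightarrow> nrm w = 0"
    and A_cong: "(u, w) \<in> A \<Longrightarrow> u' \<in> X \<Longrightarrow> w' \<in> X \<Longrightarrow> nrm (u' - u) = 0 \<Longrightarrow> nrm (w' - w) = 0 \<Longrightarrow> (u', w') \<in> A"
    and A_sect: "(u, w) \<in> A \<Longrightarrow> z \<in> quarter \<Longrightarrow> Re (z * ip w u) \<le> 0"
    and A_range: "z \<in> quarter \<Longrightarrow> f \<in> X \<Longrightarrow> \<exists>u w. (u, w) \<in> A \<and> nrm (u - z \<cdot> w - f) = 0"
begin

lemma subspace_dom: "subspace (fst ` A)"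
proof (rule subspaceI)
  obtain u w where "(u, w) \<in> A" using A_range[of 1 0] by (auto simp: quarter_def)
  from A_scale[OF this, of 0] show "0 \<in> fst ` A" by force
next
  show "x + y \<in> fst ` A" if "x \<in> fst ` A" "y \<in> fst ` A" for x y using that A_add by force
  show "c \<cdot> x \<in> fst ` A" if "x \<in> fst ` A" for x c using that A_scale by force
qed

text \<open>Let \<open>g\<close> be orthogonal to the domain and solve u - w = g modulo null
  vectors. Pairing with u gives |u|^2 = Re <w, u> <= 0, so u is null, then w is null by
  \<open>A_single\<close>, and so is \<open>g\<close>.\<close>

lemma dom_dense:
  assumes f: "f \<in> X" and e: "0 < e"
  shows "\<exists>u w. (u, w) \<in> A \<and> nrm (f - u) < e"
proof -
  have "\<exists>u\<in>fst ` A. nrm (f - u) < e"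
  proof (rule dense_if_orthogonal_trivial[OF subspace_dom _ _ f e])
    show "fst ` A \<subseteq> X" using A_in by force
    fix g assume g: "g \<in> X" and o: "\<forall>u\<in>fst ` A. ip g u = 0"
    have one: "1 \<in> quarter" by (simp add: quarter_def)
    obtain u w where uw: "(u, w) \<in> A" "nrm (u - 1 \<cdot> w - g) = 0" using A_range[OF one g] by blast
    have X: "u \<in> X" "w \<in> X" using A_in uw by auto
    have "ip g u = 0" using o uw by force
    then have "ip (u - w) u = 0" using ip_eq_mod_left[of "u - w" g u] uw(2) X g by simp
    then have "ip u u = ip w u" using X by (simp add: ip_diff_left)
    then have "(nrm u)\<^sup>2 \<le> 0" using A_sect[OF uw(1) one] nrm_sq[OF X(1)] by simp
    then have u: "nrm u = 0" by simp
    then have "nrm (u - w) = 0" using A_single[OF uw(1)] nrm_triangle_diff[OF X] nrm_ge_0[OF diff_in[OF X]] by simp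
    then show "nrm g = 0" using nrm_eq_mod[of "u - w" g] uw(2) X g by simp
  qed
  then show ?thesis by force
qed

end

locale m_sectorial = semi_sectorial scl X ip A + hilbert scl X ip
  for scl :: "complex \<Rightarrow> 'v::ab_group_add \<Rightarrow> 'v" (infixr \<open>\<cdot>\<close> 75) and X ip and A :: "('v \<times> 'v) set"
begin

lemma A_solve: "z \<in> quarter \<Longrightarrow> f \<in> X \<Longrightarrow> \<exists>u w. (u, w) \<in> A \<and> u - z \<cdot> w = f"
proof -
  assume z: "z \<in> quarter" and f: "f \<in> X"
  obtain u w where A: "(u, w) \<in> A" and n: "nrm (u - z \<cdot> w - f) = 0" using A_range[OF z f] by blast
  have "u - z \<cdot> w \<in> X" using A_in[OF A] by simp
  from nrm_diff_0D[OF this f n] A show ?thesis by blast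
qed

lemma A_diff: "(u, w) \<in> A \<Longrightarrow> (u', w') \<in> A \<Longrightarrow> (u - u', w - w') \<in> A"
  using A_add[of u w "-1 \<cdot> u'" "-1 \<cdot> w'"] A_scale[of u' w' "-1"] by simp

lemma nrm_resolvent:
  assumes "(u, w) \<in> A" "z \<in> insert 0 quarter"
  shows "nrm u \<le> nrm (u - z \<cdot> w)"
proof -
  have X: "u \<in> X" "w \<in> X" using A_in assms by auto
  have "ip u w = cnj (ip w u)" using ip_cnj X by blast
  then have "Re (ip u (z \<cdot> w)) = Re (cnj (z * ip w u))" using X by (simp add: ip_simps)
  also have "\<dots> \<le> 0" using A_sect[OF assms(1), of z] assms(2) by auto
  finally have "(nrm u)\<^sup>2 \<le> (nrm (u - z \<cdot> w))\<^sup>2"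
    using nrm_diff_sq[OF X(1) scale_in[OF X(2)], of z] zero_le_power2[of "nrm (z \<cdot> w)"] by linarith
  then show ?thesis by (rule power2_le_imp_le) (use X in simp)
qed

text \<open>The resolvent of the overview. The value at \<open>z = 0\<close> is set explicitly
  because the description by \<open>A\<close> would reach only \<open>f\<close> in the domain there;
  the estimates then hold on the cone including its apex.\<close>

definition J :: "complex \<Rightarrow> 'v \<Rightarrow> 'v" where
  "J z f = (if z = 0 then f else (THE u. \<exists>w. (u, w) \<in> A \<and> u - z \<cdot> w = f))"

lemma resolvent_unique:
  assumes "(u, w) \<in> A" "(u', w') \<in> A" "z \<in> insert 0 quarter" "u - z \<cdot> w = u' - z \<cdot> w'"
  shows "u = u'"
proof (rule nrm_diff_0D)
  show X: "u \<in> X" "u' \<in> X" using A_in assms by auto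
  have "(u - u') - z \<cdot> (w - w') = 0" using assms(4) by (simp add: algebra_simps)
  then have "nrm (u - u') \<le> 0" using nrm_resolvent[OF A_diff[OF assms(1,2)] assms(3)] by simp
  then show "nrm (u - u') = 0" using nrm_ge_0[OF diff_in[OF X]] by linarith
qed

lemma J_resolvent: 
  assumes "(u, w) \<in> A" "z \<in> insert 0 quarter"
  shows "J z (u - z \<cdot> w) = u"
proof (cases "z = 0")
  case False
  have "(THE v. \<exists>w'. (v, w') \<in> A \<and> v - z \<cdot> w' = u - z \<cdot> w) = u"
    by (rule the_equality) (use assms resolvent_unique in blast)+
  then show ?thesis using False by (simp add: J_def)
qed (simp add: J_def)

lemma J_ex:
  assumes "z \<in> quarter" "f \<in> X"
  obtains w where "(J z f, w) \<in> A" "J z f - z \<cdot> w = f"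
proof -
  obtain u w where "(u, w) \<in> A" "u - z \<cdot> w = f" using A_solve[OF assms] by blast
  then show ?thesis using J_resolvent[of u w z] assms that by auto
qed

lemma J_graph: 
  assumes "z \<in> quarter" "f \<in> X"
  shows "(J z f, inverse z \<cdot> (J z f - f)) \<in> A"
proof -
  obtain w where w: "(J z f, w) \<in> A" "J z f - z \<cdot> w = f" using J_ex[OF assms] .
  have "J z f - f = z \<cdot> w" using w(2) by (metis diff_diff_eq2 add_diff_cancel_left' diff_add_cancel)
  then have "inverse z \<cdot> (J z f - f) = w" using quarter_nonzero[OF assms(1)] by simp
  then show ?thesis using w by simp
qed

lemma contr_J:
  assumes z: "z \<in> insert 0 quarter" shows "contr (J z)"
proof (cases "z = 0")
  case True then show ?thesis using contr_id by (simp add: J_def contr_def)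
next
  case False
  then have zq: "z \<in> quarter" using z by simp
  show ?thesis unfolding contr_def
  proof (intro conjI ballI allI)
    fix f assume f: "f \<in> X"
    obtain w where w: "(J z f, w) \<in> A" "J z f - z \<cdot> w = f" using J_ex[OF zq f] .
    show "J z f \<in> X" using A_in w by blast
    show "nrm (J z f) \<le> nrm f" using nrm_resolvent[OF w(1) z] w by simp
    show "J z (a \<cdot> f) = a \<cdot> J z f" for a
      using J_resolvent[OF A_scale[OF w(1), of a] z] w(2) scale_right_diff_distrib[of a "J z f" "z \<cdot> w"]
      by (simp add: scale_left_commute mult.commute)
    fix g assume g: "g \<in> X"
    obtain w' where w': "(J z g, w') \<in> A" "J z g - z \<cdot> w' = g" using J_ex[OF zq g] .
    have "f + g = (J z f + J z g) - z \<cdot> (w + w')" 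
      by (subst w(2)[symmetric], subst w'(2)[symmetric]) (simp add: algebra_simps)
    then show "J z (f + g) = J z f + J z g"
      using J_resolvent[OF A_add[OF w(1) w'(1)] z] by simp
  qed
qed

lemmas J_in = contrD(1)[OF contr_J]
  and J_nrm = contrD(2)[OF contr_J]
  and J_add = contrD(3)[OF contr_J]
  and J_scale = contrD(4)[OF contr_J]
  and J_diff = contr_diff[OF contr_J]

text \<open>The resolvent commutes with the operator, so \<open>J z u - u\<close> is
  \<open>z\<close> times the resolvent of the image \<open>w\<close> of \<open>u\<close>. The Taylor
  estimates below come from repeated use of this identity.\<close>

lemma J_step:
  assumes "(u, w) \<in> A" "z \<in> insert 0 quarter"
  shows "J z u = u + z \<cdot> J z w"
proof -
  have X: "u \<in> X" "w \<in> X" using A_in assms by auto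
  have "u = J z u - z \<cdot> J z w"
    using J_resolvent[OF assms] X assms(2) by (simp add: J_diff J_scale)
  then show ?thesis by (metis diff_add_cancel)
qed

lemma J_A:
  assumes "(u, w) \<in> A" "z \<in> insert 0 quarter"
  shows "(J z u, J z w) \<in> A"
proof (cases "z = 0")
  case False
  then have z: "z \<in> quarter" using assms by simp
  have "inverse z \<cdot> (J z u - u) = J z w" using False by (simp add: J_step[OF assms])
  then show ?thesis using J_graph[OF z, of u] A_in[OF assms(1)] by simp
qed (use assms in \<open>simp add: J_def\<close>)

lemma J_commute:
  assumes z: "z \<in> insert 0 quarter" and w: "w \<in> insert 0 quarter" and f: "f \<in> X"
  shows "J z (J w f) = J w (J z f)"
proof (cases "w = 0")
  case False
  let ?g = "J w f"
  have wq: "w \<in> quarter" using w False by simp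
  have g: "?g \<in> X" using J_in[OF w f] .
  have "J z (inverse w \<cdot> (?g - f)) = inverse w \<cdot> (J z ?g - J z f)"
    using z f g by (simp add: J_scale J_diff)
  then have "(J z ?g, inverse w \<cdot> (J z ?g - J z f)) \<in> A"
    using J_A[OF J_graph[OF wq f] z] by simp
  then have "J w (J z ?g - w \<cdot> inverse w \<cdot> (J z ?g - J z f)) = J z ?g"
    using w by (rule J_resolvent)
  then show ?thesis using False by simp
qed (simp add: J_def)

lemma J_bound1:
  assumes "(u, w) \<in> A" "z \<in> insert 0 quarter"
  shows "nrm (J z u - u) \<le> cmod z * nrm w"
  using J_step[OF assms] A_in[OF assms(1)] J_in[OF assms(2), of w] J_nrm[OF assms(2), of w]
  by (simp add: mult_left_mono)

lemma J_bound2: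
  assumes "(u, w) \<in> A" "(w, q) \<in> A" "z \<in> insert 0 quarter"
  shows "nrm (J z u - u - z \<cdot> w) \<le> (cmod z)\<^sup>2 * nrm q"
proof -
  have X: "q \<in> X" "w \<in> X" "J z q \<in> X" using A_in[OF assms(2)] J_in[OF assms(3)] by auto
  have "J z u - u - z \<cdot> w = (z * z) \<cdot> J z q"
    by (simp add: J_step[OF assms(1,3)] J_step[OF assms(2,3)] algebra_simps)
  then show ?thesis using X J_nrm[OF assms(3), of q]
    by (simp add: norm_mult power2_eq_square mult_left_mono)
qed

text \<open>Both \<open>J a (J b u)\<close> and \<open>J (a + b) u\<close> have the first order
  expansion u + (a + b) w, so they differ by second order remainders only.\<close>

lemma JJ_bound:
  assumes A: "(u, w) \<in> A" "(w, q) \<in> A" and a: "a \<in> insert 0 quarter" and b: "b \<in> insert 0 quarter"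
  shows "nrm (J a (J b u) - J (a + b) u) \<le> 2 * (cmod a + cmod b)\<^sup>2 * nrm q"
proof -
  have X: "u \<in> X" "w \<in> X" "q \<in> X" using A_in A by auto
  have JX: "J z f \<in> X" if "f \<in> X" "z = a \<or> z = b \<or> z = a + b" for z f
    using that a b cone_add J_in by metis
  let ?D = "\<lambda>z. J z u - u - z \<cdot> w"
  \<comment> \<open>\<open>?D\<close> is the Taylor remainder of a single resolvent. The first order
    parts cancel, and each of the four remaining terms is quadratic in the increments.\<close>
  have e: "J a (J b u) - J (a + b) u = J a (?D b) + ?D a + b \<cdot> (J a w - w) - ?D (a + b)"
    using X JX by (simp add: J_diff[OF a] J_add[OF a] J_scale[OF a] algebra_simps)
  have "nrm (J a (J b u) - J (a + b) u) \<le> nrm (J a (?D b)) + nrm (?D a) + nrm (b \<cdot> (J a w - w)) + nrm (?D (a + b))"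
    unfolding e using X JX by (intro nrm_triangle_add_add_diff) auto
  also have "\<dots> \<le> (cmod b)\<^sup>2 * nrm q + (cmod a)\<^sup>2 * nrm q + cmod b * (cmod a * nrm q) + (cmod (a + b))\<^sup>2 * nrm q"
  proof (intro add_mono)
    show "nrm (J a (?D b)) \<le> (cmod b)\<^sup>2 * nrm q"
      using J_bound2[OF A b] J_nrm[OF a, of "?D b"] X JX by auto
    show "nrm (b \<cdot> (J a w - w)) \<le> cmod b * (cmod a * nrm q)"
      using J_bound1[OF A(2) a] X JX by (simp add: mult_left_mono)
  qed (use J_bound2[OF A] a b cone_add in auto)
  also have "\<dots> \<le> (cmod b)\<^sup>2 * nrm q + (cmod a)\<^sup>2 * nrm q + cmod b * (cmod a * nrm q) + (cmod a + cmod b)\<^sup>2 * nrm q"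
    using X by (intro add_mono mult_right_mono power_mono norm_triangle_ineq) auto
  also have "\<dots> \<le> 2 * (cmod a + cmod b)\<^sup>2 * nrm q"
  proof -
    have "(cmod a + cmod b)\<^sup>2 * nrm q = (cmod b)\<^sup>2 * nrm q + (cmod a)\<^sup>2 * nrm q + 2 * (cmod b * (cmod a * nrm q))"
      by (simp add: power2_eq_square algebra_simps)
    moreover have "0 \<le> cmod b * (cmod a * nrm q)" using X by simp
    ultimately show ?thesis by linarith
  qed
  finally show ?thesis .
qed

text \<open>Applying a resolvent to an approximant \<open>u\<close> in the domain moves it into the
  domain of the square, at the cost of \<open>cmod h * nrm w\<close>; \<open>h\<close> is chosen to
  make this at most \<open>e / 2\<close>.\<close>

lemma dom2_dense:
  assumes f: "f \<in> X" and e: "0 < e"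
  shows "\<exists>u w q. (u, w) \<in> A \<and> (w, q) \<in> A \<and> nrm (f - u) < e"
proof -
  obtain u w where uw: "(u, w) \<in> A" "nrm (f - u) < e / 2" using dom_dense[OF f, of "e / 2"] e by auto
  have X: "u \<in> X" "w \<in> X" using A_in uw by auto
  define h where "h = complex_of_real (e / (2 * (1 + nrm w)))"
  have pos: "0 < 1 + nrm w" using nrm_ge_0[OF X(2)] by linarith
  have h: "h \<in> quarter" unfolding h_def using e pos by (intro of_real_in_quarter) simp
  then have hC: "h \<in> insert 0 quarter" by simp
  have "nrm (J h u - u) \<le> cmod h * nrm w" by (rule J_bound1[OF uw(1) hC])
  also have "cmod h = e / (2 * (1 + nrm w))" unfolding h_def norm_of_real using e pos by simp
  also have "e / (2 * (1 + nrm w)) * nrm w \<le> e / 2"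
    using e pos nrm_ge_0[OF X(2)] by (simp add: field_simps)
  finally have "nrm (f - J h u) < e"
    using nrm_triangle3[OF f X(1) J_in[OF hC X(1)]] nrm_commute[OF X(1) J_in[OF hC X(1)]] uw(2) by linarith
  then show ?thesis using J_A[OF uw(1) hC] J_graph[OF h X(2)] by blast
qed

end

section \<open>Construction of the semigroup from dyadic resolvent powers\<close>

context m_sectorial
begin

definition V :: "nat \<Rightarrow> complex \<Rightarrow> 'v \<Rightarrow> 'v" where
  "V k z = J (z / 2 ^ k) ^^ (2 ^ k)"

lemma contr_V: "z \<in> insert 0 quarter \<Longrightarrow> contr (V k z)"
  unfolding V_def by (rule contr_funpow[OF contr_J[OF cone_divide]])

lemma contr_JJ:
  "z \<in> insert 0 quarter \<Longrightarrow> w \<in> insert 0 quarter \<Longrightarrow> contr (\<lambda>f. J z (J w f))"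
  using contr_comp contr_J by blast

lemma JJ_pow_bound:
  assumes A: "(u, w) \<in> A" "(w, q) \<in> A" and a: "a \<in> insert 0 quarter" and b: "b \<in> insert 0 quarter"
  shows "nrm (((\<lambda>f. J a (J b f)) ^^ n) u - (J (a + b) ^^ n) u) \<le> real n * (2 * (cmod a + cmod b)\<^sup>2 * nrm q)"
proof -
  have u: "u \<in> X" using A_in A by auto
  have ab: "a + b \<in> insert 0 quarter" using cone_add a b .
  have "nrm (((\<lambda>f. J a (J b f)) ^^ n) u - (J (a + b) ^^ n) u) \<le> real n * nrm (J a (J b u) - J (a + b) u)"
  proof (rule contr_funpow_diff[OF contr_JJ[OF a b] contr_J[OF ab] _ u])
    fix f assume f: "f \<in> X"
    show "J a (J b (J (a + b) f)) = J (a + b) (J a (J b f))"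
      by (simp only: J_commute[OF b ab f] J_commute[OF a ab J_in[OF b f]])
  qed
  also have "\<dots> \<le> real n * (2 * (cmod a + cmod b)\<^sup>2 * nrm q)"
    by (rule mult_left_mono[OF JJ_bound[OF A a b]]) simp
  finally show ?thesis .
qed

text \<open>Each of the \<open>2 ^ k\<close> steps is split into two halves. By
  \<open>JJ_bound\<close> the error per step is of order 4^-k, and the errors add up to order
  2^-k.\<close>

lemma V_step:
  assumes A: "(u, w) \<in> A" "(w, q) \<in> A" and z: "z \<in> insert 0 quarter"
  shows "nrm (V (Suc k) z u - V k z u) \<le> 2 * (cmod z)\<^sup>2 * nrm q / 2 ^ k"
proof -
  let ?h = "z / 2 ^ Suc k"
  have h: "?h \<in> insert 0 quarter" by (rule cone_divide[OF z])
  have "(J ?h ^^ 2) ^^ (2 ^ k) = J ?h ^^ (2 * 2 ^ k)" by (rule funpow_mult)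
  moreover have "J ?h ^^ 2 = (\<lambda>f. J ?h (J ?h f))" by (simp add: numeral_2_eq_2 o_def)
  ultimately have 1: "V (Suc k) z = (\<lambda>f. J ?h (J ?h f)) ^^ (2 ^ k)" unfolding V_def by simp
  have 2: "V k z = J (?h + ?h) ^^ (2 ^ k)" unfolding V_def by simp
  have "nrm (V (Suc k) z u - V k z u) \<le> real (2 ^ k) * (2 * (cmod ?h + cmod ?h)\<^sup>2 * nrm q)"
    unfolding 1 2 by (rule JJ_pow_bound[OF A h h])
  also have "cmod ?h + cmod ?h = cmod z / 2 ^ k" by (simp add: norm_divide norm_power)
  also have "real (2 ^ k) * (2 * (cmod z / 2 ^ k)\<^sup>2 * nrm q) = 2 * (cmod z)\<^sup>2 * nrm q / 2 ^ k"
    by (simp add: power2_eq_square field_simps)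
  finally show ?thesis .
qed

text \<open>The geometric sum of the increments is kept as the exact difference
  \<open>1 / 2 ^ m - 1 / 2 ^ n\<close>, which lets the induction close.\<close>

lemma V_Cauchy:
  assumes A: "(u, w) \<in> A" "(w, q) \<in> A" and z: "z \<in> insert 0 quarter" and "m \<le> n"
  shows "nrm (V m z u - V n z u) \<le> 4 * (cmod z)\<^sup>2 * nrm q * (1 / 2 ^ m - 1 / 2 ^ n)"
  using \<open>m \<le> n\<close>
proof (induction n rule: dec_induct)
  case base
  then show ?case by simp
next
  case (step n)
  have X: "V k z u \<in> X" for k using contrD(1)[OF contr_V[OF z]] A_in[OF A(1)] by blast
  have "nrm (V m z u - V (Suc n) z u) \<le> nrm (V m z u - V n z u) + nrm (V n z u - V (Suc n) z u)"
    using X by (intro nrm_triangle3)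
  also have "nrm (V n z u - V (Suc n) z u) \<le> 2 * (cmod z)\<^sup>2 * nrm q / 2 ^ n"
    using V_step[OF A z, of n] nrm_commute[OF X X, of n "Suc n"] by simp
  also have "2 * (cmod z)\<^sup>2 * nrm q / 2 ^ n = 4 * (cmod z)\<^sup>2 * nrm q * (1 / 2 ^ n - 1 / 2 ^ Suc n)"
    by (simp add: field_simps)
  finally have "nrm (V m z u - V (Suc n) z u) \<le> 4 * (cmod z)\<^sup>2 * nrm q * (1 / 2 ^ m - 1 / 2 ^ n)
      + 4 * (cmod z)\<^sup>2 * nrm q * (1 / 2 ^ n - 1 / 2 ^ Suc n)" using step.IH by linarith
  also have "\<dots> = 4 * (cmod z)\<^sup>2 * nrm q * (1 / 2 ^ m - 1 / 2 ^ Suc n)"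
    by (simp only: distrib_left[symmetric]) simp
  finally show ?case .
qed

definition T :: "complex \<Rightarrow> 'v \<Rightarrow> 'v" where
  "T z f = (THE y. lim_to (\<lambda>k. V k z f) y)"

text \<open>Convergence on the dense domain of the square extends to \<open>X\<close> because all
  \<open>V k z\<close> are contractions.\<close>

lemma V_convergent:
  assumes z: "z \<in> insert 0 quarter" and f: "f \<in> X"
  shows "\<exists>y. lim_to (\<lambda>k. V k z f) y"
proof -
  have VX: "V k z g \<in> X" if "g \<in> X" for k g using contrD(1)[OF contr_V[OF z]] that by blast
  have "\<exists>y\<in>X. (\<lambda>k. nrm (V k z f - y)) \<longlonglongrightarrow> 0"
  proof (rule complete_nrm[OF VX[OF f]])
    fix e :: real assume e: "0 < e"
    obtain u w q where A: "(u, w) \<in> A" "(w, q) \<in> A" and near: "nrm (f - u) < e / 4"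
      using dom2_dense[OF f, of "e / 4"] e by auto
    have X: "u \<in> X" "q \<in> X" using A_in A by auto
    have "(\<lambda>m. 4 * (cmod z)\<^sup>2 * nrm q * (1 / 2 ^ m)) \<longlonglongrightarrow> 4 * (cmod z)\<^sup>2 * nrm q * 0"
      by (intro tendsto_intros LIMSEQ_divide_realpow_zero) simp
    then have "(\<lambda>m. 4 * (cmod z)\<^sup>2 * nrm q * (1 / 2 ^ m)) \<longlonglongrightarrow> 0" by simp
    from order_tendstoD(2)[OF this, of "e / 4"] e
    obtain K where K: "\<And>m. m \<ge> K \<Longrightarrow> 4 * (cmod z)\<^sup>2 * nrm q * (1 / 2 ^ m) < e / 4"
      unfolding eventually_sequentially by auto
    have main: "nrm (V m z f - V n z f) < e" if "K \<le> m" "m \<le> n" for m n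
    proof -
      have "nrm (V m z u - V n z u) \<le> 4 * (cmod z)\<^sup>2 * nrm q * (1 / 2 ^ m - 1 / 2 ^ n)"
        by (rule V_Cauchy[OF A z that(2)])
      also have "\<dots> \<le> 4 * (cmod z)\<^sup>2 * nrm q * (1 / 2 ^ m)"
        using X by (intro mult_left_mono) auto
      also have "\<dots> < e / 4" by (rule K[OF that(1)])
      finally have b: "nrm (V m z u - V n z u) < e / 4" .
      have c: "nrm (V k z f - V k z u) < e / 4" for k
        using contrD(2)[OF contr_V[OF z], of "f - u" k] near f X
        by (simp add: contr_diff[OF contr_V[OF z]])
      have "nrm (V m z f - V n z f) \<le> nrm (V m z f - V m z u) + nrm (V m z u - V n z f)"
        using VX f X by (intro nrm_triangle3)
      also have "nrm (V m z u - V n z f) \<le> nrm (V m z u - V n z u) + nrm (V n z u - V n z f)"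
        using VX f X by (intro nrm_triangle3)
      also have "nrm (V n z u - V n z f) = nrm (V n z f - V n z u)"
        using VX f X by (intro nrm_commute)
      finally show ?thesis using b c[of m] c[of n] e by linarith
    qed
    have "nrm (V m z f - V n z f) < e" if "K \<le> m" "K \<le> n" for m n
      using main[of m n] main[of n m] nrm_commute[OF VX[OF f] VX[OF f], of m n] that by linarith
    then show "\<exists>K. \<forall>m\<ge>K. \<forall>n\<ge>K. nrm (V m z f - V n z f) < e" by blast
  qed
  then show ?thesis using VX f by (auto simp: lim_to_def)
qed

lemma T_lim:
  assumes "z \<in> insert 0 quarter" "f \<in> X" shows "lim_to (\<lambda>k. V k z f) (T z f)"
  unfolding T_def using V_convergent[OF assms] lim_to_unique by (metis the_equality)

lemma T_eqI: "z \<in> insert 0 quarter \<Longrightarrow> f \<in> X \<Longrightarrow> lim_to (\<lambda>k. V k z f) y \<Longrightarrow> T z f = y"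
  using T_lim lim_to_unique by blast

lemma contr_T:
  assumes z: "z \<in> insert 0 quarter" shows "contr (T z)"
  unfolding contr_def
proof (intro conjI ballI allI)
  fix f assume f: "f \<in> X"
  show "T z f \<in> X" using T_lim[OF z f] by (simp add: lim_to_def)
  show "nrm (T z f) \<le> nrm f"
    by (rule lim_to_nrm_le[OF T_lim[OF z f] contrD(2)[OF contr_V[OF z] f]]) simp
  show "T z (a \<cdot> f) = a \<cdot> T z f" for a
    using lim_to_scale[OF T_lim[OF z f], of a] f
    by (intro T_eqI[OF z]) (simp_all add: contrD(4)[OF contr_V[OF z] f])
  show "T z (f + g) = T z f + T z g" if g: "g \<in> X" for g
    using lim_to_add[OF T_lim[OF z f] T_lim[OF z g]] f g
    by (intro T_eqI[OF z]) (simp_all add: contrD(3)[OF contr_V[OF z] f g])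
qed

lemmas T_in = contrD(1)[OF contr_T]
  and T_nrm = contrD(2)[OF contr_T]
  and T_add = contrD(3)[OF contr_T]
  and T_scale = contrD(4)[OF contr_T]
  and T_diff = contr_diff[OF contr_T]

lemma T_0: "f \<in> X \<Longrightarrow> T 0 f = f"
proof -
  assume f: "f \<in> X"
  have "V k 0 f = f" for k
  proof -
    have "(J 0 ^^ n) f = f" for n by (induction n) (simp_all add: J_def)
    then show ?thesis by (simp add: V_def)
  qed
  then show ?thesis using f by (intro T_eqI) (simp_all add: lim_to_const)
qed

lemma eq_on_dom2_eq:
  assumes P: "contr P" and Q: "contr Q" and eq: "\<And>u w q. (u, w) \<in> A \<Longrightarrow> (w, q) \<in> A \<Longrightarrow> P u = Q u"
    and f: "f \<in> X"
  shows "P f = Q f"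
proof (rule nrm_diff_0D)
  show X: "P f \<in> X" "Q f \<in> X" using contrD(1)[OF P f] contrD(1)[OF Q f] by auto
  have "nrm (P f - Q f) \<le> 0 + e" if e: "0 < e" for e
  proof -
    obtain u w q where A: "(u, w) \<in> A" "(w, q) \<in> A" and near: "nrm (f - u) < e / 2"
      using dom2_dense[OF f, of "e / 2"] e by auto
    have u: "u \<in> X" using A_in A by auto
    have "P f - Q f = P (f - u) - Q (f - u)"
      using f u by (simp add: contr_diff[OF P] contr_diff[OF Q] eq[OF A])
    also have "nrm \<dots> \<le> nrm (P (f - u)) + nrm (Q (f - u))"
      using f u contrD(1)[OF P] contrD(1)[OF Q] by (intro nrm_triangle_diff) auto
    also have "\<dots> \<le> nrm (f - u) + nrm (f - u)"
      using f u by (intro add_mono contrD(2)[OF P] contrD(2)[OF Q]) auto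
    finally show ?thesis using near by linarith
  qed
  then have "nrm (P f - Q f) \<le> 0" by (rule field_le_epsilon)
  then show "nrm (P f - Q f) = 0" using nrm_ge_0[OF diff_in[OF X]] by linarith
qed

text \<open>On the domain of the square, \<open>JJ_pow_bound\<close> compares \<open>2 ^ k\<close>
  products of the resolvents for \<open>z\<close> and \<open>w\<close> with as many resolvents for
  \<open>z + w\<close>, with an error of order 2^-k. As resolvents commute, the former are
  \<open>V k z (V k w u)\<close>.\<close>

lemma T_plus:
  assumes z: "z \<in> insert 0 quarter" and w: "w \<in> insert 0 quarter" and f: "f \<in> X"
  shows "T (z + w) f = T z (T w f)"
proof -
  have zw: "z + w \<in> insert 0 quarter" using cone_add z w .
  have "T z (T w u) = T (z + w) u" if A: "(u, v) \<in> A" "(v, q) \<in> A" for u v q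
  proof -
    have u: "u \<in> X" using A_in A by auto
    have X: "V k z g \<in> X" "V k w g \<in> X" "V k (z + w) g \<in> X" if "g \<in> X" for k g
      using that contrD(1)[OF contr_V] z w zw by auto
    let ?b = "\<lambda>k. 2 * (cmod z + cmod w)\<^sup>2 * nrm q / 2 ^ k"
    have b: "nrm (V k z (V k w u) - V k (z + w) u) \<le> ?b k" for k
    proof -
      let ?z = "z / 2 ^ k" and ?w = "w / 2 ^ k"
      have 1: "V k z (V k w u) = ((\<lambda>f. J ?z (J ?w f)) ^^ (2 ^ k)) u" unfolding V_def
        by (rule contr_funpow_prod[symmetric])
          (use z w u cone_divide contr_J J_commute in auto)
      have 2: "V k (z + w) u = (J (?z + ?w) ^^ (2 ^ k)) u" by (simp add: V_def add_divide_distrib)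
      have "nrm (V k z (V k w u) - V k (z + w) u) \<le> real (2 ^ k) * (2 * (cmod ?z + cmod ?w)\<^sup>2 * nrm q)"
        unfolding 1 2 by (rule JJ_pow_bound[OF A cone_divide[OF z] cone_divide[OF w]])
      also have "cmod ?z + cmod ?w = (cmod z + cmod w) / 2 ^ k"
        by (simp add: norm_divide norm_power add_divide_distrib)
      also have "real (2 ^ k) * (2 * ((cmod z + cmod w) / 2 ^ k)\<^sup>2 * nrm q) = ?b k"
        by (simp add: power2_eq_square field_simps)
      finally show ?thesis .
    qed
    have b0: "?b \<longlonglongrightarrow> 0" by (intro LIMSEQ_divide_realpow_zero) simp
    have l1: "lim_to (\<lambda>k. V k z (V k w u) - V k (z + w) u) 0"
      by (rule lim_toI[OF _ _ _ b0]) (use X u b in simp_all)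
    have "lim_to (\<lambda>k. V k z (V k w u) - V k z (T w u)) 0"
    proof (rule lim_toI)
      show "nrm (V k z (V k w u) - V k z (T w u) - 0) \<le> nrm (V k w u - T w u)" for k
        using contrD(2)[OF contr_V[OF z], of "V k w u - T w u" k] X(2)[OF u] T_in[OF w u]
        by (simp add: contr_diff[OF contr_V[OF z]])
      show "(\<lambda>k. nrm (V k w u - T w u)) \<longlonglongrightarrow> 0" using T_lim[OF w u] by (simp add: lim_to_def)
    qed (use X u T_in[OF w u] in auto)
    from lim_to_add[OF this T_lim[OF z T_in[OF w u]]]
    have l2: "lim_to (\<lambda>k. V k z (V k w u)) (T z (T w u))" by simp
    have "lim_to (\<lambda>k. V k z (V k w u) - (V k z (V k w u) - V k (z + w) u)) (T z (T w u) - 0)"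
      by (rule lim_to_diff[OF l2 l1])
    then have "T (z + w) u = T z (T w u)" by (intro T_eqI[OF zw u]) simp
    then show ?thesis ..
  qed
  then show ?thesis using eq_on_dom2_eq[OF contr_comp[OF contr_T[OF z] contr_T[OF w]] contr_T[OF zw] _ f] by simp
qed

text \<open>Here \<open>w\<close> itself may lie outside the domain and is compared with an
  approximant \<open>w'\<close> inside it. The factor 2 arises because \<open>w - w'\<close> enters
  once under the power and once without it.\<close>

lemma J_pow_bound:
  assumes z: "z \<in> insert 0 quarter" and A: "(u, w) \<in> A" "(w', q) \<in> A"
  shows "nrm ((J z ^^ m) w - w) \<le> 2 * nrm (w - w') + real m * cmod z * nrm q"
proof -
  note P = contr_J[OF z] contr_funpow[OF contr_J[OF z], of m]
  have X: "w \<in> X" "w' \<in> X" "q \<in> X" using A_in A by auto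
  have PX: "(J z ^^ m) f \<in> X" if "f \<in> X" for f using contrD(1)[OF P(2) that] .
  have "nrm ((J z ^^ m) w' - ((\<lambda>f. f) ^^ m) w') \<le> real m * nrm (J z w' - w')"
    by (rule contr_funpow_diff[OF P(1) contr_id _ X(2)]) simp
  also have "((\<lambda>f. f) ^^ m) w' = w'" by (induction m) auto
  also have "real m * nrm (J z w' - w') \<le> real m * (cmod z * nrm q)"
    by (intro mult_left_mono J_bound1[OF A(2) z]) simp
  finally have 1: "nrm ((J z ^^ m) w' - w') \<le> real m * cmod z * nrm q" by (simp add: mult.assoc)
  have 2: "nrm ((J z ^^ m) (w - w')) \<le> nrm (w - w')" using contrD(2)[OF P(2)] X by simp
  have "(J z ^^ m) w - w = (J z ^^ m) (w - w') + ((J z ^^ m) w' - w') - (w - w')"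
    using X by (simp add: contr_diff[OF P(2)])
  also have "nrm \<dots> \<le> nrm ((J z ^^ m) (w - w')) + nrm ((J z ^^ m) w' - w') + nrm (w - w')"
    using X PX by (intro nrm_triangle_add_diff) auto
  finally show ?thesis using 1 2 by linarith
qed

text \<open>Only first order regularity of \<open>u\<close> enters. The remainder is no longer
  quadratic but can be made small relative to the increment by the choice of \<open>w'\<close>; this
  identifies the generator on the whole domain and not only on the domain of the square.\<close>

lemma J_pow_taylor:
  assumes z: "z \<in> insert 0 quarter" and A: "(u, w) \<in> A" "(w', q) \<in> A"
  shows "m \<le> n \<Longrightarrow> nrm ((J z ^^ m) u - u - (of_nat m * z) \<cdot> w)
    \<le> real m * cmod z * (2 * nrm (w - w') + real n * cmod z * nrm q)"
proof (induction m)
  case (Suc m)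
  have X: "u \<in> X" "w \<in> X" "w' \<in> X" "q \<in> X" using A_in A by auto
  have PX: "(J z ^^ m) f \<in> X" if "f \<in> X" for f m using contrD(1)[OF contr_funpow[OF contr_J[OF z]] that] .
  have e: "(J z ^^ Suc m) u = (J z ^^ m) u + z \<cdot> (J z ^^ Suc m) w"
  proof -
    have "(J z ^^ Suc m) u = (J z ^^ m) (u + z \<cdot> J z w)" using J_step[OF A(1) z] by (simp add: funpow_swap1)
    then show ?thesis using X J_in[OF z X(2)]
      by (simp add: contrD(3,4)[OF contr_funpow[OF contr_J[OF z]]] funpow_swap1)
  qed
  have "(J z ^^ Suc m) u - u - (of_nat (Suc m) * z) \<cdot> w
      = ((J z ^^ m) u - u - (of_nat m * z) \<cdot> w) + z \<cdot> ((J z ^^ Suc m) w - w)"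
    unfolding e by (simp add: algebra_simps del: funpow.simps)
  also have "nrm \<dots> \<le> nrm ((J z ^^ m) u - u - (of_nat m * z) \<cdot> w) + nrm (z \<cdot> ((J z ^^ Suc m) w - w))"
    using X PX[of u m] PX[of w "Suc m"] by (intro nrm_triangle diff_in scale_in)
  also have "nrm (z \<cdot> ((J z ^^ Suc m) w - w)) = cmod z * nrm ((J z ^^ Suc m) w - w)"
    using X PX[of w "Suc m"] by (intro nrm_scale diff_in)
  also have "\<dots> \<le> cmod z * (2 * nrm (w - w') + real n * cmod z * nrm q)"
  proof (intro mult_left_mono order_trans[OF J_pow_bound[OF z A]] add_left_mono)
    show "real (Suc m) * cmod z * nrm q \<le> real n * cmod z * nrm q"
      using Suc.prems X by (intro mult_right_mono) auto
  qed auto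
  finally have "nrm ((J z ^^ Suc m) u - u - (of_nat (Suc m) * z) \<cdot> w)
      \<le> real m * cmod z * (2 * nrm (w - w') + real n * cmod z * nrm q)
        + cmod z * (2 * nrm (w - w') + real n * cmod z * nrm q)"
    using Suc.IH Suc.prems by linarith
  also have "\<dots> = real (Suc m) * cmod z * (2 * nrm (w - w') + real n * cmod z * nrm q)"
    by (simp add: algebra_simps)
  finally show ?case .
qed simp

lemma T_taylor:
  assumes z: "z \<in> insert 0 quarter" and A: "(u, w) \<in> A" "(w', q) \<in> A"
  shows "nrm (T z u - u - z \<cdot> w) \<le> cmod z * (2 * nrm (w - w') + cmod z * nrm q)"
proof -
  have X: "u \<in> X" "w \<in> X" using A_in A by auto
  have l: "lim_to (\<lambda>k. V k z u - (u + z \<cdot> w)) (T z u - (u + z \<cdot> w))"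
    using X by (intro lim_to_diff[OF T_lim[OF z X(1)] lim_to_const]) auto
  have "nrm (V k z u - (u + z \<cdot> w)) \<le> cmod z * (2 * nrm (w - w') + cmod z * nrm q)" for k
    using J_pow_taylor[OF cone_divide[OF z, of k] A order_refl[of "2 ^ k"]]
    by (simp add: V_def norm_divide norm_power diff_diff_eq)
  from lim_to_nrm_le[OF l this tendsto_const] show ?thesis by (simp add: diff_diff_eq)
qed

lemma T_taylor2:
  assumes "z \<in> insert 0 quarter" "(u, w) \<in> A" "(w, q) \<in> A"
  shows "nrm (T z u - u - z \<cdot> w) \<le> (cmod z)\<^sup>2 * nrm q"
  using T_taylor[OF assms] by (simp add: power2_eq_square)

lemma T_bound1:
  assumes z: "z \<in> insert 0 quarter" and A: "(u, w) \<in> A"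
  shows "nrm (T z u - u) \<le> cmod z * nrm w"
proof -
  have X: "u \<in> X" "w \<in> X" using A_in A by auto
  have "nrm (V k z u - u) \<le> cmod z * nrm w" for k
  proof -
    let ?h = "z / 2 ^ k"
    have "nrm ((J ?h ^^ m) u - ((\<lambda>f. f) ^^ m) u) \<le> real m * nrm (J ?h u - u)" for m
      by (rule contr_funpow_diff[OF contr_J[OF cone_divide[OF z]] contr_id _ X(1)]) simp
    moreover have "((\<lambda>f. f) ^^ m) u = u" for m by (induction m) auto
    ultimately have "nrm (V k z u - u) \<le> real (2 ^ k) * nrm (J ?h u - u)" unfolding V_def by metis
    also have "\<dots> \<le> real (2 ^ k) * (cmod ?h * nrm w)"
      by (intro mult_left_mono J_bound1[OF A cone_divide[OF z]]) simp
    finally show ?thesis by (simp add: norm_divide norm_power)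
  qed
  from lim_to_nrm_le[OF lim_to_diff[OF T_lim[OF z X(1)] lim_to_const[OF X(1)]] this tendsto_const]
  show ?thesis .
qed

lemma T_strong_continuity:
  assumes f: "f \<in> X"
  shows "((\<lambda>z. nrm (T z f - f)) \<longlongrightarrow> 0) (at 0 within insert 0 quarter)"
proof (rule tendstoI)
  fix e :: real assume e: "0 < e"
  obtain u w where A: "(u, w) \<in> A" and near: "nrm (f - u) < e / 4" using dom_dense[OF f, of "e / 4"] e by auto
  have X: "u \<in> X" "w \<in> X" using A_in A by auto
  have b: "nrm (T z f - f) \<le> e / 2 + cmod z * nrm w" if z: "z \<in> insert 0 quarter" for z
  proof -
    have "T z f - f = T z (f - u) + (T z u - u) - (f - u)" using X f by (simp add: T_diff[OF z])
    also have "nrm \<dots> \<le> nrm (T z (f - u)) + nrm (T z u - u) + nrm (f - u)"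
      using X f T_in[OF z] by (intro nrm_triangle_add_diff) auto
    finally show ?thesis using T_nrm[OF z, of "f - u"] X f near T_bound1[OF z A] by simp
  qed
  have "((\<lambda>z. e / 2 + cmod z * nrm w) \<longlongrightarrow> e / 2 + cmod 0 * nrm w) (at 0 within insert 0 quarter)"
    by (intro tendsto_intros)
  from order_tendstoD(2)[OF this, of e] e
  have "\<forall>\<^sub>F z in at 0 within insert 0 quarter. e / 2 + cmod z * nrm w < e" by simp
  moreover have "\<forall>\<^sub>F z in at 0 within insert 0 quarter. z \<in> insert 0 quarter"
    by (simp add: eventually_at_filter)
  ultimately show "\<forall>\<^sub>F z in at 0 within insert 0 quarter. dist (nrm (T z f - f)) 0 < e"
  proof eventually_elim
    case (elim z)
    then show ?case using b[of z] nrm_ge_0[of "T z f - f"] T_in[of z f] f by simp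
  qed
qed

text \<open>\<open>T_taylor\<close> is divided by \<open>t\<close>: first \<open>w'\<close> is taken
  close to \<open>w\<close>, then \<open>t\<close> is made small depending on the image
  \<open>q\<close> of \<open>w'\<close>.\<close>

lemma T_generator:
  assumes A: "(u, w) \<in> A" and e: "0 < e"
  shows "\<exists>\<delta>>0. \<forall>t. 0 < t \<and> t < \<delta> \<longrightarrow> nrm (inverse (of_real t) \<cdot> (T (of_real t) u - u) - w) < e"
proof -
  have X: "u \<in> X" "w \<in> X" using A_in A by auto
  obtain w' q where A': "(w', q) \<in> A" and near: "nrm (w - w') < e / 4" using dom_dense[OF X(2), of "e / 4"] e by auto
  have q: "q \<in> X" "w' \<in> X" using A_in A' by auto
  have pos: "0 < 1 + nrm q" using nrm_ge_0[OF q(1)] by linarith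
  have "nrm (inverse (of_real t) \<cdot> (T (of_real t) u - u) - w) < e" if t: "0 < t" "t < e / (2 * (1 + nrm q))" for t
  proof -
    have z: "complex_of_real t \<in> insert 0 quarter" using of_real_in_quarter t by simp
    have "inverse (of_real t) \<cdot> (T (of_real t) u - u) - w
        = inverse (of_real t) \<cdot> (T (of_real t) u - u - of_real t \<cdot> w)"
      using t by (simp add: scale_right_diff_distrib)
    also have "nrm \<dots> = inverse t * nrm (T (of_real t) u - u - of_real t \<cdot> w)"
      using X T_in[OF z X(1)] t by (subst nrm_scale) (auto simp: norm_inverse)
    also have "\<dots> \<le> inverse t * (t * (2 * nrm (w - w') + t * nrm q))"
      using T_taylor[OF z A A'] t by (intro mult_left_mono) auto
    also have "\<dots> = 2 * nrm (w - w') + t * nrm q" using t by simp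
    also have "\<dots> < e"
    proof -
      have "t * nrm q \<le> t * (1 + nrm q)" using t by (intro mult_left_mono) auto
      also have "\<dots> < e / 2" using t pos by (simp add: field_simps)
      finally show ?thesis using near by linarith
    qed
    finally show ?thesis .
  qed
  then show ?thesis using e pos by (intro exI[of _ "e / (2 * (1 + nrm q))"]) auto
qed

end

section \<open>Holomorphy of the semigroup and identification of its generator\<close>

lemma has_field_derivative_quadratic:
  fixes \<phi> :: "'a::real_normed_field \<Rightarrow> 'a"
  assumes "0 < \<rho>" and q: "\<And>h. norm h < \<rho> \<Longrightarrow> norm (\<phi> (z + h) - \<phi> z - h * D) \<le> K * (norm h)\<^sup>2"
  shows "(\<phi> has_field_derivative D) (at z)"
  unfolding DERIV_def
proof (rule LIM_zero_cancel, rule Lim_null_comparison)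
  show "\<forall>\<^sub>F h in at 0. norm ((\<phi> (z + h) - \<phi> z) / h - D) \<le> K * norm h"
    unfolding eventually_at
  proof (intro exI[of _ \<rho>] conjI ballI impI)
    fix h :: 'a assume h: "h \<noteq> 0 \<and> dist h 0 < \<rho>"
    then have "(\<phi> (z + h) - \<phi> z) / h - D = (\<phi> (z + h) - \<phi> z - h * D) / h" by (simp add: field_simps)
    then have "norm ((\<phi> (z + h) - \<phi> z) / h - D) = norm (\<phi> (z + h) - \<phi> z - h * D) / norm h"
      by (simp add: norm_divide)
    also have "\<dots> \<le> K * (norm h)\<^sup>2 / norm h" using q[of h] h by (intro divide_right_mono) auto
    also have "\<dots> = K * norm h" using h by (simp add: power2_eq_square)
    finally show "norm ((\<phi> (z + h) - \<phi> z) / h - D) \<le> K * norm h" .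
  qed (rule \<open>0 < \<rho>\<close>)
  show "((\<lambda>h. K * norm h) \<longlongrightarrow> 0) (at 0)" by (auto intro!: tendsto_eq_intros)
qed

text \<open>Taylor's formula, with the second derivative bounded by Cauchy's inequality on circles
  of radius \<open>r / 2\<close> around points of \<open>ball z (r / 4)\<close>. These circles stay
  in \<open>ball z r\<close>, and 2 M / (r/2)^2 is the constant
  \<open>8 * M / r\<^sup>2\<close>.\<close>

lemma holomorphic_second_order:
  assumes hol: "\<phi> holomorphic_on ball z r" and r: "0 < r"
    and b: "\<And>w. w \<in> ball z r \<Longrightarrow> cmod (\<phi> w) \<le> M" and h: "cmod h < r / 4"
  shows "cmod (\<phi> (z + h) - \<phi> z - h * deriv \<phi> z) \<le> 8 * M / r\<^sup>2 * (cmod h)\<^sup>2"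
proof -
  let ?S = "ball z (r / 4)"
  have "cmod (((deriv ^^ 0) \<phi>) (z + h) - (\<Sum>i\<le>1. (deriv ^^ i) \<phi> z * (z + h - z) ^ i / fact i))
      \<le> 8 * M / r\<^sup>2 * cmod (z + h - z) ^ Suc 1 / fact 1"
  proof (rule complex_Taylor[where S = "?S" and f = "\<lambda>i. (deriv ^^ i) \<phi>"])
    show "convex ?S" by simp
    show "z + h \<in> ?S" "z \<in> ?S" using h r by (auto simp: dist_norm)
    show "((deriv ^^ i) \<phi> has_field_derivative (deriv ^^ Suc i) \<phi> x) (at x within ?S)" if "x \<in> ?S" for i x
    proof -
      have "(deriv ^^ i) \<phi> holomorphic_on ball z r" by (rule holomorphic_higher_deriv[OF hol open_ball])
      then have "((deriv ^^ i) \<phi> has_field_derivative deriv ((deriv ^^ i) \<phi>) x) (at x)"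
        using that r by (intro holomorphic_derivI[where S = "ball z r"]) auto
      then show ?thesis by (simp add: has_field_derivative_at_within)
    qed
    show "cmod ((deriv ^^ Suc 1) \<phi> x) \<le> 8 * M / r\<^sup>2" if x: "x \<in> ?S" for x
    proof -
      have sub: "cball x (r / 2) \<subseteq> ball z r"
      proof
        fix y assume "y \<in> cball x (r / 2)"
        then show "y \<in> ball z r" using x r dist_triangle[of z y x] by simp
      qed
      have "cmod ((deriv ^^ 2) \<phi> x) \<le> fact 2 * M / (r / 2) ^ 2"
      proof (rule Cauchy_inequality)
        show "\<phi> holomorphic_on ball x (r / 2)" using hol sub ball_subset_cball by (blast intro: holomorphic_on_subset)
        show "continuous_on (cball x (r / 2)) \<phi>"
          using holomorphic_on_imp_continuous_on[OF hol] sub by (blast intro: continuous_on_subset)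
        show "cmod (\<phi> y) \<le> M" if "cmod (x - y) = r / 2" for y
          using that sub by (intro b) (auto simp: dist_norm subset_iff)
      qed (use r in simp)
      then show ?thesis by (simp add: numeral_2_eq_2 power2_eq_square)
    qed
  qed
  then show ?thesis by (simp add: power2_eq_square diff_diff_eq mult.commute mult.left_commute)
qed

context m_sectorial
begin

text \<open>The increment \<open>h\<close> need not lie in the sector, so the semigroup law cannot
  be applied to it directly. The shift by \<open>3 * cmod h\<close> is large enough to bring
  \<open>a + h\<close> into the sector, and \<open>cmod h < r / 3\<close> keeps \<open>z - a\<close>
  in it. The constant 28 collects 16 + 9 + 3 from the three remainders.\<close>

lemma T_holomorphic_dom2:
  assumes A: "(u, w) \<in> A" "(w, q) \<in> A" and g: "g \<in> X" and z: "z \<in> quarter"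
  shows "((\<lambda>z. ip (T z u) g) has_field_derivative ip (T z w) g) (at z)"
proof -
  have X: "u \<in> X" "w \<in> X" "q \<in> X" using A_in A by auto
  obtain r where r: "0 < r" "ball z r \<subseteq> quarter" using open_quarter z openE by blast
  show ?thesis
  proof (rule has_field_derivative_quadratic[where \<rho> = "r / 3" and K = "28 * nrm q * nrm g"])
    fix h assume h: "cmod h < r / 3"
    show "cmod (ip (T (z + h) u) g - ip (T z u) g - h * ip (T z w) g) \<le> 28 * nrm q * nrm g * (cmod h)\<^sup>2"
    proof (cases "h = 0")
      case False
      \<comment> \<open>Both \<open>z\<close> and \<open>z + h\<close> are reached from \<open>c\<close> by increments inside the sector.\<close>
      define a b c where "a = complex_of_real (3 * cmod h)" and "b = a + h" and "c = z - a"
      have a: "a \<in> quarter" unfolding a_def using False by (intro of_real_in_quarter) simp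
      have "0 < cmod h" using False by simp
      then have "\<bar>Im h\<bar> < 3 * cmod h + Re h" using abs_Im_le_cmod[of h] abs_Re_le_cmod[of h] by linarith
      then have b: "b \<in> quarter" by (simp add: b_def a_def quarter_def)
      have c: "c \<in> quarter" using r(2) h by (auto simp: c_def a_def dist_norm norm_mult)
      have C: "a \<in> insert 0 quarter" "b \<in> insert 0 quarter" "c \<in> insert 0 quarter" "z \<in> insert 0 quarter"
        using a b c z by auto
      have na: "cmod a = 3 * cmod h" unfolding a_def norm_of_real by simp
      have nb: "cmod b \<le> 4 * cmod h" unfolding b_def using norm_triangle_ineq[of a h] na by simp
      let ?D = "\<lambda>z. T z u - u - z \<cdot> w"
      have zT: "T z f = T c (T a f)" "T (z + h) f = T c (T b f)" if "f \<in> X" for f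
        using T_plus[OF C(3,1) that] T_plus[OF C(3,2) that] by (simp_all add: b_def c_def)
      have TX: "T a f \<in> X" "T b f \<in> X" "T c f \<in> X" "T z f \<in> X" "T (z + h) f \<in> X" if "f \<in> X" for f
        using that C T_in zT by auto
      have DX: "?D a \<in> X" "?D b \<in> X" "T a w - w \<in> X" using X TX(1,2) by simp_all
      have bw: "b \<cdot> w = a \<cdot> w + h \<cdot> w" by (simp add: b_def scale_left_distrib)
      have "T (z + h) u - T z u - h \<cdot> T z w = T c (T b u) - T c (T a u) - h \<cdot> T c (T a w)"
        by (simp only: zT X)
      also have "\<dots> = T c (T b u - T a u - h \<cdot> T a w)"
        using X TX by (simp add: T_diff[OF C(3)] T_scale[OF C(3)])
      also have "T b u - T a u - h \<cdot> T a w = ?D b - ?D a - h \<cdot> (T a w - w)"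
        by (simp add: bw algebra_simps)
      finally have e: "T (z + h) u - T z u - h \<cdot> T z w = T c (?D b - ?D a - h \<cdot> (T a w - w))" .
      have "nrm (T (z + h) u - T z u - h \<cdot> T z w) \<le> nrm (?D b - ?D a - h \<cdot> (T a w - w))"
        unfolding e by (rule T_nrm[OF C(3) diff_in[OF diff_in[OF DX(2,1)] scale_in[OF DX(3)]]])
      also have "\<dots> \<le> nrm (?D b) + nrm (?D a) + cmod h * nrm (T a w - w)"
        using nrm_triangle_diff[OF diff_in[OF DX(2,1)] scale_in[OF DX(3)], of h] nrm_triangle_diff[OF DX(2,1)]
          nrm_scale[OF DX(3), of h] by linarith
      also have "\<dots> \<le> (cmod b)\<^sup>2 * nrm q + (cmod a)\<^sup>2 * nrm q + cmod h * (cmod a * nrm q)"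
        using T_taylor2[OF C(1) A] T_taylor2[OF C(2) A] T_bound1[OF C(1) A(2)]
        by (intro add_mono mult_left_mono) auto
      also have "\<dots> \<le> (4 * cmod h)\<^sup>2 * nrm q + (3 * cmod h)\<^sup>2 * nrm q + cmod h * (3 * cmod h * nrm q)"
        unfolding na using X nb by (intro add_mono mult_right_mono power_mono order_refl) auto
      also have "\<dots> = 28 * nrm q * (cmod h)\<^sup>2" by (simp add: power2_eq_square algebra_simps)
      finally have n: "nrm (T (z + h) u - T z u - h \<cdot> T z w) \<le> 28 * nrm q * (cmod h)\<^sup>2" .
      have e: "ip (T (z + h) u) g - ip (T z u) g - h * ip (T z w) g = ip (T (z + h) u - T z u - h \<cdot> T z w) g"
        using X TX(4,5) g by (simp add: ip_diff_left ip_scale_left)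
      have "cmod (ip (T (z + h) u) g - ip (T z u) g - h * ip (T z w) g)
          \<le> nrm (T (z + h) u - T z u - h \<cdot> T z w) * nrm g"
        unfolding e by (intro Cauchy_Schwarz diff_in scale_in TX(4,5) X g)
      also have "\<dots> \<le> 28 * nrm q * (cmod h)\<^sup>2 * nrm g" using n g by (intro mult_right_mono) auto
      finally show ?thesis by (simp add: mult_ac)
    qed simp
  qed (use r in simp)
qed

text \<open>Approximating \<open>f\<close> from the domain of the square is uniform in
  \<open>z\<close>, as all \<open>T z\<close> are contractions, and uniform limits of holomorphic
  functions are holomorphic.\<close>

lemma T_holomorphic:
  assumes f: "f \<in> X" and g: "g \<in> X"
  shows "(\<lambda>z. ip (T z f) g) holomorphic_on quarter"
proof -
  have "\<exists>u w q. (u, w) \<in> A \<and> (w, q) \<in> A \<and> nrm (f - u) < inverse (real (Suc n))" for n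
    by (rule dom2_dense[OF f]) simp
  then obtain u w q where A: "\<And>n. (u n, w n) \<in> A" "\<And>n. (w n, q n) \<in> A"
    and near: "\<And>n. nrm (f - u n) < inverse (real (Suc n))" by metis
  have X: "u n \<in> X" for n using A_in A by blast
  show ?thesis
  proof (rule holomorphic_uniform_sequence[OF open_quarter, where f = "\<lambda>n z. ip (T z (u n)) g"])
    show "(\<lambda>z. ip (T z (u n)) g) holomorphic_on quarter" for n
      unfolding holomorphic_on_open[OF open_quarter] using T_holomorphic_dom2[OF A[of n] g] by blast
    fix z assume "z \<in> quarter"
    then obtain d where d: "0 < d" "cball z d \<subseteq> quarter" using open_quarter open_contains_cball by blast
    have "uniform_limit (cball z d) (\<lambda>n z. ip (T z (u n)) g) (\<lambda>z. ip (T z f) g) sequentially"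
    proof (rule uniform_limitI)
      fix e :: real assume e: "0 < e"
      have "(\<lambda>n. inverse (real (Suc n)) * nrm g) \<longlonglongrightarrow> 0 * nrm g"
        by (intro tendsto_intros LIMSEQ_inverse_real_of_nat)
      from order_tendstoD(2)[OF this, of e] e
      have "\<forall>\<^sub>F n in sequentially. inverse (real (Suc n)) * nrm g < e" by simp
      then show "\<forall>\<^sub>F n in sequentially. \<forall>z\<in>cball z d. dist (ip (T z (u n)) g) (ip (T z f) g) < e"
      proof eventually_elim
        case (elim n)
        show ?case
        proof
          fix y assume "y \<in> cball z d"
          then have y: "y \<in> insert 0 quarter" using d by auto
          have "dist (ip (T y (u n)) g) (ip (T y f) g) = cmod (ip (T y (f - u n)) g)"
            using f X g T_in[OF y] by (simp add: dist_norm norm_minus_commute T_diff[OF y] ip_simps)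
          also have "\<dots> \<le> nrm (T y (f - u n)) * nrm g"
            using f X g T_in[OF y] by (intro Cauchy_Schwarz) auto
          also have "\<dots> \<le> inverse (real (Suc n)) * nrm g"
            using T_nrm[OF y, of "f - u n"] near[of n] f X g by (intro mult_right_mono) auto
          finally show "dist (ip (T y (u n)) g) (ip (T y f) g) < e" using elim by linarith
        qed
      qed
    qed
    then show "\<exists>d>0. cball z d \<subseteq> quarter \<and>
        uniform_limit (cball z d) (\<lambda>n z. ip (T z (u n)) g) (\<lambda>z. ip (T z f) g) sequentially"
      using d by blast
  qed
qed

lemma T_generator_tendsto:
  assumes A: "(u, w) \<in> A"
  shows "((\<lambda>t. nrm (inverse (complex_of_real t) \<cdot> (T (of_real t) u - u) - w)) \<longlongrightarrow> 0) (at_right 0)"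
proof (rule tendstoI)
  fix e :: real assume "0 < e"
  then obtain \<delta> where d: "0 < \<delta>"
    "\<And>t. 0 < t \<Longrightarrow> t < \<delta> \<Longrightarrow> nrm (inverse (of_real t) \<cdot> (T (of_real t) u - u) - w) < e"
    using T_generator[OF A] by blast
  have X: "u \<in> X" "w \<in> X" using A_in A by auto
  have "\<bar>nrm (inverse (of_real t) \<cdot> (T (of_real t) u - u) - w)\<bar> < e" if "0 < t" "t < \<delta>" for t
    using d(2)[OF that] X T_in[of "of_real t" u] of_real_in_quarter[OF that(1)] by simp
  then show "\<forall>\<^sub>F t in at_right 0. dist (nrm (inverse (complex_of_real t) \<cdot> (T (of_real t) u - u) - w)) 0 < e"
    unfolding eventually_at_right_field using d(1) by auto
qed

text \<open>The generator cannot be a proper extension of \<open>A\<close>. If \<open>u\<close>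
  solves the resolvent equation for \<open>f - g\<close>, the difference quotients of
  \<open>v = f - u\<close> converge to \<open>v\<close> itself, while contractivity makes the real
  part of their scalar product with \<open>v\<close> nonpositive.\<close>

lemma T_generator_converse:
  assumes f: "f \<in> X" and g: "g \<in> X"
    and lim: "((\<lambda>t. nrm (inverse (complex_of_real t) \<cdot> (T (of_real t) f - f) - g)) \<longlongrightarrow> 0) (at_right 0)"
  shows "(f, g) \<in> A"
proof -
  have "1 \<in> quarter" by (simp add: quarter_def)
  then obtain u w where A: "(u, w) \<in> A" and uw: "u - 1 \<cdot> w = f - g" using A_solve f g diff_in by blast
  have X: "u \<in> X" "w \<in> X" using A_in A by auto
  define v where "v = f - u"
  have v: "v \<in> X" "g - w = v" using f X uw by (auto simp: v_def algebra_simps)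
  let ?D = "\<lambda>t f. inverse (complex_of_real t) \<cdot> (T (of_real t) f - f)"
  \<comment> \<open>The quotient of \<open>v\<close> differs from \<open>v\<close> by an error that
    tends to 0, and this error alone bounds the square norm of \<open>v\<close>.\<close>
  have b: "(nrm v)\<^sup>2 \<le> (nrm (?D t f - g) + nrm (?D t u - w)) * nrm v" if t: "0 < t" for t
  proof -
    have C: "complex_of_real t \<in> insert 0 quarter" using of_real_in_quarter[OF t] by simp
    have DX: "?D t x \<in> X" if "x \<in> X" for x using that T_in[OF C] by simp
    have "?D t v = ?D t f - ?D t u" unfolding v_def using f X by (simp add: T_diff[OF C] algebra_simps)
    then have "?D t v - v = (?D t f - ?D t u) - (g - w)" using v(2) by simp
    then have Dv: "?D t v - v = (?D t f - g) - (?D t u - w)" by (simp add: algebra_simps)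
    have "Re (ip (T (of_real t) v) v) \<le> cmod (ip (T (of_real t) v) v)" by (rule complex_Re_le_cmod)
    also have "\<dots> \<le> nrm v * nrm v"
      using Cauchy_Schwarz[OF T_in[OF C v(1)] v(1)] mult_right_mono[OF T_nrm[OF C v(1)], of "nrm v"] v(1)
      by simp
    finally have "Re (ip (T (of_real t) v) v) \<le> (nrm v)\<^sup>2" by (simp add: power2_eq_square)
    then have "Re (ip (?D t v) v) \<le> 0"
      using v(1) T_in[OF C v(1)] t by (simp add: ip_simps ip_self mult_nonneg_nonpos flip: of_real_inverse)
    moreover have "(nrm v)\<^sup>2 = Re (ip (?D t v) v) - Re (ip (?D t v - v) v)"
      using v(1) DX[OF v(1)] by (simp add: ip_diff_left nrm_sq)
    moreover have "- Re (ip (?D t v - v) v) \<le> nrm (?D t v - v) * nrm v"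
      using Cauchy_Schwarz[OF diff_in[OF DX[OF v(1)] v(1)] v(1)] abs_Re_le_cmod[of "ip (?D t v - v) v"] by linarith
    moreover have "nrm (?D t v - v) \<le> nrm (?D t f - g) + nrm (?D t u - w)"
      unfolding Dv using DX f g X by (intro nrm_triangle_diff) auto
    then have "nrm (?D t v - v) * nrm v \<le> (nrm (?D t f - g) + nrm (?D t u - w)) * nrm v"
      using v(1) by (intro mult_right_mono) auto
    ultimately show ?thesis by linarith
  qed
  have "((\<lambda>t. (nrm (?D t f - g) + nrm (?D t u - w)) * nrm v) \<longlongrightarrow> (0 + 0) * nrm v) (at_right 0)"
    by (intro tendsto_intros lim T_generator_tendsto[OF A])
  then have "(nrm v)\<^sup>2 \<le> (0 + 0) * nrm v"
    by (rule tendsto_lowerbound) (auto simp: eventually_at_right_field intro!: exI[of _ 1] b)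
  then have "v = 0" using nrm_0D[OF v(1)] by simp
  then have "u = f" "w = g" using v by (auto simp: v_def)
  then show ?thesis using A by simp
qed

end

section \<open>Linear representatives modulo null vectors\<close>

context semi_hilbert
begin

text \<open>A linear choice of representatives turns the seminorm into a norm on its range.\<close>

lemma linear_representatives:
  "\<exists>\<pi>. Vector_Spaces.linear scl scl \<pi> \<and>
    (\<forall>x\<in>X. \<pi> x \<in> X \<and> nrm (\<pi> x - x) = 0 \<and> (nrm x = 0 \<longrightarrow> \<pi> x = 0))"
proof -
  define Z where "Z = {x \<in> X. nrm x = 0}"
  have null_add: "nrm (x + y) = 0" if "x \<in> X" "y \<in> X" "nrm x = 0" "nrm y = 0" for x y
    using nrm_triangle[OF that(1,2)] nrm_ge_0[OF add_in[OF that(1,2)]] that by linarith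
  have subZ: "subspace Z" by (rule subspaceI) (auto simp: Z_def null_add)
  \<comment> \<open>A basis of the null space is extended to a basis \<open>B\<close> of
    \<open>X\<close>; \<open>\<pi>\<close> kills the first part and fixes the rest.\<close>
  obtain BZ where BZ: "BZ \<subseteq> Z" "independent BZ" "Z \<subseteq> span BZ" by (rule maximal_independent_subset)
  have "BZ \<subseteq> X" using BZ by (auto simp: Z_def)
  then obtain B where B: "BZ \<subseteq> B" "B \<subseteq> X" "independent B" "X \<subseteq> span B"
    using maximal_independent_subset_extend BZ(2) by blast
  interpret vp: vector_space_pair scl scl ..
  obtain \<pi> where lin: "Vector_Spaces.linear scl scl \<pi>" and \<pi>: "\<And>b. b \<in> B \<Longrightarrow> \<pi> b = (if b \<in> BZ then 0 else b)"
    using vp.linear_independent_extend[OF B(3), of "\<lambda>b. if b \<in> BZ then 0 else b"] by blast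
  interpret l: Vector_Spaces.linear scl scl \<pi> by (rule lin)
  have Z0: "\<pi> x = 0" if "x \<in> span BZ" for x
    using that
  proof (induction rule: span_induct)
    case base
    then show ?case unfolding subspace_def by (auto simp: l.add l.scale l.zero)
  next
    case (step x)
    then show ?case using \<pi> B(1) by auto
  qed
  have main: "x \<in> X \<and> \<pi> x \<in> X \<and> nrm (\<pi> x - x) = 0" if "x \<in> span B" for x
    using that
  proof (induction rule: span_induct)
    case base
    show ?case unfolding subspace_def
    proof (intro conjI allI ballI; clarsimp simp: l.add l.scale l.zero)
      fix x y assume "x \<in> X" "y \<in> X" "\<pi> x \<in> X" "\<pi> y \<in> X" "nrm (\<pi> x - x) = 0" "nrm (\<pi> y - y) = 0"
      then show "nrm (\<pi> x + \<pi> y - (x + y)) = 0" using null_add[of "\<pi> x - x" "\<pi> y - y"] by (simp add: algebra_simps)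
    next
      fix c x assume "x \<in> X" "\<pi> x \<in> X" "nrm (\<pi> x - x) = 0"
      then show "nrm (c \<cdot> \<pi> x - c \<cdot> x) = 0" by (simp add: scale_right_diff_distrib[symmetric])
    qed
  next
    case (step x)
    then show ?case using \<pi>[of x] B(2) BZ(1) by (auto simp: Z_def)
  qed
  have "\<pi> x = 0" if "x \<in> X" "nrm x = 0" for x using Z0[of x] BZ(3) that by (auto simp: Z_def)
  moreover have "\<pi> x \<in> X \<and> nrm (\<pi> x - x) = 0" if "x \<in> X" for x using main[of x] B(4) that by blast
  ultimately show ?thesis using lin by blast
qed

end

context semi_sectorial
begin

text \<open>The semigroup is built on the range \<open>Y\<close> of \<open>\<pi>\<close>, where the
  form is definite, and composed with \<open>\<pi>\<close>. Linearity of \<open>\<pi>\<close> makes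
  additivity, homogeneity and the semigroup law hold exactly; at time 0 one obtains
  \<open>\<pi> f\<close>, which differs from \<open>f\<close> by a null vector.\<close>

lemma sectorial_semigroup:
  obtains S where
    "\<And>z f. z \<in> insert 0 quarter \<Longrightarrow> f \<in> X \<Longrightarrow> S z f \<in> X"
    "\<And>z f. z \<in> insert 0 quarter \<Longrightarrow> f \<in> X \<Longrightarrow> nrm (S z f) \<le> nrm f"
    "\<And>z f g. z \<in> insert 0 quarter \<Longrightarrow> f \<in> X \<Longrightarrow> g \<in> X \<Longrightarrow> S z (f + g) = S z f + S z g"
    "\<And>z a f. z \<in> insert 0 quarter \<Longrightarrow> f \<in> X \<Longrightarrow> S z (a \<cdot> f) = a \<cdot> S z f"
    "\<And>f. f \<in> X \<Longrightarrow> nrm (S 0 f - f) = 0"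
    "\<And>z w f. z \<in> insert 0 quarter \<Longrightarrow> w \<in> insert 0 quarter \<Longrightarrow> f \<in> X \<Longrightarrow> S (z + w) f = S z (S w f)"
    "\<And>f g. f \<in> X \<Longrightarrow> g \<in> X \<Longrightarrow> (\<lambda>z. ip (S z f) g) holomorphic_on quarter"
    "\<And>f. f \<in> X \<Longrightarrow> ((\<lambda>z. nrm (S z f - f)) \<longlongrightarrow> 0) (at 0 within insert 0 quarter)"
    "\<And>f g. f \<in> X \<Longrightarrow> g \<in> X \<Longrightarrow> (f, g) \<in> A \<longleftrightarrow>
       ((\<lambda>t. nrm (inverse (complex_of_real t) \<cdot> (S (of_real t) f - f) - g)) \<longlongrightarrow> 0) (at_right 0)"
proof -
  obtain \<pi> where lin: "Vector_Spaces.linear scl scl \<pi>" and \<pi>X: "\<And>x. x \<in> X \<Longrightarrow> \<pi> x \<in> X"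
    and \<pi>0: "\<And>x. x \<in> X \<Longrightarrow> nrm (\<pi> x - x) = 0" and \<pi>null: "\<And>x. x \<in> X \<Longrightarrow> nrm x = 0 \<Longrightarrow> \<pi> x = 0"
    using linear_representatives by blast
  interpret l: Vector_Spaces.linear scl scl \<pi> by (rule lin)
  define Y where "Y = \<pi> ` X"
  have YX: "y \<in> X" if "y \<in> Y" for y using that \<pi>X by (auto simp: Y_def)
  have \<pi>Y: "\<pi> x \<in> Y" if "x \<in> X" for x using that by (simp add: Y_def)
  have \<pi>eq: "\<pi> x = \<pi> y" if "x \<in> X" "y \<in> X" "nrm (x - y) = 0" for x y
    using \<pi>null[of "x - y"] that by (simp add: l.diff)
  have \<pi>id: "\<pi> y = y" if y: "y \<in> Y" for y
  proof -
    obtain x where x: "x \<in> X" "y = \<pi> x" using y by (auto simp: Y_def)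
    show ?thesis unfolding x(2) by (rule \<pi>eq[OF \<pi>X[OF x(1)] x(1) \<pi>0[OF x(1)]])
  qed
  have \<pi>0': "nrm (x - \<pi> x) = 0" if "x \<in> X" for x using nrm_commute[OF that \<pi>X[OF that]] \<pi>0[OF that] by simp
  have \<pi>ip: "ip (\<pi> x) y = ip x y" "ip y (\<pi> x) = ip y x" if "x \<in> X" "y \<in> X" for x y
    using ip_eq_mod_left[of "\<pi> x" x y] ip_eq_mod_right[of "\<pi> x" x y] that \<pi>0 \<pi>X by auto
  have \<pi>A: "(\<pi> u, \<pi> w) \<in> A" if "(u, w) \<in> A" for u w
    using A_cong[OF that] A_in[OF that] \<pi>X \<pi>0 by auto
  define AY where "AY = A \<inter> Y \<times> Y"
  interpret Y: m_sectorial scl Y ip AY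
  proof
    show "subspace Y" unfolding Y_def by (rule l.subspace_image[OF subspace_X])
    show "ip (x + y) z = ip x z + ip y z" if "x \<in> Y" "y \<in> Y" "z \<in> Y" for x y z
      using that YX ip_add_left by auto
    show "ip (a \<cdot> x) y = a * ip x y" if "x \<in> Y" "y \<in> Y" for a x y
      using that YX ip_scale_left by auto
    show "ip y x = cnj (ip x y)" if "x \<in> Y" "y \<in> Y" for x y
      using ip_cnj[OF YX[OF that(1)] YX[OF that(2)]] .
    show "0 \<le> Re (ip x x)" if "x \<in> Y" for x using that YX ip_nonneg by auto
    show "x = 0" if "x \<in> Y" "ip x x = 0" for x
      using \<pi>null[of x] \<pi>id[of x] YX[of x] that by (simp add: nrm_def)
    show "\<exists>y\<in>Y. (\<lambda>n. sqrt (Re (ip (f n - y) (f n - y)))) \<longlonglongrightarrow> 0"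
      if f: "\<And>n::nat. f n \<in> Y"
        and C: "\<And>e. 0 < e \<Longrightarrow> \<exists>K. \<forall>m\<ge>K. \<forall>n\<ge>K. sqrt (Re (ip (f m - f n) (f m - f n))) < e" for f
    proof -
      obtain y where y: "y \<in> X" "(\<lambda>n. nrm (f n - y)) \<longlonglongrightarrow> 0"
        using complete[of f] f YX C unfolding nrm_def by blast
      have "nrm (f n - y) = nrm (f n - \<pi> y)" for n
        using nrm_eq_mod[of "f n - y" "f n - \<pi> y"] YX[OF f] y \<pi>X \<pi>0 by simp
      then have "(\<lambda>n. nrm (f n - \<pi> y)) \<longlonglongrightarrow> 0" using y by simp
      then show ?thesis unfolding nrm_def using \<pi>Y[OF y(1)] by blast
    qed
    show "u \<in> Y \<and> w \<in> Y" if "(u, w) \<in> AY" for u w using that by (auto simp: AY_def)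
    show "(u + u', w + w') \<in> AY" if "(u, w) \<in> AY" "(u', w') \<in> AY" for u w u' w'
      using that A_add \<open>subspace Y\<close> subspace_add by (auto simp: AY_def)
    show "(a \<cdot> u, a \<cdot> w) \<in> AY" if "(u, w) \<in> AY" for a u w
      using that A_scale \<open>subspace Y\<close> subspace_scale by (auto simp: AY_def)
    show "nrm w = 0" if "(u, w) \<in> AY" "nrm u = 0" for u w
      using A_single[of u w] that by (auto simp: AY_def)
    show "(u', w') \<in> AY" if "(u, w) \<in> AY" "u' \<in> Y" "w' \<in> Y" "nrm (u' - u) = 0" "nrm (w' - w) = 0" for u w u' w'
      using A_cong[of u w u' w'] that YX by (auto simp: AY_def)
    show "Re (z * ip w u) \<le> 0" if "(u, w) \<in> AY" "z \<in> quarter" for u w z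
      using A_sect that by (auto simp: AY_def)
    show "\<exists>u w. (u, w) \<in> AY \<and> nrm (u - z \<cdot> w - f) = 0" if z: "z \<in> quarter" and f: "f \<in> Y" for z f
    proof -
      obtain u w where A: "(u, w) \<in> A" and n: "nrm (u - z \<cdot> w - f) = 0" using A_range[OF z YX[OF f]] by blast
      have X: "u \<in> X" "w \<in> X" using A_in A by auto
      have "\<pi> (u - z \<cdot> w) = \<pi> f" using n X YX[OF f] by (intro \<pi>eq) auto
      then have "\<pi> u - z \<cdot> \<pi> w = f" using \<pi>id[OF f] by (simp add: l.diff l.scale)
      moreover have "(\<pi> u, \<pi> w) \<in> AY" using \<pi>A[OF A] \<pi>Y X by (simp add: AY_def)
      ultimately have "(\<pi> u, \<pi> w) \<in> AY \<and> nrm (\<pi> u - z \<cdot> \<pi> w - f) = 0" by simp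
      then show ?thesis by blast
    qed
  qed
  define S where "S z f = Y.T z (\<pi> f)" for z f
  have SY: "S z f \<in> Y" if "z \<in> insert 0 quarter" "f \<in> X" for z f
    unfolding S_def using Y.T_in[OF that(1) \<pi>Y[OF that(2)]] .
  have n\<pi>: "nrm (\<pi> f) = nrm f" if "f \<in> X" for f using nrm_eq_mod[of "\<pi> f" f] \<pi>0 \<pi>X that by simp
  have diffn: "nrm (S z f - f) = nrm (Y.T z (\<pi> f) - \<pi> f)" if "z \<in> insert 0 quarter" "f \<in> X" for z f
    using nrm_eq_mod[of "S z f - f" "S z f - \<pi> f"] YX[OF SY[OF that]] \<pi>X[OF that(2)] that(2) \<pi>0[OF that(2)]
    by (simp add: S_def)
  show ?thesis
  proof (rule that[of S])
    fix z f assume z: "z \<in> insert 0 quarter" and f: "f \<in> X"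
    show "S z f \<in> X" using YX[OF SY[OF z f]] .
    show "nrm (S z f) \<le> nrm f" using Y.T_nrm[OF z \<pi>Y[OF f]] n\<pi>[OF f] by (simp add: S_def)
    show "S z (f + g) = S z f + S z g" if "g \<in> X" for g
      using Y.T_add[OF z \<pi>Y[OF f] \<pi>Y[OF that]] by (simp add: S_def l.add)
    show "S z (a \<cdot> f) = a \<cdot> S z f" for a
      using Y.T_scale[OF z \<pi>Y[OF f]] by (simp add: S_def l.scale)
    show "S (y + z) f = S y (S z f)" if "y \<in> insert 0 quarter" for y
      using Y.T_plus[OF that z \<pi>Y[OF f]] \<pi>id[OF SY[OF z f]] by (simp add: S_def)
  next
    fix f assume f: "f \<in> X"
    show "nrm (S 0 f - f) = 0" using Y.T_0[OF \<pi>Y[OF f]] \<pi>0[OF f] by (simp add: S_def)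
    have "((\<lambda>z. nrm (Y.T z (\<pi> f) - \<pi> f)) \<longlongrightarrow> 0) (at 0 within insert 0 quarter)"
      by (rule Y.T_strong_continuity[OF \<pi>Y[OF f]])
    then show "((\<lambda>z. nrm (S z f - f)) \<longlongrightarrow> 0) (at 0 within insert 0 quarter)"
      by (rule Lim_transform_eventually) (auto simp: eventually_at_filter diffn f)
    fix g assume g: "g \<in> X"
    have "(\<lambda>z. ip (Y.T z (\<pi> f)) (\<pi> g)) holomorphic_on quarter"
      by (rule Y.T_holomorphic[OF \<pi>Y[OF f] \<pi>Y[OF g]])
    then show "(\<lambda>z. ip (S z f) g) holomorphic_on quarter"
      by (rule holomorphic_transform) (use \<pi>ip(2)[OF g] YX[OF SY[OF _ f]] in \<open>simp add: S_def\<close>)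
    let ?D = "\<lambda>t. nrm (inverse (complex_of_real t) \<cdot> (S (of_real t) f - f) - g)"
    let ?D' = "\<lambda>t. nrm (inverse (complex_of_real t) \<cdot> (Y.T (of_real t) (\<pi> f) - \<pi> f) - \<pi> g)"
    have eq: "?D t = ?D' t" if "0 < t" for t
    proof -
      have C: "complex_of_real t \<in> insert 0 quarter" using of_real_in_quarter[OF that] by simp
      let ?a = "inverse (complex_of_real t) \<cdot> (S (of_real t) f - f) - g"
      have "\<pi> ?a = inverse (complex_of_real t) \<cdot> (Y.T (of_real t) (\<pi> f) - \<pi> f) - \<pi> g"
        using \<pi>id[OF SY[OF C f]] by (simp add: l.diff l.scale S_def)
      moreover have "?a \<in> X" using YX[OF SY[OF C f]] f g by simp
      ultimately show ?thesis using n\<pi> by metis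
    qed
    have lim: "(?D \<longlongrightarrow> 0) (at_right 0) \<longleftrightarrow> (?D' \<longlongrightarrow> 0) (at_right 0)"
      by (rule filterlim_cong) (auto simp: eventually_at_right_field eq intro!: exI[of _ 1])
    show "(f, g) \<in> A \<longleftrightarrow> (?D \<longlongrightarrow> 0) (at_right 0)"
    proof
      assume "(f, g) \<in> A"
      then have "(\<pi> f, \<pi> g) \<in> AY" using \<pi>A \<pi>Y f g by (auto simp: AY_def)
      then show "(?D \<longlongrightarrow> 0) (at_right 0)" unfolding lim by (rule Y.T_generator_tendsto)
    next
      assume "(?D \<longlongrightarrow> 0) (at_right 0)"
      then have "(?D' \<longlongrightarrow> 0) (at_right 0)" unfolding lim .
      then have "(\<pi> f, \<pi> g) \<in> AY" by (rule Y.T_generator_converse[OF \<pi>Y[OF f] \<pi>Y[OF g]])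
      then show "(f, g) \<in> A" using A_cong[of "\<pi> f" "\<pi> g" f g] \<pi>0' f g by (auto simp: AY_def)
    qed
  qed
qed

end

section \<open>Growth of an arbitrary semigroup\<close>

text \<open>If the claim failed, take the line that starts at the graph point over \<open>a\<close>
  and has half the mean slope, which is positive. To the right of the last point \<open>s\<close>
  where the graph is not above this line, the graph would rise at least as fast as the line.\<close>

lemma right_derivative_nonpos_imp_le:
  fixes \<psi> :: "real \<Rightarrow> real"
  assumes ab: "a \<le> b" and cont: "continuous_on {a..b} \<psi>"
    and der: "\<And>t. a \<le> t \<Longrightarrow> t < b \<Longrightarrow> \<exists>D\<le>0. (\<psi> has_real_derivative D) (at_right t)"
  shows "\<psi> b \<le> \<psi> a"
proof (rule ccontr)
  assume "\<not> \<psi> b \<le> \<psi> a"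
  then have lt: "\<psi> a < \<psi> b" "a < b" using ab by (auto simp: less_le)
  define e where "e = (\<psi> b - \<psi> a) / (2 * (b - a))"
  have e: "0 < e" "e * (b - a) = (\<psi> b - \<psi> a) / 2" using lt by (auto simp: e_def field_simps)
  define g where "g t = \<psi> t - \<psi> a - e * (t - a)" for t
  have contg: "continuous_on {a..b} g" unfolding g_def by (intro continuous_intros cont)
  let ?S = "{a..b} \<inter> g -` {..0}"
  have "closed ?S" by (intro continuous_closed_preimage contg) auto
  then have "compact ?S" using compact_Int_closed[OF compact_Icc[of a b] \<open>closed ?S\<close>] by (simp add: Int_assoc[symmetric])
  moreover have "?S \<noteq> {}" using ab by (auto simp: g_def intro!: exI[of _ a])
  ultimately obtain s where s: "s \<in> ?S" and max: "\<And>t. t \<in> ?S \<Longrightarrow> t \<le> s" using compact_attains_sup by metis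
  have "g b > 0" using lt e by (simp add: g_def field_simps)
  then have sb: "a \<le> s" "s < b" "g s \<le> 0" using s by (auto simp: less_le)
  obtain D where D: "D \<le> 0" "(\<psi> has_real_derivative D) (at_right s)" using der sb by blast
  have "(g has_real_derivative D - e) (at_right s)"
    unfolding g_def by (auto intro!: derivative_eq_intros D)
  from has_real_derivative_neg_dec_right[OF this] D(1) e(1)
  obtain d where d: "d > 0" "\<And>h. 0 < h \<Longrightarrow> h < d \<Longrightarrow> g (s + h) < g s" by auto
  define h where "h = min (d / 2) (b - s)"
  have h: "0 < h" "h < d" "s + h \<le> b" using d sb by (auto simp: h_def min_def)
  then have "s + h \<in> ?S" using d(2)[OF h(1,2)] sb by auto
  then show False using max[of "s + h"] h by linarith
qed

text \<open>\<open>d s t\<close> stands for the distance between the orbit at times \<open>s\<close>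
  and \<open>t\<close>. The sets of times with small local oscillation are open, and right
  continuity makes them dense, since they contain times slightly to the right of any given one. A
  time common to all of them is a point of continuity.\<close>

lemma right_continuous_imp_continuity_point:
  fixes d :: "real \<Rightarrow> real \<Rightarrow> real"
  assumes sym: "\<And>s t. 0 \<le> s \<Longrightarrow> 0 \<le> t \<Longrightarrow> d s t = d t s"
    and tri: "\<And>s t r. 0 \<le> s \<Longrightarrow> 0 \<le> t \<Longrightarrow> 0 \<le> r \<Longrightarrow> d s r \<le> d s t + d t r"
    and right: "\<And>t e. 0 \<le> t \<Longrightarrow> 0 < e \<Longrightarrow> \<exists>\<delta>>0. \<forall>h. 0 \<le> h \<and> h < \<delta> \<longrightarrow> d (t + h) t < e"
    and eps: "0 < (\<epsilon>::real)"
  shows "\<exists>t. 0 < t \<and> t < \<epsilon> \<and> (\<forall>e>0. \<exists>\<delta>>0. \<forall>s\<ge>0. \<bar>s - t\<bar> < \<delta> \<longrightarrow> d s t < e)"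
proof -
  \<comment> \<open>The sets are taken on the whole line, which is complete; negative times belong
    to them vacuously.\<close>
  define U where "U n = {t. \<exists>\<delta>>0. \<forall>s\<ge>0. \<forall>s'\<ge>0. \<bar>s - t\<bar> < \<delta> \<longrightarrow> \<bar>s' - t\<bar> < \<delta> \<longrightarrow> d s s' < inverse (real (Suc n))}"
    for n :: nat
  have opn: "open (U n)" for n
    unfolding open_dist
  proof
    fix t assume "t \<in> U n"
    then obtain \<delta> where \<delta>: "\<delta> > 0"
      "\<And>s s'. s \<ge> 0 \<Longrightarrow> s' \<ge> 0 \<Longrightarrow> \<bar>s - t\<bar> < \<delta> \<Longrightarrow> \<bar>s' - t\<bar> < \<delta> \<Longrightarrow> d s s' < inverse (real (Suc n))"
      unfolding U_def by blast
    have "y \<in> U n" if "dist y t < \<delta> / 2" for y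
    proof -
      have "d s s' < inverse (real (Suc n))"
        if "s \<ge> 0" "s' \<ge> 0" "\<bar>s - y\<bar> < \<delta> / 2" "\<bar>s' - y\<bar> < \<delta> / 2" for s s'
      proof (rule \<delta>(2)[OF that(1,2)])
        show "\<bar>s - t\<bar> < \<delta>" "\<bar>s' - t\<bar> < \<delta>"
          using that(3,4) \<open>dist y t < \<delta> / 2\<close> unfolding dist_real_def by linarith+
      qed
      then show ?thesis unfolding U_def using \<delta>(1) by (auto intro!: exI[of _ "\<delta> / 2"])
    qed
    then show "\<exists>e>0. \<forall>y. dist y t < e \<longrightarrow> y \<in> U n" using \<delta>(1) by (intro exI[of _ "\<delta> / 2"]) auto
  qed
  have dense: "t \<in> closure (U n)" for n t
    unfolding closure_approachable
  proof (intro allI impI)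
    fix r :: real assume r: "0 < r"
    show "\<exists>y\<in>U n. dist y t < r"
    proof (cases "t < 0")
      case True
      then have "t \<in> U n" unfolding U_def by (intro CollectI exI[of _ "- t"]) auto
      then show ?thesis using r by (intro bexI[of _ t]) auto
    next
      case False
      then obtain \<delta> where \<delta>: "\<delta> > 0" "\<And>h. 0 \<le> h \<Longrightarrow> h < \<delta> \<Longrightarrow> d (t + h) t < inverse (real (Suc n)) / 2"
        using right[of t "inverse (real (Suc n)) / 2"] by auto
      define h where "h = min \<delta> r / 2"
      have h: "0 < h" "2 * h \<le> \<delta>" "h < r" using \<delta> r by (auto simp: h_def)
      \<comment> \<open>All times near \<open>t + h\<close> lie between \<open>t\<close> and
        \<open>t + 2 * h\<close>, where right continuity controls the distance to time
        \<open>t\<close>.\<close>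
      have "t + h \<in> U n" unfolding U_def
      proof (intro CollectI exI[of _ h] conjI allI impI)
        fix s s' assume s: "s \<ge> 0" "s' \<ge> 0" "\<bar>s - (t + h)\<bar> < h" "\<bar>s' - (t + h)\<bar> < h"
        have "d s t < inverse (real (Suc n)) / 2" "d s' t < inverse (real (Suc n)) / 2"
          using \<delta>(2)[of "s - t"] \<delta>(2)[of "s' - t"] s h by auto
        moreover have "d s s' \<le> d s t + d s' t" using tri[of s t s'] sym[of s' t] s False by simp
        ultimately show "d s s' < inverse (real (Suc n))" by linarith
      qed (rule h)
      then show ?thesis using h by (intro bexI[of _ "t + h"]) (auto simp: dist_real_def)
    qed
  qed
  have "UNIV \<subseteq> closure (\<Inter> (range U))"
    by (rule Baire) (use opn dense in auto)
  then have "\<epsilon> / 2 \<in> closure (\<Inter> (range U))" by blast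
  then obtain t where t: "t \<in> \<Inter> (range U)" "dist t (\<epsilon> / 2) < \<epsilon> / 2"
    using eps unfolding closure_approachable by (metis half_gt_zero)
  have t0: "0 < t" "t < \<epsilon>" using t(2) by (auto simp: dist_real_def abs_if split: if_splits)
  have "\<exists>\<delta>>0. \<forall>s\<ge>0. \<bar>s - t\<bar> < \<delta> \<longrightarrow> d s t < e" if "0 < e" for e
  proof -
    obtain n where n: "inverse (real (Suc n)) < e" using reals_Archimedean[OF \<open>0 < e\<close>] by blast
    have "t \<in> U n" using t(1) by blast
    then obtain \<delta> where \<delta>: "\<delta> > 0"
      "\<And>s s'. s \<ge> 0 \<Longrightarrow> s' \<ge> 0 \<Longrightarrow> \<bar>s - t\<bar> < \<delta> \<Longrightarrow> \<bar>s' - t\<bar> < \<delta> \<Longrightarrow> d s s' < inverse (real (Suc n))"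
      unfolding U_def by blast
    have "d s t < e" if "s \<ge> 0" "\<bar>s - t\<bar> < \<delta>" for s
      using \<delta>(2)[of s t] \<delta>(1) n t0 that by simp
    then show ?thesis using \<delta>(1) by blast
  qed
  then show ?thesis using t0 by blast
qed

context semi_hilbert
begin

text \<open>Bounded operators that are linear only modulo null vectors, in accordance with
  \<open>bounded_operator\<close>.\<close>

definition bop :: "('v \<Rightarrow> 'v) \<Rightarrow> bool" where
  "bop B \<longleftrightarrow> (\<forall>f\<in>X. B f \<in> X) \<and> (\<forall>f\<in>X. \<forall>g\<in>X. nrm (B (f + g) - (B f + B g)) = 0) \<and>
     (\<forall>a. \<forall>f\<in>X. nrm (B (a \<cdot> f) - a \<cdot> B f) = 0) \<and> (\<exists>C. \<forall>f\<in>X. nrm (B f) \<le> C * nrm f)"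

lemma nrm_le_0_iff: "x \<in> X \<Longrightarrow> nrm x \<le> 0 \<longleftrightarrow> nrm x = 0"
  using nrm_ge_0[of x] by linarith

lemma nrm_mod_trans: 
  "x \<in> X \<Longrightarrow> y \<in> X \<Longrightarrow> z \<in> X \<Longrightarrow> nrm (x - y) = 0 \<Longrightarrow> nrm (y - z) = 0 \<Longrightarrow> nrm (x - z) = 0"
  using nrm_triangle3[of x y z] by (simp add: nrm_le_0_iff)

lemma nrm_mod_add: 
  "x \<in> X \<Longrightarrow> y \<in> X \<Longrightarrow> x' \<in> X \<Longrightarrow> y' \<in> X \<Longrightarrow> nrm (x - x') = 0 \<Longrightarrow> nrm (y - y') = 0 \<Longrightarrow> nrm (x + y - (x' + y')) = 0"
  using nrm_triangle[of "x - x'" "y - y'"] nrm_le_0_iff[of "x + y - (x' + y')"] by (simp add: algebra_simps)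

lemma bop_diff:
  assumes B: "bop B" and f: "f \<in> X" and g: "g \<in> X"
  shows "nrm (B (f - g) - (B f - B g)) = 0"
proof -
  have X: "B x \<in> X" if "x \<in> X" for x using B that by (simp add: bop_def)
  have a: "nrm (B (f + (-1) \<cdot> g) - (B f + B ((-1) \<cdot> g))) = 0" and s: "nrm (B ((-1) \<cdot> g) - (-1) \<cdot> B g) = 0"
    using B f g by (simp_all add: bop_def del: scale_minus_left)
  have "nrm (B (f + (-1) \<cdot> g) - (B f + (-1) \<cdot> B g)) = 0"
    by (rule nrm_mod_trans[OF _ _ _ a nrm_mod_add[OF _ _ _ _ _ s]]) (use X f g in auto)
  then show ?thesis by simp
qed

lemma bop_lipschitz:
  assumes B: "bop B"
  shows "\<exists>C\<ge>0. \<forall>f\<in>X. \<forall>g\<in>X. nrm (B f - B g) \<le> C * nrm (f - g)"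
proof -
  obtain C where C: "\<And>f. f \<in> X \<Longrightarrow> nrm (B f) \<le> C * nrm f" using B unfolding bop_def by blast
  have X: "B x \<in> X" if "x \<in> X" for x using B that by (simp add: bop_def)
  \<comment> \<open>\<open>C\<close> comes without a sign, hence the maximum with 0.\<close>
  have "nrm (B f - B g) \<le> max C 0 * nrm (f - g)" if "f \<in> X" "g \<in> X" for f g
  proof -
    have "nrm (B f - B g) = nrm (B (f - g))" using nrm_eq_mod[OF _ _ bop_diff[OF B that]] X that by simp
    also have "\<dots> \<le> C * nrm (f - g)" using C that by simp
    also have "\<dots> \<le> max C 0 * nrm (f - g)" using that by (intro mult_right_mono) auto
    finally show ?thesis .
  qed
  then show ?thesis by (intro exI[of _ "max C 0"]) auto
qed

text \<open>The bounds of the single operators may depend on the time in an arbitrary way, so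
  neither local boundedness nor continuity of the orbits is available at the outset; the rate comes
  from dissipativity alone.\<close>

lemma semigroup_growth:
  fixes T :: "real \<Rightarrow> 'v \<Rightarrow> 'v" and G :: "('v \<times> 'v) set"
  assumes T: "\<And>t. 0 \<le> t \<Longrightarrow> bop (T t)"
    and T0: "\<And>f. f \<in> X \<Longrightarrow> nrm (T 0 f - f) = 0"
    and Tp: "\<And>t r f. 0 \<le> t \<Longrightarrow> 0 \<le> r \<Longrightarrow> f \<in> X \<Longrightarrow> nrm (T (t + r) f - T t (T r f)) = 0"
    and Tc: "\<And>f. f \<in> X \<Longrightarrow> ((\<lambda>t. nrm (T t f - f)) \<longlongrightarrow> 0) (at_right 0)"
    and G: "\<And>f g. (f, g) \<in> G \<longleftrightarrow> f \<in> X \<and> g \<in> X \<and>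
       ((\<lambda>t. nrm (inverse (complex_of_real t) \<cdot> (T t f - f) - g)) \<longlongrightarrow> 0) (at_right 0)"
    and diss: "\<And>f g. (f, g) \<in> G \<Longrightarrow> Re (ip g f) \<le> \<omega> * (nrm f)\<^sup>2"
    and dense: "\<And>f e. f \<in> X \<Longrightarrow> 0 < e \<Longrightarrow> \<exists>u w. (u, w) \<in> G \<and> nrm (f - u) < e"
    and t: "0 \<le> t" and f: "f \<in> X"
  shows "nrm (T t f) \<le> exp (\<omega> * t) * nrm f"
proof -
  have TX: "T t f \<in> X" if "0 \<le> t" "f \<in> X" for t f using T[OF that(1)] that(2) by (simp add: bop_def)
  have lip: "\<exists>C\<ge>0. \<forall>f\<in>X. \<forall>g\<in>X. nrm (T t f - T t g) \<le> C * nrm (f - g)" if "0 \<le> t" for t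
    using bop_lipschitz[OF T[OF that]] .
  have Tsum: "nrm (T (t + r) f - T t g) = nrm (T t (T r f) - T t g)" if "0 \<le> t" "0 \<le> r" "f \<in> X" "g \<in> X" for t r f g
    using that TX nrm_eq_mod[of "T (t + r) f - T t g" "T t (T r f) - T t g"] Tp[of t r f] by simp
  \<comment> \<open>Invariance of the domain: up to null vectors, the difference quotient at
    \<open>T s f\<close> is \<open>T s\<close> applied to the one at \<open>f\<close>, and
    \<open>T s\<close> is Lipschitz.\<close>
  have orbit: "(T s f, T s g) \<in> G" if fg: "(f, g) \<in> G" and s: "0 \<le> s" for s f g
  proof -
    have X: "f \<in> X" "g \<in> X" using fg G by auto
    obtain C where C: "\<And>f g. f \<in> X \<Longrightarrow> g \<in> X \<Longrightarrow> nrm (T s f - T s g) \<le> C * nrm (f - g)" using lip[OF s] by blast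
    have b: "nrm (inverse (complex_of_real h) \<cdot> (T h (T s f) - T s f) - T s g)
        \<le> C * nrm (inverse (complex_of_real h) \<cdot> (T h f - f) - g)" if h: "0 < h" for h
    proof -
      let ?a = "inverse (complex_of_real h)"
      have hX: "T h f \<in> X" "T h (T s f) \<in> X" "T s (T h f) \<in> X" "T s f \<in> X" "T s g \<in> X" "T (s + h) f \<in> X"
        using TX s h X by auto
      have "nrm (T h (T s f) - T (s + h) f) = 0"
        using Tp[of h s f] h s X nrm_commute[OF hX(2,6)] by (simp add: add.commute)
      then have "nrm (T h (T s f) - T s (T h f)) = 0"
        using Tp[of s h f] h s X nrm_mod_trans[OF hX(2,6,3)] by simp
      then have 1: "nrm (T h (T s f) - T s f - (T s (T h f) - T s f)) = 0" by simp
      have 2: "nrm (T s (T h f) - T s f - T s (T h f - f)) = 0"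
        using bop_diff[OF T[OF s] hX(1) X(1)] nrm_commute[of "T s (T h f) - T s f" "T s (T h f - f)"] hX X TX[OF s]
        by simp
      have 3: "nrm (T h (T s f) - T s f - T s (T h f - f)) = 0"
        using nrm_mod_trans[OF _ _ _ 1 2] hX X TX[OF s] by simp
      have 4: "nrm (?a \<cdot> (T h (T s f) - T s f) - ?a \<cdot> T s (T h f - f)) = 0"
        unfolding scale_right_diff_distrib[symmetric] using 3 hX X TX[OF s] by (subst nrm_scale) auto
      have 5: "nrm (?a \<cdot> T s (T h f - f) - T s (?a \<cdot> (T h f - f))) = 0"
      proof -
        have "nrm (T s (?a \<cdot> (T h f - f)) - ?a \<cdot> T s (T h f - f)) = 0"
          using T[OF s] hX X by (simp add: bop_def)
        then show ?thesis using nrm_commute[of "?a \<cdot> T s (T h f - f)" "T s (?a \<cdot> (T h f - f))"] hX X TX[OF s] by simp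
      qed
      have "nrm (?a \<cdot> (T h (T s f) - T s f) - T s (?a \<cdot> (T h f - f))) = 0"
        using nrm_mod_trans[OF _ _ _ 4 5] hX X TX[OF s] by simp
      then have "nrm (?a \<cdot> (T h (T s f) - T s f) - T s g) = nrm (T s (?a \<cdot> (T h f - f)) - T s g)"
        using nrm_eq_mod[of "?a \<cdot> (T h (T s f) - T s f) - T s g" "T s (?a \<cdot> (T h f - f)) - T s g"] hX X TX[OF s]
        by simp
      also have "\<dots> \<le> C * nrm (?a \<cdot> (T h f - f) - g)" using hX X by (intro C) auto
      finally show ?thesis .
    qed
    have "((\<lambda>h. C * nrm (inverse (complex_of_real h) \<cdot> (T h f - f) - g)) \<longlongrightarrow> 0) (at_right 0)"
      using fg unfolding G by (intro tendsto_mult_right_zero) auto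
    then have "((\<lambda>h. nrm (inverse (complex_of_real h) \<cdot> (T h (T s f) - T s f) - T s g)) \<longlongrightarrow> 0) (at_right 0)"
      by (rule Lim_null_comparison[rotated])
        (use b TX s X in \<open>auto simp: eventually_at_right_field intro!: exI[of _ 1]\<close>)
    then show ?thesis unfolding G using TX s X by auto
  qed
  have right_cont: "\<exists>\<delta>>0. \<forall>h. 0 \<le> h \<and> h < \<delta> \<longrightarrow> nrm (T (s + h) f - T s f) < e"
    if f: "f \<in> X" and s: "0 \<le> s" and e: "0 < e" for f s e
  proof -
    obtain C where C: "C \<ge> 0" "\<And>f g. f \<in> X \<Longrightarrow> g \<in> X \<Longrightarrow> nrm (T s f - T s g) \<le> C * nrm (f - g)" using lip[OF s] by blast
    have "\<forall>\<^sub>F t in at_right 0. nrm (T t f - f) < e / (1 + C)"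
      by (rule order_tendstoD(2)[OF Tc[OF f]]) (use e C in auto)
    then obtain \<delta> where \<delta>: "\<delta> > 0" "\<And>h. 0 < h \<Longrightarrow> h < \<delta> \<Longrightarrow> nrm (T h f - f) < e / (1 + C)"
      unfolding eventually_at_right_field by auto
    have "nrm (T (s + h) f - T s f) < e" if h: "0 \<le> h" "h < \<delta>" for h
    proof -
      have "nrm (T h f - f) < e / (1 + C)" using \<delta>(2)[of h] h T0[OF f] e C by (cases "h = 0") auto
      then have "(1 + C) * nrm (T h f - f) < e" using C by (simp add: field_simps)
      moreover have "nrm (T (s + h) f - T s f) \<le> C * nrm (T h f - f)"
        unfolding Tsum[OF s h(1) f f] using C(2) TX f h by simp
      moreover have "0 \<le> nrm (T h f - f)" using TX f h by simp
      ultimately show ?thesis by (simp add: algebra_simps)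
    qed
    then show ?thesis using \<delta>(1) by blast
  qed
  \<comment> \<open>Two-sided continuity at one time \<open>t0 < t\<close> is carried forward to
    \<open>t\<close> by the fixed operator \<open>T (t - t0)\<close>. This is why the continuity
    point has to be found before \<open>t\<close>.\<close>
  have cont: "\<exists>\<delta>>0. \<forall>s\<ge>0. \<bar>s - t\<bar> < \<delta> \<longrightarrow> nrm (T s f - T t f) < e"
    if f: "f \<in> X" and t: "0 < t" and e: "0 < e" for f t e
  proof -
    have "\<exists>t0. 0 < t0 \<and> t0 < t \<and> (\<forall>e>0. \<exists>\<delta>>0. \<forall>s\<ge>0. \<bar>s - t0\<bar> < \<delta> \<longrightarrow> nrm (T s f - T t0 f) < e)"
    proof (rule right_continuous_imp_continuity_point[OF _ _ right_cont[OF f] t])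
      show "nrm (T s f - T r f) = nrm (T r f - T s f)" if "0 \<le> s" "0 \<le> r" for s r
        using nrm_commute TX f that by simp
      show "nrm (T s f - T r f) \<le> nrm (T s f - T q f) + nrm (T q f - T r f)" if "0 \<le> s" "0 \<le> q" "0 \<le> r" for s q r
        using nrm_triangle3 TX f that by simp
    qed
    then obtain t0 where t0: "0 < t0" "t0 < t"
      and c: "\<And>e. e > 0 \<Longrightarrow> \<exists>\<delta>>0. \<forall>s\<ge>0. \<bar>s - t0\<bar> < \<delta> \<longrightarrow> nrm (T s f - T t0 f) < e" by blast
    obtain C where C: "C \<ge> 0" "\<And>f g. f \<in> X \<Longrightarrow> g \<in> X \<Longrightarrow> nrm (T (t - t0) f - T (t - t0) g) \<le> C * nrm (f - g)"
      using lip[of "t - t0"] t0 by auto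
    obtain \<delta> where \<delta>: "\<delta> > 0" "\<And>s. s \<ge> 0 \<Longrightarrow> \<bar>s - t0\<bar> < \<delta> \<Longrightarrow> nrm (T s f - T t0 f) < e / (1 + C)"
      using c[of "e / (1 + C)"] e C by auto
    have "nrm (T s f - T t f) < e" if s: "\<bar>s - t\<bar> < min \<delta> t0" for s
    proof -
      define q where "q = t0 + (s - t)"
      have q: "0 \<le> q" "s = (t - t0) + q" "\<bar>q - t0\<bar> < \<delta>" using s by (auto simp: q_def)
      have X: "T q f \<in> X" "T t0 f \<in> X" "T s f \<in> X" "T t f \<in> X" using q t0 t TX f by auto
      have t': "t = (t - t0) + t0" by simp
      have d: "0 \<le> t - t0" using t0 by simp
      have XX: "T (t - t0) (T q f) \<in> X" "T (t - t0) (T t0 f) \<in> X" using TX X d by auto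
      have "nrm (T s f - T (t - t0) (T q f)) = 0" using Tp[OF d q(1) f] q(2) by simp
      then have "nrm (T s f - T t f) = nrm (T (t - t0) (T q f) - T t f)"
        using nrm_eq_mod[of "T s f - T t f" "T (t - t0) (T q f) - T t f"] X XX by simp
      also have "\<dots> = nrm (T (t - t0) (T q f) - T (t - t0) (T t0 f))"
        using nrm_eq_mod[of "T (t - t0) (T q f) - T t f" "T (t - t0) (T q f) - T (t - t0) (T t0 f)"] X XX
          Tp[OF d less_imp_le[OF t0(1)] f] nrm_commute[OF X(4) XX(2)] by simp
      also have "\<dots> \<le> C * nrm (T q f - T t0 f)" using C(2) X by simp
      finally have "nrm (T s f - T t f) \<le> C * nrm (T q f - T t0 f)" .
      moreover have "(1 + C) * nrm (T q f - T t0 f) < e" using \<delta>(2)[OF q(1,3)] C by (simp add: field_simps)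
      moreover have "0 \<le> nrm (T q f - T t0 f)" using X by simp
      ultimately show ?thesis by (simp add: algebra_simps)
    qed
    then show ?thesis using \<delta>(1) t0 by (intro exI[of _ "min \<delta> t0"]) auto
  qed
  have dom: "nrm (T t f) \<le> exp (\<omega> * t) * nrm f" if fg: "(f, g) \<in> G" for f g
  proof -
    have X: "f \<in> X" "g \<in> X" using fg G by auto
    define \<psi> where "\<psi> s = exp (- 2 * \<omega> * s) * (nrm (T s f))\<^sup>2" for s
    have nlip: "\<bar>nrm (T s f) - nrm (T r f)\<bar> \<le> nrm (T s f - T r f)" if "0 \<le> s" "0 \<le> r" for s r
      using nrm_diff_ge TX X that by simp
    have ncont: "isCont (\<lambda>s. nrm (T s f)) s" if s: "0 < s" for s
      unfolding continuous_at_eps_delta dist_real_def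
    proof (intro allI impI)
      fix e :: real assume "0 < e"
      then obtain \<delta> where \<delta>: "\<delta> > 0" "\<And>r. r \<ge> 0 \<Longrightarrow> \<bar>r - s\<bar> < \<delta> \<Longrightarrow> nrm (T r f - T s f) < e"
        using cont[OF X(1) s] by blast
      have "\<bar>nrm (T r f) - nrm (T s f)\<bar> < e" if "\<bar>r - s\<bar> < min \<delta> s" for r
      proof -
        have "0 \<le> r" using that by (simp add: abs_if split: if_splits)
        then show ?thesis using \<delta>(2)[of r] nlip[of r s] that s by simp
      qed
      then show "\<exists>d>0. \<forall>r. \<bar>r - s\<bar> < d \<longrightarrow> \<bar>nrm (T r f) - nrm (T s f)\<bar> < e"
        using \<delta>(1) s by (intro exI[of _ "min \<delta> s"]) auto
    qed
    have der: "\<exists>D\<le>0. (\<psi> has_real_derivative D) (at_right s)" if s: "0 \<le> s" for s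
    proof -
      let ?y = "T s f" and ?w = "T s g"
      have y: "(?y, ?w) \<in> G" "?y \<in> X" "?w \<in> X" using orbit[OF fg s] TX s X by auto
      let ?D = "\<lambda>h. inverse (complex_of_real h) \<cdot> (T h ?y - ?y)"
      have lim: "((\<lambda>h. nrm (?D h - ?w)) \<longlongrightarrow> 0) (at_right 0)" using y(1) unfolding G by auto
      have lim2: "((\<lambda>h. nrm (T h ?y - ?y)) \<longlongrightarrow> 0) (at_right 0)" using Tc[OF y(2)] .
      \<comment> \<open>\<open>?E\<close> bounds the error of replacing the quotient
        \<open>?D h\<close> by \<open>?w\<close> and \<open>T h ?y\<close> by \<open>?y\<close> in
        the derivative of the square norm.\<close>
      let ?E = "\<lambda>h. nrm (?D h - ?w) * (2 * nrm ?y + nrm (T h ?y - ?y)) + nrm ?w * nrm (T h ?y - ?y)"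
      have quot: "\<bar>((nrm (T (s + h) f))\<^sup>2 - (nrm (T s f))\<^sup>2) / h - 2 * Re (ip ?w ?y)\<bar> \<le> ?E h" if h: "0 < h" for h
      proof -
        have hX: "T h ?y \<in> X" "?D h \<in> X" "T (s + h) f \<in> X" using TX h s y X by auto
        have "nrm (T (s + h) f) = nrm (T h ?y)"
          using Tp[of h s f] h s X hX nrm_eq_mod[of "T (s + h) f" "T h ?y"] by (simp add: add.commute)
        moreover have "(nrm (T h ?y))\<^sup>2 - (nrm ?y)\<^sup>2 = h * (Re (ip (?D h) (T h ?y)) + Re (ip (?D h) ?y))"
        proof -
          have "h * Re (ip (?D h) v) = Re (ip (T h ?y - ?y) v)" if "v \<in> X" for v
          proof -
            have "ip (?D h) v = inverse (complex_of_real h) * ip (T h ?y - ?y) v"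
              using that hX y by (intro ip_scale_left) auto
            also have "\<dots> = complex_of_real (inverse h) * ip (T h ?y - ?y) v" by simp
            finally have "Re (ip (?D h) v) = inverse h * Re (ip (T h ?y - ?y) v)"
              by (simp only: Re_complex_of_real Im_complex_of_real times_complex.sel mult_zero_left diff_zero)
            then show ?thesis using h by simp
          qed
          then have "h * (Re (ip (?D h) (T h ?y)) + Re (ip (?D h) ?y))
              = Re (ip (T h ?y - ?y) (T h ?y)) + Re (ip (T h ?y - ?y) ?y)"
            using hX y by (simp only: distrib_left)
          also have "\<dots> = (nrm (T h ?y))\<^sup>2 - (nrm ?y)\<^sup>2"
            using hX y ip_cnj[OF hX(1) y(2)] by (simp add: ip_diff_left nrm_sq)
          finally show ?thesis by simp
        qed
        ultimately have q: "((nrm (T (s + h) f))\<^sup>2 - (nrm (T s f))\<^sup>2) / h = Re (ip (?D h) (T h ?y)) + Re (ip (?D h) ?y)"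
          using h by simp
        have i1: "ip (?D h) (T h ?y) - ip ?w ?y = ip (?D h - ?w) (T h ?y) + ip ?w (T h ?y - ?y)"
          unfolding ip_diff_left[OF hX(2) y(3) hX(1)] ip_diff_right[OF hX(1) y(2,3)] by simp
        have i2: "ip (?D h) ?y - ip ?w ?y = ip (?D h - ?w) ?y"
          unfolding ip_diff_left[OF hX(2) y(3,2)] by simp
        have e: "((nrm (T (s + h) f))\<^sup>2 - (nrm (T s f))\<^sup>2) / h - 2 * Re (ip ?w ?y)
            = Re (ip (?D h - ?w) (T h ?y) + ip ?w (T h ?y - ?y) + ip (?D h - ?w) ?y)"
          unfolding q i1[symmetric] i2[symmetric] by (simp only: plus_complex.sel minus_complex.sel)
        have "\<bar>Re (ip (?D h - ?w) (T h ?y) + ip ?w (T h ?y - ?y) + ip (?D h - ?w) ?y)\<bar>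
            \<le> cmod (ip (?D h - ?w) (T h ?y)) + cmod (ip ?w (T h ?y - ?y)) + cmod (ip (?D h - ?w) ?y)"
          by (intro order_trans[OF abs_Re_le_cmod] norm_triangle_mono order_refl)
        also have "\<dots> \<le> nrm (?D h - ?w) * nrm (T h ?y) + nrm ?w * nrm (T h ?y - ?y) + nrm (?D h - ?w) * nrm ?y"
          using hX y by (intro add_mono Cauchy_Schwarz diff_in)
        also have "\<dots> \<le> nrm (?D h - ?w) * (nrm ?y + nrm (T h ?y - ?y)) + nrm ?w * nrm (T h ?y - ?y) + nrm (?D h - ?w) * nrm ?y"
          using hX y nrm_diff_ge[OF hX(1) y(2)] nrm_ge_0[of "?D h - ?w"]
          by (intro add_mono mult_left_mono order_refl) auto
        also have "\<dots> = ?E h" by (simp add: algebra_simps)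
        finally show ?thesis unfolding e .
      qed
      have "(?E \<longlongrightarrow> 0 * (2 * nrm ?y + 0) + nrm ?w * 0) (at_right 0)" by (intro tendsto_intros lim lim2)
      then have E0: "(?E \<longlongrightarrow> 0) (at_right 0)" by simp
      have "((\<lambda>h. ((nrm (T (s + h) f))\<^sup>2 - (nrm (T s f))\<^sup>2) / h) \<longlongrightarrow> 2 * Re (ip ?w ?y)) (at_right 0)"
        by (rule LIM_zero_cancel, rule Lim_null_comparison[OF _ E0])
          (use quot in \<open>auto simp: eventually_at_right_field intro!: exI[of _ 1]\<close>)
      then have dN: "((\<lambda>s. (nrm (T s f))\<^sup>2) has_real_derivative 2 * Re (ip ?w ?y)) (at_right s)"
        unfolding has_field_derivative_iff by (subst filterlim_at_right_to_0) (simp add: add.commute)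
      have "((\<lambda>s. exp (- 2 * \<omega> * s)) has_real_derivative exp (- 2 * \<omega> * s) * (- 2 * \<omega>)) (at_right s)"
        by (auto intro!: derivative_eq_intros)
      from DERIV_mult[OF this dN] have d\<psi>: "(\<psi> has_real_derivative exp (- 2 * \<omega> * s) * (- 2 * \<omega>) * (nrm ?y)\<^sup>2 + 2 * Re (ip ?w ?y) * exp (- 2 * \<omega> * s)) (at_right s)"
        unfolding \<psi>_def .
      have "exp (- 2 * \<omega> * s) * (- 2 * \<omega>) * (nrm ?y)\<^sup>2 + 2 * Re (ip ?w ?y) * exp (- 2 * \<omega> * s)
          = 2 * exp (- 2 * \<omega> * s) * (Re (ip ?w ?y) - \<omega> * (nrm ?y)\<^sup>2)" by (simp add: algebra_simps)
      also have "\<dots> \<le> 0" using diss[OF y(1)] by (intro mult_nonneg_nonpos) auto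
      finally show ?thesis using d\<psi> by blast
    qed
    \<comment> \<open>Two-sided continuity is known at positive times only, so monotonicity is first
      shown away from 0; the right derivative at 0 then provides the limit \<open>s\<close> to
      0.\<close>
    have le: "\<psi> t \<le> \<psi> s" if "0 < s" "s \<le> t" for s
    proof (rule right_derivative_nonpos_imp_le[OF that(2)])
      show "continuous_on {s..t} \<psi>" unfolding \<psi>_def
        using that ncont by (intro continuous_intros continuous_at_imp_continuous_on) auto
      show "\<exists>D\<le>0. (\<psi> has_real_derivative D) (at_right r)" if "s \<le> r" for r
        using der that \<open>0 < s\<close> by simp
    qed
    have "\<psi> t \<le> \<psi> 0"
    proof (cases "t = 0")
      case False
      obtain D where "(\<psi> has_real_derivative D) (at_right 0)" using der[of 0] by auto
      then have "(\<psi> \<longlongrightarrow> \<psi> 0) (at_right 0)"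
        using DERIV_isCont has_field_derivative_imp_has_derivative has_derivative_continuous continuous_within by blast
      moreover have "\<forall>\<^sub>F s in at_right 0. \<psi> t \<le> \<psi> s"
        unfolding eventually_at_right_field using le t False by (intro exI[of _ t]) auto
      ultimately show ?thesis by (intro tendsto_lowerbound) auto
    qed simp
    also have "\<psi> 0 = (nrm f)\<^sup>2" using nrm_eq_mod[of "T 0 f" f] T0 X TX[of 0 f] by (simp add: \<psi>_def)
    finally have "exp (2 * \<omega> * t) * \<psi> t \<le> exp (2 * \<omega> * t) * (nrm f)\<^sup>2" by simp
    moreover have "exp (2 * \<omega> * t) * \<psi> t = (nrm (T t f))\<^sup>2"
      by (simp add: \<psi>_def mult_exp_exp flip: mult.assoc)
    moreover have "exp (2 * \<omega> * t) * (nrm f)\<^sup>2 = (exp (\<omega> * t) * nrm f)\<^sup>2"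
      by (simp add: power_mult_distrib exp_double[symmetric] mult.assoc)
    ultimately have "(nrm (T t f))\<^sup>2 \<le> (exp (\<omega> * t) * nrm f)\<^sup>2" by simp
    then show ?thesis by (rule power2_le_imp_le) (use X in simp)
  qed
  obtain C where C: "C \<ge> 0" "\<And>f g. f \<in> X \<Longrightarrow> g \<in> X \<Longrightarrow> nrm (T t f - T t g) \<le> C * nrm (f - g)" using lip[OF t] by blast
  show ?thesis
  proof (rule field_le_epsilon)
    fix e :: real assume e: "0 < e"
    \<comment> \<open>\<open>T t\<close> has its own Lipschitz constant \<open>C\<close>, whose
      contribution disappears as the approximation of \<open>f\<close> from the domain
      improves.\<close>
    let ?K = "1 + C + exp (\<omega> * t)"
    have K: "0 < ?K" using C by (simp add: add_pos_pos add_nonneg_pos)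
    obtain u w where uw: "(u, w) \<in> G" "nrm (f - u) < e / ?K" using dense[OF f, of "e / ?K"] e K by auto
    have u: "u \<in> X" using uw G by auto
    have "nrm (T t f) \<le> nrm (T t f - T t u) + nrm (T t u)"
      using nrm_triangle[of "T t f - T t u" "T t u"] TX t f u by simp
    also have "\<dots> \<le> C * nrm (f - u) + exp (\<omega> * t) * nrm u"
      using C(2)[OF f u] dom[OF uw(1)] by (intro add_mono)
    also have "nrm u \<le> nrm (f - u) + nrm f"
      using nrm_triangle_diff[of f "f - u"] f u by simp
    finally have "nrm (T t f) \<le> (C + exp (\<omega> * t)) * nrm (f - u) + exp (\<omega> * t) * nrm f"
      by (simp add: algebra_simps)
    moreover have "(C + exp (\<omega> * t)) * nrm (f - u) \<le> ?K * nrm (f - u)"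
      using f u by (intro mult_right_mono) auto
    moreover have "?K * nrm (f - u) < e" using uw(2) K by (simp add: field_simps)
    ultimately show "nrm (T t f) \<le> exp (\<omega> * t) * nrm f + e" by linarith
  qed
qed

end

section \<open>Holomorphic semigroups on function spaces\<close>

context semi_hilbert
begin

text \<open>The second order estimate for the functions \<open>ip (S w f) g\<close> is uniform in
  \<open>f\<close> and \<open>g\<close> of norm at most 1. By duality the difference quotients then
  satisfy a Cauchy estimate in operator norm, and \<open>B\<close> is their limit.\<close>

lemma op_derivative:
  fixes S :: "complex \<Rightarrow> 'v \<Rightarrow> 'v"
  assumes r: "0 < r" and M: "0 \<le> M"
    and SX: "\<And>w f. w \<in> ball z r \<Longrightarrow> f \<in> X \<Longrightarrow> S w f \<in> X"
    and Sb: "\<And>w f. w \<in> ball z r \<Longrightarrow> f \<in> X \<Longrightarrow> nrm (S w f) \<le> M * nrm f"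
    and Sadd: "\<And>w f g. w \<in> ball z r \<Longrightarrow> f \<in> X \<Longrightarrow> g \<in> X \<Longrightarrow> S w (f + g) = S w f + S w g"
    and Sscale: "\<And>w a f. w \<in> ball z r \<Longrightarrow> f \<in> X \<Longrightarrow> S w (a \<cdot> f) = a \<cdot> S w f"
    and hol: "\<And>f g. f \<in> X \<Longrightarrow> g \<in> X \<Longrightarrow> (\<lambda>w. ip (S w f) g) holomorphic_on ball z r"
  shows "\<exists>B K. bop B \<and> 0 \<le> K \<and> (\<forall>h f. h \<noteq> 0 \<longrightarrow> cmod h < r / 4 \<longrightarrow> f \<in> X \<longrightarrow>
    nrm (inverse h \<cdot> (S (z + h) f - S z f) - B f) \<le> K * cmod h * nrm f)"
proof -
  define D where "D h f = inverse h \<cdot> (S (z + h) f - S z f)" for h f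
  define c where "c = 8 * M / r\<^sup>2"
  have c: "0 \<le> c" using M by (simp add: c_def)
  have zb: "z \<in> ball z r" "cmod h < r / 4 \<Longrightarrow> z + h \<in> ball z r" for h using r by (auto simp: dist_norm)
  have DX: "D h f \<in> X" if "cmod h < r / 4" "f \<in> X" for h f
    unfolding D_def using SX zb that by simp
  have second: "cmod (ip (D h f) g - deriv (\<lambda>w. ip (S w f) g) z) \<le> c * nrm f * nrm g * cmod h"
    if h: "h \<noteq> 0" "cmod h < r / 4" and f: "f \<in> X" and g: "g \<in> X" for h f g
  proof -
    let ?\<phi> = "\<lambda>w. ip (S w f) g"
    have b: "cmod (?\<phi> w) \<le> M * nrm f * nrm g" if "w \<in> ball z r" for w
      using Cauchy_Schwarz[OF SX[OF that f] g] mult_right_mono[OF Sb[OF that f] nrm_ge_0[OF g]] by linarith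
    have "cmod (?\<phi> (z + h) - ?\<phi> z - h * deriv ?\<phi> z) \<le> 8 * (M * nrm f * nrm g) / r\<^sup>2 * (cmod h)\<^sup>2"
      by (rule holomorphic_second_order[OF hol[OF f g] r b h(2)])
    then have "cmod (?\<phi> (z + h) - ?\<phi> z - h * deriv ?\<phi> z) / cmod h \<le> 8 * (M * nrm f * nrm g) / r\<^sup>2 * (cmod h)\<^sup>2 / cmod h"
      by (rule divide_right_mono) simp
    also have "\<dots> = c * nrm f * nrm g * cmod h" using h by (simp add: c_def power2_eq_square)
    also have "cmod (?\<phi> (z + h) - ?\<phi> z - h * deriv ?\<phi> z) / cmod h
        = cmod ((?\<phi> (z + h) - ?\<phi> z - h * deriv ?\<phi> z) / h)" by (simp add: norm_divide)
    also have "(?\<phi> (z + h) - ?\<phi> z - h * deriv ?\<phi> z) / h = ip (D h f) g - deriv ?\<phi> z"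
      unfolding D_def using SX[OF zb(1) f] SX[OF zb(2)[OF h(2)] f] g h
      by (simp add: ip_scale_left ip_diff_left field_simps)
    finally show ?thesis .
  qed
  have Cau: "nrm (D h f - D k f) \<le> c * nrm f * (cmod h + cmod k)"
    if h: "h \<noteq> 0" "cmod h < r / 4" and k: "k \<noteq> 0" "cmod k < r / 4" and f: "f \<in> X" for h k f
  proof (rule nrm_dual_bound)
    fix g assume g: "g \<in> X"
    have "ip (D h f - D k f) g = (ip (D h f) g - deriv (\<lambda>w. ip (S w f) g) z) - (ip (D k f) g - deriv (\<lambda>w. ip (S w f) g) z)"
      using DX h k f g by (simp add: ip_diff_left)
    also have "cmod \<dots> \<le> c * nrm f * nrm g * cmod h + c * nrm f * nrm g * cmod k"
      by (rule order_trans[OF norm_triangle_ineq4 add_mono[OF second[OF h f g] second[OF k f g]]])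
    finally show "cmod (ip (D h f - D k f) g) \<le> c * nrm f * (cmod h + cmod k) * nrm g"
      by (simp add: algebra_simps)
  qed (use DX h k f c in auto)
  \<comment> \<open>A concrete null sequence of increments below \<open>r / 4\<close>, along which
    the derivative is defined as a limit.\<close>
  define h where "h n = complex_of_real (r / 8 * inverse (real (Suc n)))" for n
  have ch: "cmod (h n) = r / 8 * inverse (real (Suc n))" for n unfolding h_def norm_of_real using r by simp
  have h: "h n \<noteq> 0" "cmod (h n) < r / 4" for n
  proof -
    have "0 < r / 8 * inverse (real (Suc n))" using r by simp
    then show "h n \<noteq> 0" using ch[of n] by auto
    have "r / 8 * inverse (real (Suc n)) \<le> r / 8 * 1"
      using r by (intro mult_left_mono) (auto simp: inverse_le_1_iff)
    then show "cmod (h n) < r / 4" unfolding ch using r by linarith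
  qed
  have h0: "(\<lambda>n. cmod (h n)) \<longlonglongrightarrow> 0"
    unfolding ch using tendsto_mult[OF tendsto_const LIMSEQ_inverse_real_of_nat, of "r / 8"] by simp
  have "\<exists>y\<in>X. (\<lambda>n. nrm (D (h n) f - y)) \<longlonglongrightarrow> 0" if f: "f \<in> X" for f
  proof (rule complete_null[OF DX[OF h(2) f]])
    show "(\<lambda>n. c * nrm f * (2 * cmod (h n))) \<longlonglongrightarrow> 0"
      using h0 by (intro tendsto_mult_right_zero) 
    fix m n :: nat assume "m \<le> n"
    then have "cmod (h n) \<le> cmod (h m)" unfolding ch using r by (intro mult_left_mono) (auto simp: field_simps)
    then have "c * nrm f * (cmod (h m) + cmod (h n)) \<le> c * nrm f * (2 * cmod (h m))"
      using c f by (intro mult_left_mono) auto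
    then show "nrm (D (h m) f - D (h n) f) \<le> c * nrm f * (2 * cmod (h m))"
      using Cau[OF h(1,2) h(1,2) f, of m n] by linarith
  qed
  then obtain B where BX: "\<And>f. f \<in> X \<Longrightarrow> B f \<in> X"
    and B: "\<And>f. f \<in> X \<Longrightarrow> (\<lambda>n. nrm (D (h n) f - B f)) \<longlonglongrightarrow> 0" by metis
  \<comment> \<open>In \<open>Cau\<close> the increment \<open>k\<close> stays fixed while the other
    one runs through \<open>h n\<close>.\<close>
  have est: "nrm (D k f - B f) \<le> c * cmod k * nrm f" if k: "k \<noteq> 0" "cmod k < r / 4" and f: "f \<in> X" for k f
  proof (rule Lim_bounded2)
    have "(\<lambda>n. c * nrm f * (cmod k + cmod (h n)) + nrm (D (h n) f - B f)) \<longlonglongrightarrow> c * nrm f * (cmod k + 0) + 0"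
      by (intro tendsto_intros h0 B f)
    then show "(\<lambda>n. c * nrm f * (cmod k + cmod (h n)) + nrm (D (h n) f - B f)) \<longlonglongrightarrow> c * cmod k * nrm f"
      by (simp add: mult.commute mult.left_commute)
    show "\<forall>n\<ge>0. nrm (D k f - B f) \<le> c * nrm f * (cmod k + cmod (h n)) + nrm (D (h n) f - B f)"
    proof (intro allI impI)
      fix n
      show "nrm (D k f - B f) \<le> c * nrm f * (cmod k + cmod (h n)) + nrm (D (h n) f - B f)"
        using nrm_triangle3[OF DX[OF k(2) f] DX[OF h(2) f] BX[OF f], of n] Cau[OF k h(1,2) f, of n] by linarith
    qed
  qed
  \<comment> \<open>Linearity of \<open>B\<close> is inherited from the quotients, but only modulo
    null vectors, since limits are not unique.\<close>
  have zero: "nrm x = 0" if "x \<in> X" "\<And>n. nrm x \<le> b n" "b \<longlonglongrightarrow> 0" for x and b :: "nat \<Rightarrow> real"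
    using LIMSEQ_le_const[OF that(3), of "nrm x"] that(2) nrm_le_0_iff[OF that(1)] by blast
  have "bop B" unfolding bop_def
  proof (intro conjI ballI allI)
    show "B f \<in> X" if "f \<in> X" for f using BX[OF that] .
    show "nrm (B (f + g) - (B f + B g)) = 0" if f: "f \<in> X" and g: "g \<in> X" for f g
    proof (rule zero)
      show "B (f + g) - (B f + B g) \<in> X" using BX f g by simp
      show "nrm (B (f + g) - (B f + B g))
          \<le> nrm (D (h n) (f + g) - B (f + g)) + nrm (D (h n) f - B f) + nrm (D (h n) g - B g)" for n
      proof -
        have X: "D (h n) f \<in> X" "D (h n) g \<in> X" "D (h n) (f + g) \<in> X" using DX h f g by auto
        have "D (h n) (f + g) = D (h n) f + D (h n) g"
          unfolding D_def Sadd[OF zb(2)[OF h(2)] f g] Sadd[OF zb(1) f g] by (simp add: algebra_simps)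
        then have "B (f + g) - (B f + B g) = (D (h n) f - B f) + (D (h n) g - B g) - (D (h n) (f + g) - B (f + g))"
          by simp
        also have "nrm \<dots> \<le> nrm (D (h n) f - B f) + nrm (D (h n) g - B g) + nrm (D (h n) (f + g) - B (f + g))"
          using X BX f g by (intro nrm_triangle_add_diff) auto
        finally show ?thesis by linarith
      qed
      show "(\<lambda>n. nrm (D (h n) (f + g) - B (f + g)) + nrm (D (h n) f - B f) + nrm (D (h n) g - B g)) \<longlonglongrightarrow> 0"
        by (intro tendsto_add_zero B add_in f g)
    qed
    show "nrm (B (a \<cdot> f) - a \<cdot> B f) = 0" if f: "f \<in> X" for a f
    proof (rule zero)
      show "B (a \<cdot> f) - a \<cdot> B f \<in> X" using BX f by simp
      show "nrm (B (a \<cdot> f) - a \<cdot> B f) \<le> cmod a * nrm (D (h n) f - B f) + nrm (D (h n) (a \<cdot> f) - B (a \<cdot> f))" for n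
      proof -
        have X: "D (h n) f \<in> X" "D (h n) (a \<cdot> f) \<in> X" using DX h f by auto
        have "D (h n) (a \<cdot> f) = a \<cdot> D (h n) f"
          unfolding D_def Sscale[OF zb(2)[OF h(2)] f] Sscale[OF zb(1) f] by (simp add: algebra_simps)
        then have "B (a \<cdot> f) - a \<cdot> B f = a \<cdot> (D (h n) f - B f) - (D (h n) (a \<cdot> f) - B (a \<cdot> f))"
          by (simp add: algebra_simps)
        also have "nrm \<dots> \<le> nrm (a \<cdot> (D (h n) f - B f)) + nrm (D (h n) (a \<cdot> f) - B (a \<cdot> f))"
          using X BX f by (intro nrm_triangle_diff) auto
        finally show ?thesis using X BX f by simp
      qed
      show "(\<lambda>n. cmod a * nrm (D (h n) f - B f) + nrm (D (h n) (a \<cdot> f) - B (a \<cdot> f))) \<longlonglongrightarrow> 0"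
        by (intro tendsto_add_zero tendsto_mult_right_zero B scale_in f)
    qed
    show "\<exists>C. \<forall>f\<in>X. nrm (B f) \<le> C * nrm f"
    proof (intro exI ballI)
      fix f assume f: "f \<in> X"
      have X: "D (h 0) f \<in> X" "S (z + h 0) f \<in> X" "S z f \<in> X" using DX SX zb h f by auto
      have "nrm (B f) \<le> nrm (D (h 0) f - B f) + nrm (D (h 0) f)"
        using nrm_triangle_diff[of "D (h 0) f" "D (h 0) f - B f"] X BX f by simp
      moreover have "nrm (D (h 0) f) = cmod (inverse (h 0)) * nrm (S (z + h 0) f - S z f)"
        unfolding D_def using X by simp
      moreover have "cmod (inverse (h 0)) * nrm (S (z + h 0) f - S z f) \<le> cmod (inverse (h 0)) * (M * nrm f + M * nrm f)"
        using nrm_triangle_diff[OF X(2,3)] Sb[OF zb(1) f] Sb[OF zb(2)[OF h(2)] f, of 0]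
        by (intro mult_left_mono) auto
      ultimately have "nrm (B f) \<le> c * cmod (h 0) * nrm f + cmod (inverse (h 0)) * (M * nrm f + M * nrm f)"
        using est[OF h f, of 0] by linarith
      then show "nrm (B f) \<le> (c * cmod (h 0) + cmod (inverse (h 0)) * (2 * M)) * nrm f" by (simp add: algebra_simps)
    qed
  qed
  then show ?thesis using est c unfolding D_def by blast
qed

end

text \<open>In the open right half plane \<open>Arg z\<close> is the arctangent of
  \<open>Im z / Re z\<close>; for other nonzero \<open>z\<close> its modulus is at least
  \<pi>/2.\<close>

lemma sector_eq_quarter: "sector (pi / 4) = quarter"
proof -
  have "z \<noteq> 0 \<and> \<bar>Arg z\<bar> < pi / 4 \<longleftrightarrow> \<bar>Im z\<bar> < Re z" for z
  proof (cases "Re z > 0")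
    case True
    let ?x = "Im z / Re z"
    have "arctan ?x < pi / 4 \<longleftrightarrow> ?x < 1" by (metis arctan_less_iff arctan_one)
    moreover have "- (pi / 4) < arctan ?x \<longleftrightarrow> - 1 < ?x" by (metis arctan_less_iff arctan_minus arctan_one)
    ultimately have "\<bar>Arg z\<bar> < pi / 4 \<longleftrightarrow> - 1 < ?x \<and> ?x < 1"
      unfolding arg_conv_arctan[OF True] by auto
    also have "\<dots> \<longleftrightarrow> \<bar>Im z\<bar> < Re z" using True by (auto simp: field_simps abs_less_iff)
    finally show ?thesis using True by auto
  next
    case False
    then have "\<not> (z \<noteq> 0 \<and> \<bar>Arg z\<bar> < pi / 2)" using Arg_Re_pos[of z] by auto
    then show ?thesis using False pi_gt_zero by fastforce
  qed
  then show ?thesis by (auto simp: sector_def quarter_def)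
qed

lemma vector_space_fun: "vector_space (\<lambda>c (f :: 'a \<Rightarrow> complex) s. c * f s)"
  by standard (auto simp: fun_eq_iff algebra_simps)

text \<open>The assumptions of \<open>semi_sectorial\<close> for \<open>G\<close> shifted by
  \<open>- \<omega>\<close>, phrased for pointwise operations on functions.\<close>

locale quasi_sectorial = semi_hilbert "\<lambda>c f s. c * f s" X ip
  for X :: "('a \<Rightarrow> complex) set" and ip +
  fixes G :: "(('a \<Rightarrow> complex) \<times> ('a \<Rightarrow> complex)) set" and \<omega> :: real
  assumes G_in: "(u, w) \<in> G \<Longrightarrow> u \<in> X \<and> w \<in> X"
    and G_add: "(u, w) \<in> G \<Longrightarrow> (u', w') \<in> G \<Longrightarrow> (u + u', w + w') \<in> G"
    and G_scale: "(u, w) \<in> G \<Longrightarrow> (\<lambda>s. a * u s, \<lambda>s. a * w s) \<in> G"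
    and G_single: "(u, w) \<in> G \<Longrightarrow> nrm u = 0 \<Longrightarrow> nrm w = 0"
    and G_cong: "(u, w) \<in> G \<Longrightarrow> u' \<in> X \<Longrightarrow> w' \<in> X \<Longrightarrow> nrm (u' - u) = 0 \<Longrightarrow> nrm (w' - w) = 0 \<Longrightarrow> (u', w') \<in> G"
    and G_sect: "(u, w) \<in> G \<Longrightarrow> z \<in> quarter \<Longrightarrow> Re (z * (ip w u - of_real \<omega> * ip u u)) \<le> 0"
    and G_range: "z \<in> quarter \<Longrightarrow> f \<in> X \<Longrightarrow>
      \<exists>u w. (u, w) \<in> G \<and> nrm (\<lambda>s. u s - z * (w s - of_real \<omega> * u s) - f s) = 0"
begin

abbreviation smult :: "complex \<Rightarrow> ('a \<Rightarrow> complex) \<Rightarrow> 'a \<Rightarrow> complex" (infixr \<open>\<cdot>\<close> 75) where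
  "c \<cdot> f \<equiv> (\<lambda>s. c * f s)"

definition A :: "(('a \<Rightarrow> complex) \<times> ('a \<Rightarrow> complex)) set" where
  "A = {(u, w). (u, w + of_real \<omega> \<cdot> u) \<in> G}"

lemma A_in: "(u, w) \<in> A \<Longrightarrow> u \<in> X \<and> w \<in> X"
proof -
  assume "(u, w) \<in> A"
  then have X: "u \<in> X" "w + of_real \<omega> \<cdot> u \<in> X" using G_in by (auto simp: A_def)
  then have "(w + of_real \<omega> \<cdot> u) - of_real \<omega> \<cdot> u \<in> X" by (intro diff_in scale_in)
  then show ?thesis using X by simp
qed

sublocale A: semi_sectorial "\<lambda>c f s. c * f s" X ip A
proof
  show "u \<in> X \<and> w \<in> X" if "(u, w) \<in> A" for u w using A_in[OF that] .
  show "(u + u', w + w') \<in> A" if "(u, w) \<in> A" "(u', w') \<in> A" for u w u' w'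
  proof -
    have "w + w' + of_real \<omega> \<cdot> (u + u') = (w + of_real \<omega> \<cdot> u) + (w' + of_real \<omega> \<cdot> u')"
      by (rule ext, simp only: plus_fun_apply minus_apply, algebra)
    moreover have "(u + u', (w + of_real \<omega> \<cdot> u) + (w' + of_real \<omega> \<cdot> u')) \<in> G"
      using that by (intro G_add) (simp_all add: A_def)
    ultimately show ?thesis by (simp only: A_def mem_Collect_eq prod.case)
  qed
  show "(a \<cdot> u, a \<cdot> w) \<in> A" if "(u, w) \<in> A" for u w a
  proof -
    have "a \<cdot> w + of_real \<omega> \<cdot> a \<cdot> u = a \<cdot> (w + of_real \<omega> \<cdot> u)" by (rule ext, simp only: plus_fun_apply minus_apply, algebra)
    then show ?thesis using G_scale[of u "w + of_real \<omega> \<cdot> u" a] that by (simp add: A_def)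
  qed
  show "nrm w = 0" if "(u, w) \<in> A" "nrm u = 0" for u w
  proof -
    have X: "u \<in> X" "w \<in> X" using A_in that by auto
    have "nrm (w + of_real \<omega> \<cdot> u) = 0" using G_single that by (simp add: A_def)
    moreover have "nrm ((w + of_real \<omega> \<cdot> u) - of_real \<omega> \<cdot> u) \<le> nrm (w + of_real \<omega> \<cdot> u) + nrm (of_real \<omega> \<cdot> u)"
      using X by (intro nrm_triangle_diff add_in scale_in)
    ultimately show ?thesis using X that nrm_le_0_iff by simp
  qed
  show "(u', w') \<in> A"
    if A: "(u, w) \<in> A" and X': "u' \<in> X" "w' \<in> X" and n: "nrm (u' - u) = 0" "nrm (w' - w) = 0" for u w u' w'
  proof -
    have X: "u \<in> X" "w \<in> X" using A_in A by auto
    have eq: "(w' + of_real \<omega> \<cdot> u') - (w + of_real \<omega> \<cdot> u) = (w' - w) + of_real \<omega> \<cdot> (u' - u)"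
      by (rule ext, simp only: plus_fun_apply minus_apply, algebra)
    have d: "w' - w \<in> X" "u' - u \<in> X" using X X' by auto
    have "nrm ((w' - w) + of_real \<omega> \<cdot> (u' - u)) \<le> 0"
      using nrm_triangle[OF d(1) scale_in[OF d(2)], of "of_real \<omega>"] nrm_scale[OF d(2), of "of_real \<omega>"] n by simp
    then have "nrm ((w' + of_real \<omega> \<cdot> u') - (w + of_real \<omega> \<cdot> u)) = 0"
      unfolding eq using nrm_le_0_iff[OF add_in[OF d(1) scale_in[OF d(2)]]] by simp
    then show ?thesis using G_cong[of u "w + of_real \<omega> \<cdot> u" u' "w' + of_real \<omega> \<cdot> u'"] A X X' n by (simp add: A_def)
  qed
  show "Re (z * ip w u) \<le> 0" if "(u, w) \<in> A" "z \<in> quarter" for u w z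
  proof -
    have X: "u \<in> X" "w \<in> X" using A_in that by auto
    have "ip (w + of_real \<omega> \<cdot> u) u - of_real \<omega> * ip u u = ip w u"
      using ip_add_left[OF X(2) scale_in[OF X(1)] X(1)] ip_scale_left[OF X(1,1)] by simp
    then show ?thesis using G_sect[of u "w + of_real \<omega> \<cdot> u" z] that by (simp add: A_def)
  qed
  show "\<exists>u w. (u, w) \<in> A \<and> nrm (u - z \<cdot> w - f) = 0" if z: "z \<in> quarter" and f: "f \<in> X" for z f
  proof -
    obtain u w where G: "(u, w) \<in> G" and n: "nrm (\<lambda>s. u s - z * (w s - of_real \<omega> * u s) - f s) = 0"
      using G_range[OF z f] by blast
    have "(u, w - of_real \<omega> \<cdot> u) \<in> A" using G by (simp add: A_def)
    moreover have "u - z \<cdot> (w - of_real \<omega> \<cdot> u) - f = (\<lambda>s. u s - z * (w s - of_real \<omega> * u s) - f s)"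
      by (simp add: fun_eq_iff)
    ultimately show ?thesis using n by metis
  qed
qed

lemma bop_iff_bounded_operator: "bop B \<longleftrightarrow> bounded_operator X nrm B"
  unfolding bop_def bounded_operator_def same_class_def plus_fun_def fun_diff_def ..

text \<open>The set under the supremum contains the value at the zero function, which makes it
  nonempty and the supremum nonnegative.\<close>

lemma op_norm_le:
  assumes "\<And>f. f \<in> X \<Longrightarrow> B f \<in> X" "\<And>f. f \<in> X \<Longrightarrow> nrm (B f) \<le> K * nrm f" "0 \<le> K"
  shows "op_norm X nrm B \<le> K" "0 \<le> op_norm X nrm B"
proof -
  let ?S = "{nrm (B f) |f. f \<in> X \<and> nrm f \<le> 1}"
  have ub: "x \<le> K" if x: "x \<in> ?S" for x
  proof -
    obtain f where f: "x = nrm (B f)" "f \<in> X" "nrm f \<le> 1" using x by blast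
    have "x \<le> K * nrm f" using assms(2) f by simp
    also have "\<dots> \<le> K * 1" using assms(3) f by (intro mult_left_mono)
    finally show ?thesis by simp
  qed
  have mem: "nrm (B 0) \<in> ?S" by auto
  show "op_norm X nrm B \<le> K" unfolding op_norm_def using mem ub by (intro cSup_least) blast+
  have "bdd_above ?S" using ub by (intro bdd_aboveI)
  then have "nrm (B 0) \<le> op_norm X nrm B" unfolding op_norm_def using mem by (intro cSup_upper)
  then show "0 \<le> op_norm X nrm B" using nrm_ge_0[OF assms(1)[OF zero_in]] by linarith
qed

text \<open>The contraction semigroup of the shifted operator is multiplied by
  \<open>exp (of_real \<omega> * z)\<close>. The product is bounded on bounded parts of the sector,
  which suffices for a derivative in operator norm.\<close>

theorem generates_holomorphic: "generates_holomorphic_semigroup X nrm G"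
proof -
  obtain S where S_in: "\<And>z f. z \<in> insert 0 quarter \<Longrightarrow> f \<in> X \<Longrightarrow> S z f \<in> X"
    and S_nrm: "\<And>z f. z \<in> insert 0 quarter \<Longrightarrow> f \<in> X \<Longrightarrow> nrm (S z f) \<le> nrm f"
    and S_add: "\<And>z f g. z \<in> insert 0 quarter \<Longrightarrow> f \<in> X \<Longrightarrow> g \<in> X \<Longrightarrow> S z (f + g) = S z f + S z g"
    and S_scale: "\<And>z a f. z \<in> insert 0 quarter \<Longrightarrow> f \<in> X \<Longrightarrow> S z (a \<cdot> f) = a \<cdot> S z f"
    and S_0: "\<And>f. f \<in> X \<Longrightarrow> nrm (S 0 f - f) = 0"
    and S_plus: "\<And>z w f. z \<in> insert 0 quarter \<Longrightarrow> w \<in> insert 0 quarter \<Longrightarrow> f \<in> X \<Longrightarrow> S (z + w) f = S z (S w f)"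
    and S_hol: "\<And>f g. f \<in> X \<Longrightarrow> g \<in> X \<Longrightarrow> (\<lambda>z. ip (S z f) g) holomorphic_on quarter"
    and S_cont: "\<And>f. f \<in> X \<Longrightarrow> ((\<lambda>z. nrm (S z f - f)) \<longlongrightarrow> 0) (at 0 within insert 0 quarter)"
    and S_gen: "\<And>f g. f \<in> X \<Longrightarrow> g \<in> X \<Longrightarrow> (f, g) \<in> A \<longleftrightarrow>
       ((\<lambda>t. nrm (inverse (complex_of_real t) \<cdot> (S (of_real t) f - f) - g)) \<longlongrightarrow> 0) (at_right 0)"
    by (rule A.sectorial_semigroup) blast
  define e :: "complex \<Rightarrow> complex" where "e z = exp (of_real \<omega> * z)" for z
  define T where "T z f = e z \<cdot> S z f" for z f
  have T_in: "T z f \<in> X" if "z \<in> insert 0 quarter" "f \<in> X" for z f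
    unfolding T_def using S_in that by (intro scale_in)
  have T_nrm: "nrm (T z f) \<le> cmod (e z) * nrm f" if "z \<in> insert 0 quarter" "f \<in> X" for z f
    unfolding T_def using nrm_scale[OF S_in[OF that]] S_nrm[OF that] by (simp add: mult_left_mono)
  have T_add: "T z (f + g) = T z f + T z g" if "z \<in> insert 0 quarter" "f \<in> X" "g \<in> X" for z f g
    unfolding T_def S_add[OF that] by (rule ext, simp only: plus_fun_apply minus_apply, algebra)
  have T_scale: "T z (a \<cdot> f) = a \<cdot> T z f" if "z \<in> insert 0 quarter" "f \<in> X" for z a f
    unfolding T_def S_scale[OF that] by (rule ext, simp only: mult_ac)
  have T_bop: "bop (T z)" if z: "z \<in> insert 0 quarter" for z
    unfolding bop_def using T_in[OF z] T_nrm[OF z] T_add[OF z] T_scale[OF z] by auto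
  have T_0: "nrm (T 0 f - f) = 0" if "f \<in> X" for f using S_0[OF that] by (simp add: T_def e_def)
  have T_plus: "T (z + w) f = T z (T w f)" if "z \<in> insert 0 quarter" "w \<in> insert 0 quarter" "f \<in> X" for z w f
  proof -
    have e: "e (z + w) = e z * e w" by (simp add: e_def exp_add distrib_left)
    show ?thesis unfolding T_def S_plus[OF that] S_scale[OF that(1) S_in[OF that(2,3)]] e
      by (rule ext, simp only: mult.assoc)
  qed
  have e_cont: "(e \<longlongrightarrow> 1) (at 0 within D)" for D
    unfolding e_def by (auto intro!: tendsto_eq_intros)
  have T_cont: "((\<lambda>z. nrm (T z f - f)) \<longlongrightarrow> 0) (at 0 within insert 0 quarter)" if f: "f \<in> X" for f
  proof (rule Lim_null_comparison)
    have "((\<lambda>z. cmod (e z) * nrm (S z f - f) + cmod (e z - 1) * nrm f) \<longlongrightarrow> cmod 1 * 0 + cmod (1 - 1) * nrm f)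
        (at 0 within insert 0 quarter)"
      by (intro tendsto_intros S_cont f e_cont)
    then show "((\<lambda>z. cmod (e z) * nrm (S z f - f) + cmod (e z - 1) * nrm f) \<longlongrightarrow> 0) (at 0 within insert 0 quarter)" by simp
    have "norm (nrm (T z f - f)) \<le> cmod (e z) * nrm (S z f - f) + cmod (e z - 1) * nrm f"
      if z: "z \<in> insert 0 quarter" for z
    proof -
      have "T z f - f = e z \<cdot> (S z f - f) + (e z - 1) \<cdot> f" unfolding T_def by (rule ext, simp only: plus_fun_apply minus_apply, algebra)
      moreover have "nrm (e z \<cdot> (S z f - f) + (e z - 1) \<cdot> f) \<le> nrm (e z \<cdot> (S z f - f)) + nrm ((e z - 1) \<cdot> f)"
        using S_in[OF z f] f by (intro nrm_triangle scale_in diff_in)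
      moreover have "nrm (e z \<cdot> (S z f - f)) = cmod (e z) * nrm (S z f - f)" "nrm ((e z - 1) \<cdot> f) = cmod (e z - 1) * nrm f"
        by (rule nrm_scale[OF diff_in[OF S_in[OF z f] f]] nrm_scale[OF f])+
      ultimately have "nrm (T z f - f) \<le> cmod (e z) * nrm (S z f - f) + cmod (e z - 1) * nrm f" by simp
      moreover have "0 \<le> nrm (T z f - f)" using T_in[OF z f] f by (intro nrm_ge_0 diff_in)
      ultimately show ?thesis by simp
    qed
    then show "\<forall>\<^sub>F z in at 0 within insert 0 quarter. norm (nrm (T z f - f)) \<le> cmod (e z) * nrm (S z f - f) + cmod (e z - 1) * nrm f"
      by (auto simp: eventually_at_filter)
  qed
  \<comment> \<open>Around each \<open>z\<close> of the open sector there is a ball on which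
    \<open>T\<close> is bounded by \<open>?M\<close>, so \<open>op_derivative\<close>
    applies.\<close>
  have T_diff: "\<exists>B. bop B \<and> ((\<lambda>h. op_norm X nrm (\<lambda>f s. (T (z + h) f s - T z f s) / h - B f s)) \<longlongrightarrow> 0) (at 0)"
    if z: "z \<in> quarter" for z
  proof -
    obtain r where r: "0 < r" "ball z r \<subseteq> quarter" using open_quarter z openE by blast
    have C: "w \<in> insert 0 quarter" if "w \<in> ball z r" for w using r that by auto
    let ?M = "exp (\<bar>\<omega>\<bar> * (cmod z + r))"
    have M: "cmod (e w) \<le> ?M" if w: "w \<in> ball z r" for w
    proof -
      have "cmod w \<le> cmod z + r" using w norm_triangle_ineq2[of w z] by (simp add: dist_norm norm_minus_commute)
      then have "\<bar>\<omega>\<bar> * cmod w \<le> \<bar>\<omega>\<bar> * (cmod z + r)" by (intro mult_left_mono) auto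
      moreover have "\<omega> * Re w \<le> \<bar>\<omega>\<bar> * cmod w"
        using abs_Re_le_cmod[of w] by (metis abs_ge_self abs_ge_zero abs_mult mult_left_mono order_trans)
      ultimately show ?thesis by (simp add: e_def)
    qed
    have "\<exists>B K. bop B \<and> 0 \<le> K \<and> (\<forall>h f. h \<noteq> 0 \<longrightarrow> cmod h < r / 4 \<longrightarrow> f \<in> X \<longrightarrow>
      nrm (inverse h \<cdot> (T (z + h) f - T z f) - B f) \<le> K * cmod h * nrm f)"
    proof (rule op_derivative[OF r(1), of ?M])
      show "nrm (T w f) \<le> ?M * nrm f" if "w \<in> ball z r" "f \<in> X" for w f
        using T_nrm[OF C that(2)] that mult_right_mono[OF M[OF that(1)] nrm_ge_0[OF that(2)]] by force
      show "(\<lambda>w. ip (T w f) g) holomorphic_on ball z r" if "f \<in> X" "g \<in> X" for f g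
      proof (rule holomorphic_transform)
        show "(\<lambda>w. e w * ip (S w f) g) holomorphic_on ball z r"
          unfolding e_def by (intro holomorphic_intros holomorphic_on_subset[OF S_hol[OF that]] r)
        show "e w * ip (S w f) g = ip (T w f) g" if "w \<in> ball z r" for w
          unfolding T_def using ip_scale_left[OF S_in[OF C[OF that] \<open>f \<in> X\<close>] \<open>g \<in> X\<close>] by simp
      qed
      show "T w f \<in> X" if "w \<in> ball z r" "f \<in> X" for w f using T_in[OF C[OF that(1)] that(2)] .
      show "T w (f + g) = T w f + T w g" if "w \<in> ball z r" "f \<in> X" "g \<in> X" for w f g
        using T_add[OF C[OF that(1)] that(2,3)] .
      show "T w (a \<cdot> f) = a \<cdot> T w f" if "w \<in> ball z r" "f \<in> X" for w a f
        using T_scale[OF C[OF that(1)] that(2)] .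
    qed simp
    then obtain B K where B: "bop B" "0 \<le> K" and est: "\<And>h f. h \<noteq> 0 \<Longrightarrow> cmod h < r / 4 \<Longrightarrow> f \<in> X \<Longrightarrow>
      nrm (inverse h \<cdot> (T (z + h) f - T z f) - B f) \<le> K * cmod h * nrm f" by blast
    have BX: "B f \<in> X" if "f \<in> X" for f using B(1) that by (simp add: bop_def)
    have "((\<lambda>h. op_norm X nrm (\<lambda>f s. (T (z + h) f s - T z f s) / h - B f s)) \<longlongrightarrow> 0) (at 0)"
    proof (rule Lim_null_comparison)
      show "((\<lambda>h. K * cmod h) \<longlongrightarrow> 0) (at 0)" by (auto intro!: tendsto_eq_intros)
      have "norm (op_norm X nrm (\<lambda>f s. (T (z + h) f s - T z f s) / h - B f s)) \<le> K * cmod h"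
        if h: "h \<noteq> 0" "cmod h < r / 4" for h
      proof -
        have zh: "z \<in> insert 0 quarter" "z + h \<in> insert 0 quarter" using C[of "z + h"] C[of z] h r by (auto simp: dist_norm)
        have eq: "(\<lambda>f s. (T (z + h) f s - T z f s) / h - B f s) = (\<lambda>f. inverse h \<cdot> (T (z + h) f - T z f) - B f)"
          by (simp add: fun_eq_iff divide_inverse mult.commute)
        have X: "inverse h \<cdot> (T (z + h) f - T z f) - B f \<in> X" if "f \<in> X" for f
          using T_in[OF zh(1) that] T_in[OF zh(2) that] BX[OF that] by (intro diff_in scale_in)
        show ?thesis unfolding eq
          using op_norm_le[of "\<lambda>f. inverse h \<cdot> (T (z + h) f - T z f) - B f", OF X est[OF h]] B(2) by simp
      qed
      then show "\<forall>\<^sub>F h in at 0. norm (op_norm X nrm (\<lambda>f s. (T (z + h) f s - T z f s) / h - B f s)) \<le> K * cmod h"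
        unfolding eventually_at using r(1) by (intro exI[of _ "r / 4"]) auto
    qed
    then show ?thesis using B(1) by blast
  qed
  have hol: "holomorphic_semigroup X nrm (pi / 4) T"
    unfolding holomorphic_semigroup_def sector_eq_quarter
  proof (intro conjI ballI allI impI)
    show "bounded_operator X nrm (T z)" if "z \<in> insert 0 quarter" for z
      using T_bop[OF that] unfolding bop_iff_bounded_operator .
    show "same_class nrm (T 0 f) f" if "f \<in> X" for f using T_0[OF that] by (simp add: same_class_def fun_diff_def)
    show "same_class nrm (T (z + w) f) (T z (T w f))" if "z \<in> insert 0 quarter" "w \<in> insert 0 quarter" "f \<in> X" for z w f
      using nrm_zero by (simp add: T_plus[OF that] same_class_def zero_fun_def)
    show "\<exists>B. bounded_operator X nrm B \<and>
        ((\<lambda>h. op_norm X nrm (\<lambda>f s. (T (z + h) f s - T z f s) / h - B f s)) \<longlongrightarrow> 0) (at 0)" if "z \<in> quarter" for z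
      using T_diff[OF that] unfolding bop_iff_bounded_operator .
    fix \<theta>' f assume th: "0 < \<theta>' \<and> \<theta>' < pi / 4" and f: "f \<in> X"
    have "sector \<theta>' \<subseteq> sector (pi / 4)" using th by (auto simp: sector_def)
    then have "sector \<theta>' \<subseteq> insert 0 quarter" unfolding sector_eq_quarter by auto
    from tendsto_within_subset[OF T_cont[OF f] this]
    show "((\<lambda>z. nrm (\<lambda>s. T z f s - f s)) \<longlongrightarrow> 0) (at 0 within sector \<theta>')" by (simp add: fun_diff_def)
  qed
  have real_in: "complex_of_real t \<in> insert 0 quarter" if "0 \<le> t" for t
    using of_real_in_quarter[of t] that by (cases "t = 0") auto
  have flim: "filterlim complex_of_real (at 0 within insert 0 quarter) (at_right 0)"
    unfolding filterlim_at
  proof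
    show "\<forall>\<^sub>F x in at_right 0. complex_of_real x \<in> insert 0 quarter \<and> complex_of_real x \<noteq> 0"
      unfolding eventually_at_right_field using of_real_in_quarter by (intro exI[of _ 1]) auto
    show "(complex_of_real \<longlongrightarrow> 0) (at_right 0)" by (auto intro!: tendsto_eq_intros)
  qed
  have C0: "C0_semigroup X nrm (\<lambda>t. T (complex_of_real t))"
    unfolding C0_semigroup_def
  proof (intro conjI ballI allI impI)
    show "bounded_operator X nrm (T (complex_of_real t))" if "0 \<le> t" for t
      using T_bop[OF real_in[OF that]] unfolding bop_iff_bounded_operator .
    show "same_class nrm (T (complex_of_real 0) f) f" if "f \<in> X" for f
      using T_0[OF that] by (simp add: same_class_def fun_diff_def)
    show "same_class nrm (T (complex_of_real (t + r)) f) (T (complex_of_real t) (T (complex_of_real r) f))"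
      if "0 \<le> t" "0 \<le> r" "f \<in> X" for t r f
      using T_plus[OF real_in[OF that(1)] real_in[OF that(2)] that(3)] nrm_zero by (simp add: same_class_def zero_fun_def)
    show "((\<lambda>t. nrm (\<lambda>s. T (complex_of_real t) f s - f s)) \<longlongrightarrow> 0) (at_right 0)" if "f \<in> X" for f
      using filterlim_compose[OF T_cont[OF that] flim] by (simp add: fun_diff_def)
  qed
  \<comment> \<open>Multiplication by the exponential adds \<open>\<omega>\<close> to the generator;
    \<open>g'\<close> is what the unscaled generator has to assign to \<open>f\<close>.\<close>
  have gen: "(f, g) \<in> G \<longleftrightarrow>
      ((\<lambda>t. nrm (\<lambda>s. (T (complex_of_real t) f s - f s) / complex_of_real t - g s)) \<longlongrightarrow> 0) (at_right 0)"
    if f: "f \<in> X" and g: "g \<in> X" for f g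
  proof -
    define g' where "g' = g - of_real \<omega> \<cdot> f"
    have g': "g' \<in> X" unfolding g'_def using f g by (intro diff_in scale_in)
    let ?D = "\<lambda>t. inverse (complex_of_real t) \<cdot> (S (of_real t) f - f) - g'"
    let ?E = "\<lambda>t. inverse (complex_of_real t) \<cdot> (T (of_real t) f - f) - g"
    let ?a = "\<lambda>t. e (complex_of_real t) - 1"
    let ?b = "\<lambda>t. (e (complex_of_real t) - 1) / complex_of_real t - of_real \<omega>"
    let ?r = "\<lambda>t. cmod (?a t) * nrm g' + cmod (?b t) * nrm f"
    have r0: "(?r \<longlongrightarrow> 0) (at_right 0)"
    proof -
      have "((\<lambda>z. exp (of_real \<omega> * z)) has_field_derivative of_real \<omega>) (at 0)"
        by (auto intro!: derivative_eq_intros)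
      then have "((\<lambda>z. (e z - 1) / z) \<longlongrightarrow> of_real \<omega>) (at 0)" by (simp add: has_field_derivative_iff e_def)
      moreover have "filterlim complex_of_real (at 0) (at_right 0)"
        by (rule filterlim_mono[OF flim at_le order_refl]) auto
      ultimately have "((\<lambda>t. (e (complex_of_real t) - 1) / complex_of_real t) \<longlongrightarrow> of_real \<omega>) (at_right 0)"
        by (rule filterlim_compose)
      moreover have "((\<lambda>t. e (complex_of_real t)) \<longlongrightarrow> 1) (at_right 0)"
        by (rule filterlim_compose[OF e_cont flim])
      ultimately have "(?r \<longlongrightarrow> cmod (1 - 1) * nrm g' + cmod (of_real \<omega> - of_real \<omega>) * nrm f) (at_right 0)"
        by (intro tendsto_intros)
      then show ?thesis by simp
    qed
    have X: "?D t \<in> X" "?E t \<in> X" if "0 < t" for t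
    proof -
      have C: "complex_of_real t \<in> insert 0 quarter" by (rule real_in[OF less_imp_le[OF that]])
      show "?D t \<in> X" by (intro diff_in scale_in S_in[OF C f] f g')
      show "?E t \<in> X" by (intro diff_in scale_in T_in[OF C f] f g)
    qed
    \<comment> \<open>Product rule for difference quotients. The last two terms have norm at most
      \<open>?r t\<close>, which tends to 0, and the factor \<open>e\<close> tends to 1, so
      \<open>?D\<close> and \<open>?E\<close> tend to 0 simultaneously.\<close>
    have eq: "?E t = e (of_real t) \<cdot> ?D t + ?a t \<cdot> g' + ?b t \<cdot> f" if "0 < t" for t
      using that by (simp add: fun_eq_iff T_def g'_def field_simps)
    have rX: "?a t \<cdot> g' + ?b t \<cdot> f \<in> X" for t using f g' by (intro add_in scale_in)
    have rn: "nrm (?a t \<cdot> g' + ?b t \<cdot> f) \<le> ?r t" for t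
      using nrm_triangle[OF scale_in[OF g'] scale_in[OF f], of "?a t" "?b t"] nrm_scale[OF g', of "?a t"] nrm_scale[OF f, of "?b t"]
      by simp
    have le1: "nrm (?E t) \<le> cmod (e (of_real t)) * nrm (?D t) + ?r t" if "0 < t" for t
    proof -
      have "?E t = e (of_real t) \<cdot> ?D t + (?a t \<cdot> g' + ?b t \<cdot> f)" unfolding eq[OF that] by (simp only: add.assoc)
      then have "nrm (?E t) \<le> nrm (e (of_real t) \<cdot> ?D t) + nrm (?a t \<cdot> g' + ?b t \<cdot> f)"
        using nrm_triangle[OF scale_in[OF X(1)[OF that]] rX] by metis
      then show ?thesis using nrm_scale[OF X(1)[OF that], of "e (of_real t)"] rn[of t] by linarith
    qed
    have le2: "nrm (?D t) \<le> cmod (inverse (e (of_real t))) * (nrm (?E t) + ?r t)" if "0 < t" for t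
    proof -
      have "?D t = inverse (e (of_real t)) \<cdot> (?E t - (?a t \<cdot> g' + ?b t \<cdot> f))"
        unfolding eq[OF that] by (simp add: fun_eq_iff e_def)
      then have "nrm (?D t) = cmod (inverse (e (of_real t))) * nrm (?E t - (?a t \<cdot> g' + ?b t \<cdot> f))"
        using nrm_scale[OF diff_in[OF X(2)[OF that] rX], of "inverse (e (of_real t))"] by metis
      also have "\<dots> \<le> cmod (inverse (e (of_real t))) * (nrm (?E t) + ?r t)"
        using nrm_triangle_diff[OF X(2)[OF that] rX, of t] rn[of t] by (intro mult_left_mono) auto
      finally show ?thesis .
    qed
    have e1: "((\<lambda>t. e (complex_of_real t)) \<longlongrightarrow> 1) (at_right 0)"
      by (rule filterlim_compose[OF e_cont flim])
    have "((\<lambda>t. nrm (?D t)) \<longlongrightarrow> 0) (at_right 0) \<longleftrightarrow> ((\<lambda>t. nrm (?E t)) \<longlongrightarrow> 0) (at_right 0)"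
    proof
      assume "((\<lambda>t. nrm (?D t)) \<longlongrightarrow> 0) (at_right 0)"
      then have "((\<lambda>t. cmod (e (of_real t)) * nrm (?D t) + ?r t) \<longlongrightarrow> cmod 1 * 0 + 0) (at_right 0)"
        by (intro tendsto_add tendsto_mult tendsto_norm e1 r0)
      then have "((\<lambda>t. cmod (e (of_real t)) * nrm (?D t) + ?r t) \<longlongrightarrow> 0) (at_right 0)"
        by (simp only: mult_zero_right add_0_left)
      moreover have "\<forall>\<^sub>F t in at_right 0. norm (nrm (?E t)) \<le> cmod (e (of_real t)) * nrm (?D t) + ?r t"
        unfolding eventually_at_right_field
      proof (intro exI[of _ 1] conjI allI impI)
        fix t :: real assume t: "0 < t"
        show "norm (nrm (?E t)) \<le> cmod (e (of_real t)) * nrm (?D t) + ?r t"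
          unfolding real_norm_def using nrm_ge_0[OF X(2)[OF t]] le1[OF t] by linarith
      qed simp
      ultimately show "((\<lambda>t. nrm (?E t)) \<longlongrightarrow> 0) (at_right 0)" by (rule Lim_null_comparison[rotated])
    next
      assume "((\<lambda>t. nrm (?E t)) \<longlongrightarrow> 0) (at_right 0)"
      then have "((\<lambda>t. cmod (inverse (e (of_real t))) * (nrm (?E t) + ?r t)) \<longlongrightarrow> cmod (inverse 1) * (0 + 0)) (at_right 0)"
        by (intro tendsto_add tendsto_mult tendsto_norm tendsto_inverse e1 r0) simp_all
      then have "((\<lambda>t. cmod (inverse (e (of_real t))) * (nrm (?E t) + ?r t)) \<longlongrightarrow> 0) (at_right 0)"
        by (simp only: mult_zero_right add_0_left)
      moreover have "\<forall>\<^sub>F t in at_right 0. norm (nrm (?D t)) \<le> cmod (inverse (e (of_real t))) * (nrm (?E t) + ?r t)"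
        unfolding eventually_at_right_field
      proof (intro exI[of _ 1] conjI allI impI)
        fix t :: real assume t: "0 < t"
        show "norm (nrm (?D t)) \<le> cmod (inverse (e (of_real t))) * (nrm (?E t) + ?r t)"
          unfolding real_norm_def using nrm_ge_0[OF X(1)[OF t]] le2[OF t] by linarith
      qed simp
      ultimately show "((\<lambda>t. nrm (?D t)) \<longlongrightarrow> 0) (at_right 0)" by (rule Lim_null_comparison[rotated])
    qed
    moreover have "(f, g) \<in> G \<longleftrightarrow> (f, g') \<in> A" by (simp add: A_def g'_def)
    moreover have "?E t = (\<lambda>s. (T (complex_of_real t) f s - f s) / complex_of_real t - g s)" for t
      by (simp add: fun_eq_iff divide_inverse mult.commute)
    ultimately show ?thesis using S_gen[OF f g'] by simp
  qed
  have "generator X nrm (\<lambda>t. T (complex_of_real t)) = G"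
    unfolding generator_def using gen G_in by blast
  then show ?thesis
    unfolding generates_holomorphic_semigroup_def generates_semigroup_def using hol C0
    by (intro exI[of _ "pi / 4"] exI[of _ T]) auto
qed

lemma dom_dense:
  assumes f: "f \<in> X" and e: "0 < e"
  shows "\<exists>u w. (u, w) \<in> G \<and> nrm (f - u) < e"
  using A.dom_dense[OF f e] by (auto simp: A_def)

theorem growth_bound:
  assumes T: "generates_semigroup X nrm G T" and t: "0 \<le> t"
  shows "op_norm X nrm (T t) \<le> exp (\<omega> * t)"
proof (rule op_norm_le)
  have C0: "C0_semigroup X nrm T" and gen: "generator X nrm T = G" using T by (auto simp: generates_semigroup_def)
  have bop: "bop (T t)" if "0 \<le> t" for t
    using C0 that unfolding bop_iff_bounded_operator C0_semigroup_def by blast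
  show "T t f \<in> X" if "f \<in> X" for f using bop[OF t] that by (simp add: bop_def)
  show "nrm (T t f) \<le> exp (\<omega> * t) * nrm f" if f: "f \<in> X" for f
  proof (rule semigroup_growth[where G = G, OF bop _ _ _ _ _ dom_dense t f])
    show "nrm (T 0 f - f) = 0" if "f \<in> X" for f
      using C0 that by (simp add: C0_semigroup_def same_class_def fun_diff_def)
    show "nrm (T (t + r) f - T t (T r f)) = 0" if "0 \<le> t" "0 \<le> r" "f \<in> X" for t r f
      using C0 that by (simp add: C0_semigroup_def same_class_def fun_diff_def)
    show "((\<lambda>t. nrm (T t f - f)) \<longlongrightarrow> 0) (at_right 0)" if "f \<in> X" for f
      using C0 that by (simp add: C0_semigroup_def fun_diff_def)
    show "(f, g) \<in> G \<longleftrightarrow> f \<in> X \<and> g \<in> X \<and>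
        ((\<lambda>t. nrm (inverse (complex_of_real t) \<cdot> (T t f - f) - g)) \<longlongrightarrow> 0) (at_right 0)" for f g
    proof -
      have "inverse (complex_of_real t) \<cdot> (T t f - f) - g = (\<lambda>s. (T t f s - f s) / complex_of_real t - g s)" for t
        by (simp add: fun_eq_iff divide_inverse mult.commute)
      then show ?thesis unfolding gen[symmetric] generator_def by simp
    qed
    \<comment> \<open>The sectorial estimate at \<open>z = 1\<close> is quasi-dissipativity.\<close>
    show "Re (ip g f) \<le> \<omega> * (nrm f)\<^sup>2" if "(f, g) \<in> G" for f g
      using G_sect[OF that, of 1] G_in[OF that] by (simp add: quarter_def nrm_sq)
  qed auto
qed simp

end

section \<open>Completeness of the space of square integrable functions\<close>

lemma cmod_diff_sq_le: "(cmod (a - b))\<^sup>2 \<le> 2 * (cmod a)\<^sup>2 + 2 * (cmod b)\<^sup>2"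
proof -
  have "(cmod (a - b))\<^sup>2 \<le> (cmod a + cmod b)\<^sup>2" by (intro power_mono norm_triangle_ineq4) simp
  then show ?thesis using sum_squares_bound[of "cmod a" "cmod b"] by (simp add: power2_sum)
qed

lemma integrable_cmod_sq_diff:
  assumes [measurable]: "f \<in> borel_measurable M" "g \<in> borel_measurable M"
    and "integrable M (\<lambda>x. (cmod (f x))\<^sup>2)" "integrable M (\<lambda>x. (cmod (g x))\<^sup>2)"
  shows "integrable M (\<lambda>x. (cmod (f x - g x))\<^sup>2)"
proof (rule Bochner_Integration.integrable_bound)
  show "integrable M (\<lambda>x. 2 * (cmod (f x))\<^sup>2 + 2 * (cmod (g x))\<^sup>2)" using assms by simp
  show "AE x in M. norm ((cmod (f x - g x))\<^sup>2) \<le> norm (2 * (cmod (f x))\<^sup>2 + 2 * (cmod (g x))\<^sup>2)"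
    using cmod_diff_sq_le by (auto intro!: AE_I2)
qed measurable

lemma integrable_mult_cnj:
  fixes f g :: "'a \<Rightarrow> complex"
  assumes [measurable]: "f \<in> borel_measurable M" "g \<in> borel_measurable M"
    and "integrable M (\<lambda>x. (cmod (f x))\<^sup>2)" "integrable M (\<lambda>x. (cmod (g x))\<^sup>2)"
  shows "integrable M (\<lambda>x. f x * cnj (g x))"
proof (rule Bochner_Integration.integrable_bound)
  show "integrable M (\<lambda>x. (cmod (f x))\<^sup>2 + (cmod (g x))\<^sup>2)" using assms by simp
  show "AE x in M. norm (f x * cnj (g x)) \<le> norm ((cmod (f x))\<^sup>2 + (cmod (g x))\<^sup>2)"
  proof (intro AE_I2)
    fix x
    have "cmod (f x) * cmod (g x) \<le> 2 * cmod (f x) * cmod (g x)" by (simp add: mult.assoc)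
    also have "\<dots> \<le> (cmod (f x))\<^sup>2 + (cmod (g x))\<^sup>2" by (rule sum_squares_bound)
    finally show "norm (f x * cnj (g x)) \<le> norm ((cmod (f x))\<^sup>2 + (cmod (g x))\<^sup>2)" by (simp add: norm_mult)
  qed
  have "cnj \<in> borel_measurable borel" by (intro borel_measurable_continuous_onI continuous_intros)
  then show "(\<lambda>x. f x * cnj (g x)) \<in> borel_measurable M" by measurable
qed

text \<open>Riesz--Fischer. The weights \<open>2 ^ k\<close> make the squared increments of a fast subsequence
  summable almost everywhere together with the increments themselves.\<close>

lemma square_integrable_complete:
  fixes f :: "nat \<Rightarrow> 'a \<Rightarrow> complex"
  assumes f[measurable]: "\<And>n. f n \<in> borel_measurable M"
    and int: "\<And>n. integrable M (\<lambda>x. (cmod (f n x))\<^sup>2)"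
    and Cau: "\<And>e. 0 < e \<Longrightarrow> \<exists>K. \<forall>m\<ge>K. \<forall>n\<ge>K. (LINT x|M. (cmod (f m x - f n x))\<^sup>2) < e"
  shows "\<exists>F \<in> borel_measurable M. integrable M (\<lambda>x. (cmod (F x))\<^sup>2) \<and>
    (\<lambda>n. LINT x|M. (cmod (f n x - F x))\<^sup>2) \<longlonglongrightarrow> 0"
proof -
  define N where "N m n = (LINT x|M. (cmod (f m x - f n x))\<^sup>2)" for m n
  have nn: "(\<integral>\<^sup>+x. ennreal ((cmod (f m x - f n x))\<^sup>2) \<partial>M) = ennreal (N m n)" for m n
    unfolding N_def using integrable_cmod_sq_diff[OF f f int int]
    by (intro nn_integral_eq_integral) auto
  have "\<exists>K. \<forall>m\<ge>K. \<forall>n\<ge>K. N m n < (1/4) ^ k" for k :: nat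
    unfolding N_def by (rule Cau) simp
  then obtain K where K: "\<And>k m n. m \<ge> K k \<Longrightarrow> n \<ge> K k \<Longrightarrow> N m n < (1/4) ^ k" by metis
  \<comment> \<open>Index of the fast subsequence: the sum dominates \<open>K j\<close> for all
    \<open>j \<le> k\<close>, and the summand \<open>k\<close> makes the indices unbounded.\<close>
  define r where "r k = (\<Sum>j\<le>k. K j) + k" for k
  have rK: "K k \<le> r k" "K k \<le> r (Suc k)" "k \<le> r k" for k
    unfolding r_def using member_le_sum[of k "{..k}" K] by auto
  define D where "D k x = (cmod (f (r (Suc k)) x - f (r k) x))\<^sup>2" for k x
  have Dm[measurable]: "D k \<in> borel_measurable M" for k unfolding D_def by measurable
  let ?S = "\<lambda>x. \<Sum>k. ennreal (2 ^ k * D k x)"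
  have "(\<integral>\<^sup>+x. ?S x \<partial>M) = (\<Sum>k. \<integral>\<^sup>+x. ennreal (2 ^ k * D k x) \<partial>M)" by (rule nn_integral_suminf) measurable
  also have "\<dots> \<le> (\<Sum>k. ennreal ((1/2) ^ k))"
  proof (rule suminf_le)
    fix k
    have "(\<integral>\<^sup>+x. ennreal (2 ^ k * D k x) \<partial>M) = (\<integral>\<^sup>+x. ennreal (2 ^ k) * ennreal (D k x) \<partial>M)"
      by (intro nn_integral_cong) (simp add: ennreal_mult D_def)
    also have "\<dots> = ennreal (2 ^ k) * ennreal (N (r (Suc k)) (r k))"
      by (subst nn_integral_cmult) (simp_all add: D_def nn)
    also have "\<dots> \<le> ennreal (2 ^ k) * ennreal ((1/4) ^ k)"
      using K[OF rK(2) rK(1)] by (intro mult_left_mono ennreal_leI) (auto intro: less_imp_le)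
    also have "\<dots> = ennreal ((1/2) ^ k)" by (simp add: ennreal_mult'[symmetric] power_mult_distrib[symmetric])
    finally show "(\<integral>\<^sup>+x. ennreal (2 ^ k * D k x) \<partial>M) \<le> ennreal ((1/2) ^ k)" .
  qed auto
  also have "\<dots> < \<infinity>" by (subst suminf_ennreal2) (auto simp: summable_geometric)
  finally have "AE x in M. ?S x \<noteq> \<infinity>" by (intro nn_integral_noteq_infinite) auto
  then have conv: "AE x in M. convergent (\<lambda>k. f (r k) x)"
  proof eventually_elim
    case (elim x)
    define C where "C = enn2real (?S x)"
    have b: "2 ^ k * D k x \<le> C" for k
    proof -
      have "ennreal (2 ^ k * D k x) \<le> ?S x" using sum_le_suminf[of "\<lambda>k. ennreal (2 ^ k * D k x)" "{k}"] by simp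
      also have "\<dots> = ennreal C" using elim by (simp add: C_def top.not_eq_extremum)
      finally show ?thesis by (simp add: C_def)
    qed
    have le: "norm (f (r (Suc k)) x - f (r k) x) \<le> sqrt C * sqrt (1/2) ^ k" for k
    proof -
      have "D k x \<le> C * (1/2) ^ k" using b[of k] by (simp add: field_simps)
      then have "sqrt (D k x) \<le> sqrt (C * (1/2) ^ k)" by (rule real_sqrt_le_mono)
      then show ?thesis by (simp add: D_def real_sqrt_mult real_sqrt_power)
    qed
    have "norm (sqrt (1/2)) < 1" by simp
    then have sm: "summable (\<lambda>k. sqrt C * sqrt (1/2) ^ k)" by (intro summable_mult summable_geometric)
    have "summable (\<lambda>k. f (r (Suc k)) x - f (r k) x)" by (rule summable_comparison_test'[OF sm le])
    then have "convergent (\<lambda>n. f (r n) x - f (r 0) x)"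
      by (simp add: summable_iff_convergent sum_lessThan_telescope[of "\<lambda>k. f (r k) x"])
    from convergent_add[OF this convergent_const[of "f (r 0) x"]] show ?case by simp
  qed
  define F where "F x = lim (\<lambda>k. f (r k) x)" for x
  have F[measurable]: "F \<in> borel_measurable M" unfolding F_def by measurable
  \<comment> \<open>Fatou's lemma along the subsequence turns the Cauchy estimate into one for the
    limit and shows that \<open>f n - F\<close> is square integrable.\<close>
  have small: "integrable M (\<lambda>x. (cmod (f n x - F x))\<^sup>2) \<and> (LINT x|M. (cmod (f n x - F x))\<^sup>2) \<le> (1/4) ^ j"
    if n: "n \<ge> K j" for n j
  proof -
    have "(\<integral>\<^sup>+x. ennreal ((cmod (f n x - F x))\<^sup>2) \<partial>M)
        = (\<integral>\<^sup>+x. liminf (\<lambda>k. ennreal ((cmod (f n x - f (r k) x))\<^sup>2)) \<partial>M)"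
      using conv
    proof (intro nn_integral_cong_AE, eventually_elim)
      case (elim x)
      then have "(\<lambda>k. f (r k) x) \<longlonglongrightarrow> F x" unfolding F_def by (simp add: convergent_LIMSEQ_iff)
      then have "(\<lambda>k. ennreal ((cmod (f n x - f (r k) x))\<^sup>2)) \<longlonglongrightarrow> ennreal ((cmod (f n x - F x))\<^sup>2)"
        by (intro tendsto_intros tendsto_ennrealI)
      from lim_imp_Liminf[OF _ this] show ?case by simp
    qed
    also have "\<dots> \<le> liminf (\<lambda>k. \<integral>\<^sup>+x. ennreal ((cmod (f n x - f (r k) x))\<^sup>2) \<partial>M)"
      by (rule nn_integral_liminf) measurable
    also have "\<dots> \<le> ennreal ((1/4) ^ j)"
    proof -
      have "\<forall>\<^sub>F k in sequentially. (\<integral>\<^sup>+x. ennreal ((cmod (f n x - f (r k) x))\<^sup>2) \<partial>M) \<le> ennreal ((1/4) ^ j)"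
        using eventually_ge_at_top[of "K j"]
      proof eventually_elim
        case (elim k)
        then have "K j \<le> r k" using rK(3)[of k] by linarith
        then show ?case unfolding nn using K[OF n] by (intro ennreal_leI less_imp_le)
      qed
      then have "limsup (\<lambda>k. \<integral>\<^sup>+x. ennreal ((cmod (f n x - f (r k) x))\<^sup>2) \<partial>M) \<le> ennreal ((1/4) ^ j)"
        by (rule Limsup_bounded)
      then show ?thesis using Liminf_le_Limsup[OF sequentially_bot] order_trans by blast
    qed
    finally have le: "(\<integral>\<^sup>+x. ennreal ((cmod (f n x - F x))\<^sup>2) \<partial>M) \<le> ennreal ((1/4) ^ j)" .
    have "integrable M (\<lambda>x. (cmod (f n x - F x))\<^sup>2)"
      using le by (intro integrableI_bounded) (auto simp: le_less_trans)
    moreover have "(LINT x|M. (cmod (f n x - F x))\<^sup>2) \<le> (1/4) ^ j"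
      using le by (subst integral_eq_nn_integral) (auto intro: enn2real_leI)
    ultimately show ?thesis ..
  qed
  have "integrable M (\<lambda>x. (cmod (F x))\<^sup>2)"
    using integrable_cmod_sq_diff[of "f (K 0)" M "\<lambda>x. f (K 0) x - F x"] int small[of 0 "K 0"] by simp
  moreover have "(\<lambda>n. LINT x|M. (cmod (f n x - F x))\<^sup>2) \<longlonglongrightarrow> 0"
  proof (rule LIMSEQ_I)
    fix e :: real assume "0 < e"
    then obtain j where j: "(1/4 :: real) ^ j < e" using real_arch_pow_inv[of e "1/4"] by auto
    have "norm ((LINT x|M. (cmod (f n x - F x))\<^sup>2) - 0) < e" if "n \<ge> K j" for n
      using small[OF that] j by (simp add: integral_nonneg_AE)
    then show "\<exists>no. \<forall>n\<ge>no. norm ((LINT x|M. (cmod (f n x - F x))\<^sup>2) - 0) < e" by blast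
  qed
  ultimately show ?thesis using F by blast
qed

section \<open>The space of square integrable functions on the graph\<close>

lemma L2_graphD:
  assumes "u \<in> L2_graph N d" "i \<in> {1..N}"
  shows "(\<lambda>x. u (i, x)) \<in> borel_measurable (lebesgue_on {0<..<d i})"
    "integrable (lebesgue_on {0<..<d i}) (\<lambda>x. (cmod (u (i, x)))\<^sup>2)"
  using assms by (auto simp: L2_graph_def on_edge_def)

lemma Re_L2_inner_self:
  "Re (L2_inner N d u u) = (\<Sum>i\<in>{1..N}. LINT x|lebesgue_on {0<..<d i}. (cmod (u (i, x)))\<^sup>2)"
proof -
  have "u (i, x) * cnj (u (i, x)) = complex_of_real ((cmod (u (i, x)))\<^sup>2)" for i x
    by (rule complex_norm_square[symmetric])
  then show ?thesis unfolding L2_inner_def on_edge_def Re_sum by (simp del: of_real_power)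
qed

lemma L2_norm_nonneg: "0 \<le> L2_norm N d u"
  unfolding L2_norm_def Re_L2_inner_self by (intro real_sqrt_ge_zero sum_nonneg integral_nonneg_AE) simp

lemma L2_norm_sq: "(L2_norm N d u)\<^sup>2 = (\<Sum>i\<in>{1..N}. LINT x|lebesgue_on {0<..<d i}. (cmod (u (i, x)))\<^sup>2)"
  unfolding L2_norm_def Re_L2_inner_self by (intro real_sqrt_pow2 sum_nonneg integral_nonneg_AE) simp

lemma semi_hilbert_L2_graph: "semi_hilbert (\<lambda>c f s. c * f s) (L2_graph N d) (L2_inner N d)"
proof -
  interpret vector_space "\<lambda>c (f :: nat \<times> real \<Rightarrow> complex) s. c * f s"
    by standard (auto simp: fun_eq_iff ring_distribs)
  let ?M = "\<lambda>i. lebesgue_on {0<..<d i}"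
  have minus_in: "(\<lambda>s. u s - v s) \<in> L2_graph N d" if "u \<in> L2_graph N d" "v \<in> L2_graph N d" for u v
    using L2_graphD[OF that(1)] L2_graphD[OF that(2)]
    by (auto simp: L2_graph_def on_edge_def intro!: integrable_cmod_sq_diff)
  have scale_in: "(\<lambda>s. a * u s) \<in> L2_graph N d" if "u \<in> L2_graph N d" for a u
    using L2_graphD[OF that] by (auto simp: L2_graph_def on_edge_def norm_mult power_mult_distrib)
  have add_in: "u + v \<in> L2_graph N d" if "u \<in> L2_graph N d" "v \<in> L2_graph N d" for u v
    using minus_in[OF that(1) scale_in[OF that(2), of "-1"]] by (simp add: plus_fun_def)
  have int: "integrable (?M i) (\<lambda>x. u (i, x) * cnj (v (i, x)))"
    if "u \<in> L2_graph N d" "v \<in> L2_graph N d" "i \<in> {1..N}" for u v i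
    using L2_graphD[OF that(1,3)] L2_graphD[OF that(2,3)] by (intro integrable_mult_cnj)
  show ?thesis
  proof
    show "subspace (L2_graph N d)"
      by (rule subspaceI) (rule add_in scale_in, assumption+ | simp add: L2_graph_def on_edge_def)+
    show "L2_inner N d (x + y) z = L2_inner N d x z + L2_inner N d y z"
      if "x \<in> L2_graph N d" "y \<in> L2_graph N d" "z \<in> L2_graph N d" for x y z
      unfolding L2_inner_def on_edge_def sum.distrib[symmetric]
      by (intro sum.cong refl) (simp add: distrib_right int that)
    show "L2_inner N d (\<lambda>s. a * x s) y = a * L2_inner N d x y"
      if "x \<in> L2_graph N d" "y \<in> L2_graph N d" for a x y
      unfolding L2_inner_def on_edge_def sum_distrib_left
      by (intro sum.cong refl) (simp add: mult.assoc)
    show "L2_inner N d y x = cnj (L2_inner N d x y)"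
      if "x \<in> L2_graph N d" "y \<in> L2_graph N d" for x y
      unfolding L2_inner_def on_edge_def by (simp add: Bochner_Integration.integral_cnj[symmetric] mult.commute)
    show "0 \<le> Re (L2_inner N d x x)" if "x \<in> L2_graph N d" for x
      unfolding Re_L2_inner_self by (intro sum_nonneg integral_nonneg_AE) simp
    fix f :: "nat \<Rightarrow> graph_fun"
    assume f: "\<And>n. f n \<in> L2_graph N d"
      and C: "\<And>e. 0 < e \<Longrightarrow> \<exists>K. \<forall>m\<ge>K. \<forall>n\<ge>K. sqrt (Re (L2_inner N d (f m - f n) (f m - f n))) < e"
    \<comment> \<open>Completeness is proved edge by edge: the norm on one edge is dominated by the
      full norm, and the limits on the finitely many edges are glued together.\<close>
    have "\<exists>F \<in> borel_measurable (?M i). integrable (?M i) (\<lambda>x. (cmod (F x))\<^sup>2) \<and>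
      (\<lambda>n. LINT x|?M i. (cmod (f n (i, x) - F x))\<^sup>2) \<longlonglongrightarrow> 0" if i: "i \<in> {1..N}" for i
    proof (rule square_integrable_complete[OF L2_graphD(1)[OF f i] L2_graphD(2)[OF f i]])
      fix e :: real assume e: "0 < e"
      obtain K where K: "\<And>m n. m \<ge> K \<Longrightarrow> n \<ge> K \<Longrightarrow> L2_norm N d (f m - f n) < sqrt e"
        using C[of "sqrt e"] e unfolding L2_norm_def by auto
      have "(LINT x|?M i. (cmod (f m (i, x) - f n (i, x)))\<^sup>2) < e" if "m \<ge> K" "n \<ge> K" for m n
      proof -
        have "(LINT x|?M i. (cmod (f m (i, x) - f n (i, x)))\<^sup>2) \<le> (L2_norm N d (f m - f n))\<^sup>2"
          unfolding L2_norm_sq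
          using member_le_sum[OF i, of "\<lambda>i. LINT x|?M i. (cmod ((f m - f n) (i, x)))\<^sup>2"] by simp
        also have "\<dots> < (sqrt e)\<^sup>2"
          using K[OF that] by (rule power_strict_mono[OF _ L2_norm_nonneg]) simp
        finally show ?thesis using e by simp
      qed
      then show "\<exists>K. \<forall>m\<ge>K. \<forall>n\<ge>K. (LINT x|?M i. (cmod (f m (i, x) - f n (i, x)))\<^sup>2) < e" by blast
    qed
    then have "\<forall>i\<in>{1..N}. \<exists>F. F \<in> borel_measurable (?M i) \<and> integrable (?M i) (\<lambda>x. (cmod (F x))\<^sup>2) \<and>
        (\<lambda>n. LINT x|?M i. (cmod (f n (i, x) - F x))\<^sup>2) \<longlonglongrightarrow> 0" by blast
    from bchoice[OF this] obtain F where "\<forall>i\<in>{1..N}. F i \<in> borel_measurable (?M i) \<and>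
        integrable (?M i) (\<lambda>x. (cmod (F i x))\<^sup>2) \<and>
        (\<lambda>n. LINT x|?M i. (cmod (f n (i, x) - F i x))\<^sup>2) \<longlonglongrightarrow> 0" ..
    then have F: "F i \<in> borel_measurable (?M i)" "integrable (?M i) (\<lambda>x. (cmod (F i x))\<^sup>2)"
      "(\<lambda>n. LINT x|?M i. (cmod (f n (i, x) - F i x))\<^sup>2) \<longlonglongrightarrow> 0" if "i \<in> {1..N}" for i
      using that by blast+
    define y where "y = (\<lambda>(i, x). F i x)"
    have yL: "y \<in> L2_graph N d" using F by (auto simp: L2_graph_def on_edge_def y_def)
    have "(\<lambda>n. \<Sum>i\<in>{1..N}. LINT x|?M i. (cmod (f n (i, x) - F i x))\<^sup>2) \<longlonglongrightarrow> (\<Sum>i\<in>{1..N}. 0)"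
      by (intro tendsto_sum F)
    then have "(\<lambda>n. (L2_norm N d (f n - y))\<^sup>2) \<longlonglongrightarrow> 0" by (simp add: L2_norm_sq y_def)
    then have "(\<lambda>n. sqrt ((L2_norm N d (f n - y))\<^sup>2)) \<longlonglongrightarrow> sqrt 0" by (rule tendsto_real_sqrt)
    then have "(\<lambda>n. L2_norm N d (f n - y)) \<longlonglongrightarrow> 0" by (simp add: L2_norm_nonneg)
    then show "\<exists>y\<in>L2_graph N d. (\<lambda>n. sqrt (Re (L2_inner N d (f n - y) (f n - y)))) \<longlonglongrightarrow> 0"
      using yL unfolding L2_norm_def by blast
  qed
qed

section \<open>Smooth bump functions and test functions\<close>

lemma coinductive_smooth:
  fixes f :: "real \<Rightarrow> real"
  assumes "f \<in> \<F>" and step: "\<And>f. f \<in> \<F> \<Longrightarrow> \<exists>f'\<in>\<F>. \<forall>x. (f has_real_derivative f' x) (at x)"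
  shows "((deriv ^^ k) f) field_differentiable (at x)"
proof -
  \<comment> \<open>The iterated derivatives stay in the family, so smoothness follows without any
    formula for them.\<close>
  have "(deriv ^^ k) f \<in> \<F>" for k
  proof (induction k)
    case (Suc k)
    obtain f' where f': "f' \<in> \<F>" "\<And>x. ((deriv ^^ k) f has_real_derivative f' x) (at x)" using step[OF Suc] by blast
    then have "deriv ((deriv ^^ k) f) = f'" by (intro ext DERIV_imp_deriv)
    then show ?case using f'(1) by simp
  qed (simp add: assms)
  then show ?thesis using step[of "(deriv ^^ k) f"] field_differentiable_def by blast
qed

definition smooth :: "(real \<Rightarrow> real) \<Rightarrow> bool" where
  "smooth f \<longleftrightarrow> (\<forall>k x. ((deriv ^^ k) f) field_differentiable (at x))"

lemma smooth_deriv: 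
  assumes "smooth f" shows "smooth (deriv f)" "(f has_real_derivative deriv f x) (at x)"
proof -
  have "((deriv ^^ k) (deriv f)) field_differentiable (at x)" for k x
    using assms[unfolded smooth_def, rule_format, of "Suc k" x] by (simp only: funpow.simps(2) funpow_swap1 o_apply)
  then show "smooth (deriv f)" by (simp add: smooth_def)
  show "(f has_real_derivative deriv f x) (at x)"
    using assms[unfolded smooth_def, rule_format, of 0 x] by (simp add: field_differentiable_derivI)
qed

lemma smooth_diff_scaled:
  assumes "smooth f" "smooth g" shows "smooth (\<lambda>x. f x - c * g x)"
proof -
  let ?F = "{(\<lambda>x. f x - c * g x) | f g. smooth f \<and> smooth g}"
  have step: "\<exists>h'\<in>?F. \<forall>x. (h has_real_derivative h' x) (at x)" if hF: "h \<in> ?F" for h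
  proof -
    obtain f g where h: "h = (\<lambda>x. f x - c * g x)" "smooth f" "smooth g" using hF by blast
    have "(h has_real_derivative (deriv f x - c * deriv g x)) (at x)" for x
      unfolding h by (intro DERIV_diff DERIV_cmult smooth_deriv h)
    then show ?thesis using smooth_deriv(1)[OF h(2)] smooth_deriv(1)[OF h(3)]
      by (intro bexI[of _ "\<lambda>x. deriv f x - c * deriv g x"]) blast+
  qed
  have mem: "(\<lambda>x. f x - c * g x) \<in> ?F" by (rule CollectI, rule exI[of _ f], rule exI[of _ g]) (simp add: assms)
  show ?thesis unfolding smooth_def by (intro allI) (rule coinductive_smooth[OF mem step])
qed

text \<open>Adjoining \<open>F\<close> to the smooth functions gives a family that is again closed
  under differentiation.\<close>

lemma smooth_antiderivative:
  assumes f: "smooth f" and d: "\<And>x. (F has_real_derivative f x) (at x)" shows "smooth F"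
proof -
  have step: "\<exists>h'\<in>insert F (Collect smooth). \<forall>x. (h has_real_derivative h' x) (at x)"
    if "h \<in> insert F (Collect smooth)" for h
  proof (cases "h = F")
    case True then show ?thesis using f d by (intro bexI[of _ f]) auto
  next
    case False then show ?thesis using that smooth_deriv[of h] by (intro bexI[of _ "deriv h"]) auto
  qed
  show ?thesis unfolding smooth_def by (intro allI) (rule coinductive_smooth[OF insertI1 step])
qed

text \<open>A flat cut-off to the interval from \<open>\<alpha>\<close> to \<open>\<beta>\<close>
  with two parameters: letting \<open>\<epsilon>\<close> tend to 0 recovers the indicator function,
  and the factor \<open>g\<close> makes the family closed under differentiation.\<close>

definition bump :: "real \<Rightarrow> real \<Rightarrow> real \<Rightarrow> (real \<Rightarrow> real) \<Rightarrow> real \<Rightarrow> real" where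
  "bump \<alpha> \<beta> \<epsilon> g x =
     (if \<alpha> < x \<and> x < \<beta> then g x * exp (- \<epsilon> * (1 / (x - \<alpha>) + 1 / (\<beta> - x))) else 0)"

text \<open>The rational factors that arise from differentiating the bump function.\<close>

inductive pole_poly :: "real \<Rightarrow> real \<Rightarrow> (real \<Rightarrow> real) \<Rightarrow> bool" for \<alpha> \<beta> where
  const: "pole_poly \<alpha> \<beta> (\<lambda>x. c)"
| left: "pole_poly \<alpha> \<beta> (\<lambda>x. 1 / (x - \<alpha>))"
| right: "pole_poly \<alpha> \<beta> (\<lambda>x. 1 / (\<beta> - x))"
| add: "pole_poly \<alpha> \<beta> f \<Longrightarrow> pole_poly \<alpha> \<beta> g \<Longrightarrow> pole_poly \<alpha> \<beta> (\<lambda>x. f x + g x)"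
| mult: "pole_poly \<alpha> \<beta> f \<Longrightarrow> pole_poly \<alpha> \<beta> g \<Longrightarrow> pole_poly \<alpha> \<beta> (\<lambda>x. f x * g x)"

lemma deriv_left_pole:
  "\<alpha> < x \<Longrightarrow> ((\<lambda>x. 1 / (x - \<alpha>)) has_real_derivative (-1) * (1 / (x - \<alpha>) * (1 / (x - \<alpha>)))) (at x)"
  by (auto intro!: derivative_eq_intros simp: power2_eq_square)

lemma deriv_right_pole:
  "x < \<beta> \<Longrightarrow> ((\<lambda>x. 1 / (\<beta> - x)) has_real_derivative 1 / (\<beta> - x) * (1 / (\<beta> - x))) (at x)"
  by (auto intro!: derivative_eq_intros simp: power2_eq_square)

lemma pole_poly_deriv:
  assumes "pole_poly \<alpha> \<beta> g"
  shows "\<exists>g'. pole_poly \<alpha> \<beta> g' \<and> (\<forall>x. \<alpha> < x \<and> x < \<beta> \<longrightarrow> (g has_real_derivative g' x) (at x))"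
  using assms
proof induction
  case (const c)
  show ?case by (intro exI[of _ "\<lambda>x. 0"]) (auto intro: pole_poly.const)
next
  case left
  show ?case
  proof (intro exI conjI allI impI)
    show "pole_poly \<alpha> \<beta> (\<lambda>x. (-1) * (1 / (x - \<alpha>) * (1 / (x - \<alpha>))))" by (intro pole_poly.intros)
  qed (rule deriv_left_pole, simp)
next
  case right
  show ?case
  proof (intro exI conjI allI impI)
    show "pole_poly \<alpha> \<beta> (\<lambda>x. 1 / (\<beta> - x) * (1 / (\<beta> - x)))" by (intro pole_poly.intros)
  qed (rule deriv_right_pole, simp)
next
  case (add f g)
  then obtain f' g' where "pole_poly \<alpha> \<beta> f'" "pole_poly \<alpha> \<beta> g'"
    "\<And>x. \<alpha> < x \<Longrightarrow> x < \<beta> \<Longrightarrow> (f has_real_derivative f' x) (at x)"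
    "\<And>x. \<alpha> < x \<Longrightarrow> x < \<beta> \<Longrightarrow> (g has_real_derivative g' x) (at x)" by blast
  then show ?case
    by (intro exI[of _ "\<lambda>x. f' x + g' x"]) (auto intro!: pole_poly.add DERIV_add)
next
  case (mult f g)
  then obtain f' g' where "pole_poly \<alpha> \<beta> f'" "pole_poly \<alpha> \<beta> g'"
    "\<And>x. \<alpha> < x \<Longrightarrow> x < \<beta> \<Longrightarrow> (f has_real_derivative f' x) (at x)"
    "\<And>x. \<alpha> < x \<Longrightarrow> x < \<beta> \<Longrightarrow> (g has_real_derivative g' x) (at x)" by blast
  then show ?case using mult.hyps
    by (intro exI[of _ "\<lambda>x. f' x * g x + g' x * f x"]) (auto intro!: pole_poly.add pole_poly.mult DERIV_mult)
qed

text \<open>Inside the interval the base of the power is at least 1, so two exponents can be merged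
  by enlarging both to their sum.\<close>

lemma pole_poly_growth:
  assumes "pole_poly \<alpha> \<beta> g"
  shows "\<exists>C m. 0 \<le> C \<and> (\<forall>x. \<alpha> < x \<and> x < \<beta> \<longrightarrow> \<bar>g x\<bar> \<le> C * (1 + 1 / (x - \<alpha>) + 1 / (\<beta> - x)) ^ m)"
  using assms
proof induction
  case (const c)
  show ?case by (intro exI[of _ "\<bar>c\<bar>"] exI[of _ 0]) auto
next
  case left
  show ?case by (intro exI[of _ 1] exI[of _ 1]) auto
next
  case right
  show ?case by (intro exI[of _ 1] exI[of _ 1]) auto
next
  case (add f g)
  let ?s = "\<lambda>x. 1 + 1 / (x - \<alpha>) + 1 / (\<beta> - x)"
  obtain C m D n where C: "0 \<le> C" "\<And>x. \<alpha> < x \<Longrightarrow> x < \<beta> \<Longrightarrow> \<bar>f x\<bar> \<le> C * ?s x ^ m"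
    and D: "0 \<le> D" "\<And>x. \<alpha> < x \<Longrightarrow> x < \<beta> \<Longrightarrow> \<bar>g x\<bar> \<le> D * ?s x ^ n" using add.IH by blast
  have "\<bar>f x + g x\<bar> \<le> (C + D) * ?s x ^ (m + n)" if "\<alpha> < x" "x < \<beta>" for x
  proof -
    have "1 \<le> ?s x" using that by simp
    then have "C * ?s x ^ m \<le> C * ?s x ^ (m + n)" "D * ?s x ^ n \<le> D * ?s x ^ (m + n)"
      using C(1) D(1) by (auto intro!: mult_left_mono power_increasing)
    then show ?thesis using C(2)[OF that] D(2)[OF that] by (simp add: distrib_right)
  qed
  then show ?case using C(1) D(1) by (intro exI[of _ "C + D"] exI[of _ "m + n"]) auto
next
  case (mult f g)
  let ?s = "\<lambda>x. 1 + 1 / (x - \<alpha>) + 1 / (\<beta> - x)"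
  obtain C m D n where C: "0 \<le> C" "\<And>x. \<alpha> < x \<Longrightarrow> x < \<beta> \<Longrightarrow> \<bar>f x\<bar> \<le> C * ?s x ^ m"
    and D: "0 \<le> D" "\<And>x. \<alpha> < x \<Longrightarrow> x < \<beta> \<Longrightarrow> \<bar>g x\<bar> \<le> D * ?s x ^ n" using mult.IH by blast
  have "\<bar>f x * g x\<bar> \<le> (C * D) * ?s x ^ (m + n)" if "\<alpha> < x" "x < \<beta>" for x
  proof -
    have "0 \<le> ?s x" using that by simp
    then have "\<bar>f x\<bar> * \<bar>g x\<bar> \<le> (C * ?s x ^ m) * (D * ?s x ^ n)"
      using C D that by (intro mult_mono) auto
    then show ?thesis by (simp add: abs_mult power_add mult_ac)
  qed
  then show ?case using C(1) D(1) by (intro exI[of _ "C * D"] exI[of _ "m + n"]) auto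
qed

text \<open>The inequality y <= exp y, with y = \<epsilon> s / k and raised to the power
  \<open>k\<close>, yields the bound \<open>(real k / \<epsilon>) ^ k\<close>. The exponent 0 is
  separate because of the division.\<close>

lemma power_times_exp_bounded:
  assumes e: "0 < (\<epsilon>::real)"
  shows "\<exists>K\<ge>0. \<forall>s\<ge>0. s ^ k * exp (- \<epsilon> * s) \<le> K"
proof (cases "k = 0")
  case True
  then show ?thesis using e by (intro exI[of _ 1]) auto
next
  case False
  have "s ^ k * exp (- \<epsilon> * s) \<le> (real k / \<epsilon>) ^ k" if s: "0 \<le> s" for s
  proof -
    have "\<epsilon> * s / real k \<le> exp (\<epsilon> * s / real k)" using exp_ge_add_one_self[of "\<epsilon> * s / real k"] by linarith
    then have "(\<epsilon> * s / real k) ^ k \<le> exp (\<epsilon> * s / real k) ^ k" using e s by (intro power_mono) auto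
    also have "\<dots> = exp (\<epsilon> * s)" using False by (simp add: exp_of_nat_mult[symmetric])
    finally have "(\<epsilon> / real k) ^ k * (s ^ k) \<le> exp (\<epsilon> * s)" by (simp add: power_mult_distrib power_divide)
    then have "(real k / \<epsilon>) ^ k * ((\<epsilon> / real k) ^ k * (s ^ k)) \<le> (real k / \<epsilon>) ^ k * exp (\<epsilon> * s)"
      using e by (intro mult_left_mono) auto
    moreover have "(real k / \<epsilon>) ^ k * ((\<epsilon> / real k) ^ k * (s ^ k)) = s ^ k"
      using e False by (simp add: power_divide)
    ultimately have "s ^ k \<le> (real k / \<epsilon>) ^ k * exp (\<epsilon> * s)" by simp
    then have "s ^ k * exp (- \<epsilon> * s) \<le> (real k / \<epsilon>) ^ k * exp (\<epsilon> * s) * exp (- \<epsilon> * s)"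
      by (intro mult_right_mono) auto
    then show ?thesis by (simp add: mult.assoc mult_exp_exp)
  qed
  then show ?thesis using e by (intro exI[of _ "(real k / \<epsilon>) ^ k"]) auto
qed

text \<open>Quadratic vanishing at both ends is the form in which
  \<open>has_field_derivative_quadratic\<close> yields derivative 0 there.\<close>

lemma bump_flat:
  assumes e: "0 < \<epsilon>" and g: "pole_poly \<alpha> \<beta> g"
  shows "\<exists>K\<ge>0. \<forall>x. \<bar>bump \<alpha> \<beta> \<epsilon> g x\<bar> \<le> K * (x - \<alpha>)\<^sup>2 \<and> \<bar>bump \<alpha> \<beta> \<epsilon> g x\<bar> \<le> K * (\<beta> - x)\<^sup>2"
proof -
  obtain C m where C: "0 \<le> C" "\<And>x. \<alpha> < x \<Longrightarrow> x < \<beta> \<Longrightarrow> \<bar>g x\<bar> \<le> C * (1 + 1 / (x - \<alpha>) + 1 / (\<beta> - x)) ^ m"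
    using pole_poly_growth[OF g] by blast
  \<comment> \<open>The exponent \<open>m + 2\<close> provides two spare powers of \<open>s\<close>,
    which are paid for by \<open>y\<^sup>2\<close> because \<open>y * s\<close> is at least 1. The
    summand 1 in \<open>s\<close> is responsible for the factor
    \<open>exp \<epsilon>\<close>.\<close>
  obtain K where K: "K \<ge> 0" "\<And>s. s \<ge> 0 \<Longrightarrow> s ^ (m + 2) * exp (- \<epsilon> * s) \<le> K"
    using power_times_exp_bounded[OF e, of "m + 2"] by blast
  let ?K = "C * K * exp \<epsilon>"
  have main: "\<bar>bump \<alpha> \<beta> \<epsilon> g x\<bar> \<le> ?K * y\<^sup>2"
    if x: "\<alpha> < x" "x < \<beta>" and y: "y = x - \<alpha> \<or> y = \<beta> - x" for x y
  proof -
    define s where "s = 1 + 1 / (x - \<alpha>) + 1 / (\<beta> - x)"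
    have yp: "0 < y" "1 / y \<le> s" using x y by (auto simp: s_def)
    have s: "0 < s" using x by (simp add: s_def add_pos_pos)
    have ys: "1 \<le> y * s" using yp by (simp add: field_simps)
    have "\<bar>bump \<alpha> \<beta> \<epsilon> g x\<bar> = \<bar>g x\<bar> * exp (- \<epsilon> * (s - 1))"
      using x by (simp add: bump_def abs_mult s_def algebra_simps)
    also have "\<dots> \<le> C * s ^ m * exp (- \<epsilon> * (s - 1))"
      using C(2)[OF x] by (intro mult_right_mono) (auto simp: s_def)
    also have "\<dots> = C * exp \<epsilon> * (s ^ m * exp (- \<epsilon> * s)) * 1"
      by (simp add: algebra_simps mult_exp_exp)
    also have "\<dots> \<le> C * exp \<epsilon> * (s ^ m * exp (- \<epsilon> * s)) * (y * s)\<^sup>2"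
      using C(1) s ys by (intro mult_left_mono one_le_power) auto
    also have "\<dots> = C * exp \<epsilon> * (s ^ (m + 2) * exp (- \<epsilon> * s)) * y\<^sup>2"
      by (simp add: power_mult_distrib power_add power2_eq_square mult_ac)
    also have "\<dots> \<le> C * exp \<epsilon> * K * y\<^sup>2"
      using C(1) K(2)[of s] s by (intro mult_right_mono mult_left_mono) auto
    finally show ?thesis by (simp add: mult_ac)
  qed
  have K0: "0 \<le> ?K" using C K by simp
  have "\<bar>bump \<alpha> \<beta> \<epsilon> g x\<bar> \<le> ?K * (x - \<alpha>)\<^sup>2 \<and> \<bar>bump \<alpha> \<beta> \<epsilon> g x\<bar> \<le> ?K * (\<beta> - x)\<^sup>2" for x
  proof (cases "\<alpha> < x \<and> x < \<beta>")
    case True then show ?thesis using main by blast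
  next
    case False then have "bump \<alpha> \<beta> \<epsilon> g x = 0" by (auto simp: bump_def)
    then show ?thesis using K0 by simp
  qed
  then show ?thesis using K0 by blast
qed

text \<open>Inside the interval this is the product rule and outside the function vanishes. At the
  ends \<open>bump_flat\<close> gives derivative 0, which is the value of every bump there.\<close>

lemma bump_deriv:
  assumes e: "0 < \<epsilon>" and g: "pole_poly \<alpha> \<beta> g"
  shows "\<exists>g'. pole_poly \<alpha> \<beta> g' \<and> (\<forall>x. (bump \<alpha> \<beta> \<epsilon> g has_real_derivative bump \<alpha> \<beta> \<epsilon> g' x) (at x))"
proof -
  obtain g1 where g1: "pole_poly \<alpha> \<beta> g1"
    "\<And>x. \<alpha> < x \<Longrightarrow> x < \<beta> \<Longrightarrow> (g has_real_derivative g1 x) (at x)" using pole_poly_deriv[OF g] by blast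
  \<comment> \<open>The derivative of the exponent, which is again a
    \<open>pole_poly\<close>.\<close>
  define w where "w x = \<epsilon> * (1 / (x - \<alpha>) * (1 / (x - \<alpha>))) + (- \<epsilon>) * (1 / (\<beta> - x) * (1 / (\<beta> - x)))" for x
  have w: "pole_poly \<alpha> \<beta> w" unfolding w_def by (intro pole_poly.intros)
  define g' where "g' x = g1 x + g x * w x" for x
  have g': "pole_poly \<alpha> \<beta> g'" unfolding g'_def by (intro pole_poly.add pole_poly.mult g g1 w)
  obtain K where K: "\<And>x. \<bar>bump \<alpha> \<beta> \<epsilon> g x\<bar> \<le> K * (x - \<alpha>)\<^sup>2" "\<And>x. \<bar>bump \<alpha> \<beta> \<epsilon> g x\<bar> \<le> K * (\<beta> - x)\<^sup>2"
    using bump_flat[OF e g] by blast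
  have "(bump \<alpha> \<beta> \<epsilon> g has_real_derivative bump \<alpha> \<beta> \<epsilon> g' x) (at x)" for x
  proof -
    consider "\<alpha> < x" "x < \<beta>" | "x < \<alpha> \<or> \<beta> < x" | "x = \<alpha>" | "x = \<beta>" by linarith
    then show ?thesis
    proof cases
      case 1
      let ?E = "\<lambda>x. exp (- \<epsilon> * (1 / (x - \<alpha>) + 1 / (\<beta> - x)))"
      have "((\<lambda>x. - \<epsilon> * (1 / (x - \<alpha>) + 1 / (\<beta> - x))) has_real_derivative w x) (at x)"
        using DERIV_cmult[OF DERIV_add[OF deriv_left_pole[OF 1(1)] deriv_right_pole[OF 1(2)]], of "- \<epsilon>"]
        by (simp add: w_def algebra_simps)
      then have "(?E has_real_derivative ?E x * w x) (at x)" by (rule DERIV_fun_exp)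
      from DERIV_mult[OF g1(2)[OF 1] this]
      have "((\<lambda>x. g x * ?E x) has_real_derivative bump \<alpha> \<beta> \<epsilon> g' x) (at x)"
        using 1 by (simp add: bump_def g'_def algebra_simps)
      then show ?thesis
        by (rule has_field_derivative_transform_within_open[of _ _ _ "{\<alpha><..<\<beta>}"]) (use 1 in \<open>auto simp: bump_def\<close>)
    next
      case 2
      have "((\<lambda>x. 0) has_real_derivative 0) (at x)" by simp
      then have "(bump \<alpha> \<beta> \<epsilon> g has_real_derivative 0) (at x)"
        by (rule has_field_derivative_transform_within_open[of _ _ _ "{..<\<alpha>} \<union> {\<beta><..}"])
          (use 2 in \<open>auto simp: bump_def\<close>)
      then show ?thesis using 2 by (auto simp: bump_def)
    next
      case 3
      have "(bump \<alpha> \<beta> \<epsilon> g has_real_derivative 0) (at \<alpha>)"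
        by (rule has_field_derivative_quadratic[where K = K and \<rho> = 1])
          (use K(1)[of "\<alpha> + h" for h] in \<open>simp_all add: bump_def[of _ _ _ _ \<alpha>]\<close>)
      then show ?thesis using 3 by (simp add: bump_def)
    next
      case 4
      have "(bump \<alpha> \<beta> \<epsilon> g has_real_derivative 0) (at \<beta>)"
      proof (rule has_field_derivative_quadratic[where K = K and \<rho> = 1])
        show "norm (bump \<alpha> \<beta> \<epsilon> g (\<beta> + h) - bump \<alpha> \<beta> \<epsilon> g \<beta> - h * 0) \<le> K * (norm h)\<^sup>2" for h
          using K(2)[of "\<beta> + h"] by (simp add: bump_def[of _ _ _ _ \<beta>])
      qed simp
      then show ?thesis using 4 by (simp add: bump_def)
    qed
  qed
  then show ?thesis using g' by blast
qed

lemma smooth_bump: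
  assumes e: "0 < \<epsilon>" and g: "pole_poly \<alpha> \<beta> g" shows "smooth (bump \<alpha> \<beta> \<epsilon> g)"
proof -
  let ?F = "{bump \<alpha> \<beta> \<epsilon> g | g. pole_poly \<alpha> \<beta> g}"
  have step: "\<exists>h'\<in>?F. \<forall>x. (h has_real_derivative h' x) (at x)" if "h \<in> ?F" for h
    using that bump_deriv[OF e] by blast
  have mem: "bump \<alpha> \<beta> \<epsilon> g \<in> ?F" by (rule CollectI, rule exI[of _ g]) (simp add: g)
  show ?thesis unfolding smooth_def by (intro allI) (rule coinductive_smooth[OF mem step])
qed

lemma test_function_iff:
  "test_function a \<phi> \<longleftrightarrow> smooth \<phi> \<and> (\<exists>K. compact K \<and> K \<subseteq> {0<..<a} \<and> (\<forall>x. x \<notin> K \<longrightarrow> \<phi> x = 0))"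
  by (simp add: test_function_def smooth_def)

text \<open>Smooth minorants of the indicator function of an interval. As \<open>\<epsilon>\<close>
  tends to 0 they converge to it, so integrals over intervals become limits of integrals against
  test functions.\<close>

abbreviation plateau :: "real \<Rightarrow> real \<Rightarrow> real \<Rightarrow> real \<Rightarrow> real" where
  "plateau \<alpha> \<beta> \<epsilon> \<equiv> bump \<alpha> \<beta> \<epsilon> (\<lambda>_. 1)"

lemma smooth_plateau: "0 < \<epsilon> \<Longrightarrow> smooth (plateau \<alpha> \<beta> \<epsilon>)"
  by (rule smooth_bump[OF _ pole_poly.const])

lemma plateau_bounds: 
  assumes "0 < \<epsilon>"
  shows "0 \<le> plateau \<alpha> \<beta> \<epsilon> x" "plateau \<alpha> \<beta> \<epsilon> x \<le> indicator {\<alpha><..<\<beta>} x"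
  using assms by (auto simp: bump_def)

lemma plateau_tendsto: "(\<lambda>n. plateau \<alpha> \<beta> (inverse (real (Suc n))) x) \<longlonglongrightarrow> indicator {\<alpha><..<\<beta>} x"
proof (cases "\<alpha> < x \<and> x < \<beta>")
  case True
  have "(\<lambda>n. exp (- inverse (real (Suc n)) * (1 / (x - \<alpha>) + 1 / (\<beta> - x)))) \<longlonglongrightarrow> exp (- 0 * (1 / (x - \<alpha>) + 1 / (\<beta> - x)))"
    by (intro tendsto_intros LIMSEQ_inverse_real_of_nat)
  then show ?thesis using True by (simp add: bump_def)
qed (auto simp: bump_def)

lemma test_function_plateau:
  assumes "0 < \<epsilon>" "0 < \<alpha>" "\<beta> < a" shows "test_function a (plateau \<alpha> \<beta> \<epsilon>)"
  unfolding test_function_iff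
proof (intro conjI exI[of _ "{\<alpha>..\<beta>}"])
  show "smooth (plateau \<alpha> \<beta> \<epsilon>)" by (rule smooth_plateau[OF assms(1)])
qed (use assms in \<open>auto simp: bump_def\<close>)

lemma plateau_integral_pos:
  assumes e: "0 < \<epsilon>" and ab: "\<alpha> < \<beta>" shows "0 < integral {\<alpha>..\<beta>} (plateau \<alpha> \<beta> \<epsilon>)"
proof -
  have cont: "continuous_on S (plateau \<alpha> \<beta> \<epsilon>)" for S
    using smooth_deriv(2)[OF smooth_plateau[OF e]] DERIV_isCont continuous_at_imp_continuous_on by blast
  have int: "plateau \<alpha> \<beta> \<epsilon> integrable_on {\<alpha>..\<beta>}" by (rule integrable_continuous_real[OF cont])
  have "0 \<le> integral {\<alpha>..\<beta>} (plateau \<alpha> \<beta> \<epsilon>)" by (intro integral_nonneg int plateau_bounds e)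
  moreover have "integral {\<alpha>..\<beta>} (plateau \<alpha> \<beta> \<epsilon>) \<noteq> 0"
  proof
    assume "integral {\<alpha>..\<beta>} (plateau \<alpha> \<beta> \<epsilon>) = 0"
    then have "(plateau \<alpha> \<beta> \<epsilon> has_integral 0) (cbox \<alpha> \<beta>)" using int by (simp add: has_integral_iff)
    from has_integral_0_cbox_imp_0[OF cont plateau_bounds(1)[OF e] this, of "(\<alpha> + \<beta>) / 2"] ab
    have "plateau \<alpha> \<beta> \<epsilon> ((\<alpha> + \<beta>) / 2) = 0" by auto
    then show False using ab by (simp add: bump_def)
  qed
  ultimately show ?thesis by linarith
qed

text \<open>Vanishing mean is what makes the primitive vanish again to the right of the
  support.\<close>

lemma test_function_antiderivative:
  assumes s: "smooth f" and supp: "\<And>x. x \<notin> {A..B} \<Longrightarrow> f x = 0" and AB: "0 < A" "A \<le> B" "B < a"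
    and mean: "integral {A..B} f = 0"
  shows "\<exists>\<phi>. test_function a \<phi> \<and> (\<forall>x. deriv \<phi> x = f x)"
proof -
  have cont: "continuous_on S f" for S
    using smooth_deriv(2)[OF s] DERIV_isCont continuous_at_imp_continuous_on by blast
  \<comment> \<open>The lower limit lies strictly left of the support, so that every
    \<open>x \<ge> A\<close> is interior to an interval on which the fundamental theorem
    applies.\<close>
  define \<phi> where "\<phi> x = integral {A - 1..x} f" for x
  have int: "f integrable_on {x..y}" for x y by (rule integrable_continuous_real[OF cont])
  have low: "\<phi> x = 0" if "x < A" for x
  proof -
    have "\<phi> x = integral {A - 1..x} (\<lambda>_. 0)" unfolding \<phi>_def using that supp by (intro integral_cong) auto
    then show ?thesis by simp
  qed
  have high: "\<phi> x = 0" if "B < x" for x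
  proof -
    have "\<phi> x = integral {A - 1..A} f + integral {A..x} f"
      unfolding \<phi>_def using that AB int by (intro Henstock_Kurzweil_Integration.integral_combine[symmetric]) auto
    also have "integral {A..x} f = integral {A..B} f + integral {B..x} f"
      using that AB int by (intro Henstock_Kurzweil_Integration.integral_combine[symmetric]) auto
    also have "integral {B..x} f = integral {B<..<x} f" by (rule integral_open_interval_real)
    also have "\<dots> = integral {B<..<x} (\<lambda>_. 0)" using supp by (intro integral_cong) auto
    also have "integral {A - 1..A} f = integral {A - 1<..<A} f" by (rule integral_open_interval_real)
    also have "\<dots> = integral {A - 1<..<A} (\<lambda>_. 0)" using supp by (intro integral_cong) auto
    finally show ?thesis using mean by simp
  qed
  have d: "(\<phi> has_real_derivative f x) (at x)" for x
  proof (cases "x < A")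
    case True
    have "((\<lambda>x. 0) has_real_derivative 0) (at x)" by simp
    then have "(\<phi> has_real_derivative 0) (at x)"
      by (rule has_field_derivative_transform_within_open[of _ _ _ "{..<A}"]) (use True low in auto)
    then show ?thesis using supp[of x] True by simp
  next
    case False
    have "(\<phi> has_real_derivative f x) (at x within {A - 1..x + 1})"
      unfolding \<phi>_def using False by (intro integral_has_real_derivative cont) auto
    then show ?thesis using False by (subst (asm) at_within_interior) auto
  qed
  have "test_function a \<phi>" unfolding test_function_iff
    using smooth_antiderivative[OF s d] low high AB by (auto intro!: exI[of _ "{A..B}"] simp: not_le)
  then show ?thesis using d DERIV_imp_deriv by blast
qed

section \<open>Functions whose integrals over intervals vanish\<close>

lemma interval_integrals_zero_imp_AE_zero_real:
  fixes h :: "real \<Rightarrow> real"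
  assumes int: "integrable lebesgue h"
    and zero: "\<And>a b. a \<le> b \<Longrightarrow> (LINT x:{a..b}|lebesgue. h x) = 0"
  shows "AE x in lebesgue. h x = 0"
proof -
  have si: "set_integrable lebesgue S h" if "S \<in> sets lebesgue" for S
    unfolding set_integrable_def by (rule integrable_mult_indicator[OF that int])
  have bs: "S \<in> sets lebesgue" if "S \<in> sets borel" for S :: "real set" using that by simp
  \<comment> \<open>The total integral is what the complement step of the induction over Borel sets
    uses.\<close>
  have univ: "(LINT x:UNIV|lebesgue. h x) = 0"
  proof -
    have "(\<lambda>n. LINT x:{- real n..real n}|lebesgue. h x) \<longlonglongrightarrow> (LINT x:(\<Union>n. {- real n..real n})|lebesgue. h x)"
    proof (rule set_integral_cont_up)
      show "incseq (\<lambda>n. {- real n..real n})" by (auto simp: incseq_def)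
    qed (auto intro: si)
    moreover have "(\<Union>n. {- real n..real n}) = UNIV"
    proof -
      have "\<exists>n. - real n \<le> x \<and> x \<le> real n" for x :: real
        using real_arch_simple[of "\<bar>x\<bar>"] by (auto simp: abs_le_iff minus_le_iff)
      then show ?thesis by auto
    qed
    ultimately have "(\<lambda>n. 0) \<longlonglongrightarrow> (LINT x:UNIV|lebesgue. h x)" by (simp add: zero)
    then show ?thesis using LIMSEQ_unique tendsto_const by blast
  qed
  have borel: "(LINT x:S|lebesgue. h x) = 0" if "S \<in> sets borel" for S
    using that
  proof (induction rule: borel_set_induct)
    case empty
    then show ?case by (simp add: set_lebesgue_integral_def)
  next
    case (interval a b)
    then show ?case by (rule zero)
  next
    case (compl S)
    have "(LINT x:S \<union> - S|lebesgue. h x) = (LINT x:S|lebesgue. h x) + (LINT x:- S|lebesgue. h x)"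
      using compl bs by (intro set_integral_Un si) auto
    then show ?case using compl univ by simp
  next
    case (union f)
    have "(LINT x:(\<Union>i. f i)|lebesgue. h x) = (\<Sum>i. LINT x:f i|lebesgue. h x)"
      using union bs by (intro lebesgue_integral_countable_add si sets.countable_UN) (auto simp: disjoint_family_on_def)
    then show ?case using union by simp
  qed
  \<comment> \<open>Up to a null set, a Lebesgue measurable set is a countable union of compact
    sets, hence Borel.\<close>
  have leb: "(LINT x:S|lebesgue. h x) = 0" if "S \<in> sets lebesgue" for S
  proof -
    obtain C T where CT: "fsigma C" "T \<in> null_sets lebesgue" "C \<union> T = S" "disjnt C T"
      using lebesgue_set_almost_fsigma[OF \<open>S \<in> sets lebesgue\<close>] .
    obtain F :: "nat \<Rightarrow> real set" where F: "range F \<subseteq> Collect compact" "C = \<Union> (range F)"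
      using CT(1) unfolding fsigma_Union_compact by blast
    have "F n \<in> sets borel" for n using F(1) by (intro borel_closed compact_imp_closed) auto
    then have C: "C \<in> sets borel" unfolding F(2) by (intro sets.countable_UN) auto
    have "(LINT x:C \<union> T|lebesgue. h x) = (LINT x:C|lebesgue. h x) + (LINT x:T|lebesgue. h x)"
      using CT bs[OF C] by (intro set_integral_Un si) (auto simp: disjnt_def)
    moreover have "(LINT x:T|lebesgue. h x) = 0"
      unfolding set_lebesgue_integral_def
      by (rule integral_eq_zero_AE) (use AE_not_in[OF CT(2)] in eventually_elim, simp)
    ultimately show ?thesis using borel[OF C] CT by simp
  qed
  \<comment> \<open>\<open>h\<close> and 0 are densities of the same set function, which is
    identically 0.\<close>
  show ?thesis using density_unique_real[of lebesgue h "\<lambda>_. 0"] int leb by simp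
qed

text \<open>The function is extended by 0 outside \<open>{A..B}\<close>, and the real case is
  applied to its real and imaginary parts.\<close>

lemma interval_integrals_zero_imp_AE_zero:
  fixes h :: "real \<Rightarrow> complex"
  assumes ai: "h absolutely_integrable_on {A..B}"
    and zero: "\<And>\<alpha> \<beta>. A \<le> \<alpha> \<Longrightarrow> \<alpha> \<le> \<beta> \<Longrightarrow> \<beta> \<le> B \<Longrightarrow> integral {\<alpha>..\<beta>} h = 0"
  shows "AE x in lebesgue. x \<in> {A..B} \<longrightarrow> h x = 0"
proof -
  let ?k = "\<lambda>x. indicator {A..B} x *\<^sub>R h x"
  have int: "integrable lebesgue ?k" using ai by (simp add: set_integrable_def)
  have z: "(LINT x:{a..b}|lebesgue. ?k x) = 0" if "a \<le> b" for a b
  proof -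
    have "(LINT x:{a..b}|lebesgue. ?k x) = (LINT x:{max a A..min b B}|lebesgue. h x)"
      unfolding set_lebesgue_integral_def
      by (intro Bochner_Integration.integral_cong refl) (auto simp: indicator_def)
    also have "\<dots> = integral {max a A..min b B} h"
      by (intro set_lebesgue_integral_eq_integral absolutely_integrable_on_subinterval[OF ai]) auto
    also have "\<dots> = 0" using zero[of "max a A" "min b B"] by (cases "max a A \<le> min b B") auto
    finally show ?thesis .
  qed
  have si: "set_integrable lebesgue {a..b} ?k" for a b
    unfolding set_integrable_def by (rule integrable_mult_indicator[OF _ int]) simp
  have ReIm: "(LINT x:{a..b}|lebesgue. Re (?k x)) = Re (LINT x:{a..b}|lebesgue. ?k x)"
    "(LINT x:{a..b}|lebesgue. Im (?k x)) = Im (LINT x:{a..b}|lebesgue. ?k x)" for a b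
    using si[of a b] unfolding set_integrable_def set_lebesgue_integral_def
    by (simp_all add: integral_Re[symmetric] integral_Im[symmetric] del: scaleR_scaleR)
  have "AE x in lebesgue. Re (?k x) = 0"
    by (rule interval_integrals_zero_imp_AE_zero_real[OF integrable_Re[OF int]]) (simp only: ReIm z zero_complex.sel)
  moreover have "AE x in lebesgue. Im (?k x) = 0"
    by (rule interval_integrals_zero_imp_AE_zero_real[OF integrable_Im[OF int]]) (simp only: ReIm z zero_complex.sel)
  ultimately show ?thesis by eventually_elim (auto simp: complex_eq_iff)
qed

section \<open>Weak derivatives and absolutely continuous representatives\<close>

text \<open>Absolute continuity in integral form. The density \<open>g\<close> matters only almost
  everywhere, and no pointwise derivative of \<open>F\<close> is mentioned.\<close>

definition primitive :: "real \<Rightarrow> (real \<Rightarrow> complex) \<Rightarrow> (real \<Rightarrow> complex) \<Rightarrow> bool" where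
  "primitive a F g \<longleftrightarrow> g absolutely_integrable_on {0..a} \<and>
     (\<forall>x\<in>{0..a}. F x = F 0 + integral {0..x} g)"

lemma primitiveD:
  assumes "primitive a F g"
  shows "g absolutely_integrable_on {0..a}" "x \<in> {0..a} \<Longrightarrow> F x = F 0 + integral {0..x} g"
  using assms unfolding primitive_def by blast+

lemma primitive_diff:
  assumes p: "primitive a F g" and x: "0 \<le> x" "x \<le> y" "y \<le> a"
  shows "integral {x..y} g = F y - F x"
proof -
  have "g absolutely_integrable_on {0..y}"
    by (rule absolutely_integrable_on_subinterval[OF primitiveD(1)[OF p]]) (use x in auto)
  then have "g integrable_on {0..y}" by (rule set_lebesgue_integral_eq_integral(1))
  then have "integral {0..x} g + integral {x..y} g = integral {0..y} g"
    by (rule Henstock_Kurzweil_Integration.integral_combine[OF x(1,2)])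
  moreover have "F x = F 0 + integral {0..x} g" "F y = F 0 + integral {0..y} g"
    by (rule primitiveD(2)[OF p], use x in simp)+
  ultimately show ?thesis by (simp add: algebra_simps)
qed

lemma primitive_continuous: "primitive a F g \<Longrightarrow> continuous_on {0..a} F"
proof -
  assume p: "primitive a F g"
  have "continuous_on {0..a} (\<lambda>x. F 0 + integral {0..x} g)"
    by (intro continuous_intros indefinite_integral_continuous_1 set_lebesgue_integral_eq_integral(1) primitiveD(1)[OF p])
  then show ?thesis by (rule continuous_on_eq) (rule primitiveD(2)[OF p, symmetric])
qed

lemma primitive_of_continuous:
  assumes d: "\<And>x. x \<in> {0..a} \<Longrightarrow> (F has_vector_derivative g x) (at x within {0..a})"
    and c: "continuous_on {0..a} g"
  shows "primitive a F g"
  unfolding primitive_def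
proof (intro conjI ballI)
  show "g absolutely_integrable_on {0..a}" by (rule absolutely_integrable_continuous_real[OF c])
  fix x assume x: "x \<in> {0..a}"
  have "(g has_integral (F x - F 0)) {0..x}"
    using x by (intro fundamental_theorem_of_calculus has_vector_derivative_within_subset[OF d]) auto
  then show "F x = F 0 + integral {0..x} g" by (simp add: integral_unique)
qed

lemma primitive_has_vector_derivative:
  assumes p: "primitive a F g" and c: "continuous_on {0..a} g" and x: "x \<in> {0..a}"
  shows "(F has_vector_derivative g x) (at x within {0..a})"
proof -
  have "((\<lambda>x. F 0 + integral {0..x} g) has_vector_derivative (0 + g x)) (at x within {0..a})"
    by (intro derivative_intros integral_has_vector_derivative c x)
  then have "((\<lambda>x. F 0 + integral {0..x} g) has_vector_derivative g x) (at x within {0..a})" by simp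
  with x primitiveD(2)[OF p] show ?thesis by (rule has_vector_derivative_transform)
qed

lemma absolutely_integrable_mult_continuous:
  fixes f g :: "real \<Rightarrow> complex"
  assumes g: "g absolutely_integrable_on {a..b}" and v: "continuous_on {a..b} v"
  shows "(\<lambda>x. g x * v x) absolutely_integrable_on {a..b}"
proof -
  have "(\<lambda>x. v x * g x) absolutely_integrable_on {a..b}"
  proof (rule absolutely_integrable_bounded_measurable_product[OF bilinear_times _ _ _ g])
    show "v \<in> borel_measurable (lebesgue_on {a..b})"
      by (intro continuous_imp_measurable_on_sets_lebesgue v) auto
    show "bounded (v ` {a..b})" by (intro compact_imp_bounded compact_continuous_image v) auto
  qed auto
  then show ?thesis by (simp add: mult.commute)
qed

text \<open>Continuity of \<open>H\<close> makes the difference quotients of \<open>\<Phi>\<close>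
  tend to 0 at every point, so no exceptional null set has to be handled.\<close>

lemma constant_if_increments_small:
  fixes \<Phi> :: "real \<Rightarrow> complex" and H :: "real \<Rightarrow> real"
  assumes H: "continuous_on {0..a} H"
    and b: "\<And>x y. 0 \<le> x \<Longrightarrow> x \<le> y \<Longrightarrow> y \<le> a \<Longrightarrow> cmod (\<Phi> y - \<Phi> x) \<le> (y - x) * \<bar>H y - H x\<bar>"
    and x: "x \<in> {0..a}"
  shows "\<Phi> x = \<Phi> 0"
proof -
  have b': "norm (\<Phi> y - \<Phi> x) \<le> \<bar>H y - H x\<bar> * norm (y - x)" if "x \<in> {0..a}" "y \<in> {0..a}" for x y
  proof (cases "x \<le> y")
    case True
    then show ?thesis using b[of x y] that by (simp add: mult.commute)
  next
    case False
    then show ?thesis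
      using b[of y x] that norm_minus_commute[of "\<Phi> y" "\<Phi> x"] abs_minus_commute[of "H y" "H x"] by (simp add: mult.commute)
  qed
  have "(\<Phi> has_derivative (\<lambda>h. 0)) (at x within {0..a})" if x: "x \<in> {0..a}" for x
    unfolding has_derivative_within_alt2
  proof (intro conjI allI impI)
    fix e :: real assume e: "0 < e"
    have "(H \<longlongrightarrow> H x) (at x within {0..a})" using H x by (simp add: continuous_on_def)
    from tendstoD[OF this e]
    have "\<forall>\<^sub>F y in at x within {0..a}. dist (H y) (H x) < e" .
    moreover have "\<forall>\<^sub>F y in at x within {0..a}. y \<in> {0..a}" by (simp add: eventually_at_filter)
    ultimately show "\<forall>\<^sub>F y in at x within {0..a}. norm (\<Phi> y - \<Phi> x - 0) \<le> e * norm (y - x)"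
    proof eventually_elim
      case (elim y)
      then have "norm (\<Phi> y - \<Phi> x) \<le> \<bar>H y - H x\<bar> * norm (y - x)" by (intro b' x)
      also have "\<dots> \<le> e * norm (y - x)" using elim by (intro mult_right_mono) (auto simp: dist_real_def)
      finally show ?case by simp
    qed
  qed simp
  then obtain c where "\<And>x. x \<in> {0..a} \<Longrightarrow> \<Phi> x = c"
    using has_derivative_zero_constant[of "{0..a}" \<Phi>] by auto
  then show ?thesis using x by simp
qed

text \<open>The difference of the two sides of the product rule has increments over \<open>[x, y]\<close> that are
  bounded by \<open>y - x\<close> times the increment of a continuous function, hence it is constant.\<close>

lemma primitive_mult:
  fixes v v' :: "real \<Rightarrow> complex"
  assumes p: "primitive a F g"
    and v: "\<And>x. x \<in> {0..a} \<Longrightarrow> (v has_vector_derivative v' x) (at x within {0..a})"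
    and v': "continuous_on {0..a} v'"
  shows "primitive a (\<lambda>x. F x * v x) (\<lambda>x. g x * v x + F x * v' x)"
proof -
  have g: "g absolutely_integrable_on {0..a}" by (rule primitiveD(1)[OF p])
  have cF: "continuous_on {0..a} F" by (rule primitive_continuous[OF p])
  have cv: "continuous_on {0..a} v" using v has_vector_derivative_continuous continuous_on_eq_continuous_within by blast
  have pv: "primitive a v v'" by (rule primitive_of_continuous[OF v v'])
  let ?p = "\<lambda>x. g x * v x + F x * v' x"
  have ai: "?p absolutely_integrable_on {0..a}"
    by (intro set_integral_add(1) absolutely_integrable_mult_continuous[OF g cv]
        absolutely_integrable_continuous_real continuous_intros cF v')
  have sub: "f integrable_on {x..y}" if "f absolutely_integrable_on {0..a}" "0 \<le> x" "y \<le> a" for f :: "real \<Rightarrow> complex" and x y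
    using absolutely_integrable_on_subinterval[OF that(1), where a = x and b = y] that(2,3) by (auto simp: absolutely_integrable_on_def)
  obtain C where "0 < C" and C: "\<forall>y\<in>v' ` {0..a}. cmod y \<le> C"
    using compact_imp_bounded[OF compact_continuous_image[OF v' compact_Icc]] unfolding bounded_pos by blast
  then have C: "0 \<le> C" "\<And>x. x \<in> {0..a} \<Longrightarrow> cmod (v' x) \<le> C" by auto
  define H where "H x = 2 * C * integral {0..x} (\<lambda>s. cmod (g s))" for x
  have ng: "(\<lambda>s. cmod (g s)) integrable_on {x..y}" if "0 \<le> x" "y \<le> a" for x y
    using absolutely_integrable_on_subinterval[OF g, where a = x and b = y] that by (auto simp: absolutely_integrable_on_def)
  define \<Phi> where "\<Phi> x = F x * v x - integral {0..x} ?p" for x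
  have const: "\<Phi> x = \<Phi> 0" if "x \<in> {0..a}" for x
  proof (rule constant_if_increments_small[OF _ _ that])
    show "continuous_on {0..a} H"
      unfolding H_def by (intro continuous_intros indefinite_integral_continuous_1 ng) auto
    fix x y assume xy: "0 \<le> x" "x \<le> y" "y \<le> a"
    have vb: "cmod (v z - v x) \<le> C * (y - x)" if "x \<le> z" "z \<le> y" for z
    proof -
      have "cmod (integral {x..z} v') \<le> C * (z - x)"
        using that xy C by (intro integral_bound continuous_on_subset[OF v']) auto
      also have "\<dots> \<le> C * (y - x)" using C that by (intro mult_left_mono) auto
      finally show ?thesis using primitive_diff[OF pv, of x z] that xy by simp
    qed
    let ?G = "integral {x..y} (\<lambda>s. cmod (g s))"
    have Fb: "cmod (F y - F s) \<le> ?G" if "x \<le> s" "s \<le> y" for s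
    proof -
      have "cmod (integral {s..y} g) \<le> integral {s..y} (\<lambda>s. cmod (g s))"
        using that xy by (intro integral_norm_bound_integral sub[OF g] ng) auto
      also have "\<dots> \<le> ?G" using that xy by (intro integral_subset_le ng) auto
      finally show ?thesis using primitive_diff[OF p, of s y] that xy by simp
    qed
    have G0: "0 \<le> ?G" using xy by (intro integral_nonneg ng) auto
    \<comment> \<open>Freezing \<open>v\<close> at \<open>x\<close> and \<open>F\<close> at
      \<open>y\<close> reproduces the increment of the product exactly; \<open>?q\<close> is the
      integrand of the error made by freezing.\<close>
    let ?q = "\<lambda>s. g s * (v x - v s) + (F y - F s) * v' s"
    have i1: "integral {x..y} (\<lambda>s. g s * v x) = (F y - F x) * v x"
      using primitive_diff[OF p xy] by simp
    have i2: "integral {x..y} (\<lambda>s. F y * v' s) = F y * (v y - v x)"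
      using primitive_diff[OF pv xy] by simp
    have int1: "(\<lambda>s. g s * v x) integrable_on {x..y}" using sub[OF g] xy by (intro integrable_on_mult_left) auto
    have int2: "(\<lambda>s. F y * v' s) integrable_on {x..y}"
      using xy by (intro integrable_on_mult_right integrable_continuous_real continuous_on_subset[OF v']) auto
    have int3: "?p integrable_on {x..y}" using sub[OF ai] xy by auto
    have "integral {0..y} ?p = integral {0..x} ?p + integral {x..y} ?p"
      using xy sub[OF ai, of 0 y] by (intro Henstock_Kurzweil_Integration.integral_combine[symmetric]) auto
    then have "\<Phi> y - \<Phi> x = (F y - F x) * v x + F y * (v y - v x) - integral {x..y} ?p"
      unfolding \<Phi>_def by (simp add: algebra_simps)
    also have "\<dots> = integral {x..y} (\<lambda>s. g s * v x) + integral {x..y} (\<lambda>s. F y * v' s) - integral {x..y} ?p"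
      unfolding i1 i2 ..
    also have "\<dots> = integral {x..y} (\<lambda>s. g s * v x + F y * v' s - ?p s)"
      using int1 int2 int3 by (simp add: Henstock_Kurzweil_Integration.integral_add Henstock_Kurzweil_Integration.integral_diff integrable_add)
    also have "(\<lambda>s. g s * v x + F y * v' s - ?p s) = ?q" by (simp add: fun_eq_iff algebra_simps)
    finally have eq: "\<Phi> y - \<Phi> x = integral {x..y} ?q" .
    have "cmod (integral {x..y} ?q) \<le> integral {x..y} (\<lambda>s. C * (y - x) * cmod (g s) + C * ?G)"
    proof (rule integral_norm_bound_integral)
      show "?q integrable_on {x..y}"
      proof -
        have "(\<lambda>s. g s * v x + F y * v' s - ?p s) integrable_on {x..y}"
          by (intro integrable_diff integrable_add int1 int2 int3)
        then show ?thesis by (rule integrable_eq) (simp add: algebra_simps)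
      qed
      show "(\<lambda>s. C * (y - x) * cmod (g s) + C * ?G) integrable_on {x..y}"
        using xy by (intro integrable_add integrable_on_mult_right ng) auto
      fix s assume s: "s \<in> {x..y}"
      have "cmod (?q s) \<le> cmod (g s) * cmod (v s - v x) + cmod (F y - F s) * cmod (v' s)"
        by (rule order_trans[OF norm_triangle_ineq]) (simp add: norm_mult norm_minus_commute)
      also have "\<dots> \<le> cmod (g s) * (C * (y - x)) + ?G * C"
        using vb[of s] Fb[of s] C(2)[of s] s xy G0 by (intro add_mono mult_mono) auto
      finally show "cmod (?q s) \<le> C * (y - x) * cmod (g s) + C * ?G" by (simp add: mult_ac)
    qed
    also have "\<dots> = C * (y - x) * ?G + C * ?G * (y - x)"
      using xy by (subst Henstock_Kurzweil_Integration.integral_add) (auto intro!: integrable_on_mult_right ng simp: mult_ac)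
    also have "\<dots> = (y - x) * (2 * C * ?G)" by (simp add: algebra_simps)
    also have "2 * C * ?G = H y - H x"
    proof -
      have "integral {0..x} (\<lambda>s. cmod (g s)) + ?G = integral {0..y} (\<lambda>s. cmod (g s))"
        using xy by (intro Henstock_Kurzweil_Integration.integral_combine ng) auto
      then show ?thesis unfolding H_def by (simp add: algebra_simps flip: distrib_left)
    qed
    also have "(y - x) * (H y - H x) \<le> (y - x) * \<bar>H y - H x\<bar>" using xy by (intro mult_left_mono) auto
    finally show "cmod (\<Phi> y - \<Phi> x) \<le> (y - x) * \<bar>H y - H x\<bar>" unfolding eq .
  qed
  show ?thesis unfolding primitive_def
  proof (intro conjI ballI ai)
    fix x assume "x \<in> {0..a}"
    from const[OF this] show "F x * v x = F 0 * v 0 + integral {0..x} ?p" by (simp add: \<Phi>_def algebra_simps)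
  qed
qed

lemma integral_restrict_eq_lebesgue:
  fixes f :: "real \<Rightarrow> 'b::{banach, second_countable_topology}"
  assumes "\<And>x. x \<notin> {0<..<a} \<Longrightarrow> f x = 0"
  shows "(LINT x|lebesgue_on {0<..<a}. f x) = (LINT x|lebesgue. f x)"
    "integrable (lebesgue_on {0<..<a}) f \<longleftrightarrow> integrable lebesgue f"
proof -
  have "(\<lambda>x. indicator {0<..<a} x *\<^sub>R f x) = f" using assms by (auto simp: fun_eq_iff indicator_def)
  then show "(LINT x|lebesgue_on {0<..<a}. f x) = (LINT x|lebesgue. f x)"
    "integrable (lebesgue_on {0<..<a}) f \<longleftrightarrow> integrable lebesgue f"
    by (simp_all add: integral_restrict_space integrable_restrict_space)
qed

text \<open>Mediates between almost everywhere statements of Lebesgue integration and negligible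
  sets of gauge integration.\<close>

lemma AE_interval_iff_negligible:
  "(AE x in lebesgue_on {0<..<a::real}. P x) \<longleftrightarrow> negligible {x \<in> {0<..<a}. \<not> P x}"
proof -
  have "(AE x in lebesgue_on {0<..<a}. P x) \<longleftrightarrow> (AE x in lebesgue. x \<in> {0<..<a} \<longrightarrow> P x)"
    by (rule AE_restrict_space_iff) simp
  also have "\<dots> \<longleftrightarrow> (\<exists>N. negligible N \<and> {x. \<not> (x \<in> {0<..<a} \<longrightarrow> P x)} \<subseteq> N)"
    by (rule eventually_ae_filter_negligible)
  also have "{x. \<not> (x \<in> {0<..<a} \<longrightarrow> P x)} = {x \<in> {0<..<a}. \<not> P x}" by auto
  also have "(\<exists>N. negligible N \<and> {x \<in> {0<..<a}. \<not> P x} \<subseteq> N) \<longleftrightarrow> negligible {x \<in> {0<..<a}. \<not> P x}"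
    using negligible_subset by blast
  finally show ?thesis .
qed

lemma loc_integrable_subset:
  assumes "f absolutely_integrable_on {0..a}" shows "loc_integrable a f"
  unfolding loc_integrable_def
proof (intro allI impI)
  fix K :: "real set" assume K: "compact K \<and> K \<subseteq> {0<..<a}"
  then have "K \<in> sets lebesgue" by (simp add: lmeasurable_compact fmeasurableD)
  then show "f absolutely_integrable_on K"
    by (rule set_integrable_subset[OF assms]) (use K in auto)
qed

lemma loc_integrable_diff: "loc_integrable a f \<Longrightarrow> loc_integrable a g \<Longrightarrow> loc_integrable a (\<lambda>x. f x - g x)"
  unfolding loc_integrable_def using set_integral_diff(1) by blast

lemma loc_integrable_const: "loc_integrable a (\<lambda>x. c)"
  by (intro loc_integrable_subset absolutely_integrable_continuous_real continuous_intros)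

lemma test_functionD:
  assumes "test_function a \<phi>"
  shows "\<And>x. (\<phi> has_real_derivative deriv \<phi> x) (at x)" "smooth (deriv \<phi>)"
    "continuous_on S \<phi>" "continuous_on S (deriv \<phi>)"
    "\<exists>K. compact K \<and> K \<subseteq> {0<..<a} \<and> (\<forall>x. x \<notin> K \<longrightarrow> \<phi> x = 0 \<and> deriv \<phi> x = 0)"
proof -
  have s: "smooth \<phi>" using assms by (simp add: test_function_iff)
  show d: "(\<phi> has_real_derivative deriv \<phi> x) (at x)" for x by (rule smooth_deriv(2)[OF s])
  show s': "smooth (deriv \<phi>)" by (rule smooth_deriv(1)[OF s])
  show "continuous_on S \<phi>" using d DERIV_isCont continuous_at_imp_continuous_on by blast
  show "continuous_on S (deriv \<phi>)" using smooth_deriv(2)[OF s'] DERIV_isCont continuous_at_imp_continuous_on by blast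
  obtain K where K: "compact K" "K \<subseteq> {0<..<a}" "\<And>x. x \<notin> K \<Longrightarrow> \<phi> x = 0"
    using assms by (auto simp: test_function_def)
  have "deriv \<phi> x = 0" if x: "x \<notin> K" for x
  proof -
    have "((\<lambda>x. 0) has_real_derivative 0) (at x)" by simp
    then have "(\<phi> has_real_derivative 0) (at x)"
      by (rule has_field_derivative_transform_within_open[of _ _ _ "- K"])
        (use x K compact_imp_closed in \<open>auto simp: open_Compl\<close>)
    then show ?thesis by (rule DERIV_imp_deriv)
  qed
  then show "\<exists>K. compact K \<and> K \<subseteq> {0<..<a} \<and> (\<forall>x. x \<notin> K \<longrightarrow> \<phi> x = 0 \<and> deriv \<phi> x = 0)"
    using K by blast
qed

lemma loc_integrable_times_compact_support:
  assumes h: "loc_integrable a h" and K: "compact K" "K \<subseteq> {0<..<a}" "\<And>x. x \<notin> K \<Longrightarrow> \<phi> x = 0"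
    and c: "continuous_on K \<phi>"
  shows "integrable lebesgue (\<lambda>x. h x * complex_of_real (\<phi> x))"
proof -
  have KL: "K \<in> sets lebesgue" using K by (simp add: lmeasurable_compact fmeasurableD)
  have cc: "continuous_on K (\<lambda>x. complex_of_real (\<phi> x))" by (intro continuous_intros c)
  have "(\<lambda>x. complex_of_real (\<phi> x) * h x) absolutely_integrable_on K"
  proof (rule absolutely_integrable_bounded_measurable_product[OF bilinear_times _ KL])
    show "(\<lambda>x. complex_of_real (\<phi> x)) \<in> borel_measurable (lebesgue_on K)"
      by (rule continuous_imp_measurable_on_sets_lebesgue[OF cc KL])
    show "bounded ((\<lambda>x. complex_of_real (\<phi> x)) ` K)"
      by (rule compact_imp_bounded[OF compact_continuous_image[OF cc K(1)]])
    show "h absolutely_integrable_on K" using h K by (simp add: loc_integrable_def)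
  qed
  moreover have "(\<lambda>x. indicator K x *\<^sub>R (complex_of_real (\<phi> x) * h x)) = (\<lambda>x. h x * complex_of_real (\<phi> x))"
    using K(3) by (auto simp: fun_eq_iff indicator_def)
  ultimately show ?thesis by (simp add: set_integrable_def)
qed

lemma test_function_integrable:
  assumes h: "loc_integrable a h" and t: "test_function a \<phi>"
  shows "integrable (lebesgue_on {0<..<a}) (\<lambda>x. h x * complex_of_real (\<phi> x))"
    "integrable (lebesgue_on {0<..<a}) (\<lambda>x. h x * complex_of_real (deriv \<phi> x))"
proof -
  obtain K where K: "compact K" "K \<subseteq> {0<..<a}" "\<And>x. x \<notin> K \<Longrightarrow> \<phi> x = 0" "\<And>x. x \<notin> K \<Longrightarrow> deriv \<phi> x = 0"
    using test_functionD(5)[OF t] by blast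
  have nK: "x \<notin> K" if "x \<notin> {0<..<a}" for x using K(2) that by blast
  have z: "h x * complex_of_real (\<phi> x) = 0" "h x * complex_of_real (deriv \<phi> x) = 0" if "x \<notin> {0<..<a}" for x
    using K(3,4)[OF nK[OF that]] by simp_all
  show "integrable (lebesgue_on {0<..<a}) (\<lambda>x. h x * complex_of_real (\<phi> x))"
    by (rule iffD2[OF integral_restrict_eq_lebesgue(2)], rule z(1), assumption)
      (rule loc_integrable_times_compact_support[OF h K(1,2,3) test_functionD(3)[OF t]])
  show "integrable (lebesgue_on {0<..<a}) (\<lambda>x. h x * complex_of_real (deriv \<phi> x))"
    by (rule iffD2[OF integral_restrict_eq_lebesgue(2)], rule z(2), assumption)
      (rule loc_integrable_times_compact_support[OF h K(1,2,4) test_functionD(4)[OF t]])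
qed

text \<open>The fundamental lemma of the calculus of variations. Dominated convergence along
  plateaus gives vanishing integrals over compact subintervals; as \<open>h\<close> is only locally
  integrable, the open interval is then exhausted by such subintervals.\<close>

lemma AE_zero_if_plateau_integrals_zero:
  assumes h: "loc_integrable a h"
    and z: "\<And>\<alpha> \<beta> \<epsilon>. 0 < \<alpha> \<Longrightarrow> \<alpha> < \<beta> \<Longrightarrow> \<beta> < a \<Longrightarrow> 0 < \<epsilon> \<Longrightarrow>
      (LINT x|lebesgue_on {0<..<a}. h x * complex_of_real (plateau \<alpha> \<beta> \<epsilon> x)) = 0"
  shows "AE x in lebesgue_on {0<..<a}. h x = 0"
proof -
  have ai: "h absolutely_integrable_on {\<alpha>..\<beta>}" if "0 < \<alpha>" "\<beta> < a" for \<alpha> \<beta>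
    using h[unfolded loc_integrable_def, rule_format, of "{\<alpha>..\<beta>}"] that by fastforce
  have zero: "integral {\<alpha>..\<beta>} h = 0" if ab: "0 < \<alpha>" "\<alpha> < \<beta>" "\<beta> < a" for \<alpha> \<beta>
  proof -
    let ?s = "\<lambda>n x. h x * complex_of_real (plateau \<alpha> \<beta> (inverse (real (Suc n))) x)"
    let ?f = "\<lambda>x. indicator {\<alpha><..<\<beta>} x *\<^sub>R h x"
    let ?k = "\<lambda>x. indicator {\<alpha>..\<beta>} x *\<^sub>R h x"
    have k: "integrable lebesgue ?k" using ai[OF ab(1,3)] by (simp add: set_integrable_def)
    have eq: "?f = (\<lambda>x. indicator {\<alpha><..<\<beta>} x *\<^sub>R ?k x)"
    proof
      show "?f x = indicator {\<alpha><..<\<beta>} x *\<^sub>R ?k x" for x by (cases "x \<in> {\<alpha><..<\<beta>}") auto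
    qed
    have fint: "set_integrable lebesgue {\<alpha><..<\<beta>} h"
      unfolding set_integrable_def by (subst eq) (intro integrable_mult_indicator k, simp)
    have sint: "integrable lebesgue (?s n)" for n
    proof (rule loc_integrable_times_compact_support[OF h])
      show "compact {\<alpha>..\<beta>}" "{\<alpha>..\<beta>} \<subseteq> {0<..<a}" using ab by auto
      show "continuous_on {\<alpha>..\<beta>} (plateau \<alpha> \<beta> (inverse (real (Suc n))))"
        using smooth_deriv(2)[OF smooth_plateau] DERIV_isCont continuous_at_imp_continuous_on
        by (metis inverse_positive_iff_positive of_nat_0_less_iff zero_less_Suc)
    qed (auto simp: bump_def)
    have "(\<lambda>n. LINT x|lebesgue. ?s n x) \<longlonglongrightarrow> (LINT x|lebesgue. ?f x)"
    proof (rule integral_dominated_convergence[where w = "\<lambda>x. norm (?k x)"])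
      show "?f \<in> borel_measurable lebesgue" using fint by (simp add: set_integrable_def borel_measurable_integrable)
      show "?s n \<in> borel_measurable lebesgue" for n using sint by (rule borel_measurable_integrable)
      show "integrable lebesgue (\<lambda>x. norm (?k x))" by (rule integrable_norm[OF k])
      show "AE x in lebesgue. (\<lambda>n. ?s n x) \<longlonglongrightarrow> ?f x"
      proof (rule AE_I2)
        fix x
        have "(\<lambda>n. ?s n x) \<longlonglongrightarrow> h x * complex_of_real (indicator {\<alpha><..<\<beta>} x)"
          by (intro tendsto_intros plateau_tendsto)
        then show "(\<lambda>n. ?s n x) \<longlonglongrightarrow> ?f x" by (simp add: scaleR_conv_of_real mult.commute)
      qed
      show "AE x in lebesgue. norm (?s n x) \<le> norm (?k x)" for n
      proof (rule AE_I2)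
        fix x
        have p: "0 \<le> plateau \<alpha> \<beta> (inverse (real (Suc n))) x" "plateau \<alpha> \<beta> (inverse (real (Suc n))) x \<le> indicator {\<alpha><..<\<beta>} x"
          by (rule plateau_bounds, simp)+
        have "norm (?s n x) = norm (h x) * plateau \<alpha> \<beta> (inverse (real (Suc n))) x" using p(1) by (simp add: norm_mult)
        also have "\<dots> \<le> norm (h x) * indicator {\<alpha>..\<beta>} x"
        proof (rule mult_left_mono[OF order_trans[OF p(2)]])
          show "indicator {\<alpha><..<\<beta>} x \<le> (indicator {\<alpha>..\<beta>} x :: real)" by (auto simp: indicator_def)
        qed simp
        finally show "norm (?s n x) \<le> norm (?k x)" by (simp add: mult.commute)
      qed
    qed
    moreover have "(LINT x|lebesgue. ?s n x) = 0" for n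
    proof -
      have "(LINT x|lebesgue_on {0<..<a}. ?s n x) = (LINT x|lebesgue. ?s n x)"
        by (rule integral_restrict_eq_lebesgue) (use ab in \<open>auto simp: bump_def\<close>)
      then show ?thesis using z[OF ab, of "inverse (real (Suc n))"] by simp
    qed
    ultimately have "(LINT x|lebesgue. ?f x) = 0" using LIMSEQ_unique tendsto_const by (metis (lifting) ext)
    then have "integral {\<alpha><..<\<beta>} h = 0"
      using set_lebesgue_integral_eq_integral(2)[OF fint] by (simp add: set_lebesgue_integral_def)
    then show ?thesis by (simp add: integral_open_interval_real)
  qed
  \<comment> \<open>Positive margins that tend to 0, so that the intervals between
    \<open>?A n\<close> and \<open>a - ?A n\<close> exhaust the open interval.\<close>
  let ?A = "\<lambda>n. a / (real n + 3)"
  have AE: "AE x in lebesgue. \<forall>n. x \<in> {?A n..a - ?A n} \<longrightarrow> h x = 0" if a: "0 < a"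
    unfolding AE_all_countable
  proof
    fix n
    have p: "0 < ?A n" using a by simp
    show "AE x in lebesgue. x \<in> {?A n..a - ?A n} \<longrightarrow> h x = 0"
    proof (rule interval_integrals_zero_imp_AE_zero)
      show "h absolutely_integrable_on {?A n..a - ?A n}" using p by (intro ai) auto
      show "integral {\<alpha>..\<beta>} h = 0" if "?A n \<le> \<alpha>" "\<alpha> \<le> \<beta>" "\<beta> \<le> a - ?A n" for \<alpha> \<beta>
        using zero[of \<alpha> \<beta>] that p by (cases "\<alpha> = \<beta>") auto
    qed
  qed
  have cover: "\<exists>n. x \<in> {?A n..a - ?A n}" if x: "0 < x" "x < a" for x
  proof -
    obtain n where n: "a / min x (a - x) \<le> real n" using real_arch_simple by blast
    have m: "0 < min x (a - x)" using x by simp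
    have "a \<le> real n * min x (a - x)" using n m by (simp add: pos_divide_le_eq)
    also have "\<dots> \<le> (real n + 3) * min x (a - x)" using m by (intro mult_right_mono) auto
    finally have le: "a \<le> min x (a - x) * (real n + 3)" by (simp only: mult.commute)
    have "?A n \<le> min x (a - x)" unfolding pos_divide_le_eq[of "real n + 3", simplified] by (rule le)
    then show ?thesis by (intro exI[of _ n]) auto
  qed
  have "AE x in lebesgue. x \<in> {0<..<a} \<longrightarrow> h x = 0"
  proof (cases "0 < a")
    case True
    from AE[OF this] show ?thesis by eventually_elim (use cover in auto)
  qed auto
  then show ?thesis by (subst AE_restrict_space_iff) simp_all
qed

lemma is_weak_deriv_unique:
  assumes "is_weak_deriv a f g" "is_weak_deriv a f g'"
  shows "AE x in lebesgue_on {0<..<a}. g x = g' x"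
proof -
  have loc: "loc_integrable a g" "loc_integrable a g'" using assms by (auto simp: is_weak_deriv_def)
  have "AE x in lebesgue_on {0<..<a}. g x - g' x = 0"
  proof (rule AE_zero_if_plateau_integrals_zero[OF loc_integrable_diff[OF loc]])
    fix \<alpha> \<beta> \<epsilon> :: real assume "0 < \<alpha>" "\<alpha> < \<beta>" "\<beta> < a" "0 < \<epsilon>"
    then have t: "test_function a (plateau \<alpha> \<beta> \<epsilon>)" by (intro test_function_plateau)
    show "(LINT x|lebesgue_on {0<..<a}. (g x - g' x) * complex_of_real (plateau \<alpha> \<beta> \<epsilon> x)) = 0"
      using assms t test_function_integrable(1)[OF loc(1) t] test_function_integrable(1)[OF loc(2) t]
      unfolding is_weak_deriv_def by (simp add: left_diff_distrib)
  qed
  then show ?thesis by simp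
qed

lemma plateau_integral_subset:
  assumes "A \<le> \<alpha>" "\<beta> \<le> B"
  shows "integral {A..B} (plateau \<alpha> \<beta> \<epsilon>) = integral {\<alpha>..\<beta>} (plateau \<alpha> \<beta> \<epsilon>)"
proof -
  have "{\<alpha>..\<beta>} \<inter> {A..B} = {\<alpha>..\<beta>}" using assms by auto
  then have "integral {A..B} (\<lambda>x. if x \<in> {\<alpha>..\<beta>} then plateau \<alpha> \<beta> \<epsilon> x else 0) = integral {\<alpha>..\<beta>} (plateau \<alpha> \<beta> \<epsilon>)"
    by (simp only: Henstock_Kurzweil_Integration.integral_restrict_Int)
  moreover have "(\<lambda>x. if x \<in> {\<alpha>..\<beta>} then plateau \<alpha> \<beta> \<epsilon> x else 0) = plateau \<alpha> \<beta> \<epsilon>"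
    by (auto simp: fun_eq_iff bump_def)
  ultimately show ?thesis by simp
qed

text \<open>The lemma of du Bois-Reymond. A plateau minus the multiple of \<open>\<psi>0\<close>
  with the same integral has mean 0, hence is the derivative of a test function. Testing with it
  shows that \<open>h\<close> integrates against plateaus like the constant
  \<open>c\<close>.\<close>

lemma AE_constant_if_weak_deriv_zero:
  assumes h: "loc_integrable a h" and a: "0 < a"
    and z: "\<And>\<phi>. test_function a \<phi> \<Longrightarrow> (LINT x|lebesgue_on {0<..<a}. h x * complex_of_real (deriv \<phi> x)) = 0"
  shows "\<exists>c. AE x in lebesgue_on {0<..<a}. h x = c"
proof -
  let ?M = "lebesgue_on {0<..<a}"
  \<comment> \<open>A fixed test function with positive integral; \<open>c\<close> will be the mean
    of \<open>h\<close> with weight \<open>\<psi>0\<close>.\<close>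
  define \<psi>0 where "\<psi>0 = plateau (a / 4) (a / 2) 1"
  define I0 where "I0 = integral {a / 4..a / 2} \<psi>0"
  have I0: "0 < I0" unfolding I0_def \<psi>0_def using a by (intro plateau_integral_pos) auto
  have t0: "test_function a \<psi>0" unfolding \<psi>0_def using a by (intro test_function_plateau) auto
  have s0: "smooth \<psi>0" unfolding \<psi>0_def by (rule smooth_plateau) simp
  define c where "c = (LINT x|?M. h x * complex_of_real (\<psi>0 x)) / of_real I0"
  have "AE x in ?M. h x - c = 0"
  proof (rule AE_zero_if_plateau_integrals_zero[OF loc_integrable_diff[OF h loc_integrable_const]])
    fix \<alpha> \<beta> \<epsilon> :: real assume ab: "0 < \<alpha>" "\<alpha> < \<beta>" "\<beta> < a" "0 < \<epsilon>"
    define \<psi> where "\<psi> = plateau \<alpha> \<beta> \<epsilon>"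
    define I where "I = integral {\<alpha>..\<beta>} \<psi>"
    have t: "test_function a \<psi>" unfolding \<psi>_def using ab by (intro test_function_plateau)
    have s: "smooth \<psi>" unfolding \<psi>_def using ab by (intro smooth_plateau)
    define A B where "A = min \<alpha> (a / 4)" and "B = max \<beta> (a / 2)"
    have cont: "continuous_on S \<psi>" "continuous_on S \<psi>0" for S
      using test_functionD(3)[OF t] test_functionD(3)[OF t0] by auto
    have ints: "\<psi> integrable_on {x..y}" "\<psi>0 integrable_on {x..y}" for x y
      by (intro integrable_continuous_real cont)+
    let ?f = "\<lambda>x. \<psi> x - I / I0 * \<psi>0 x"
    have "\<exists>\<phi>. test_function a \<phi> \<and> (\<forall>x. deriv \<phi> x = ?f x)"
    proof (rule test_function_antiderivative[of _ A B])
      show "smooth ?f" by (rule smooth_diff_scaled[OF s s0])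
      show "?f x = 0" if "x \<notin> {A..B}" for x
        using that by (auto simp: \<psi>_def \<psi>0_def bump_def A_def B_def)
      show "0 < A" "A \<le> B" "B < a" using ab a by (auto simp: A_def B_def)
      have "integral {A..B} ?f = integral {A..B} \<psi> - I / I0 * integral {A..B} \<psi>0"
        using Henstock_Kurzweil_Integration.integral_diff[OF ints(1) integrable_on_mult_right[OF ints(2)], of A B "I / I0"]
        by (simp only: Henstock_Kurzweil_Integration.integral_mult_right)
      also have "integral {A..B} \<psi> = I" unfolding \<psi>_def I_def
        by (rule plateau_integral_subset) (auto simp: A_def B_def)
      also have "integral {A..B} \<psi>0 = I0" unfolding \<psi>0_def I0_def
        by (rule plateau_integral_subset) (auto simp: A_def B_def)
      finally show "integral {A..B} ?f = 0" using I0 by simp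
    qed
    then obtain \<phi> where \<phi>: "test_function a \<phi>" "\<And>x. deriv \<phi> x = ?f x" by blast
    note i = test_function_integrable(1)[OF h t] test_function_integrable(1)[OF h t0]
    have "0 = (LINT x|?M. h x * complex_of_real (\<psi> x) - of_real (I / I0) * (h x * complex_of_real (\<psi>0 x)))"
      using z[OF \<phi>(1)] by (simp add: \<phi>(2) algebra_simps)
    also have "\<dots> = (LINT x|?M. h x * complex_of_real (\<psi> x)) - of_real (I / I0) * (LINT x|?M. h x * complex_of_real (\<psi>0 x))"
      using i by simp
    also have "\<dots> = (LINT x|?M. h x * complex_of_real (\<psi> x)) - of_real I * c"
      by (simp add: c_def)
    finally have 1: "(LINT x|?M. h x * complex_of_real (\<psi> x)) = of_real I * c" by simp
    have iM: "integrable ?M (\<lambda>x. complex_of_real (\<psi> x))"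
      using test_function_integrable(1)[OF loc_integrable_const[of a 1] t] by simp
    then have iM': "integrable ?M \<psi>" by (simp add: complex_of_real_integrable_eq)
    have "(LINT x|?M. \<psi> x) = integral {0<..<a} \<psi>" by (rule lebesgue_integral_eq_integral[OF iM']) simp
    also have "\<dots> = I" unfolding integral_open_interval_real[symmetric] \<psi>_def I_def
      by (rule plateau_integral_subset) (use ab in auto)
    finally have "(LINT x|?M. complex_of_real (\<psi> x)) = of_real I" by simp
    then show "(LINT x|?M. (h x - c) * complex_of_real (plateau \<alpha> \<beta> \<epsilon> x)) = 0"
      using 1 i(1) iM by (simp add: left_diff_distrib \<psi>_def[symmetric])
  qed
  then show ?thesis by auto
qed

text \<open>The product rule for F \<phi>, whose boundary values vanish because the support of
  \<open>\<phi>\<close> is compact in the open interval.\<close>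

lemma primitive_integration_by_parts:
  assumes p: "primitive a F g" and t: "test_function a \<phi>" and a: "0 < a"
  shows "(LINT x|lebesgue_on {0<..<a}. F x * complex_of_real (deriv \<phi> x)) =
    - (LINT x|lebesgue_on {0<..<a}. g x * complex_of_real (\<phi> x))"
proof -
  let ?M = "lebesgue_on {0<..<a}"
  have loc: "loc_integrable a F" "loc_integrable a g"
    by (intro loc_integrable_subset absolutely_integrable_continuous_real primitive_continuous[OF p])
      (rule loc_integrable_subset[OF primitiveD(1)[OF p]])
  note i = test_function_integrable(1)[OF loc(2) t] test_function_integrable(2)[OF loc(1) t]
  obtain K where K: "K \<subseteq> {0<..<a}" "\<And>x. x \<notin> K \<Longrightarrow> \<phi> x = 0" using test_functionD(5)[OF t] by blast
  have "0 \<notin> K" "a \<notin> K" using K(1) by auto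
  then have ends: "\<phi> 0 = 0" "\<phi> a = 0" using K(2) by blast+
  let ?p = "\<lambda>x. g x * complex_of_real (\<phi> x) + F x * complex_of_real (deriv \<phi> x)"
  have "primitive a (\<lambda>x. F x * complex_of_real (\<phi> x)) ?p"
  proof (rule primitive_mult[OF p])
    show "((\<lambda>x. complex_of_real (\<phi> x)) has_vector_derivative complex_of_real (deriv \<phi> x)) (at x within {0..a})" for x
      using test_functionD(1)[OF t, of x]
      by (intro has_vector_derivative_of_real) (simp add: has_real_derivative_iff_has_vector_derivative[symmetric] has_field_derivative_at_within)
    show "continuous_on {0..a} (\<lambda>x. complex_of_real (deriv \<phi> x))"
      by (intro continuous_intros test_functionD(4)[OF t])
  qed
  from primitiveD(2)[OF this, of a] have "integral {0..a} ?p = 0" using a ends by simp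
  then have "(LINT x|?M. ?p x) = 0"
    using i by (subst lebesgue_integral_eq_integral) (auto simp: integral_open_interval_real)
  then show ?thesis using i by (simp add: eq_neg_iff_add_eq_0 add.commute)
qed

text \<open>The difference of \<open>f\<close> and the indefinite integral of \<open>g\<close> has
  weak derivative 0, hence is constant almost everywhere.\<close>

lemma weak_deriv_imp_primitive:
  assumes w: "is_weak_deriv a f g" and g: "g absolutely_integrable_on {0..a}" and a: "0 < a"
  shows "\<exists>F. primitive a F g \<and> (AE x in lebesgue_on {0<..<a}. f x = F x)"
proof -
  define G where "G x = integral {0..x} g" for x
  have pG: "primitive a G g" using g by (simp add: primitive_def G_def)
  have loc: "loc_integrable a f" "loc_integrable a G"
    using w by (auto simp: is_weak_deriv_def intro!: loc_integrable_subset absolutely_integrable_continuous_real primitive_continuous[OF pG])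
  have "\<exists>c. AE x in lebesgue_on {0<..<a}. f x - G x = c"
  proof (rule AE_constant_if_weak_deriv_zero[OF loc_integrable_diff[OF loc] a])
    fix \<phi> assume t: "test_function a \<phi>"
    show "(LINT x|lebesgue_on {0<..<a}. (f x - G x) * complex_of_real (deriv \<phi> x)) = 0"
      using test_function_integrable(2)[OF loc(1) t] test_function_integrable(2)[OF loc(2) t]
        primitive_integration_by_parts[OF pG t a] w t
      by (simp add: left_diff_distrib is_weak_deriv_def)
  qed
  then obtain c where c: "AE x in lebesgue_on {0<..<a}. f x - G x = c" by blast
  have "primitive a (\<lambda>x. G x + c) g" using g by (simp add: primitive_def G_def)
  moreover have "AE x in lebesgue_on {0<..<a}. f x = G x + c"
    using c by eventually_elim (auto simp: algebra_simps)
  ultimately show ?thesis by blast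
qed

lemma primitive_imp_weak_deriv:
  assumes p: "primitive a F g" and ae: "AE x in lebesgue_on {0<..<a}. f x = F x" and a: "0 < a"
  shows "is_weak_deriv a f g"
proof -
  have locF: "loc_integrable a F"
    by (intro loc_integrable_subset absolutely_integrable_continuous_real primitive_continuous[OF p])
  have locg: "loc_integrable a g" by (rule loc_integrable_subset[OF primitiveD(1)[OF p]])
  have neg: "negligible {x \<in> {0<..<a}. f x \<noteq> F x}" using ae by (simp only: AE_interval_iff_negligible)
  have locf: "loc_integrable a f" unfolding loc_integrable_def
  proof (intro allI impI)
    fix K :: "real set" assume K: "compact K \<and> K \<subseteq> {0<..<a}"
    then have "F absolutely_integrable_on K" using locF by (simp add: loc_integrable_def)
    then show "f absolutely_integrable_on K"
      by (rule absolutely_integrable_spike[OF _ neg]) (use K in auto)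
  qed
  have "(LINT x|lebesgue_on {0<..<a}. f x * complex_of_real (deriv \<phi> x)) =
      - (LINT x|lebesgue_on {0<..<a}. g x * complex_of_real (\<phi> x))" if t: "test_function a \<phi>" for \<phi>
  proof -
    have "(LINT x|lebesgue_on {0<..<a}. f x * complex_of_real (deriv \<phi> x))
        = (LINT x|lebesgue_on {0<..<a}. F x * complex_of_real (deriv \<phi> x))"
      using test_function_integrable(2)[OF locf t] test_function_integrable(2)[OF locF t] ae
      by (intro integral_cong_AE) auto
    then show ?thesis using primitive_integration_by_parts[OF p t a] by simp
  qed
  then show ?thesis using locf locg by (simp add: is_weak_deriv_def)
qed

lemma continuous_AE_eq_imp_eq:
  assumes F: "continuous_on {0..a} F" and G: "continuous_on {0..a} (G :: real \<Rightarrow> complex)" and a: "0 < a"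
    and ae: "AE x in lebesgue_on {0<..<a}. F x = G x" and x: "x \<in> {0..a}"
  shows "F x = G x"
proof -
  let ?S = "{x \<in> {0<..<a}. F x \<noteq> G x}"
  have c: "continuous_on {0<..<a} (\<lambda>x. F x - G x)"
    by (intro continuous_intros continuous_on_subset[OF F] continuous_on_subset[OF G]) auto
  have "?S = {0<..<a} \<inter> (\<lambda>x. F x - G x) -` (- {0})" by auto
  then have "open ?S" using continuous_open_preimage[OF c, of "- {0}"] by auto
  moreover have "negligible ?S" using ae by (simp only: AE_interval_iff_negligible)
  ultimately have "?S = {}" using open_not_negligible by blast
  then have eq: "F y - G y = 0" if "y \<in> {0<..<a}" for y using that by auto
  have "closure {0<..<a} = {0..a}" using a by simp
  then have "F x - G x = 0"
    using continuous_constant_on_closure[of "{0<..<a}" "\<lambda>x. F x - G x" 0 x] eq x F G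
    by (simp add: continuous_on_diff)
  then show ?thesis by simp
qed

text \<open>Pins down the choice made in \<open>cont_rep\<close>: two continuous functions that
  agree almost everywhere inside also agree at the endpoints.\<close>

lemma cont_rep_eq:
  assumes F: "continuous_on {0..a} F" and a: "0 < a"
    and ae: "AE x in lebesgue_on {0<..<a}. f x = F x" and x: "x \<in> {0..a}"
  shows "cont_rep a f x = F x"
proof -
  have "continuous_on {0..a} (cont_rep a f) \<and> (AE x in lebesgue_on {0<..<a}. cont_rep a f x = f x)"
    unfolding cont_rep_def
  proof (rule someI[of _ F])
    show "continuous_on {0..a} F \<and> (AE x in lebesgue_on {0<..<a}. F x = f x)"
      using F ae by (auto elim: eventually_mono)
  qed
  moreover from this have "AE x in lebesgue_on {0<..<a}. cont_rep a f x = F x"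
    using ae by (auto elim: eventually_elim2)
  ultimately show ?thesis using continuous_AE_eq_imp_eq[OF _ F a _ x] by blast
qed

lemma square_integrable_imp_absolutely_integrable:
  fixes f :: "real \<Rightarrow> complex"
  assumes f: "f \<in> borel_measurable (lebesgue_on {0<..<a})"
    and i: "integrable (lebesgue_on {0<..<a}) (\<lambda>x. (cmod (f x))\<^sup>2)"
  shows "f absolutely_integrable_on {0..a}"
proof -
  have "integrable (lebesgue_on {0<..<a}) f"
  proof (rule Bochner_Integration.integrable_bound[OF _ f])
    have "(\<lambda>x. (1::real)) absolutely_integrable_on {0<..<a}"
      using absolutely_integrable_on_open_interval[where f = "\<lambda>x. 1 :: real" and a = 0 and b = a]
        absolutely_integrable_continuous_real[where f = "\<lambda>x. 1 :: real" and a = 0 and b = a] by simp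
    then have "integrable (lebesgue_on {0<..<a}) (\<lambda>x. (1::real))"
      by (rule absolutely_integrable_imp_integrable) simp
    then show "integrable (lebesgue_on {0<..<a}) (\<lambda>x. 1 + (cmod (f x))\<^sup>2)"
      using i by (rule Bochner_Integration.integrable_add)
    show "AE x in lebesgue_on {0<..<a}. norm (f x) \<le> norm (1 + (cmod (f x))\<^sup>2)"
    proof (rule AE_I2)
      fix x
      have "2 * cmod (f x) * 1 \<le> (cmod (f x))\<^sup>2 + 1\<^sup>2" by (rule sum_squares_bound)
      moreover have "0 \<le> cmod (f x)" by simp
      ultimately have "cmod (f x) \<le> 1 + (cmod (f x))\<^sup>2" unfolding mult_1_right one_power2 by linarith
      then show "norm (f x) \<le> norm (1 + (cmod (f x))\<^sup>2)" by simp
    qed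
  qed
  then have "f absolutely_integrable_on {0<..<a}"
    by (simp add: set_integrable_def integrable_restrict_space)
  then show ?thesis using absolutely_integrable_on_open_interval[where f = f and a = 0 and b = a] by simp
qed

section \<open>Square linear systems\<close>

lemma sum_fun_apply: "(\<Sum>i\<in>I. f i) x = (\<Sum>i\<in>I. f i x)"
  for f :: "'i \<Rightarrow> 'a \<Rightarrow> complex"
  by (induction I rule: infinite_finite_induct) auto

text \<open>Injectivity implies surjectivity by counting. The images of the unit vectors are
  independent, and there are as many of them as unit vectors, so a right-hand side outside their
  span would give an independent set that is too large.\<close>

lemma finite_linear_system:
  fixes \<Phi> :: "('i \<Rightarrow> complex) \<Rightarrow> 'i \<Rightarrow> complex"
  assumes I: "finite I"
    and add: "\<And>x y i. i \<in> I \<Longrightarrow> \<Phi> (\<lambda>j. x j + y j) i = \<Phi> x i + \<Phi> y i"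
    and scale: "\<And>c x i. i \<in> I \<Longrightarrow> \<Phi> (\<lambda>j. c * x j) i = c * \<Phi> x i"
    and inj: "\<And>x. (\<And>i. i \<in> I \<Longrightarrow> \<Phi> x i = 0) \<Longrightarrow> (\<And>i. i \<in> I \<Longrightarrow> x i = 0)"
  shows "\<exists>x. \<forall>i\<in>I. \<Phi> x i = b i"
proof -
  interpret vector_space "\<lambda>c (f :: 'i \<Rightarrow> complex) s. c * f s" by (rule vector_space_fun)
  define e :: "'i \<Rightarrow> 'i \<Rightarrow> complex" where "e i = (\<lambda>j. if j = i then 1 else 0)" for i
  define g where "g i = (\<lambda>j. if j \<in> I then \<Phi> (e i) j else 0)" for i
  define comb :: "('i \<Rightarrow> complex) \<Rightarrow> 'i set \<Rightarrow> 'i \<Rightarrow> complex" where "comb c J = (\<lambda>s. \<Sum>i\<in>J. c i * e i s)" for c J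
  have \<Phi>0: "\<Phi> (\<lambda>j. 0) i = 0" if "i \<in> I" for i using scale[OF that, of 0 "\<lambda>j. 0"] by simp
  have lin: "\<Phi> (comb c J) i = (\<Sum>j\<in>J. c j * \<Phi> (e j) i)" if "i \<in> I" "finite J" for c J i
    using that(2)
  proof (induction J)
    case empty
    then show ?case using \<Phi>0[OF that(1)] by (simp add: comb_def)
  next
    case (insert j J)
    have "comb c (insert j J) = (\<lambda>s. c j * e j s + comb c J s)" using insert by (simp add: comb_def)
    then show ?case using insert add[OF that(1)] scale[OF that(1)] by simp
  qed
  have comb_at: "comb c I i = c i" if "i \<in> I" for c i
    unfolding comb_def e_def using I that by (simp add: sum.delta' if_distrib[of "\<lambda>x. c _ * x"] cong: if_cong)
  have indep: "c i = 0" if z: "\<And>j. j \<in> I \<Longrightarrow> (\<Sum>i\<in>I. c i * g i j) = 0" and i: "i \<in> I" for c i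
  proof -
    have "\<Phi> (comb c I) j = 0" if "j \<in> I" for j
      using z[OF that] lin[OF that I, of c] that by (simp add: g_def)
    then show ?thesis using inj[of "comb c I" i] comb_at[OF i] i by simp
  qed
  \<comment> \<open>The count needs as many images as indices, so coincidences among the images are
    excluded first, by a combination with coefficients 1 and -1.\<close>
  have g_inj: "inj_on g I"
  proof (rule inj_onI, rule ccontr)
    fix i j assume ij: "i \<in> I" "j \<in> I" "g i = g j" "i \<noteq> j"
    let ?c = "\<lambda>k. if k = i then 1 else if k = j then - 1 else (0::complex)"
    have "(\<Sum>k\<in>I. ?c k * g k m) = 0" for m
    proof -
      have "(\<Sum>k\<in>I. ?c k * g k m) = (\<Sum>k\<in>{i, j}. ?c k * g k m)"
        using I ij by (intro sum.mono_neutral_right) auto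
      also have "\<dots> = 0" using ij(4) fun_cong[OF ij(3), of m] by simp
      finally show ?thesis .
    qed
    from indep[OF this ij(1)] show False by simp
  qed
  let ?S = "g ` I" and ?T = "e ` I"
  have indS: "independent ?S"
  proof (rule independent_if_scalars_zero)
    show "finite ?S" using I by simp
    fix f x assume z: "(\<Sum>x\<in>?S. (\<lambda>s. f x * x s)) = 0" and x: "x \<in> ?S"
    have "(\<Sum>i\<in>I. f (g i) * g i j) = 0" for j
      using fun_cong[OF z, of j] g_inj by (simp add: sum_fun_apply sum.reindex)
    then show "f x = 0" using indep[of "\<lambda>i. f (g i)"] x by auto
  qed
  have span: "v \<in> span ?T" if "\<And>j. j \<notin> I \<Longrightarrow> v j = 0" for v
  proof -
    have "v = (\<Sum>i\<in>I. (\<lambda>s. v i * e i s))"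
    proof
      fix s
      show "v s = (\<Sum>i\<in>I. (\<lambda>s. v i * e i s)) s"
      proof (cases "s \<in> I")
        case True
        then show ?thesis using comb_at[OF True, of v] by (simp add: sum_fun_apply comb_def)
      next
        case False
        then have "(\<Sum>i\<in>I. v i * e i s) = 0" by (intro sum.neutral) (auto simp: e_def)
        then show ?thesis using that[OF False] by (simp add: sum_fun_apply)
      qed
    qed
    also have "\<dots> \<in> span ?T" by (intro span_sum span_scale span_base) auto
    finally show ?thesis .
  qed
  define b' where "b' = (\<lambda>j. if j \<in> I then b j else 0)"
  have "b' \<in> span ?S"
  proof (rule ccontr)
    assume n: "b' \<notin> span ?S"
    then have ind: "independent (insert b' ?S)" using indS independent_insert by auto
    have "insert b' ?S \<subseteq> span ?T" using span by (auto simp: b'_def g_def)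
    then have "card (insert b' ?S) \<le> card ?T" using independent_span_bound[OF _ ind] I by blast
    moreover have "b' \<notin> ?S" using n span_base by blast
    ultimately have "Suc (card I) \<le> card ?T" using I card_image[OF g_inj] by simp
    then show False using card_image_le[OF I, of e] by simp
  qed
  then obtain u where "b' = (\<Sum>v\<in>?S. (\<lambda>s. u v * v s))" using span_finite[of ?S] I by auto
  then have "b' j = (\<Sum>v\<in>?S. (\<lambda>s. u v * v s)) j" for j by (rule fun_cong)
  then have u: "(\<Sum>i\<in>I. u (g i) * g i j) = b' j" for j
    unfolding sum_fun_apply sum.reindex[OF g_inj] o_def by (rule sym)
  have "\<Phi> (comb (\<lambda>i. u (g i)) I) j = b j" if "j \<in> I" for j
    using that u[of j] lin[OF that I, of "\<lambda>i. u (g i)"] by (simp add: b'_def g_def)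
  then show ?thesis by blast
qed

section \<open>Calculus of primitives and the trace inequality\<close>

lemma primitive_integrable:
  assumes p: "primitive a F g" and "0 \<le> x" "y \<le> a" shows "g integrable_on {x..y}"
proof -
  have "g absolutely_integrable_on {x..y}"
    by (rule absolutely_integrable_on_subinterval[OF primitiveD(1)[OF p]]) (use assms in auto)
  then show ?thesis by (rule set_lebesgue_integral_eq_integral(1))
qed

lemma primitive_add:
  assumes p: "primitive a F g" and q: "primitive a G h"
  shows "primitive a (\<lambda>x. F x + G x) (\<lambda>x. g x + h x)"
  unfolding primitive_def
proof (intro conjI ballI)
  show "(\<lambda>x. g x + h x) absolutely_integrable_on {0..a}"
    by (rule set_integral_add(1)[OF primitiveD(1)[OF p] primitiveD(1)[OF q]])
  fix x assume x: "x \<in> {0..a}"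
  have "integral {0..x} (\<lambda>x. g x + h x) = integral {0..x} g + integral {0..x} h"
    using x by (intro Henstock_Kurzweil_Integration.integral_add primitive_integrable[OF p] primitive_integrable[OF q]) auto
  moreover note primitiveD(2)[OF p x] primitiveD(2)[OF q x]
  ultimately show "F x + G x = F 0 + G 0 + integral {0..x} (\<lambda>x. g x + h x)" by (metis add.assoc add.left_commute)
qed

lemma primitive_scale:
  assumes p: "primitive a F g" shows "primitive a (\<lambda>x. c * F x) (\<lambda>x. c * g x)"
  unfolding primitive_def
proof (intro conjI ballI)
  show "(\<lambda>x. c * g x) absolutely_integrable_on {0..a}"
    using primitiveD(1)[OF p] by (intro set_integrable_mult_right) auto
  fix x assume x: "x \<in> {0..a}"
  have "c * F x = c * (F 0 + integral {0..x} g)" using primitiveD(2)[OF p x] by (rule arg_cong)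
  then show "c * F x = c * F 0 + integral {0..x} (\<lambda>x. c * g x)" by (simp add: distrib_left)
qed

lemma primitive_cong_AE:
  assumes p: "primitive a F g" and ae: "AE x in lebesgue_on {0<..<a}. g x = h x"
  shows "primitive a F h"
proof -
  let ?N = "{x \<in> {0<..<a}. g x \<noteq> h x} \<union> {0, a}"
  have N: "negligible ?N" using ae by (intro negligible_Un) (simp_all only: AE_interval_iff_negligible, simp)
  have eq: "h x = g x" if "x \<in> {0..y} - ?N" "y \<le> a" for x y using that by auto
  show ?thesis unfolding primitive_def
  proof (intro conjI ballI)
    show "h absolutely_integrable_on {0..a}"
      by (rule absolutely_integrable_spike[OF primitiveD(1)[OF p] N eq]) auto
    fix x assume x: "x \<in> {0..a}"
    have "integral {0..x} g = integral {0..x} h" by (rule integral_spike[OF N eq]) (use x in auto)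
    then show "F x = F 0 + integral {0..x} h" using primitiveD(2)[OF p x] by simp
  qed
qed

lemma primitive_constant_imp_AE_zero:
  assumes p: "primitive a F g" and z: "\<And>x. x \<in> {0..a} \<Longrightarrow> F x = c"
  shows "AE x in lebesgue_on {0<..<a}. g x = 0"
proof -
  have "AE x in lebesgue. x \<in> {0..a} \<longrightarrow> g x = 0"
  proof (rule interval_integrals_zero_imp_AE_zero[OF primitiveD(1)[OF p]])
    show "integral {\<alpha>..\<beta>} g = 0" if "0 \<le> \<alpha>" "\<alpha> \<le> \<beta>" "\<beta> \<le> a" for \<alpha> \<beta>
      using primitive_diff[OF p that] z[of \<alpha>] z[of \<beta>] that by simp
  qed
  then have "AE x in lebesgue. x \<in> {0<..<a} \<longrightarrow> g x = 0" by eventually_elim auto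
  then show ?thesis by (subst AE_restrict_space_iff) simp_all
qed

lemma primitive_constant_imp_zero:
  assumes p: "primitive a F g" and z: "\<And>x. x \<in> {0..a} \<Longrightarrow> F x = c"
    and g: "continuous_on {0..a} g" and a: "0 < a" and x: "x \<in> {0..a}"
  shows "g x = 0"
  using continuous_AE_eq_imp_eq[OF g continuous_on_const a primitive_constant_imp_AE_zero[OF p z] x] by blast

lemma LINT_eq_integral_spike:
  fixes f g :: "real \<Rightarrow> 'b::euclidean_space"
  assumes i: "integrable (lebesgue_on {0<..<a}) f" and ae: "AE x in lebesgue_on {0<..<a}. f x = g x"
  shows "(LINT x|lebesgue_on {0<..<a}. f x) = integral {0..a} g"
proof -
  have "(LINT x|lebesgue_on {0<..<a}. f x) = integral {0<..<a} f"
    by (rule lebesgue_integral_eq_integral[OF i]) simp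
  also have "\<dots> = integral {0<..<a} g"
    by (rule integral_spike[of "{x \<in> {0<..<a}. f x \<noteq> g x}"]) (use ae in \<open>auto simp only: AE_interval_iff_negligible\<close>)
  finally show ?thesis by (simp add: integral_open_interval_real)
qed

lemma primitive_mult_cnj:
  assumes V: "primitive a V h" and U: "primitive a U W" and W: "continuous_on {0..a} W"
  shows "primitive a (\<lambda>x. V x * cnj (U x)) (\<lambda>x. h x * cnj (U x) + V x * cnj (W x))"
proof (rule primitive_mult[OF V])
  show "((\<lambda>x. cnj (U x)) has_vector_derivative cnj (W x)) (at x within {0..a})" if "x \<in> {0..a}" for x
    by (rule bounded_linear.has_vector_derivative[OF bounded_linear_cnj primitive_has_vector_derivative[OF U W that]])
  show "continuous_on {0..a} (\<lambda>x. cnj (W x))" by (intro continuous_intros W)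
qed

text \<open>Young's inequality with weight \<open>e\<close> bounds every increment of the squared
  modulus of \<open>U\<close> by \<open>R\<close>. Averaging the resulting bound over the second
  point replaces its value there by the mean, which is where \<open>1 / a\<close> comes
  from.\<close>

lemma trace_inequality:
  assumes U: "primitive a U V" and V: "continuous_on {0..a} V" and a: "0 < a" and e: "0 < e"
    and y: "y \<in> {0..a}"
  shows "(cmod (U y))\<^sup>2 \<le> e * integral {0..a} (\<lambda>x. (cmod (V x))\<^sup>2) + (1 / a + 1 / e) * integral {0..a} (\<lambda>x. (cmod (U x))\<^sup>2)"
proof -
  have cU: "continuous_on {0..a} U" by (rule primitive_continuous[OF U])
  let ?nU = "integral {0..a} (\<lambda>x. (cmod (U x))\<^sup>2)" and ?nV = "integral {0..a} (\<lambda>x. (cmod (V x))\<^sup>2)"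
  let ?r = "\<lambda>x. e * (cmod (V x))\<^sup>2 + 1 / e * (cmod (U x))\<^sup>2"
  have iU: "(\<lambda>x. (cmod (U x))\<^sup>2) integrable_on {0..a}" and iV: "(\<lambda>x. (cmod (V x))\<^sup>2) integrable_on {0..a}"
    by (intro integrable_continuous_real continuous_intros cU V)+
  have cr: "continuous_on {0..a} ?r" by (intro continuous_intros cU V)
  define R where "R = integral {0..a} ?r"
  have R: "R = e * ?nV + 1 / e * ?nU"
    unfolding R_def
    by (simp only: Henstock_Kurzweil_Integration.integral_add[OF integrable_on_mult_right[OF iV] integrable_on_mult_right[OF iU]]
        Henstock_Kurzweil_Integration.integral_mult_right)
  have p: "primitive a (\<lambda>x. U x * cnj (U x)) (\<lambda>x. V x * cnj (U x) + U x * cnj (V x))"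
    by (rule primitive_mult_cnj[OF U U V])
  have incr: "\<bar>(cmod (U t))\<^sup>2 - (cmod (U s))\<^sup>2\<bar> \<le> R" if st: "0 \<le> s" "s \<le> t" "t \<le> a" for s t
  proof -
    let ?q = "\<lambda>x. V x * cnj (U x) + U x * cnj (V x)"
    have "cmod (integral {s..t} ?q) \<le> integral {s..t} ?r"
    proof (rule integral_norm_bound_integral)
      show "?q integrable_on {s..t}" using primitive_integrable[OF p] st by auto
      show "?r integrable_on {s..t}" using st by (intro integrable_continuous_real continuous_on_subset[OF cr]) auto
      fix x
      have "cmod (?q x) \<le> 2 * (sqrt e * cmod (V x)) * (cmod (U x) / sqrt e)"
        using e by (intro order_trans[OF norm_triangle_ineq]) (simp add: norm_mult)
      also have "\<dots> \<le> (sqrt e * cmod (V x))\<^sup>2 + (cmod (U x) / sqrt e)\<^sup>2" by (rule sum_squares_bound)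
      also have "\<dots> = ?r x" using e by (simp add: power_mult_distrib power_divide)
      finally show "cmod (?q x) \<le> ?r x" .
    qed
    also have "integral {s..t} ?r \<le> R" unfolding R_def
      using st e by (intro integral_subset_le integrable_continuous_real continuous_on_subset[OF cr]) auto
    also have "integral {s..t} ?q = complex_of_real ((cmod (U t))\<^sup>2 - (cmod (U s))\<^sup>2)"
      using primitive_diff[OF p st] by (simp only: complex_norm_square of_real_diff)
    finally show ?thesis by (simp only: norm_of_real)
  qed
  have pt: "(cmod (U y))\<^sup>2 \<le> (cmod (U x))\<^sup>2 + R" if "x \<in> {0..a}" for x
    using incr[of x y] incr[of y x] y that by (cases "x \<le> y") (auto simp: abs_le_iff)
  have "integral {0..a} (\<lambda>x. (cmod (U y))\<^sup>2) \<le> integral {0..a} (\<lambda>x. (cmod (U x))\<^sup>2 + R)"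
    by (rule integral_le) (use pt iU in \<open>auto intro!: integrable_add\<close>)
  also have "\<dots> = ?nU + a * R" using iU a by (subst Henstock_Kurzweil_Integration.integral_add) auto
  finally have "a * (cmod (U y))\<^sup>2 \<le> ?nU + a * R" using a by simp
  then have "(cmod (U y))\<^sup>2 \<le> ?nU / a + R" using a by (simp add: field_simps)
  then show ?thesis unfolding R by (simp add: algebra_simps)
qed

section \<open>Linear differential equations of second order on an edge\<close>

definition ode_plus :: "complex \<Rightarrow> (real \<Rightarrow> complex) \<Rightarrow> complex \<Rightarrow> real \<Rightarrow> complex" where
  "ode_plus \<mu> g \<alpha> x = (\<alpha> + integral {0..x} (\<lambda>s. g s * exp (- \<mu> * of_real s))) * exp (\<mu> * of_real x)"

lemma has_vector_derivative_exp_line: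
  "((\<lambda>x. exp (\<mu> * of_real x)) has_vector_derivative \<mu> * exp (\<mu> * of_real x)) (at x within S)"
  for \<mu> :: complex
proof -
  have "((\<lambda>z. exp (\<mu> * z)) has_field_derivative \<mu> * exp (\<mu> * of_real x)) (at (of_real x))"
    by (auto intro!: derivative_eq_intros)
  then have "((\<lambda>x. exp (\<mu> * of_real x)) has_vector_derivative \<mu> * exp (\<mu> * of_real x)) (at x)"
    by (rule has_vector_derivative_real_field)
  then show ?thesis by (rule has_vector_derivative_at_within)
qed

text \<open>Variation of constants for y' = \<mu> y + g with y(0) = \<alpha>. Since \<open>g\<close>
  is merely integrable, the equation is obtained from the product rule for primitives.\<close>

lemma primitive_ode_plus:
  assumes g: "g absolutely_integrable_on {0..a}"
  shows "primitive a (ode_plus \<mu> g \<alpha>) (\<lambda>x. g x + \<mu> * ode_plus \<mu> g \<alpha> x)"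
proof -
  let ?h = "\<lambda>s. g s * exp (- \<mu> * of_real s)"
  have h: "?h absolutely_integrable_on {0..a}"
    by (rule absolutely_integrable_mult_continuous[OF g]) (intro continuous_intros)
  have "primitive a (\<lambda>x. \<alpha> + integral {0..x} ?h) ?h" using h by (simp add: primitive_def)
  then have p: "primitive a (\<lambda>x. (\<alpha> + integral {0..x} ?h) * exp (\<mu> * of_real x))
      (\<lambda>x. ?h x * exp (\<mu> * of_real x) + (\<alpha> + integral {0..x} ?h) * (\<mu> * exp (\<mu> * of_real x)))"
    by (rule primitive_mult[OF _ has_vector_derivative_exp_line]) (intro continuous_intros)
  have "?h x * exp (\<mu> * of_real x) + (\<alpha> + integral {0..x} ?h) * (\<mu> * exp (\<mu> * of_real x))
      = g x + \<mu> * ode_plus \<mu> g \<alpha> x" for x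
  proof -
    have "exp (- \<mu> * of_real x) * exp (\<mu> * of_real x) = 1" by (simp add: mult_exp_exp)
    then show ?thesis unfolding ode_plus_def by (simp only: mult.assoc mult_1_right mult.left_commute)
  qed
  then have "(\<lambda>x. ?h x * exp (\<mu> * of_real x) + (\<alpha> + integral {0..x} ?h) * (\<mu> * exp (\<mu> * of_real x)))
      = (\<lambda>x. g x + \<mu> * ode_plus \<mu> g \<alpha> x)" by (rule ext)
  moreover have "(\<lambda>x. (\<alpha> + integral {0..x} ?h) * exp (\<mu> * of_real x)) = ode_plus \<mu> g \<alpha>"
    by (rule ext) (simp only: ode_plus_def)
  ultimately show ?thesis using p by (simp only:)
qed

text \<open>The equation U'' = \<mu>^2 U + g is factorised: U' + \<mu> U and U' - \<mu> U solve
  first order equations with rates \<mu> and -\<mu> and initial values \<open>\<alpha>\<close> and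
  \<open>\<beta>\<close>. Half their difference divided by \<mu> is U, and half their sum is U',
  which is \<open>ode_der\<close>.\<close>

definition ode_fun :: "complex \<Rightarrow> (real \<Rightarrow> complex) \<Rightarrow> complex \<Rightarrow> complex \<Rightarrow> real \<Rightarrow> complex" where
  "ode_fun \<mu> g \<alpha> \<beta> x = 1 / (2 * \<mu>) * (ode_plus \<mu> g \<alpha> x + - 1 * ode_plus (- \<mu>) g \<beta> x)"

definition ode_der :: "complex \<Rightarrow> (real \<Rightarrow> complex) \<Rightarrow> complex \<Rightarrow> complex \<Rightarrow> real \<Rightarrow> complex" where
  "ode_der \<mu> g \<alpha> \<beta> x = 1 / 2 * (ode_plus \<mu> g \<alpha> x + ode_plus (- \<mu>) g \<beta> x)"

lemma primitive_ode:
  assumes g: "g absolutely_integrable_on {0..a}" and \<mu>: "\<mu> \<noteq> 0"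
  shows "primitive a (ode_fun \<mu> g \<alpha> \<beta>) (ode_der \<mu> g \<alpha> \<beta>)"
    "primitive a (ode_der \<mu> g \<alpha> \<beta>) (\<lambda>x. \<mu>\<^sup>2 * ode_fun \<mu> g \<alpha> \<beta> x + g x)"
proof -
  note p = primitive_ode_plus[OF g, of \<mu> \<alpha>] primitive_ode_plus[OF g, of "- \<mu>" \<beta>]
  have h: "1 / (2 * \<mu>) * (y + \<mu> * A + - 1 * (y + - \<mu> * B)) = 1 / 2 * (A + B)"
    "1 / 2 * (y + \<mu> * A + (y + - \<mu> * B)) = \<mu>\<^sup>2 * (1 / (2 * \<mu>) * (A + - 1 * B)) + y" for y A B :: complex
    using \<mu> by (simp_all add: field_simps power2_eq_square)
  show "primitive a (ode_fun \<mu> g \<alpha> \<beta>) (ode_der \<mu> g \<alpha> \<beta>)"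
    using primitive_scale[OF primitive_add[OF p(1) primitive_scale[OF p(2), of "- 1"]], of "1 / (2 * \<mu>)"]
    unfolding h ode_fun_def[abs_def] ode_der_def[abs_def] .
  show "primitive a (ode_der \<mu> g \<alpha> \<beta>) (\<lambda>x. \<mu>\<^sup>2 * ode_fun \<mu> g \<alpha> \<beta> x + g x)"
    using primitive_scale[OF primitive_add[OF p], of "1 / 2"]
    unfolding h ode_fun_def[abs_def] ode_der_def[abs_def] .
qed

lemma ode_plus_split:
  "ode_plus \<mu> g \<alpha> x = ode_plus \<mu> (\<lambda>_. 0) \<alpha> x + ode_plus \<mu> g 0 x"
  by (simp add: ode_plus_def distrib_right)

lemma ode_plus_zero: "ode_plus \<mu> (\<lambda>_. 0) \<alpha> x = \<alpha> * exp (\<mu> * of_real x)"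
  by (simp add: ode_plus_def)

text \<open>Superposition: the parameters enter through the homogeneous solution, the datum
  \<open>g\<close> through the particular solution with zero parameters.\<close>

lemma ode_split:
  "ode_fun \<mu> g \<alpha> \<beta> x = ode_fun \<mu> (\<lambda>_. 0) \<alpha> \<beta> x + ode_fun \<mu> g 0 0 x"
  "ode_der \<mu> g \<alpha> \<beta> x = ode_der \<mu> (\<lambda>_. 0) \<alpha> \<beta> x + ode_der \<mu> g 0 0 x"
proof -
  have h: "c * ((A + A') + e * (B + B')) = c * (A + e * B) + c * (A' + e * B')" for c e A A' B B' :: complex
    by (simp only: distrib_left ac_simps)
  show "ode_fun \<mu> g \<alpha> \<beta> x = ode_fun \<mu> (\<lambda>_. 0) \<alpha> \<beta> x + ode_fun \<mu> g 0 0 x"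
    unfolding ode_fun_def ode_plus_split[of _ g \<alpha>] ode_plus_split[of _ g \<beta>] h ..
  show "ode_der \<mu> g \<alpha> \<beta> x = ode_der \<mu> (\<lambda>_. 0) \<alpha> \<beta> x + ode_der \<mu> g 0 0 x"
    unfolding ode_der_def ode_plus_split[of _ g \<alpha>] ode_plus_split[of _ g \<beta>]
    using h[of "1 / 2" _ _ 1] by simp
qed

lemma ode_hom_add:
  "ode_fun \<mu> (\<lambda>_. 0) (\<alpha> + \<alpha>') (\<beta> + \<beta>') x = ode_fun \<mu> (\<lambda>_. 0) \<alpha> \<beta> x + ode_fun \<mu> (\<lambda>_. 0) \<alpha>' \<beta>' x"
  "ode_der \<mu> (\<lambda>_. 0) (\<alpha> + \<alpha>') (\<beta> + \<beta>') x = ode_der \<mu> (\<lambda>_. 0) \<alpha> \<beta> x + ode_der \<mu> (\<lambda>_. 0) \<alpha>' \<beta>' x"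
  unfolding ode_fun_def ode_der_def ode_plus_zero by algebra+

lemma ode_hom_scale:
  "ode_fun \<mu> (\<lambda>_. 0) (c * \<alpha>) (c * \<beta>) x = c * ode_fun \<mu> (\<lambda>_. 0) \<alpha> \<beta> x"
  "ode_der \<mu> (\<lambda>_. 0) (c * \<alpha>) (c * \<beta>) x = c * ode_der \<mu> (\<lambda>_. 0) \<alpha> \<beta> x"
  unfolding ode_fun_def ode_der_def ode_plus_zero by algebra+

text \<open>Value and derivative at 0 are multiples of \<open>\<alpha> - \<beta>\<close> and
  \<open>\<alpha> + \<beta>\<close>.\<close>

lemma ode_initial_zero:
  assumes "ode_fun \<mu> g \<alpha> \<beta> 0 = 0" "ode_der \<mu> g \<alpha> \<beta> 0 = 0" "\<mu> \<noteq> 0"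
  shows "\<alpha> = 0" "\<beta> = 0"
proof -
  have "\<alpha> - \<beta> = 0" "\<alpha> + \<beta> = 0" using assms by (auto simp: ode_fun_def ode_der_def ode_plus_def)
  then show "\<alpha> = 0" "\<beta> = 0" by (auto simp: add_eq_0_iff)
qed

lemma L2_norm_eq_0_iff:
  assumes "v \<in> L2_graph N d"
  shows "L2_norm N d v = 0 \<longleftrightarrow> (\<forall>i\<in>{1..N}. AE x in lebesgue_on {0<..<d i}. v (i, x) = 0)"
proof -
  let ?I = "\<lambda>i. LINT x|lebesgue_on {0<..<d i}. (cmod (v (i, x)))\<^sup>2"
  have "L2_norm N d v = 0 \<longleftrightarrow> (\<Sum>i\<in>{1..N}. ?I i) = 0" 
    unfolding L2_norm_sq[symmetric] by simp
  also have "\<dots> \<longleftrightarrow> (\<forall>i\<in>{1..N}. ?I i = 0)" by (intro sum_nonneg_eq_0_iff) (auto intro!: integral_nonneg_AE)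
  also have "\<dots> \<longleftrightarrow> (\<forall>i\<in>{1..N}. AE x in lebesgue_on {0<..<d i}. v (i, x) = 0)"
    using integral_nonneg_eq_0_iff_AE[OF L2_graphD(2)[OF assms]] by (intro ball_cong refl) simp
  finally show ?thesis .
qed

lemma square_integrable_cong_AE:
  fixes f g :: "real \<Rightarrow> complex"
  assumes f: "f \<in> borel_measurable (lebesgue_on {0<..<a})"
    and i: "integrable (lebesgue_on {0<..<a}) (\<lambda>x. (cmod (f x))\<^sup>2)"
    and ae: "AE x in lebesgue_on {0<..<a}. f x = g x"
  shows "g \<in> borel_measurable (lebesgue_on {0<..<a})" "integrable (lebesgue_on {0<..<a}) (\<lambda>x. (cmod (g x))\<^sup>2)"
proof -
  have N: "negligible {x \<in> {0<..<a}. f x \<noteq> g x}" using ae by (simp only: AE_interval_iff_negligible)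
  have "f absolutely_integrable_on {0<..<a}"
    using square_integrable_imp_absolutely_integrable[OF f i]
      absolutely_integrable_on_open_interval[where f = f and a = 0 and b = a] by simp
  then have "g absolutely_integrable_on {0<..<a}" by (rule absolutely_integrable_spike[OF _ N]) auto
  then show "g \<in> borel_measurable (lebesgue_on {0<..<a})" by (rule absolutely_integrable_imp_borel_measurable) simp
  have "(\<lambda>x. (cmod (f x))\<^sup>2) absolutely_integrable_on {0<..<a}"
    using i by (simp add: set_integrable_def integrable_restrict_space)
  then have "(\<lambda>x. (cmod (g x))\<^sup>2) absolutely_integrable_on {0<..<a}" by (rule absolutely_integrable_spike[OF _ N]) auto
  then show "integrable (lebesgue_on {0<..<a}) (\<lambda>x. (cmod (g x))\<^sup>2)"
    by (rule absolutely_integrable_imp_integrable) simp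
qed

lemma continuous_square_integrable:
  fixes f :: "real \<Rightarrow> complex"
  assumes c: "continuous_on {0..a} f"
  shows "f \<in> borel_measurable (lebesgue_on {0<..<a})" "integrable (lebesgue_on {0<..<a}) (\<lambda>x. (cmod (f x))\<^sup>2)"
proof -
  have c': "continuous_on {0<..<a} f" by (rule continuous_on_subset[OF c]) auto
  show "f \<in> borel_measurable (lebesgue_on {0<..<a})" by (rule continuous_imp_measurable_on_sets_lebesgue[OF c']) simp
  have "(\<lambda>x. (cmod (f x))\<^sup>2) absolutely_integrable_on {0..a}"
    by (intro absolutely_integrable_continuous_real continuous_intros c)
  then have "(\<lambda>x. (cmod (f x))\<^sup>2) absolutely_integrable_on {0<..<a}"
    using absolutely_integrable_on_open_interval[where f = "\<lambda>x. (cmod (f x))\<^sup>2" and a = 0 and b = a] by simp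
  then show "integrable (lebesgue_on {0<..<a}) (\<lambda>x. (cmod (f x))\<^sup>2)"
    by (rule absolutely_integrable_imp_integrable) simp
qed

section \<open>The operators on the graph\<close>

lemma green_identity:
  assumes U: "primitive a U V" and V: "primitive a V h" and a: "0 < a"
  shows "integral {0..a} (\<lambda>x. h x * cnj (U x)) =
    V a * cnj (U a) - V 0 * cnj (U 0) - of_real (integral {0..a} (\<lambda>x. (cmod (V x))\<^sup>2))"
proof -
  have cU: "continuous_on {0..a} U" and cV: "continuous_on {0..a} V"
    by (rule primitive_continuous[OF U], rule primitive_continuous[OF V])
  have "(\<lambda>x. h x * cnj (U x)) absolutely_integrable_on {0..a}"
    by (rule absolutely_integrable_mult_continuous[OF primitiveD(1)[OF V]]) (intro continuous_intros cU)
  then have i: "(\<lambda>x. h x * cnj (U x)) integrable_on {0..a}" by (rule set_lebesgue_integral_eq_integral(1))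
  have j: "(\<lambda>x. V x * cnj (V x)) integrable_on {0..a}" and j': "(\<lambda>x. (cmod (V x))\<^sup>2) integrable_on {0..a}"
    by (intro integrable_continuous_real continuous_intros cV)+
  have "integral {0..a} (\<lambda>x. h x * cnj (U x)) + integral {0..a} (\<lambda>x. V x * cnj (V x)) =
      V a * cnj (U a) - V 0 * cnj (U 0)"
    using primitive_diff[OF primitive_mult_cnj[OF V U cV] order_refl less_imp_le[OF a] order_refl]
    by (simp only: Henstock_Kurzweil_Integration.integral_add[OF i j])
  moreover have "integral {0..a} (\<lambda>x. V x * cnj (V x)) = of_real (integral {0..a} (\<lambda>x. (cmod (V x))\<^sup>2))"
    using integral_linear[OF j' bounded_linear_of_real[where 'a = complex]]
    by (simp only: o_def complex_norm_square)
  ultimately show ?thesis by (simp add: algebra_simps)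
qed

text \<open>The incidence structure enters the analysis only through linear, bounded boundary
  functionals \<open>FL\<close> and \<open>FR\<close>. Their arguments are the families of left and
  right endpoint values; \<open>k0\<close> is a lower bound for the parameters \<open>k\<close> to
  be treated.\<close>

locale robin_graph =
  fixes N :: nat and d \<sigma> :: "nat \<Rightarrow> real" and FL FR :: "(nat \<Rightarrow> complex) \<Rightarrow> (nat \<Rightarrow> complex) \<Rightarrow> nat \<Rightarrow> complex"
    and C k0 :: real
  assumes d_pos: "i \<in> {1..N} \<Longrightarrow> 0 < d i" and \<sigma>_pos: "i \<in> {1..N} \<Longrightarrow> 0 < \<sigma> i"
    and C_nonneg: "0 \<le> C" and k0_pos: "0 < k0"
    and F_add: "i \<in> {1..N} \<Longrightarrow> FL (\<lambda>j. p j + p' j) (\<lambda>j. q j + q' j) i = FL p q i + FL p' q' i"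
      "i \<in> {1..N} \<Longrightarrow> FR (\<lambda>j. p j + p' j) (\<lambda>j. q j + q' j) i = FR p q i + FR p' q' i"
    and F_scale: "i \<in> {1..N} \<Longrightarrow> FL (\<lambda>j. a * p j) (\<lambda>j. a * q j) i = a * FL p q i"
      "i \<in> {1..N} \<Longrightarrow> FR (\<lambda>j. a * p j) (\<lambda>j. a * q j) i = a * FR p q i"
    and F_bound: "i \<in> {1..N} \<Longrightarrow> cmod (FL p q i) \<le> C * (\<Sum>j\<in>{1..N}. cmod (p j) + cmod (q j))"
      "i \<in> {1..N} \<Longrightarrow> cmod (FR p q i) \<le> C * (\<Sum>j\<in>{1..N}. cmod (p j) + cmod (q j))"
begin

sublocale L2: semi_hilbert "\<lambda>c f s. c * f s" "L2_graph N d" "L2_inner N d"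
  by (rule semi_hilbert_L2_graph)

lemma nrm_L2: "L2.nrm = L2_norm N d"
  by (rule ext) (simp add: L2.nrm_def L2_norm_def)

text \<open>\<open>U i\<close> and \<open>V i\<close> are the absolutely continuous representatives of \<open>u\<close> and \<open>u'\<close> on the edge \<open>i\<close>.\<close>

definition solution :: "real \<Rightarrow> graph_fun \<Rightarrow> graph_fun \<Rightarrow> (nat \<Rightarrow> real \<Rightarrow> complex) \<Rightarrow> (nat \<Rightarrow> real \<Rightarrow> complex) \<Rightarrow> bool" where
  "solution k u w U V \<longleftrightarrow> (\<forall>i\<in>{1..N}.
     primitive (d i) (U i) (V i) \<and> primitive (d i) (V i) (\<lambda>x. w (i, x) / of_real (k * \<sigma> i)) \<and>
     (AE x in lebesgue_on {0<..<d i}. u (i, x) = U i x) \<and>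
     of_real k * V i 0 = FL (\<lambda>j. U j 0) (\<lambda>j. U j (d j)) i \<and>
     of_real k * V i (d i) = FR (\<lambda>j. U j 0) (\<lambda>j. U j (d j)) i)"

text \<open>The operator in terms of absolutely continuous representatives; \<open>G_eq_H2\<close>
  relates it to weak derivatives.\<close>

definition G :: "real \<Rightarrow> (graph_fun \<times> graph_fun) set" where
  "G k = {(u, w). u \<in> L2_graph N d \<and> w \<in> L2_graph N d \<and> (\<exists>U V. solution k u w U V)}"

lemma solutionD:
  assumes "solution k u w U V" "i \<in> {1..N}"
  shows "primitive (d i) (U i) (V i)" "primitive (d i) (V i) (\<lambda>x. w (i, x) / of_real (k * \<sigma> i))"
    "AE x in lebesgue_on {0<..<d i}. u (i, x) = U i x"
    "of_real k * V i 0 = FL (\<lambda>j. U j 0) (\<lambda>j. U j (d j)) i"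
    "of_real k * V i (d i) = FR (\<lambda>j. U j 0) (\<lambda>j. U j (d j)) i"
  using assms unfolding solution_def by blast+

lemma solution_add:
  assumes s: "solution k u w U V" and s': "solution k u' w' U' V'"
  shows "solution k (u + u') (w + w') (\<lambda>i x. U i x + U' i x) (\<lambda>i x. V i x + V' i x)"
  unfolding solution_def
proof (intro ballI conjI)
  fix i assume i: "i \<in> {1..N}"
  note D = solutionD[OF s i] and D' = solutionD[OF s' i]
  show "primitive (d i) (\<lambda>x. U i x + U' i x) (\<lambda>x. V i x + V' i x)" by (rule primitive_add[OF D(1) D'(1)])
  show "primitive (d i) (\<lambda>x. V i x + V' i x) (\<lambda>x. (w + w') (i, x) / of_real (k * \<sigma> i))"
    using primitive_add[OF D(2) D'(2)] by (simp only: plus_fun_apply add_divide_distrib)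
  show "AE x in lebesgue_on {0<..<d i}. (u + u') (i, x) = U i x + U' i x"
    using D(3) D'(3) by eventually_elim simp
  show "of_real k * (V i 0 + V' i 0) = FL (\<lambda>j. U j 0 + U' j 0) (\<lambda>j. U j (d j) + U' j (d j)) i"
    unfolding F_add[OF i] distrib_left D(4) D'(4) ..
  show "of_real k * (V i (d i) + V' i (d i)) = FR (\<lambda>j. U j 0 + U' j 0) (\<lambda>j. U j (d j) + U' j (d j)) i"
    unfolding F_add[OF i] distrib_left D(5) D'(5) ..
qed

lemma solution_scale:
  assumes s: "solution k u w U V"
  shows "solution k (\<lambda>s. a * u s) (\<lambda>s. a * w s) (\<lambda>i x. a * U i x) (\<lambda>i x. a * V i x)"
  unfolding solution_def
proof (intro ballI conjI)
  fix i assume i: "i \<in> {1..N}"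
  note D = solutionD[OF s i]
  show "primitive (d i) (\<lambda>x. a * U i x) (\<lambda>x. a * V i x)" by (rule primitive_scale[OF D(1)])
  show "primitive (d i) (\<lambda>x. a * V i x) (\<lambda>x. a * w (i, x) / of_real (k * \<sigma> i))"
    using primitive_scale[OF D(2), of a] by (simp only: times_divide_eq_right)
  show "AE x in lebesgue_on {0<..<d i}. a * u (i, x) = a * U i x"
    using D(3) by eventually_elim simp
  show "of_real k * (a * V i 0) = FL (\<lambda>j. a * U j 0) (\<lambda>j. a * U j (d j)) i"
    unfolding F_scale[OF i] D(4)[symmetric] by (rule mult.left_commute)
  show "of_real k * (a * V i (d i)) = FR (\<lambda>j. a * U j 0) (\<lambda>j. a * U j (d j)) i"
    unfolding F_scale[OF i] D(5)[symmetric] by (rule mult.left_commute)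
qed

lemma solution_cong_AE:
  assumes s: "solution k u w U V"
    and u: "\<And>i. i \<in> {1..N} \<Longrightarrow> AE x in lebesgue_on {0<..<d i}. u' (i, x) = u (i, x)"
    and w: "\<And>i. i \<in> {1..N} \<Longrightarrow> AE x in lebesgue_on {0<..<d i}. w' (i, x) = w (i, x)"
  shows "solution k u' w' U V"
  unfolding solution_def
proof (intro ballI conjI)
  fix i assume i: "i \<in> {1..N}"
  note D = solutionD[OF s i]
  show "primitive (d i) (U i) (V i)" "of_real k * V i 0 = FL (\<lambda>j. U j 0) (\<lambda>j. U j (d j)) i"
    "of_real k * V i (d i) = FR (\<lambda>j. U j 0) (\<lambda>j. U j (d j)) i" by (fact D)+
  show "primitive (d i) (V i) (\<lambda>x. w' (i, x) / of_real (k * \<sigma> i))"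
    by (rule primitive_cong_AE[OF D(2)]) (use w[OF i] in eventually_elim, simp)
  show "AE x in lebesgue_on {0<..<d i}. u' (i, x) = U i x" using u[OF i] D(3) by eventually_elim simp
qed

lemma solution_zero:
  assumes s: "solution k u w U V" and i: "i \<in> {1..N}" and k: "0 < k"
    and z: "AE x in lebesgue_on {0<..<d i}. u (i, x) = 0"
  shows "x \<in> {0..d i} \<Longrightarrow> U i x = 0" "x \<in> {0..d i} \<Longrightarrow> V i x = 0"
    "AE x in lebesgue_on {0<..<d i}. w (i, x) = 0"
proof -
  note D = solutionD[OF s i]
  have ae: "AE x in lebesgue_on {0<..<d i}. U i x = 0" using z D(3) by eventually_elim simp
  have U0: "U i x = 0" if "x \<in> {0..d i}" for x
    by (rule continuous_AE_eq_imp_eq[OF primitive_continuous[OF D(1)] continuous_on_const d_pos[OF i] ae that])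
  have V0: "V i x = 0" if "x \<in> {0..d i}" for x
    by (rule primitive_constant_imp_zero[OF D(1) U0 primitive_continuous[OF D(2)] d_pos[OF i] that])
  show "x \<in> {0..d i} \<Longrightarrow> U i x = 0" "x \<in> {0..d i} \<Longrightarrow> V i x = 0" by (fact U0 V0)+
  have "AE x in lebesgue_on {0<..<d i}. w (i, x) / of_real (k * \<sigma> i) = 0"
    by (rule primitive_constant_imp_AE_zero[OF D(2) V0])
  then show "AE x in lebesgue_on {0<..<d i}. w (i, x) = 0"
    by eventually_elim (use k \<sigma>_pos[OF i] in simp)
qed

text \<open>The constant of \<open>boundary_form_bound\<close>: \<open>C\<close> and the sum of the
  weights come from the functionals, \<open>2 * real N\<close> from passing from a squared sum to a
  sum of squares.\<close>

definition K :: real where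
  "K = 2 * real N * C * (\<Sum>i\<in>{1..N}. \<sigma> i)"

text \<open>The weight in the trace inequality, small enough for
  \<open>4 * K * eps i \<le> k0 * \<sigma> i\<close>; the summand 4 keeps the denominator positive
  if \<open>K = 0\<close>.\<close>

definition eps :: "nat \<Rightarrow> real" where
  "eps i = k0 * \<sigma> i / (4 * K + 4)"

text \<open>The factor 4 is 2 for the two ends of an edge times 2 for the rotation by
  \<open>z\<close>; the summand 1 ensures positivity.\<close>

definition \<gamma> :: real where
  "\<gamma> = 1 + 4 * K * (\<Sum>i\<in>{1..N}. 1 / d i + 1 / eps i)"

lemma K_nonneg: "0 \<le> K"
  unfolding K_def using C_nonneg \<sigma>_pos by (intro mult_nonneg_nonneg sum_nonneg) (auto intro: less_imp_le)

lemma eps_pos: "i \<in> {1..N} \<Longrightarrow> 0 < eps i"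
  unfolding eps_def using k0_pos \<sigma>_pos K_nonneg by simp

lemma \<gamma>_pos: "0 < \<gamma>"
proof -
  have "0 \<le> 4 * K * (\<Sum>i\<in>{1..N}. 1 / d i + 1 / eps i)"
    using K_nonneg eps_pos d_pos by (intro mult_nonneg_nonneg sum_nonneg add_nonneg_nonneg) (auto intro: less_imp_le)
  then show ?thesis by (simp add: \<gamma>_def)
qed

text \<open>Let \<open>B\<close> be the sum of all endpoint moduli. The functionals contribute a
  factor \<open>C * B\<close>, summing the test values gives another \<open>B\<close>, and the
  Cauchy-Schwarz inequality bounds the square of \<open>B\<close>.\<close>

lemma boundary_form_bound:
  "cmod (\<Sum>i\<in>{1..N}. of_real (\<sigma> i) * (FR p q i * cnj (q i) - FL p q i * cnj (p i)))
    \<le> K * (\<Sum>i\<in>{1..N}. (cmod (p i))\<^sup>2 + (cmod (q i))\<^sup>2)"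
proof -
  define B where "B = (\<Sum>j\<in>{1..N}. cmod (p j) + cmod (q j))"
  define S where "S = (\<Sum>i\<in>{1..N}. \<sigma> i)"
  have B0: "0 \<le> B" unfolding B_def by (intro sum_nonneg) simp
  have S0: "0 \<le> S" unfolding S_def by (intro sum_nonneg less_imp_le \<sigma>_pos)
  have \<sigma>S: "\<sigma> i \<le> S" if "i \<in> {1..N}" for i
    unfolding S_def by (rule member_le_sum[OF that]) (auto intro!: less_imp_le[OF \<sigma>_pos])
  have "cmod (of_real (\<sigma> i) * (FR p q i * cnj (q i) - FL p q i * cnj (p i))) \<le> S * (C * B) * (cmod (p i) + cmod (q i))"
    if i: "i \<in> {1..N}" for i
  proof -
    have "cmod (FR p q i * cnj (q i) - FL p q i * cnj (p i)) \<le> cmod (FR p q i) * cmod (q i) + cmod (FL p q i) * cmod (p i)"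
      by (metis norm_triangle_ineq4 norm_mult complex_mod_cnj)
    also have "\<dots> \<le> C * B * cmod (q i) + C * B * cmod (p i)"
      unfolding B_def by (intro add_mono mult_right_mono F_bound[OF i]) auto
    finally have "cmod (FR p q i * cnj (q i) - FL p q i * cnj (p i)) \<le> C * B * (cmod (p i) + cmod (q i))"
      by (simp add: distrib_left)
    then have "\<sigma> i * cmod (FR p q i * cnj (q i) - FL p q i * cnj (p i)) \<le> S * (C * B * (cmod (p i) + cmod (q i)))"
      using \<sigma>_pos[OF i] by (intro mult_mono \<sigma>S[OF i] S0) auto
    then show ?thesis using \<sigma>_pos[OF i] by (simp add: norm_mult mult.assoc)
  qed
  then have "cmod (\<Sum>i\<in>{1..N}. of_real (\<sigma> i) * (FR p q i * cnj (q i) - FL p q i * cnj (p i)))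
      \<le> (\<Sum>i\<in>{1..N}. S * (C * B) * (cmod (p i) + cmod (q i)))"
    by (intro order_trans[OF norm_sum sum_mono])
  also have "\<dots> = S * C * B\<^sup>2"
    unfolding sum_distrib_left[symmetric] B_def[symmetric] by (simp add: power2_eq_square)
  also have "\<dots> \<le> S * C * (2 * real N * (\<Sum>i\<in>{1..N}. (cmod (p i))\<^sup>2 + (cmod (q i))\<^sup>2))"
  proof (intro mult_left_mono)
    have "B\<^sup>2 \<le> (\<Sum>i\<in>{1..N}. (cmod (p i) + cmod (q i))\<^sup>2) * (\<Sum>i\<in>{1..N}. 1\<^sup>2)"
      using Cauchy_Schwarz_ineq_sum[of "\<lambda>i. cmod (p i) + cmod (q i)" "\<lambda>_. 1" "{1..N}"] by (simp add: B_def)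
    also have "\<dots> \<le> (\<Sum>i\<in>{1..N}. 2 * ((cmod (p i))\<^sup>2 + (cmod (q i))\<^sup>2)) * (\<Sum>i\<in>{1..N}. 1\<^sup>2)"
    proof (intro mult_right_mono sum_mono)
      have "2 * (x\<^sup>2 + y\<^sup>2) - (x + y)\<^sup>2 = (x - y)\<^sup>2" for x y :: real
        by (simp add: power2_eq_square algebra_simps)
      then have "(x + y)\<^sup>2 \<le> 2 * (x\<^sup>2 + y\<^sup>2)" for x y :: real by (metis diff_ge_0_iff_ge zero_le_power2)
      then show "(cmod (p i) + cmod (q i))\<^sup>2 \<le> 2 * ((cmod (p i))\<^sup>2 + (cmod (q i))\<^sup>2)" for i .
    qed simp
    also have "\<dots> = 2 * real N * (\<Sum>i\<in>{1..N}. (cmod (p i))\<^sup>2 + (cmod (q i))\<^sup>2)"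
      unfolding sum_distrib_left[symmetric] by simp
    finally show "B\<^sup>2 \<le> 2 * real N * (\<Sum>i\<in>{1..N}. (cmod (p i))\<^sup>2 + (cmod (q i))\<^sup>2)" .
  qed (use S0 C_nonneg in simp)
  finally show ?thesis by (simp add: K_def S_def ac_simps)
qed

lemma G_sectorial:
  assumes G: "(u, w) \<in> G k" and k: "k0 \<le> k" and z: "z \<in> quarter"
  shows "Re (z * (L2_inner N d w u - of_real \<gamma> * L2_inner N d u u)) \<le> 0"
proof -
  obtain U V where u: "u \<in> L2_graph N d" and w: "w \<in> L2_graph N d" and s: "solution k u w U V"
    using G by (auto simp: G_def)
  define p where "p i = U i 0" for i
  define q where "q i = U i (d i)" for i
  define nU where "nU i = integral {0..d i} (\<lambda>x. (cmod (U i x))\<^sup>2)" for i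
  define nV where "nV i = integral {0..d i} (\<lambda>x. (cmod (V i x))\<^sup>2)" for i
  define b where "b = (\<Sum>i\<in>{1..N}. of_real (\<sigma> i) * (FR p q i * cnj (q i) - FL p q i * cnj (p i)))"
  define D where "D = (\<Sum>i\<in>{1..N}. k * \<sigma> i * nV i)"
  define n where "n = (\<Sum>i\<in>{1..N}. nU i)"
  have k_pos: "0 < k" using k k0_pos by simp
  have nU0: "0 \<le> nU i" and nV0: "0 \<le> nV i" if "i \<in> {1..N}" for i
    unfolding nU_def nV_def
    by (intro integral_nonneg integrable_continuous_real continuous_intros
        primitive_continuous[OF solutionD(1)[OF s that]] primitive_continuous[OF solutionD(2)[OF s that]] zero_le_power2)+
  \<comment> \<open>Green's identity on each edge. The boundary conditions replace \<open>k\<close>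
    times the end values of \<open>V\<close> by \<open>FR\<close> and \<open>FL\<close>, which
    leaves \<open>k\<close> only in the gradient term \<open>D\<close>.\<close>
  have wu: "L2_inner N d w u = b - of_real D"
  proof -
    have "(LINT x|lebesgue_on {0<..<d i}. on_edge w i x * cnj (on_edge u i x)) =
        of_real (\<sigma> i) * (FR p q i * cnj (q i) - FL p q i * cnj (p i)) - of_real (k * \<sigma> i * nV i)"
      if i: "i \<in> {1..N}" for i
    proof -
      note Di = solutionD[OF s i]
      let ?h = "\<lambda>x. w (i, x) / of_real (k * \<sigma> i)"
      have nz: "complex_of_real (k * \<sigma> i) \<noteq> 0" using k_pos \<sigma>_pos[OF i] by simp
      have "(LINT x|lebesgue_on {0<..<d i}. on_edge w i x * cnj (on_edge u i x)) =
          integral {0..d i} (\<lambda>x. of_real (k * \<sigma> i) * (?h x * cnj (U i x)))"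
      proof (rule LINT_eq_integral_spike)
        show "integrable (lebesgue_on {0<..<d i}) (\<lambda>x. on_edge w i x * cnj (on_edge u i x))"
          unfolding on_edge_def by (rule integrable_mult_cnj[OF L2_graphD(1)[OF w i] L2_graphD(1)[OF u i] L2_graphD(2)[OF w i] L2_graphD(2)[OF u i]])
        show "AE x in lebesgue_on {0<..<d i}. on_edge w i x * cnj (on_edge u i x) = of_real (k * \<sigma> i) * (?h x * cnj (U i x))"
          using Di(3) by eventually_elim (use nz in \<open>simp add: on_edge_def\<close>)
      qed
      also have "\<dots> = of_real (k * \<sigma> i) * (V i (d i) * cnj (U i (d i)) - V i 0 * cnj (U i 0) - of_real (nV i))"
        by (simp only: Henstock_Kurzweil_Integration.integral_mult_right green_identity[OF Di(1,2) d_pos[OF i]] nV_def)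
      also have "\<dots> = of_real (\<sigma> i) * ((of_real k * V i (d i)) * cnj (U i (d i)) - (of_real k * V i 0) * cnj (U i 0)) - of_real (k * \<sigma> i * nV i)"
        by (simp add: algebra_simps)
      finally show ?thesis unfolding Di(4,5) p_def[symmetric] q_def[symmetric] .
    qed
    then show ?thesis unfolding L2_inner_def b_def D_def by (simp add: sum_subtractf)
  qed
  have uu: "L2_inner N d u u = of_real n"
  proof -
    have "(LINT x|lebesgue_on {0<..<d i}. (cmod (u (i, x)))\<^sup>2) = nU i" if i: "i \<in> {1..N}" for i
      unfolding nU_def
      by (rule LINT_eq_integral_spike[OF L2_graphD(2)[OF u i]]) (use solutionD(3)[OF s i] in eventually_elim, simp)
    then have "Re (L2_inner N d u u) = n" unfolding Re_L2_inner_self n_def by (intro sum.cong refl)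
    then show ?thesis by (simp only: L2.ip_self[OF u] Re_complex_of_real)
  qed
  have "cmod b \<le> K * (\<Sum>i\<in>{1..N}. (cmod (p i))\<^sup>2 + (cmod (q i))\<^sup>2)"
    unfolding b_def by (rule boundary_form_bound)
  moreover have "4 * K * (\<Sum>i\<in>{1..N}. eps i * nV i) \<le> D"
  proof -
    have "4 * K * eps i * nV i \<le> k * \<sigma> i * nV i" if i: "i \<in> {1..N}" for i
    proof (intro mult_right_mono nV0[OF i])
      have "4 * K * eps i = k0 * \<sigma> i * (4 * K / (4 * K + 4))" by (simp add: eps_def)
      also have "\<dots> \<le> k0 * \<sigma> i * 1"
        using k0_pos \<sigma>_pos[OF i] K_nonneg by (intro mult_left_mono) auto
      also have "\<dots> \<le> k * \<sigma> i" using k \<sigma>_pos[OF i] by simp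
      finally show "4 * K * eps i \<le> k * \<sigma> i" .
    qed
    then show ?thesis unfolding D_def sum_distrib_left by (intro sum_mono) (simp add: mult.assoc)
  qed
  moreover have "(\<Sum>i\<in>{1..N}. (cmod (p i))\<^sup>2 + (cmod (q i))\<^sup>2) \<le>
      2 * (\<Sum>i\<in>{1..N}. eps i * nV i) + 2 * (\<Sum>i\<in>{1..N}. 1 / d i + 1 / eps i) * n"
  proof -
    let ?M = "\<Sum>i\<in>{1..N}. 1 / d i + 1 / eps i"
    have "(cmod (p i))\<^sup>2 + (cmod (q i))\<^sup>2 \<le> 2 * (eps i * nV i) + 2 * ?M * nU i" if i: "i \<in> {1..N}" for i
    proof -
      note tr = trace_inequality[OF solutionD(1)[OF s i] primitive_continuous[OF solutionD(2)[OF s i]] d_pos[OF i] eps_pos[OF i]]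
      have "1 / d i + 1 / eps i \<le> ?M"
        using less_imp_le[OF d_pos] less_imp_le[OF eps_pos] by (intro member_le_sum[OF i] add_nonneg_nonneg) auto
      then have "(1 / d i + 1 / eps i) * nU i \<le> ?M * nU i" by (intro mult_right_mono nU0[OF i])
      moreover have "(cmod (p i))\<^sup>2 \<le> eps i * nV i + (1 / d i + 1 / eps i) * nU i"
        "(cmod (q i))\<^sup>2 \<le> eps i * nV i + (1 / d i + 1 / eps i) * nU i"
        unfolding p_def q_def nU_def nV_def using d_pos[OF i] by (intro tr; simp)+
      ultimately show ?thesis by linarith
    qed
    then have "(\<Sum>i\<in>{1..N}. (cmod (p i))\<^sup>2 + (cmod (q i))\<^sup>2) \<le> (\<Sum>i\<in>{1..N}. 2 * (eps i * nV i) + 2 * ?M * nU i)"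
      by (rule sum_mono)
    also have "\<dots> = 2 * (\<Sum>i\<in>{1..N}. eps i * nV i) + 2 * ?M * n"
      unfolding sum.distrib sum_distrib_left[symmetric] n_def ..
    finally show ?thesis .
  qed
  \<comment> \<open>The factor 2 pays for the rotation of \<open>b\<close> by \<open>z\<close>, as
    \<open>cmod z \<le> 2 * Re z\<close> on the sector; \<open>D\<close> and \<open>n\<close> are
    real and meet only \<open>Re z\<close>.\<close>
  ultimately have main: "2 * cmod b \<le> D + \<gamma> * n"
  proof -
    assume 1: "cmod b \<le> K * (\<Sum>i\<in>{1..N}. (cmod (p i))\<^sup>2 + (cmod (q i))\<^sup>2)"
      and 2: "4 * K * (\<Sum>i\<in>{1..N}. eps i * nV i) \<le> D"
      and 3: "(\<Sum>i\<in>{1..N}. (cmod (p i))\<^sup>2 + (cmod (q i))\<^sup>2) \<le>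
        2 * (\<Sum>i\<in>{1..N}. eps i * nV i) + 2 * (\<Sum>i\<in>{1..N}. 1 / d i + 1 / eps i) * n"
    have n0: "0 \<le> n" unfolding n_def by (intro sum_nonneg nU0)
    have "2 * cmod b \<le> 2 * (K * (2 * (\<Sum>i\<in>{1..N}. eps i * nV i) + 2 * (\<Sum>i\<in>{1..N}. 1 / d i + 1 / eps i) * n))"
      using 1 mult_left_mono[OF 3 K_nonneg] by linarith
    also have "\<dots> = 4 * K * (\<Sum>i\<in>{1..N}. eps i * nV i) + (\<gamma> - 1) * n"
      unfolding \<gamma>_def by algebra
    also have "\<dots> \<le> D + \<gamma> * n" using 2 n0 by (simp add: left_diff_distrib)
    finally show ?thesis .
  qed
  have zr: "\<bar>Im z\<bar> < Re z" using z by (simp add: quarter_def)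
  then have "cmod z \<le> 2 * Re z" using cmod_le[of z] by linarith
  then have "cmod z * cmod b \<le> 2 * Re z * cmod b" by (rule mult_right_mono) simp
  moreover have "Re (z * b) \<le> cmod z * cmod b" by (metis complex_Re_le_cmod norm_mult)
  moreover have "Re z * (2 * cmod b) \<le> Re z * (D + \<gamma> * n)" using zr by (intro mult_left_mono[OF main]) simp
  moreover have "Re (z * (b - of_real D - of_real \<gamma> * of_real n)) = Re (z * b) - Re z * (D + \<gamma> * n)"
    by (simp add: algebra_simps)
  ultimately show ?thesis unfolding wu uu by simp
qed

lemma nrm_0_iff: "v \<in> L2_graph N d \<Longrightarrow> L2.nrm v = 0 \<longleftrightarrow> (\<forall>i\<in>{1..N}. AE x in lebesgue_on {0<..<d i}. v (i, x) = 0)"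
  unfolding nrm_L2 by (rule L2_norm_eq_0_iff)

end

section \<open>Solvability of the resolvent equation\<close>

context robin_graph
begin

text \<open>The equation u - z (k \<sigma> u'' - \<gamma> u) = f reads u'' = \<mu>^2 u - f / (z k
  \<sigma>) with this root \<mu>; the last term is \<open>source\<close>.\<close>

definition ode_root :: "real \<Rightarrow> complex \<Rightarrow> nat \<Rightarrow> complex" where
  "ode_root k z i = csqrt ((1 + z * of_real \<gamma>) / (z * of_real (k * \<sigma> i)))"

text \<open>\<open>U\<close> and \<open>V = U'\<close> solve \<open>U'' = \<mu>\<^sup>2 U + g\<close> on every edge; \<open>x\<close> collects the free parameters.\<close>

definition edge_fun :: "real \<Rightarrow> complex \<Rightarrow> (nat \<Rightarrow> real \<Rightarrow> complex) \<Rightarrow> (nat \<times> bool \<Rightarrow> complex) \<Rightarrow> nat \<Rightarrow> real \<Rightarrow> complex" where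
  "edge_fun k z g x i = ode_fun (ode_root k z i) (g i) (x (i, True)) (x (i, False))"

definition edge_der :: "real \<Rightarrow> complex \<Rightarrow> (nat \<Rightarrow> real \<Rightarrow> complex) \<Rightarrow> (nat \<times> bool \<Rightarrow> complex) \<Rightarrow> nat \<Rightarrow> real \<Rightarrow> complex" where
  "edge_der k z g x i = ode_der (ode_root k z i) (g i) (x (i, True)) (x (i, False))"

text \<open>The defects of the two boundary conditions of an edge, with \<open>True\<close> for the
  right end. Equations and free parameters share one index set, the pairs of an edge and a truth
  value, so the system is square.\<close>

definition residual :: "real \<Rightarrow> complex \<Rightarrow> (nat \<Rightarrow> real \<Rightarrow> complex) \<Rightarrow> (nat \<times> bool \<Rightarrow> complex) \<Rightarrow> nat \<times> bool \<Rightarrow> complex" where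
  "residual k z g x = (\<lambda>(i, b). if b
     then of_real k * edge_der k z g x i (d i) - FR (\<lambda>j. edge_fun k z g x j 0) (\<lambda>j. edge_fun k z g x j (d j)) i
     else of_real k * edge_der k z g x i 0 - FL (\<lambda>j. edge_fun k z g x j 0) (\<lambda>j. edge_fun k z g x j (d j)) i)"

definition source :: "real \<Rightarrow> complex \<Rightarrow> graph_fun \<Rightarrow> nat \<Rightarrow> real \<Rightarrow> complex" where
  "source k z f i x = - (1 / (z * of_real (k * \<sigma> i))) * f (i, x)"

lemma edge_split:
  "edge_fun k z g x i s = edge_fun k z (\<lambda>_ _. 0) x i s + edge_fun k z g (\<lambda>_. 0) i s"
  "edge_der k z g x i s = edge_der k z (\<lambda>_ _. 0) x i s + edge_der k z g (\<lambda>_. 0) i s"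
  unfolding edge_fun_def edge_der_def by (rule ode_split)+

lemma edge_add:
  "edge_fun k z (\<lambda>_ _. 0) (\<lambda>j. x j + y j) i s = edge_fun k z (\<lambda>_ _. 0) x i s + edge_fun k z (\<lambda>_ _. 0) y i s"
  "edge_der k z (\<lambda>_ _. 0) (\<lambda>j. x j + y j) i s = edge_der k z (\<lambda>_ _. 0) x i s + edge_der k z (\<lambda>_ _. 0) y i s"
  unfolding edge_fun_def edge_der_def by (rule ode_hom_add)+

lemma edge_scale:
  "edge_fun k z (\<lambda>_ _. 0) (\<lambda>j. a * x j) i s = a * edge_fun k z (\<lambda>_ _. 0) x i s"
  "edge_der k z (\<lambda>_ _. 0) (\<lambda>j. a * x j) i s = a * edge_der k z (\<lambda>_ _. 0) x i s"
  unfolding edge_fun_def edge_der_def by (rule ode_hom_scale)+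

lemma residual_split:
  assumes "i \<in> {1..N}"
  shows "residual k z g x (i, b) = residual k z (\<lambda>_ _. 0) x (i, b) + residual k z g (\<lambda>_. 0) (i, b)"
  unfolding residual_def prod.case edge_split[of k z g x] F_add[OF assms] distrib_left by simp

lemma residual_add:
  assumes "i \<in> {1..N}"
  shows "residual k z (\<lambda>_ _. 0) (\<lambda>j. x j + y j) (i, b) = residual k z (\<lambda>_ _. 0) x (i, b) + residual k z (\<lambda>_ _. 0) y (i, b)"
  unfolding residual_def prod.case edge_add F_add[OF assms] distrib_left by simp

lemma residual_scale:
  assumes "i \<in> {1..N}"
  shows "residual k z (\<lambda>_ _. 0) (\<lambda>j. a * x j) (i, b) = a * residual k z (\<lambda>_ _. 0) x (i, b)"
  unfolding residual_def prod.case edge_scale F_scale[OF assms]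
  by (simp add: right_diff_distrib mult.left_commute)

lemma one_plus_nonzero: "z \<in> quarter \<Longrightarrow> 1 + z * of_real \<gamma> \<noteq> 0"
proof
  assume z: "z \<in> quarter" and "1 + z * of_real \<gamma> = 0"
  then have "Re (1 + z * of_real \<gamma>) = 0" by simp
  moreover have "0 \<le> Re z * \<gamma>" using z \<gamma>_pos by (intro mult_nonneg_nonneg) (auto simp: quarter_def)
  ultimately show False by simp
qed

lemma ode_root_nonzero: "i \<in> {1..N} \<Longrightarrow> 0 < k \<Longrightarrow> z \<in> quarter \<Longrightarrow> ode_root k z i \<noteq> 0"
  using \<sigma>_pos[of i] quarter_nonzero[of z] one_plus_nonzero[of z] unfolding ode_root_def csqrt_eq_0 by simp

text \<open>\<open>w\<close> is obtained by solving the resolvent equation for it, so this equation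
  holds by construction. What remains is that \<open>w\<close> is the image of \<open>u\<close>, and
  this is the differential equation together with the vanishing residuals.\<close>

lemma edge_solution:
  assumes z: "z \<in> quarter" and k: "0 < k" and f: "f \<in> L2_graph N d"
    and r: "\<And>i b. i \<in> {1..N} \<Longrightarrow> residual k z (source k z f) x (i, b) = 0"
    and u: "u = (\<lambda>(i, s). edge_fun k z (source k z f) x i s)"
    and w: "w = (\<lambda>s. 1 / z * ((1 + z * of_real \<gamma>) * u s - f s))"
  shows "u \<in> L2_graph N d" "w \<in> L2_graph N d"
    "solution k u w (edge_fun k z (source k z f) x) (edge_der k z (source k z f) x)"
proof -
  let ?g = "source k z f"
  have p: "primitive (d i) (edge_fun k z ?g x i) (edge_der k z ?g x i)"
    "primitive (d i) (edge_der k z ?g x i) (\<lambda>s. (ode_root k z i)\<^sup>2 * edge_fun k z ?g x i s + ?g i s)"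
    if i: "i \<in> {1..N}" for i
  proof -
    have "(\<lambda>x. f (i, x)) absolutely_integrable_on {0..d i}"
      by (rule square_integrable_imp_absolutely_integrable[OF L2_graphD[OF f i]])
    then have "(\<lambda>x. - (1 / (z * of_real (k * \<sigma> i))) * f (i, x)) absolutely_integrable_on {0..d i}"
      by (rule set_integrable_mult_right)
    then have "?g i absolutely_integrable_on {0..d i}" by (simp only: source_def[abs_def])
    note P = primitive_ode[OF this ode_root_nonzero[OF i k z]]
    show "primitive (d i) (edge_fun k z ?g x i) (edge_der k z ?g x i)"
      "primitive (d i) (edge_der k z ?g x i) (\<lambda>s. (ode_root k z i)\<^sup>2 * edge_fun k z ?g x i s + ?g i s)"
      unfolding edge_fun_def edge_der_def by (rule P)+
  qed
  show uX: "u \<in> L2_graph N d"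
  proof -
    have e: "on_edge u i = edge_fun k z ?g x i" for i by (rule ext) (simp add: on_edge_def u)
    show ?thesis
      unfolding L2_graph_def mem_Collect_eq e by (intro ballI conjI continuous_square_integrable[OF primitive_continuous[OF p(1)]])
  qed
  have "(\<lambda>s. (1 + z * of_real \<gamma>) * u s) - f \<in> L2_graph N d" by (intro L2.diff_in L2.scale_in uX f)
  from L2.scale_in[OF this, of "1 / z"] show "w \<in> L2_graph N d" unfolding w minus_apply .
  show "solution k u w (edge_fun k z ?g x) (edge_der k z ?g x)"
    unfolding solution_def
  proof (intro ballI conjI)
    fix i assume i: "i \<in> {1..N}"
    show "primitive (d i) (edge_fun k z ?g x i) (edge_der k z ?g x i)" by (rule p(1)[OF i])
    have "(ode_root k z i)\<^sup>2 * edge_fun k z ?g x i s + ?g i s = w (i, s) / of_real (k * \<sigma> i)" for s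
    proof -
      have nz: "z \<noteq> 0" "complex_of_real (k * \<sigma> i) \<noteq> 0" using quarter_nonzero[OF z] k \<sigma>_pos[OF i] by simp_all
      have "(1 + z * of_real \<gamma>) / (z * c) * y + - (1 / (z * c)) * e = 1 / z * ((1 + z * of_real \<gamma>) * y - e) / c"
        if "c \<noteq> 0" for c y e :: complex
        using nz(1) that by (simp add: field_simps)
      from this[OF nz(2)] show ?thesis by (simp only: ode_root_def power2_csqrt source_def w u prod.case)
    qed
    then show "primitive (d i) (edge_der k z ?g x i) (\<lambda>s. w (i, s) / of_real (k * \<sigma> i))"
      using p(2)[OF i] by (simp only:)
    show "AE s in lebesgue_on {0<..<d i}. u (i, s) = edge_fun k z ?g x i s" by (simp add: u)
    show "of_real k * edge_der k z ?g x i 0 = FL (\<lambda>j. edge_fun k z ?g x j 0) (\<lambda>j. edge_fun k z ?g x j (d j)) i"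
      using r[OF i, of False] by (simp add: residual_def)
    show "of_real k * edge_der k z ?g x i (d i) = FR (\<lambda>j. edge_fun k z ?g x j 0) (\<lambda>j. edge_fun k z ?g x j (d j)) i"
      using r[OF i, of True] by (simp add: residual_def)
  qed
qed

text \<open>A homogeneous solution gives a pair in \<open>G k\<close> with w - \<gamma> u = u / z,
  so the quantity that sectoriality makes nonpositive is the square norm of \<open>u\<close>. Hence
  \<open>u\<close> is null, and its vanishing value and derivative at 0 determine the
  parameters.\<close>

lemma residual_injective:
  assumes z: "z \<in> quarter" and k: "k0 \<le> k"
    and r: "\<And>i b. i \<in> {1..N} \<Longrightarrow> residual k z (\<lambda>_ _. 0) x (i, b) = 0" and i: "i \<in> {1..N}"
  shows "x (i, b) = 0"
proof -
  have k_pos: "0 < k" using k k0_pos by simp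
  have src: "source k z (\<lambda>_. 0) = (\<lambda>_ _. 0)" by (intro ext) (simp add: source_def)
  have zero: "(\<lambda>_. 0) \<in> L2_graph N d" using L2.zero_in by (simp only: zero_fun_def)
  define u where "u = (\<lambda>(i, s). edge_fun k z (\<lambda>_ _. 0) x i s)"
  define w where "w = (\<lambda>s. 1 / z * ((1 + z * of_real \<gamma>) * u s - 0))"
  note E = edge_solution[OF z k_pos zero, unfolded src, OF r u_def w_def]
  have "(u, w) \<in> G k" using E by (auto simp: G_def)
  from G_sectorial[OF this k z] have le: "Re (z * (L2_inner N d w u - of_real \<gamma> * L2_inner N d u u)) \<le> 0" .
  have "w = (\<lambda>s. (1 / z * (1 + z * of_real \<gamma>)) * u s)" by (simp add: w_def)
  then have "L2_inner N d w u = 1 / z * (1 + z * of_real \<gamma>) * L2_inner N d u u"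
    by (simp only: L2.ip_scale_left[OF E(1) E(1)])
  then have "z * (L2_inner N d w u - of_real \<gamma> * L2_inner N d u u) = L2_inner N d u u"
    using quarter_nonzero[OF z] by (simp add: field_simps)
  then have "L2.nrm u = 0" using le L2.ip_nonneg[OF E(1)] by (simp add: L2.nrm_def)
  then have ae: "AE x in lebesgue_on {0<..<d i}. u (i, x) = 0"
    using L2_norm_eq_0_iff[OF E(1)] i unfolding nrm_L2 by blast
  have "0 \<in> {0..d i}" using d_pos[OF i] by simp
  then have "ode_fun (ode_root k z i) (\<lambda>_. 0) (x (i, True)) (x (i, False)) 0 = 0"
    "ode_der (ode_root k z i) (\<lambda>_. 0) (x (i, True)) (x (i, False)) 0 = 0"
    using solution_zero(1,2)[OF E(3) i k_pos ae, of 0] by (simp_all add: edge_fun_def edge_der_def)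
  from ode_initial_zero[OF this ode_root_nonzero[OF i k_pos z]] show ?thesis by (cases b) simp_all
qed

text \<open>The parameters are chosen so that the homogeneous solution cancels the boundary defects
  of the particular solution with zero parameters.\<close>

lemma G_resolvent:
  assumes z: "z \<in> quarter" and k: "k0 \<le> k" and f: "f \<in> L2_graph N d"
  shows "\<exists>u w. (u, w) \<in> G k \<and> L2.nrm (\<lambda>s. u s - z * (w s - of_real \<gamma> * u s) - f s) = 0"
proof -
  have k_pos: "0 < k" using k k0_pos by simp
  have "\<exists>x. \<forall>j\<in>{1..N} \<times> UNIV. residual k z (\<lambda>_ _. 0) x j = - residual k z (source k z f) (\<lambda>_. 0) j"
  proof (rule finite_linear_system)
    show "residual k z (\<lambda>_ _. 0) (\<lambda>j. x j + y j) j = residual k z (\<lambda>_ _. 0) x j + residual k z (\<lambda>_ _. 0) y j"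
      if "j \<in> {1..N} \<times> UNIV" for x y j
      using that residual_add[of "fst j" k z x y "snd j"] by auto
    show "residual k z (\<lambda>_ _. 0) (\<lambda>j. a * x j) j = a * residual k z (\<lambda>_ _. 0) x j"
      if "j \<in> {1..N} \<times> UNIV" for a x j
      using that residual_scale[of "fst j" k z a x "snd j"] by auto
    show "x j = 0" if r: "\<And>j. j \<in> {1..N} \<times> UNIV \<Longrightarrow> residual k z (\<lambda>_ _. 0) x j = 0" and j: "j \<in> {1..N} \<times> UNIV" for x j
      using residual_injective[OF z k, of x "fst j" "snd j"] r j by auto
  qed simp
  then obtain x where x: "\<And>j. j \<in> {1..N} \<times> UNIV \<Longrightarrow> residual k z (\<lambda>_ _. 0) x j = - residual k z (source k z f) (\<lambda>_. 0) j"
    by blast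
  have r: "residual k z (source k z f) x (i, b) = 0" if "i \<in> {1..N}" for i b
    using x[of "(i, b)"] that unfolding residual_split[OF that, of k z "source k z f" x] by simp
  define u where "u = (\<lambda>(i, s). edge_fun k z (source k z f) x i s)"
  define w where "w = (\<lambda>s. 1 / z * ((1 + z * of_real \<gamma>) * u s - f s))"
  have "(u, w) \<in> G k" using edge_solution[OF z k_pos f r u_def w_def] by (auto simp: G_def)
  moreover have "u s - z * (w s - of_real \<gamma> * u s) - f s = 0" for s
    using quarter_nonzero[OF z] by (simp add: w_def right_diff_distrib distrib_right)
  moreover have "L2.nrm (\<lambda>s. 0) = 0" by (simp add: L2.nrm_def Re_L2_inner_self)
  ultimately show ?thesis by (intro exI[of _ u] exI[of _ w]) (simp only: simp_thms)
qed

lemma G_iff: "(u, w) \<in> G k \<longleftrightarrow> u \<in> L2_graph N d \<and> w \<in> L2_graph N d \<and> (\<exists>U V. solution k u w U V)"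
  by (simp add: G_def)

theorem quasi_sectorial_G:
  assumes k: "k0 \<le> k"
  shows "quasi_sectorial (L2_graph N d) (L2_inner N d) (G k) \<gamma>"
proof (intro quasi_sectorial.intro quasi_sectorial_axioms.intro semi_hilbert_L2_graph)
  have k_pos: "0 < k" using k k0_pos by simp
  show "u \<in> L2_graph N d \<and> w \<in> L2_graph N d" if "(u, w) \<in> G k" for u w
    using that by (auto simp: G_def)
  show "(u + u', w + w') \<in> G k" if uw: "(u, w) \<in> G k" "(u', w') \<in> G k" for u w u' w'
  proof -
    obtain U V U' V' where "solution k u w U V" "solution k u' w' U' V'"
      using uw unfolding G_iff by (elim conjE exE)
    from solution_add[OF this] show ?thesis using uw unfolding G_iff by (intro conjI L2.add_in exI) simp_all
  qed
  show "(\<lambda>s. a * u s, \<lambda>s. a * w s) \<in> G k" if uw: "(u, w) \<in> G k" for a u w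
  proof -
    obtain U V where "solution k u w U V" using uw unfolding G_iff by (elim conjE exE)
    from solution_scale[OF this] show ?thesis using uw unfolding G_iff by (intro conjI L2.scale_in exI) simp_all
  qed
  show "L2.nrm w = 0" if uw: "(u, w) \<in> G k" and z: "L2.nrm u = 0" for u w
  proof -
    obtain U V where u: "u \<in> L2_graph N d" and w: "w \<in> L2_graph N d" and s: "solution k u w U V"
      using uw by (auto simp: G_def)
    show ?thesis using solution_zero(3)[OF s _ k_pos] z unfolding nrm_0_iff[OF u] nrm_0_iff[OF w] by blast
  qed
  show "(u', w') \<in> G k" if uw: "(u, w) \<in> G k" and u': "u' \<in> L2_graph N d" and w': "w' \<in> L2_graph N d"
    and zu: "L2.nrm (u' - u) = 0" and zw: "L2.nrm (w' - w) = 0" for u w u' w'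
  proof -
    obtain U V where u: "u \<in> L2_graph N d" and w: "w \<in> L2_graph N d" and s: "solution k u w U V"
      using uw by (auto simp: G_def)
    have "AE x in lebesgue_on {0<..<d i}. u' (i, x) = u (i, x)" "AE x in lebesgue_on {0<..<d i}. w' (i, x) = w (i, x)"
      if "i \<in> {1..N}" for i
      using zu zw that unfolding nrm_0_iff[OF L2.diff_in[OF u' u]] nrm_0_iff[OF L2.diff_in[OF w' w]] by simp_all
    from solution_cong_AE[OF s this] show ?thesis using u' w' unfolding G_def by blast
  qed
  show "Re (z * (L2_inner N d w u - of_real \<gamma> * L2_inner N d u u)) \<le> 0" if "(u, w) \<in> G k" "z \<in> quarter" for u w z
    by (rule G_sectorial[OF that(1) k that(2)])
  show "\<exists>u w. (u, w) \<in> G k \<and> L2.nrm (\<lambda>s. u s - z * (w s - of_real \<gamma> * u s) - f s) = 0"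
    if "z \<in> quarter" "f \<in> L2_graph N d" for z f
    by (rule G_resolvent[OF that(1) k that(2)])
qed

end

section \<open>Weak derivatives on the graph and primitives\<close>

lemma weakly_differentiable_imp: "weakly_differentiable a f \<Longrightarrow> is_weak_deriv a f (weak_deriv a f)"
  unfolding weakly_differentiable_def weak_deriv_def by (erule someI_ex)

lemma on_edge_graph_deriv: "on_edge (graph_deriv d u) i = weak_deriv (d i) (on_edge u i)"
  by (rule ext) (simp add: graph_deriv_def on_edge_def)

text \<open>Both weak derivatives are square integrable, so \<open>weak_deriv_imp_primitive\<close>
  applies to \<open>u\<close> and to its derivative. The density of the first primitive is then
  replaced by its continuous representative \<open>V\<close>.\<close>

lemma H2_graph_primitive:
  assumes u: "u \<in> H2_graph N d" and i: "i \<in> {1..N}" and d: "0 < d i"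
  obtains U V where "primitive (d i) U V" "primitive (d i) V (\<lambda>x. graph_deriv d (graph_deriv d u) (i, x))"
    "AE x in lebesgue_on {0<..<d i}. u (i, x) = U x" "AE x in lebesgue_on {0<..<d i}. graph_deriv d u (i, x) = V x"
proof -
  have H: "\<exists>F. primitive (d i) F (\<lambda>x. graph_deriv d v (i, x)) \<and> (AE x in lebesgue_on {0<..<d i}. v (i, x) = F x)"
    if v: "weakly_differentiable (d i) (on_edge v i)" "graph_deriv d v \<in> L2_graph N d" for v
  proof -
    have "is_weak_deriv (d i) (\<lambda>x. v (i, x)) (\<lambda>x. graph_deriv d v (i, x))"
      using weakly_differentiable_imp[OF v(1), folded on_edge_graph_deriv] unfolding on_edge_def .
    then show ?thesis
      by (rule weak_deriv_imp_primitive[OF _ square_integrable_imp_absolutely_integrable[OF L2_graphD[OF v(2) i]] d])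
  qed
  obtain U where U: "primitive (d i) U (\<lambda>x. graph_deriv d u (i, x))" "AE x in lebesgue_on {0<..<d i}. u (i, x) = U x"
    using H[of u] u i unfolding H2_graph_def by blast
  obtain V where V: "primitive (d i) V (\<lambda>x. graph_deriv d (graph_deriv d u) (i, x))"
      "AE x in lebesgue_on {0<..<d i}. graph_deriv d u (i, x) = V x"
    using H[of "graph_deriv d u"] u i unfolding H2_graph_def by blast
  show thesis by (rule that[OF primitive_cong_AE[OF U(1) V(2)] V(1) U(2) V(2)])
qed

lemma weak_deriv_AE_eq:
  assumes p: "primitive (d i) F g" and f: "AE x in lebesgue_on {0<..<d i}. u (i, x) = F x" and d: "0 < d i"
  shows "weakly_differentiable (d i) (on_edge u i)"
    "AE x in lebesgue_on {0<..<d i}. graph_deriv d u (i, x) = g x"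
proof -
  have w: "is_weak_deriv (d i) (on_edge u i) g"
    unfolding on_edge_def by (rule primitive_imp_weak_deriv[OF p f d])
  then show wd: "weakly_differentiable (d i) (on_edge u i)" unfolding weakly_differentiable_def by blast
  have "AE x in lebesgue_on {0<..<d i}. on_edge (graph_deriv d u) i x = g x"
    unfolding on_edge_graph_deriv by (rule is_weak_deriv_unique[OF weakly_differentiable_imp[OF wd] w])
  then show "AE x in lebesgue_on {0<..<d i}. graph_deriv d u (i, x) = g x" by (simp add: on_edge_def)
qed

lemma L2_graph_edgewise_scale:
  assumes "w \<in> L2_graph N d" shows "(\<lambda>(i, x). a i * w (i, x)) \<in> L2_graph N d"
  using L2_graphD[OF assms] unfolding L2_graph_def on_edge_def
  by (auto simp: norm_mult power_mult_distrib)

lemma endpoint_values: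
  assumes p: "primitive (d i) F g" and f: "AE x in lebesgue_on {0<..<d i}. u (i, x) = F x" and d: "0 < d i"
  shows "left_value d u i = F 0" "right_value d u i = F (d i)"
  unfolding left_value_def right_value_def on_edge_def
  using d by (auto intro!: cont_rep_eq[OF primitive_continuous[OF p] d f])

text \<open>\<open>graph_deriv\<close> is a choice among weak derivatives and determined almost
  everywhere only. It has to be identified with \<open>V\<close> before the same argument can be
  applied to the second derivative.\<close>

lemma H2_graphI:
  assumes u: "u \<in> L2_graph N d" and h: "h \<in> L2_graph N d" and d: "\<And>i. i \<in> {1..N} \<Longrightarrow> 0 < d i"
    and p: "\<And>i. i \<in> {1..N} \<Longrightarrow> primitive (d i) (U i) (V i)" "\<And>i. i \<in> {1..N} \<Longrightarrow> primitive (d i) (V i) (\<lambda>x. h (i, x))"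
    and ae: "\<And>i. i \<in> {1..N} \<Longrightarrow> AE x in lebesgue_on {0<..<d i}. u (i, x) = U i x"
  shows "u \<in> H2_graph N d"
    "\<And>i. i \<in> {1..N} \<Longrightarrow> AE x in lebesgue_on {0<..<d i}. graph_deriv d u (i, x) = V i x"
    "\<And>i. i \<in> {1..N} \<Longrightarrow> AE x in lebesgue_on {0<..<d i}. graph_deriv d (graph_deriv d u) (i, x) = h (i, x)"
proof -
  show ae1: "AE x in lebesgue_on {0<..<d i}. graph_deriv d u (i, x) = V i x" if "i \<in> {1..N}" for i
    by (rule weak_deriv_AE_eq(2)[where d = d and i = i and u = u and F = "U i", OF p(1)[OF that] ae[OF that] d[OF that]])
  show ae2: "AE x in lebesgue_on {0<..<d i}. graph_deriv d (graph_deriv d u) (i, x) = h (i, x)" if "i \<in> {1..N}" for i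
    by (rule weak_deriv_AE_eq(2)[where d = d and i = i and u = "graph_deriv d u" and F = "V i" and g = "\<lambda>x. h (i, x)",
      OF p(2)[OF that] ae1[OF that] d[OF that]])
  have "graph_deriv d u \<in> L2_graph N d"
  proof -
    have "(\<lambda>x. graph_deriv d u (i, x)) \<in> borel_measurable (lebesgue_on {0<..<d i})"
      "integrable (lebesgue_on {0<..<d i}) (\<lambda>x. (cmod (graph_deriv d u (i, x)))\<^sup>2)" if i: "i \<in> {1..N}" for i
    proof -
      have "AE x in lebesgue_on {0<..<d i}. V i x = graph_deriv d u (i, x)" using ae1[OF i] by eventually_elim simp
      note square_integrable_cong_AE[OF continuous_square_integrable[OF primitive_continuous[OF p(2)[OF i]]] this]
      then show "(\<lambda>x. graph_deriv d u (i, x)) \<in> borel_measurable (lebesgue_on {0<..<d i})"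
        "integrable (lebesgue_on {0<..<d i}) (\<lambda>x. (cmod (graph_deriv d u (i, x)))\<^sup>2)" by blast+
    qed
    then show ?thesis unfolding L2_graph_def on_edge_def by blast
  qed
  moreover have "graph_deriv d (graph_deriv d u) \<in> L2_graph N d"
  proof -
    have "(\<lambda>x. graph_deriv d (graph_deriv d u) (i, x)) \<in> borel_measurable (lebesgue_on {0<..<d i})"
      "integrable (lebesgue_on {0<..<d i}) (\<lambda>x. (cmod (graph_deriv d (graph_deriv d u) (i, x)))\<^sup>2)" if i: "i \<in> {1..N}" for i
    proof -
      have "AE x in lebesgue_on {0<..<d i}. h (i, x) = graph_deriv d (graph_deriv d u) (i, x)"
        using ae2[OF i] by eventually_elim simp
      note square_integrable_cong_AE[OF L2_graphD[OF h i] this]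
      then show "(\<lambda>x. graph_deriv d (graph_deriv d u) (i, x)) \<in> borel_measurable (lebesgue_on {0<..<d i})"
        "integrable (lebesgue_on {0<..<d i}) (\<lambda>x. (cmod (graph_deriv d (graph_deriv d u) (i, x)))\<^sup>2)" by blast+
    qed
    then show ?thesis unfolding L2_graph_def on_edge_def by blast
  qed
  moreover have "weakly_differentiable (d i) (on_edge u i)" "weakly_differentiable (d i) (on_edge (graph_deriv d u) i)"
    if i: "i \<in> {1..N}" for i
    using weak_deriv_AE_eq(1)[where d = d and i = i and u = u, OF p(1)[OF i] ae[OF i] d[OF i]]
      weak_deriv_AE_eq(1)[where d = d and i = i and u = "graph_deriv d u", OF p(2)[OF i] ae1[OF i] d[OF i]]
    by blast+
  ultimately show "u \<in> H2_graph N d" using u unfolding H2_graph_def by blast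
qed

context robin_graph
begin

text \<open>Boundedness implies that the functionals see only the values on the edges: for a
  difference that vanishes there, the bound is 0.\<close>

lemma F_cong:
  assumes i: "i \<in> {1..N}" and e: "\<And>j. j \<in> {1..N} \<Longrightarrow> p j = p' j \<and> q j = q' j"
  shows "FL p q i = FL p' q' i" "FR p q i = FR p' q' i"
proof -
  have z: "(\<Sum>j\<in>{1..N}. cmod (p j - p' j) + cmod (q j - q' j)) = 0" using e by (intro sum.neutral) simp
  have "FL (\<lambda>j. p j - p' j) (\<lambda>j. q j - q' j) i = 0" "FR (\<lambda>j. p j - p' j) (\<lambda>j. q j - q' j) i = 0"
    using F_bound[OF i, of "\<lambda>j. p j - p' j" "\<lambda>j. q j - q' j"] unfolding z by simp_all
  then show "FL p q i = FL p' q' i" "FR p q i = FR p' q' i"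
    using F_add[OF i, of "\<lambda>j. p j - p' j" p' "\<lambda>j. q j - q' j" q'] by simp_all
qed

text \<open>Whichever weak derivatives are chosen, \<open>left_value\<close> and
  \<open>right_value\<close> read off the absolutely continuous representatives, so both
  descriptions impose the same boundary conditions.\<close>

lemma G_eq_H2:
  assumes k: "0 < k"
  shows "G k = {(u, w). (u \<in> H2_graph N d \<and> (\<forall>i\<in>{1..N}.
      of_real k * left_value d (graph_deriv d u) i = FL (left_value d u) (right_value d u) i \<and>
      of_real k * right_value d (graph_deriv d u) i = FR (left_value d u) (right_value d u) i)) \<and> w \<in> L2_graph N d \<and>
      same_class (L2_norm N d) w (\<lambda>(i, x). of_real (k * \<sigma> i) * graph_deriv d (graph_deriv d u) (i, x))}"
    (is "_ = ?R")
proof (intro set_eqI iffI)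
  have nz: "complex_of_real (k * \<sigma> i) \<noteq> 0" if "i \<in> {1..N}" for i using k \<sigma>_pos[OF that] by simp
  have same_class_iff: "same_class (L2_norm N d) w (\<lambda>(i, x). of_real (k * \<sigma> i) * h (i, x)) \<longleftrightarrow>
      (\<forall>i\<in>{1..N}. AE x in lebesgue_on {0<..<d i}. w (i, x) = of_real (k * \<sigma> i) * h (i, x))"
    if "w \<in> L2_graph N d" "h \<in> L2_graph N d" for w h
    unfolding same_class_def
    using nrm_0_iff[OF L2.diff_in[OF that(1) L2_graph_edgewise_scale[OF that(2), of "\<lambda>i. of_real (k * \<sigma> i)"]]]
    by (simp add: nrm_L2 fun_diff_def)
  fix uw assume "uw \<in> G k"
  then obtain u w U V where uw: "uw = (u, w)" and u: "u \<in> L2_graph N d" and w: "w \<in> L2_graph N d" and s: "solution k u w U V"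
    by (cases uw) (auto simp: G_iff)
  note D = solutionD[OF s]
  \<comment> \<open>The second derivative that \<open>w\<close> dictates on each edge.\<close>
  define h where "h = (\<lambda>(i, x). 1 / of_real (k * \<sigma> i) * w (i, x))"
  have h: "h \<in> L2_graph N d" unfolding h_def by (rule L2_graph_edgewise_scale[OF w])
  have ph: "primitive (d i) (V i) (\<lambda>x. h (i, x))" if "i \<in> {1..N}" for i
    using D(2)[OF that] by (simp add: h_def)
  note H' = H2_graphI[OF u h d_pos D(1) ph D(3)]
  have H: "u \<in> H2_graph N d" by (rule H'(1))
  have H1: "AE x in lebesgue_on {0<..<d i}. graph_deriv d u (i, x) = V i x" if "i \<in> {1..N}" for i
    by (rule H'(2)) (use that in simp_all)
  have H2: "AE x in lebesgue_on {0<..<d i}. graph_deriv d (graph_deriv d u) (i, x) = h (i, x)" if "i \<in> {1..N}" for i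
    by (rule H'(3)) (use that in simp_all)
  have "AE x in lebesgue_on {0<..<d i}. w (i, x) = of_real (k * \<sigma> i) * graph_deriv d (graph_deriv d u) (i, x)"
    if i: "i \<in> {1..N}" for i
    using H2[OF i] by eventually_elim (use nz[OF i] in \<open>simp add: h_def\<close>)
  moreover have "graph_deriv d (graph_deriv d u) \<in> L2_graph N d" using H by (simp add: H2_graph_def)
  ultimately have "same_class (L2_norm N d) w (\<lambda>(i, x). of_real (k * \<sigma> i) * graph_deriv d (graph_deriv d u) (i, x))"
    using same_class_iff[OF w] by blast
  moreover have bc: "of_real k * left_value d (graph_deriv d u) i = FL (left_value d u) (right_value d u) i \<and>
      of_real k * right_value d (graph_deriv d u) i = FR (left_value d u) (right_value d u) i" if i: "i \<in> {1..N}" for i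
  proof -
    have v: "left_value d u j = U j 0 \<and> right_value d u j = U j (d j)" if "j \<in> {1..N}" for j
      using endpoint_values[where d = d and i = j and u = u, OF D(1)[OF that] D(3)[OF that] d_pos[OF that]] by blast
    have F: "FL (left_value d u) (right_value d u) i = FL (\<lambda>j. U j 0) (\<lambda>j. U j (d j)) i"
      "FR (left_value d u) (right_value d u) i = FR (\<lambda>j. U j 0) (\<lambda>j. U j (d j)) i"
      by (rule F_cong[OF i v], assumption)+
    show ?thesis
      unfolding F endpoint_values[where d = d and i = i and u = "graph_deriv d u", OF D(2)[OF i] H1[OF i] d_pos[OF i]]
      using D(4,5)[OF i] by blast
  qed
  ultimately show "uw \<in> ?R" unfolding uw mem_Collect_eq prod.case by (intro conjI ballI H w bc)
next
  have nz: "complex_of_real (k * \<sigma> i) \<noteq> 0" if "i \<in> {1..N}" for i using k \<sigma>_pos[OF that] by simp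
  fix uw assume R: "uw \<in> ?R"
  obtain u w where uw: "uw = (u, w)" by (cases uw)
  note R' = R[unfolded uw mem_Collect_eq prod.case]
  have u: "u \<in> H2_graph N d" and w: "w \<in> L2_graph N d"
    and sc: "same_class (L2_norm N d) w (\<lambda>(i, x). of_real (k * \<sigma> i) * graph_deriv d (graph_deriv d u) (i, x))"
    by (rule R'[THEN conjunct1, THEN conjunct1], rule R'[THEN conjunct2, THEN conjunct1], rule R'[THEN conjunct2, THEN conjunct2])
  have bc: "of_real k * left_value d (graph_deriv d u) i = FL (left_value d u) (right_value d u) i"
    "of_real k * right_value d (graph_deriv d u) i = FR (left_value d u) (right_value d u) i" if "i \<in> {1..N}" for i
    using bspec[OF R'[THEN conjunct1, THEN conjunct2] that] by (rule conjunct1, rule conjunct2)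
  let ?g = "graph_deriv d (graph_deriv d u)"
  have L2: "u \<in> L2_graph N d" "?g \<in> L2_graph N d" using u by (auto simp: H2_graph_def)
  have "\<forall>i\<in>{1..N}. \<exists>UV. primitive (d i) (fst UV) (snd UV) \<and> primitive (d i) (snd UV) (\<lambda>x. ?g (i, x)) \<and>
      (AE x in lebesgue_on {0<..<d i}. u (i, x) = fst UV x) \<and> (AE x in lebesgue_on {0<..<d i}. graph_deriv d u (i, x) = snd UV x)"
  proof
    fix i assume i: "i \<in> {1..N}"
    obtain U V where "primitive (d i) U V" "primitive (d i) V (\<lambda>x. ?g (i, x))"
      "AE x in lebesgue_on {0<..<d i}. u (i, x) = U x" "AE x in lebesgue_on {0<..<d i}. graph_deriv d u (i, x) = V x"
      by (rule H2_graph_primitive[of u N d i, OF u i d_pos[OF i]])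
    then show "\<exists>UV. primitive (d i) (fst UV) (snd UV) \<and> primitive (d i) (snd UV) (\<lambda>x. ?g (i, x)) \<and>
      (AE x in lebesgue_on {0<..<d i}. u (i, x) = fst UV x) \<and> (AE x in lebesgue_on {0<..<d i}. graph_deriv d u (i, x) = snd UV x)"
      by (intro exI[of _ "(U, V)"]) (simp only: fst_conv snd_conv simp_thms)
  qed
  from bchoice[OF this] obtain UV where UV: "\<forall>i\<in>{1..N}. primitive (d i) (fst (UV i)) (snd (UV i)) \<and> primitive (d i) (snd (UV i)) (\<lambda>x. ?g (i, x)) \<and>
      (AE x in lebesgue_on {0<..<d i}. u (i, x) = fst (UV i) x) \<and> (AE x in lebesgue_on {0<..<d i}. graph_deriv d u (i, x) = snd (UV i) x)" ..
  define U where "U i = fst (UV i)" for i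
  define V where "V i = snd (UV i)" for i
  note P0 = bspec[OF UV, folded U_def V_def]
  note P = P0[THEN conjunct1] P0[THEN conjunct2, THEN conjunct1] P0[THEN conjunct2, THEN conjunct2, THEN conjunct1]
    P0[THEN conjunct2, THEN conjunct2, THEN conjunct2]
  have wg: "AE x in lebesgue_on {0<..<d i}. w (i, x) = of_real (k * \<sigma> i) * ?g (i, x)" if "i \<in> {1..N}" for i
    using sc nrm_0_iff[OF L2.diff_in[OF w L2_graph_edgewise_scale[OF L2(2), of "\<lambda>i. of_real (k * \<sigma> i)"]]] that
    by (simp add: same_class_def nrm_L2 fun_diff_def)
  have v: "left_value d u j = U j 0 \<and> right_value d u j = U j (d j)" if "j \<in> {1..N}" for j
    using endpoint_values[where d = d and i = j and u = u, OF P(1)[OF that] P(3)[OF that] d_pos[OF that]] by blast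
  have "solution k u w U V"
    unfolding solution_def
  proof (intro ballI conjI)
    fix i assume i: "i \<in> {1..N}"
    show "primitive (d i) (U i) (V i)" "AE x in lebesgue_on {0<..<d i}. u (i, x) = U i x" by (rule P[OF i])+
    show "primitive (d i) (V i) (\<lambda>x. w (i, x) / of_real (k * \<sigma> i))"
      by (rule primitive_cong_AE[OF P(2)[OF i]]) (use wg[OF i] in eventually_elim, use nz[OF i] in simp)
    note e = endpoint_values[where d = d and i = i and u = "graph_deriv d u", OF P(2)[OF i] P(4)[OF i] d_pos[OF i]]
    have F: "FL (left_value d u) (right_value d u) i = FL (\<lambda>j. U j 0) (\<lambda>j. U j (d j)) i"
      "FR (left_value d u) (right_value d u) i = FR (\<lambda>j. U j 0) (\<lambda>j. U j (d j)) i"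
      by (rule F_cong[OF i v], assumption)+
    show "of_real k * V i 0 = FL (\<lambda>j. U j 0) (\<lambda>j. U j (d j)) i" using bc(1)[OF i] unfolding e F .
    show "of_real k * V i (d i) = FR (\<lambda>j. U j 0) (\<lambda>j. U j (d j)) i" using bc(2)[OF i] unfolding e F .
  qed
  then show "uw \<in> G k" using L2(1) w unfolding uw G_iff by blast
qed

end

section \<open>The boundary functionals of the graph\<close>

definition coupling_left ::
    "nat \<Rightarrow> (nat \<Rightarrow> real \<Rightarrow> real ^ 3) \<Rightarrow> (nat \<Rightarrow> real) \<Rightarrow> (nat \<Rightarrow> real) \<Rightarrow>
     (nat \<Rightarrow> nat \<Rightarrow> real) \<Rightarrow> (nat \<Rightarrow> nat \<Rightarrow> real) \<Rightarrow> (nat \<Rightarrow> complex) \<Rightarrow> (nat \<Rightarrow> complex) \<Rightarrow> nat \<Rightarrow> complex" where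
  "coupling_left N c \<sigma> l ll rr p q i =
     (of_real (\<sigma> i * l i) * p i
      - (\<Sum>j\<in>{j\<in>{1..N}. j \<noteq> i \<and> pathstart (c j) = pathstart (c i)}. of_real (\<sigma> j * ll j i) * p j)
      - (\<Sum>j\<in>{j\<in>{1..N}. j \<noteq> i \<and> pathfinish (c j) = pathstart (c i)}. of_real (\<sigma> j * rr j i) * q j)) / of_real (\<sigma> i)"

text \<open>As in \<open>coupling_left\<close>, the endpoint values of a function are replaced by
  arbitrary families \<open>p\<close> and \<open>q\<close>; in this form linearity and boundedness
  can be stated.\<close>

definition coupling_right ::
    "nat \<Rightarrow> (nat \<Rightarrow> real \<Rightarrow> real ^ 3) \<Rightarrow> (nat \<Rightarrow> real) \<Rightarrow> (nat \<Rightarrow> real) \<Rightarrow>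
     (nat \<Rightarrow> nat \<Rightarrow> real) \<Rightarrow> (nat \<Rightarrow> nat \<Rightarrow> real) \<Rightarrow> (nat \<Rightarrow> complex) \<Rightarrow> (nat \<Rightarrow> complex) \<Rightarrow> nat \<Rightarrow> complex" where
  "coupling_right N c \<sigma> r ll rr p q i =
     ((\<Sum>j\<in>{j\<in>{1..N}. j \<noteq> i \<and> pathstart (c j) = pathfinish (c i)}. of_real (\<sigma> j * ll j i) * p j)
      + (\<Sum>j\<in>{j\<in>{1..N}. j \<noteq> i \<and> pathfinish (c j) = pathfinish (c i)}. of_real (\<sigma> j * rr j i) * q j)
      - of_real (\<sigma> i * r i) * q i) / of_real (\<sigma> i)"

lemma coupling_add:
  "coupling_left N c \<sigma> l ll rr (\<lambda>j. p j + p' j) (\<lambda>j. q j + q' j) i =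
    coupling_left N c \<sigma> l ll rr p q i + coupling_left N c \<sigma> l ll rr p' q' i"
  "coupling_right N c \<sigma> r ll rr (\<lambda>j. p j + p' j) (\<lambda>j. q j + q' j) i =
    coupling_right N c \<sigma> r ll rr p q i + coupling_right N c \<sigma> r ll rr p' q' i"
  unfolding coupling_left_def coupling_right_def distrib_left sum.distrib add_divide_distrib[symmetric]
  by (simp_all only: add_diff_add ac_simps diff_diff_eq2 diff_conv_add_uminus minus_add_distrib)

lemma coupling_scale:
  "coupling_left N c \<sigma> l ll rr (\<lambda>j. a * p j) (\<lambda>j. a * q j) i = a * coupling_left N c \<sigma> l ll rr p q i"
  "coupling_right N c \<sigma> r ll rr (\<lambda>j. a * p j) (\<lambda>j. a * q j) i = a * coupling_right N c \<sigma> r ll rr p q i"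
  unfolding coupling_left_def coupling_right_def mult.left_commute[of _ a] sum_distrib_left[symmetric]
    right_diff_distrib[symmetric] distrib_left[symmetric] by simp_all

lemma weighted_sum_bound:
  fixes p :: "nat \<Rightarrow> complex"
  assumes J: "J \<subseteq> {1..N}" and p: "\<And>j. j \<in> {1..N} \<Longrightarrow> cmod (p j) \<le> B"
  shows "cmod (\<Sum>j\<in>J. of_real (a j) * p j) \<le> (\<Sum>j\<in>{1..N}. \<bar>a j\<bar>) * B"
proof -
  have "cmod (\<Sum>j\<in>J. of_real (a j) * p j) \<le> (\<Sum>j\<in>J. \<bar>a j\<bar> * B)"
    using J by (intro order_trans[OF norm_sum] sum_mono) (auto simp: norm_mult intro!: mult_left_mono p)
  also have "\<dots> \<le> (\<Sum>j\<in>{1..N}. \<bar>a j\<bar> * B)"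
    using J by (intro sum_mono2) (auto intro!: mult_nonneg_nonneg order_trans[OF norm_ge_zero p])
  finally show ?thesis by (simp add: sum_distrib_right)
qed

text \<open>Each endpoint modulus is at most the sum of all of them, so the sum of the absolute
  coefficients bounds the functional of one edge; summing over the edges makes the bound
  uniform.\<close>

lemma coupling_bounded:
  assumes \<sigma>: "\<And>i. i \<in> {1..N} \<Longrightarrow> 0 < \<sigma> i"
  shows "\<exists>C\<ge>0. \<forall>i\<in>{1..N}. \<forall>p q.
    cmod (coupling_left N c \<sigma> l ll rr p q i) \<le> C * (\<Sum>j\<in>{1..N}. cmod (p j) + cmod (q j)) \<and>
    cmod (coupling_right N c \<sigma> r ll rr p q i) \<le> C * (\<Sum>j\<in>{1..N}. cmod (p j) + cmod (q j))"
proof -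
  \<comment> \<open>\<open>E i\<close> contains the coefficients for both ends, so that one constant
    serves both functionals.\<close>
  define E where "E i = (\<bar>\<sigma> i * l i\<bar> + \<bar>\<sigma> i * r i\<bar> + (\<Sum>j\<in>{1..N}. \<bar>\<sigma> j * ll j i\<bar>) + (\<Sum>j\<in>{1..N}. \<bar>\<sigma> j * rr j i\<bar>)) / \<sigma> i" for i
  define C where "C = (\<Sum>i\<in>{1..N}. E i)"
  have E0: "0 \<le> E i" if "i \<in> {1..N}" for i
    unfolding E_def using \<sigma>[OF that] by (intro divide_nonneg_pos add_nonneg_nonneg sum_nonneg) auto
  have EC: "E i \<le> C" if "i \<in> {1..N}" for i unfolding C_def by (rule member_le_sum[OF that]) (auto intro!: E0)
  have "cmod (coupling_left N c \<sigma> l ll rr p q i) \<le> C * (\<Sum>j\<in>{1..N}. cmod (p j) + cmod (q j)) \<and>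
      cmod (coupling_right N c \<sigma> r ll rr p q i) \<le> C * (\<Sum>j\<in>{1..N}. cmod (p j) + cmod (q j))"
    if i: "i \<in> {1..N}" for i p q
  proof -
    define B where "B = (\<Sum>j\<in>{1..N}. cmod (p j) + cmod (q j))"
    have B0: "0 \<le> B" unfolding B_def by (intro sum_nonneg) simp
    have pq: "cmod (p j) + cmod (q j) \<le> B" if "j \<in> {1..N}" for j
      unfolding B_def by (rule member_le_sum[OF that]) auto
    have pB: "cmod (p j) \<le> B" and qB: "cmod (q j) \<le> B" if "j \<in> {1..N}" for j
      using pq[OF that] norm_ge_zero[of "p j"] norm_ge_zero[of "q j"] by linarith+
    have ll: "cmod (\<Sum>j\<in>J. of_real (\<sigma> j * ll j i) * p j) \<le> (\<Sum>j\<in>{1..N}. \<bar>\<sigma> j * ll j i\<bar>) * B" if "J \<subseteq> {1..N}" for J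
      by (rule weighted_sum_bound[OF that pB])
    have rr: "cmod (\<Sum>j\<in>J. of_real (\<sigma> j * rr j i) * q j) \<le> (\<Sum>j\<in>{1..N}. \<bar>\<sigma> j * rr j i\<bar>) * B" if "J \<subseteq> {1..N}" for J
      by (rule weighted_sum_bound[OF that qB])
    have li: "cmod (of_real (\<sigma> i * l i) * p i) \<le> \<bar>\<sigma> i * l i\<bar> * B"
      and ri: "cmod (of_real (\<sigma> i * r i) * q i) \<le> \<bar>\<sigma> i * r i\<bar> * B"
      unfolding norm_mult norm_of_real by (intro mult_left_mono pB qB i abs_ge_zero)+
    have nl: "0 \<le> \<bar>\<sigma> i * l i\<bar> * B" and nr: "0 \<le> \<bar>\<sigma> i * r i\<bar> * B" using B0 by simp_all
    have E: "E i * \<sigma> i * B = \<bar>\<sigma> i * l i\<bar> * B + \<bar>\<sigma> i * r i\<bar> * B + (\<Sum>j\<in>{1..N}. \<bar>\<sigma> j * ll j i\<bar>) * B + (\<Sum>j\<in>{1..N}. \<bar>\<sigma> j * rr j i\<bar>) * B"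
    proof -
      have "x / \<sigma> i * \<sigma> i = x" for x using \<sigma>[OF i] by simp
      then show ?thesis unfolding E_def by (simp only: distrib_right)
    qed
    have fin: "cmod (x / of_real (\<sigma> i)) \<le> C * B" if "cmod x \<le> E i * \<sigma> i * B" for x
    proof -
      have "cmod (x / of_real (\<sigma> i)) \<le> E i * B" using that \<sigma>[OF i] by (simp add: norm_divide field_simps)
      also have "\<dots> \<le> C * B" by (rule mult_right_mono[OF EC[OF i] B0])
      finally show ?thesis .
    qed
    have tri: "cmod (x - y - z) \<le> cmod x + cmod y + cmod z" "cmod (x + y - z) \<le> cmod x + cmod y + cmod z" for x y z
      using norm_triangle_ineq4[of "x - y" z] norm_triangle_ineq4[of x y] norm_triangle_ineq4[of "x + y" z] norm_triangle_ineq[of x y]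
      by linarith+
    have "cmod (coupling_left N c \<sigma> l ll rr p q i) \<le> C * B"
      unfolding coupling_left_def
    proof (rule fin, rule order_trans[OF tri(1)])
      let ?J = "{j\<in>{1..N}. j \<noteq> i \<and> pathstart (c j) = pathstart (c i)}" and ?J' = "{j\<in>{1..N}. j \<noteq> i \<and> pathfinish (c j) = pathstart (c i)}"
      have "?J \<subseteq> {1..N}" "?J' \<subseteq> {1..N}" by auto
      from ll[OF this(1)] rr[OF this(2)] li nr
      show "cmod (of_real (\<sigma> i * l i) * p i) + cmod (\<Sum>j\<in>?J. of_real (\<sigma> j * ll j i) * p j) +
        cmod (\<Sum>j\<in>?J'. of_real (\<sigma> j * rr j i) * q j) \<le> E i * \<sigma> i * B" unfolding E by linarith
    qed
    moreover have "cmod (coupling_right N c \<sigma> r ll rr p q i) \<le> C * B"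
      unfolding coupling_right_def
    proof (rule fin, rule order_trans[OF tri(2)])
      let ?J = "{j\<in>{1..N}. j \<noteq> i \<and> pathstart (c j) = pathfinish (c i)}" and ?J' = "{j\<in>{1..N}. j \<noteq> i \<and> pathfinish (c j) = pathfinish (c i)}"
      have "?J \<subseteq> {1..N}" "?J' \<subseteq> {1..N}" by auto
      from ll[OF this(1)] rr[OF this(2)] ri nl
      show "cmod (\<Sum>j\<in>?J. of_real (\<sigma> j * ll j i) * p j) + cmod (\<Sum>j\<in>?J'. of_real (\<sigma> j * rr j i) * q j) +
        cmod (of_real (\<sigma> i * r i) * q i) \<le> E i * \<sigma> i * B" unfolding E by linarith
    qed
    ultimately show ?thesis unfolding B_def by blast
  qed
  moreover have "0 \<le> C" unfolding C_def by (intro sum_nonneg E0)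
  ultimately show ?thesis by blast
qed

theorem theorem3p2:
  fixes V :: "(real ^ 3) set" and N :: nat and c :: "nat \<Rightarrow> real \<Rightarrow> real ^ 3"
    and d :: "nat \<Rightarrow> real" and \<sigma> l r :: "nat \<Rightarrow> real"
    and ll rr :: "nat \<Rightarrow> nat \<Rightarrow> real" and \<kappa> :: "nat \<Rightarrow> real"
  assumes "1 \<le> N"
    and "geometric_graph V N c"
    and "d = (\<lambda>i. edge_length (c i))"
    and "\<forall>i\<in>{1..N}. 0 < \<sigma> i"
    and "\<forall>i\<in>{1..N}. 0 \<le> l i \<and> 0 \<le> r i"
    and "\<forall>i\<in>{1..N}. \<forall>j\<in>{1..N}. i \<noteq> j \<longrightarrow> 0 \<le> ll i j \<and> 0 \<le> rr i j"
    and "\<forall>i\<in>{1..N}. (\<Sum>j\<in>{1..N} - {i}. ll i j) \<le> l i"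
    and "\<forall>i\<in>{1..N}. (\<Sum>j\<in>{1..N} - {i}. rr i j) \<le> r i"
    and "\<forall>i\<in>{1..N}. \<forall>j\<in>{1..N}. i \<noteq> j \<and> \<not> incident (c j) (pathstart (c i)) \<longrightarrow> ll i j = 0"
    and "\<forall>i\<in>{1..N}. \<forall>j\<in>{1..N}. i \<noteq> j \<and> \<not> incident (c j) (pathfinish (c i)) \<longrightarrow> rr i j = 0"
    and "\<forall>n\<ge>1. 0 < \<kappa> n"
    and "\<forall>m n. 1 \<le> m \<and> m \<le> n \<longrightarrow> \<kappa> m \<le> \<kappa> n"
    and "filterlim \<kappa> at_top sequentially"
  shows "(\<forall>n\<ge>1. generates_holomorphic_semigroup (L2_graph N d) (L2_norm N d)
                  (A_star N c \<sigma> l r ll rr (\<kappa> n))) \<and>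
         (\<exists>\<gamma>>0. \<forall>n\<ge>1. \<forall>T.
            generates_semigroup (L2_graph N d) (L2_norm N d) (A_star N c \<sigma> l r ll rr (\<kappa> n)) T \<longrightarrow>
            (\<forall>t\<ge>0. op_norm (L2_graph N d) (L2_norm N d) (T t) \<le> exp (\<gamma> * t)))"
proof -
  have d: "0 < d i" and \<sigma>: "0 < \<sigma> i" if "i \<in> {1..N}" for i
    using assms(2,4) that by (auto simp: assms(3) geometric_graph_def)
  obtain C where C: "0 \<le> C"
    and b: "\<And>i p q. i \<in> {1..N} \<Longrightarrow> cmod (coupling_left N c \<sigma> l ll rr p q i) \<le> C * (\<Sum>j\<in>{1..N}. cmod (p j) + cmod (q j))"
      "\<And>i p q. i \<in> {1..N} \<Longrightarrow> cmod (coupling_right N c \<sigma> r ll rr p q i) \<le> C * (\<Sum>j\<in>{1..N}. cmod (p j) + cmod (q j))"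
    using coupling_bounded[where N = N and c = c and \<sigma> = \<sigma> and l = l and r = r and ll = ll and rr = rr, OF \<sigma>] by blast
  \<comment> \<open>\<open>\<kappa> 1\<close> is the smallest term of the nondecreasing sequence, so
    it serves as lower bound and \<open>R.\<gamma>\<close> is the same for all
    \<open>n\<close>.\<close>
  interpret R: robin_graph N d \<sigma> "coupling_left N c \<sigma> l ll rr" "coupling_right N c \<sigma> r ll rr" C "\<kappa> 1"
    by (rule robin_graph.intro) (use assms(11) in \<open>auto simp: coupling_add coupling_scale intro!: d \<sigma> C b simp del: One_nat_def\<close>)
  have A: "A_star N c \<sigma> l r ll rr (\<kappa> n) = R.G (\<kappa> n)" if "1 \<le> n" for n
  proof -
    have pos: "0 < \<kappa> n" using assms(11) that by blast
    show ?thesis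
      unfolding R.G_eq_H2[OF pos]
      unfolding A_star_def A_star_dom_def F_left_def F_right_def coupling_left_def coupling_right_def Let_def
        mem_Collect_eq assms(3) ..
  qed
  have Q: "quasi_sectorial (L2_graph N d) (L2_inner N d) (A_star N c \<sigma> l r ll rr (\<kappa> n)) R.\<gamma>" if "1 \<le> n" for n
    unfolding A[OF that] by (rule R.quasi_sectorial_G) (use assms(12) that in blast)
  have "generates_holomorphic_semigroup (L2_graph N d) (L2_norm N d) (A_star N c \<sigma> l r ll rr (\<kappa> n))" if "1 \<le> n" for n
    using quasi_sectorial.generates_holomorphic[OF Q[OF that]] unfolding R.nrm_L2 .
  moreover have "op_norm (L2_graph N d) (L2_norm N d) (T t) \<le> exp (R.\<gamma> * t)"
    if "1 \<le> n" "generates_semigroup (L2_graph N d) (L2_norm N d) (A_star N c \<sigma> l r ll rr (\<kappa> n)) T" "0 \<le> t" for n T t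
    using quasi_sectorial.growth_bound[OF Q[OF that(1)], unfolded R.nrm_L2, OF that(2,3)] .
  ultimately show ?thesis using R.\<gamma>_pos by blast
qed

end
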